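(* Let $L$ be a finite-dimensional solvable restricted Lie algebra over a field $\mathbb{F}$ of prime characteristic $p$. Then $L$ has maximal $0$-PIM, i.e. $\dim_{\mathbb{F}} P_L(\mathbb{F})=p^{\dim_{\mathbb{F}} L-\mathrm{MT}(L)}$.
   Context: Let $(L,{}^{[p]})$ be a finite-dimensional restricted Lie algebra over a field $\mathbb{F}$ of prime characteristic $p$. The restricted universal enveloping algebra is $u(L,0):=U(L)/(x^p-x^{[p]}\mid x\in L)$. $\mathbb{F}$ also denotes the one-dimensional trivial $L$-module, and $P_L(\mathbb{F})$ denotes the projective cover of $\mathbb{F}$ as a (unital left) $u(L,0)$-module. A $p$-subalgebra is a subalgebra closed under the $[p]$-map. A torus of $L$ is an abelian $p$-subalgebra $T$ all of whose elements $x$ are semisimple, i.e. $x$ lies in the $p$-subalgebra generated by $x^{[p]}$. $\mathrm{MT}(L):=\max\{\dim_{\mathbb{F}}T\mid T\text{ is a torus of }L\}$. One always has $\dim_{\mathbb{F}}P_L(\mathbb{F})\le p^{\dim_{\mathbb{F}}L-\mathrm{MT}(L)}$; $L$ is said to have maximal $0$-PIM if equality holds. *)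

theory Defs
  imports
    "HOL-Algebra.Algebra"
    "HOL-Computational_Algebra.Primes"
    "Jordan_Normal_Form.Missing_VectorSpace"
begin

section \<open>Restricted Lie algebras\<close>

text \<open>Lie algebras extend the HOL-Algebra record of modules. The fields \<open>mult\<close> and \<open>one\<close>
  inherited from that record play no role.\<close>

record ('a, 'b) lie = "('a, 'b) module" +
  bracket :: "'b \<Rightarrow> 'b \<Rightarrow> 'b"

record ('a, 'b) restricted_lie = "('a, 'b) lie" +
  pmap :: "'b \<Rightarrow> 'b"

locale lie_algebra = vectorspace F L for F and L :: "('a, 'b, 'c) lie_scheme" (structure) +
  assumes bracket_closed:
      "\<lbrakk>x \<in> carrier L; y \<in> carrier L\<rbrakk> \<Longrightarrow> bracket L x y \<in> carrier L"
    and bracket_add_left: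
      "\<lbrakk>x \<in> carrier L; y \<in> carrier L; z \<in> carrier L\<rbrakk> \<Longrightarrow>
        bracket L (x \<oplus>\<^bsub>L\<^esub> y) z = bracket L x z \<oplus>\<^bsub>L\<^esub> bracket L y z"
    and bracket_add_right:
      "\<lbrakk>x \<in> carrier L; y \<in> carrier L; z \<in> carrier L\<rbrakk> \<Longrightarrow>
        bracket L x (y \<oplus>\<^bsub>L\<^esub> z) = bracket L x y \<oplus>\<^bsub>L\<^esub> bracket L x z"
    and bracket_smult_left:
      "\<lbrakk>a \<in> carrier F; x \<in> carrier L; y \<in> carrier L\<rbrakk> \<Longrightarrow>
        bracket L (a \<odot>\<^bsub>L\<^esub> x) y = a \<odot>\<^bsub>L\<^esub> bracket L x y"
    and bracket_smult_right:
      "\<lbrakk>a \<in> carrier F; x \<in> carrier L; y \<in> carrier L\<rbrakk> \<Longrightarrow>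
        bracket L x (a \<odot>\<^bsub>L\<^esub> y) = a \<odot>\<^bsub>L\<^esub> bracket L x y"
    and bracket_self:
      "x \<in> carrier L \<Longrightarrow> bracket L x x = \<zero>\<^bsub>L\<^esub>"
    and jacobi:
      "\<lbrakk>x \<in> carrier L; y \<in> carrier L; z \<in> carrier L\<rbrakk> \<Longrightarrow>
        bracket L x (bracket L y z) \<oplus>\<^bsub>L\<^esub> bracket L y (bracket L z x)
          \<oplus>\<^bsub>L\<^esub> bracket L z (bracket L x y) = \<zero>\<^bsub>L\<^esub>"

text \<open>Elements of \<open>L \<otimes> F[X]\<close> are represented by their coefficient sequences \<open>nat \<Rightarrow> L\<close>.
  \<open>ad_poly L x y\<close> is the operator \<open>ad (x \<otimes> X + y \<otimes> 1)\<close>, and Jacobson's elements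
  \<open>s\<^sub>i(x,y)\<close> are given by
  \<open>(ad (x \<otimes> X + y \<otimes> 1))\<^sup>p\<^sup>-\<^sup>1 (x \<otimes> 1) = (\<Sum>i=1..p-1. i s\<^sub>i(x,y) \<otimes> X\<^sup>i\<^sup>-\<^sup>1)\<close>.\<close>

definition ad_poly :: "('a, 'b, 'c) lie_scheme \<Rightarrow> 'b \<Rightarrow> 'b \<Rightarrow> (nat \<Rightarrow> 'b) \<Rightarrow> nat \<Rightarrow> 'b" where
  "ad_poly L x y c =
     (\<lambda>n. (case n of 0 \<Rightarrow> \<zero>\<^bsub>L\<^esub> | Suc m \<Rightarrow> bracket L x (c m)) \<oplus>\<^bsub>L\<^esub> bracket L y (c n))"

definition jacobson_s ::
  "('a, 'd) ring_scheme \<Rightarrow> ('a, 'b, 'c) lie_scheme \<Rightarrow> nat \<Rightarrow> 'b \<Rightarrow> 'b \<Rightarrow> nat \<Rightarrow> 'b" where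
  "jacobson_s F L p x y i =
     inv\<^bsub>F\<^esub> (add_pow F i \<one>\<^bsub>F\<^esub>)
       \<odot>\<^bsub>L\<^esub> ((ad_poly L x y ^^ (p - 1)) (\<lambda>n. if n = 0 then x else \<zero>\<^bsub>L\<^esub>)) (i - 1)"

locale restricted_lie_algebra = lie_algebra F L
  for F and L :: "('a, 'b, 'c) restricted_lie_scheme" (structure) +
  fixes p :: nat
  assumes prime_p: "Factorial_Ring.prime p"
    and char_p: "add_pow F p \<one>\<^bsub>F\<^esub> = \<zero>\<^bsub>F\<^esub>"
    and pmap_closed: "x \<in> carrier L \<Longrightarrow> pmap L x \<in> carrier L"
    and ad_pmap:
      "\<lbrakk>x \<in> carrier L; y \<in> carrier L\<rbrakk> \<Longrightarrow> bracket L (pmap L x) y = (bracket L x ^^ p) y"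
    and pmap_smult:
      "\<lbrakk>a \<in> carrier F; x \<in> carrier L\<rbrakk> \<Longrightarrow> pmap L (a \<odot>\<^bsub>L\<^esub> x) = (a [^]\<^bsub>F\<^esub> p) \<odot>\<^bsub>L\<^esub> pmap L x"
    and pmap_add:
      "\<lbrakk>x \<in> carrier L; y \<in> carrier L\<rbrakk> \<Longrightarrow>
        pmap L (x \<oplus>\<^bsub>L\<^esub> y) =
          pmap L x \<oplus>\<^bsub>L\<^esub> pmap L y \<oplus>\<^bsub>L\<^esub> (\<Oplus>\<^bsub>L\<^esub>i\<in>{1..p - 1}. jacobson_s F L p x y i)"

definition derived_lie :: "('a, 'd) ring_scheme \<Rightarrow> ('a, 'b, 'c) lie_scheme \<Rightarrow> 'b set \<Rightarrow> 'b set" where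
  "derived_lie F L S = module.span F L {bracket L x y | x y. x \<in> S \<and> y \<in> S}"

definition solvable_lie :: "('a, 'd) ring_scheme \<Rightarrow> ('a, 'b, 'c) lie_scheme \<Rightarrow> bool" where
  "solvable_lie F L \<longleftrightarrow> (\<exists>n. (derived_lie F L ^^ n) (carrier L) = {\<zero>\<^bsub>L\<^esub>})"


section \<open>Tori\<close>

definition p_subalgebra ::
  "('a, 'd) ring_scheme \<Rightarrow> ('a, 'b, 'c) restricted_lie_scheme \<Rightarrow> 'b set \<Rightarrow> bool" where
  "p_subalgebra F L S \<longleftrightarrow> subspace F S L
     \<and> (\<forall>x\<in>S. \<forall>y\<in>S. bracket L x y \<in> S) \<and> (\<forall>x\<in>S. pmap L x \<in> S)"

definition p_generated ::
  "('a, 'd) ring_scheme \<Rightarrow> ('a, 'b, 'c) restricted_lie_scheme \<Rightarrow> 'b set \<Rightarrow> 'b set" where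
  "p_generated F L A = \<Inter> {S. p_subalgebra F L S \<and> A \<subseteq> S}"

definition semisimple ::
  "('a, 'd) ring_scheme \<Rightarrow> ('a, 'b, 'c) restricted_lie_scheme \<Rightarrow> 'b \<Rightarrow> bool" where
  "semisimple F L x \<longleftrightarrow> x \<in> p_generated F L {pmap L x}"

definition torus ::
  "('a, 'd) ring_scheme \<Rightarrow> ('a, 'b, 'c) restricted_lie_scheme \<Rightarrow> 'b set \<Rightarrow> bool" where
  "torus F L T \<longleftrightarrow> p_subalgebra F L T
     \<and> (\<forall>x\<in>T. \<forall>y\<in>T. bracket L x y = \<zero>\<^bsub>L\<^esub>) \<and> (\<forall>x\<in>T. semisimple F L x)"

definition MT :: "('a, 'd) ring_scheme \<Rightarrow> ('a, 'b, 'c) restricted_lie_scheme \<Rightarrow> nat" where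
  "MT F L = Max {vectorspace.dim F (L\<lparr>carrier := T\<rparr>) | T. torus F L T}"


section \<open>The restricted universal enveloping algebra\<close>

text \<open>Elements of the free associative algebra on \<open>S\<close> are finitely supported functions on words.\<close>

definition free_alg :: "('a, 'd) ring_scheme \<Rightarrow> 'b set \<Rightarrow> ('b list \<Rightarrow> 'a) ring" where
  "free_alg F S =
     \<lparr>carrier = {f. range f \<subseteq> carrier F \<and> finite {w. f w \<noteq> \<zero>\<^bsub>F\<^esub>} \<and> {w. f w \<noteq> \<zero>\<^bsub>F\<^esub>} \<subseteq> lists S},
      monoid.mult = (\<lambda>f g w. \<Oplus>\<^bsub>F\<^esub>k\<in>{..length w}. f (take k w) \<otimes>\<^bsub>F\<^esub> g (drop k w)),
      one = (\<lambda>w. if w = [] then \<one>\<^bsub>F\<^esub> else \<zero>\<^bsub>F\<^esub>),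
      ring.zero = (\<lambda>w. \<zero>\<^bsub>F\<^esub>),
      add = (\<lambda>f g w. f w \<oplus>\<^bsub>F\<^esub> g w)\<rparr>"

definition free_gen :: "('a, 'd) ring_scheme \<Rightarrow> 'b \<Rightarrow> 'b list \<Rightarrow> 'a" where
  "free_gen F x = (\<lambda>w. if w = [x] then \<one>\<^bsub>F\<^esub> else \<zero>\<^bsub>F\<^esub>)"

definition free_const :: "('a, 'd) ring_scheme \<Rightarrow> 'a \<Rightarrow> 'b list \<Rightarrow> 'a" where
  "free_const F a = (\<lambda>w. if w = [] then a else \<zero>\<^bsub>F\<^esub>)"

text \<open>\<open>U(L)\<close> is the free algebra on the set \<open>L\<close> modulo the relations making the canonical map
  \<open>L \<rightarrow> U(L)\<close> linear (so that one obtains a quotient of the tensor algebra) and a Lie algebra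
  homomorphism.\<close>

definition env_relations ::
  "('a, 'd) ring_scheme \<Rightarrow> ('a, 'b, 'c) lie_scheme \<Rightarrow> ('b list \<Rightarrow> 'a) set" where
  "env_relations F L = (let A = free_alg F (carrier L); g = free_gen F in
       {g (x \<oplus>\<^bsub>L\<^esub> y) \<ominus>\<^bsub>A\<^esub> (g x \<oplus>\<^bsub>A\<^esub> g y) | x y. x \<in> carrier L \<and> y \<in> carrier L}
     \<union> {g (a \<odot>\<^bsub>L\<^esub> x) \<ominus>\<^bsub>A\<^esub> (free_const F a \<otimes>\<^bsub>A\<^esub> g x) | a x. a \<in> carrier F \<and> x \<in> carrier L}
     \<union> {(g x \<otimes>\<^bsub>A\<^esub> g y \<ominus>\<^bsub>A\<^esub> g y \<otimes>\<^bsub>A\<^esub> g x) \<ominus>\<^bsub>A\<^esub> g (bracket L x y)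
          | x y. x \<in> carrier L \<and> y \<in> carrier L})"

definition env_ideal ::
  "('a, 'd) ring_scheme \<Rightarrow> ('a, 'b, 'c) lie_scheme \<Rightarrow> ('b list \<Rightarrow> 'a) set" where
  "env_ideal F L = Idl\<^bsub>free_alg F (carrier L)\<^esub> (env_relations F L)"

definition env_alg ::
  "('a, 'd) ring_scheme \<Rightarrow> ('a, 'b, 'c) lie_scheme \<Rightarrow> ('b list \<Rightarrow> 'a) set ring" where
  "env_alg F L = free_alg F (carrier L) Quot env_ideal F L"

definition env_proj ::
  "('a, 'd) ring_scheme \<Rightarrow> ('a, 'b, 'c) lie_scheme \<Rightarrow> ('b list \<Rightarrow> 'a) \<Rightarrow> ('b list \<Rightarrow> 'a) set" where
  "env_proj F L f = env_ideal F L +>\<^bsub>free_alg F (carrier L)\<^esub> f"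

definition restricted_env_ideal ::
  "('a, 'd) ring_scheme \<Rightarrow> ('a, 'b, 'c) restricted_lie_scheme \<Rightarrow> nat \<Rightarrow> ('b list \<Rightarrow> 'a) set set" where
  "restricted_env_ideal F L p = Idl\<^bsub>env_alg F L\<^esub>
     {(env_proj F L (free_gen F x) [^]\<^bsub>env_alg F L\<^esub> p)
        \<ominus>\<^bsub>env_alg F L\<^esub> env_proj F L (free_gen F (pmap L x)) | x. x \<in> carrier L}"

definition restricted_env ::
  "('a, 'd) ring_scheme \<Rightarrow> ('a, 'b, 'c) restricted_lie_scheme \<Rightarrow> nat
     \<Rightarrow> ('b list \<Rightarrow> 'a) set set ring" where
  "restricted_env F L p = env_alg F L Quot restricted_env_ideal F L p"

definition restricted_env_scalar ::
  "('a, 'd) ring_scheme \<Rightarrow> ('a, 'b, 'c) restricted_lie_scheme \<Rightarrow> nat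
     \<Rightarrow> 'a \<Rightarrow> ('b list \<Rightarrow> 'a) set set" where
  "restricted_env_scalar F L p a =
     restricted_env_ideal F L p +>\<^bsub>env_alg F L\<^esub> env_proj F L (free_const F a)"

text \<open>The augmentation \<open>u(L,0) \<rightarrow> F\<close>, i.e. the unital \<open>F\<close>-algebra homomorphism that kills \<open>L\<close>.
  It is induced by the constant coefficient on the free algebra; as in
  \<open>FactRing_iso\<close>, \<open>the_elem (h ` C)\<close> is the common value of \<open>h\<close> on the coset \<open>C\<close>.\<close>

definition env_augmentation :: "('b list \<Rightarrow> 'a) set \<Rightarrow> 'a" where
  "env_augmentation C = the_elem ((\<lambda>f. f []) ` C)"

definition restricted_env_augmentation :: "('b list \<Rightarrow> 'a) set set \<Rightarrow> 'a" where
  "restricted_env_augmentation C = the_elem (env_augmentation ` C)"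

definition trivial_module ::
  "('a, 'd) ring_scheme \<Rightarrow> (('b list \<Rightarrow> 'a) set set, 'a) module" where
  "trivial_module F =
     \<lparr>carrier = carrier F, monoid.mult = (\<otimes>\<^bsub>F\<^esub>), one = \<one>\<^bsub>F\<^esub>, ring.zero = \<zero>\<^bsub>F\<^esub>, add = add F,
      smult = (\<lambda>u a. restricted_env_augmentation u \<otimes>\<^bsub>F\<^esub> a)\<rparr>"

definition underlying_vs ::
  "('a, 'd) ring_scheme \<Rightarrow> ('a, 'b, 'c) restricted_lie_scheme \<Rightarrow> nat
     \<Rightarrow> (('b list \<Rightarrow> 'a) set set, 'm) module \<Rightarrow> ('a, 'm) module" where
  "underlying_vs F L p M =
     \<lparr>carrier = carrier M, monoid.mult = (\<otimes>\<^bsub>M\<^esub>), one = \<one>\<^bsub>M\<^esub>, ring.zero = \<zero>\<^bsub>M\<^esub>, add = add M,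
      smult = (\<lambda>a m. restricted_env_scalar F L p a \<odot>\<^bsub>M\<^esub> m)\<rparr>"


section \<open>Projective covers\<close>

text \<open>The \<open>module\<close> locale of HOL-Algebra requires a commutative ring.\<close>

locale left_module = R?: ring R + M?: abelian_group M
  for R :: "('r, 'd) ring_scheme" (structure) and M :: "('r, 'm, 'e) module_scheme" (structure) +
  assumes smult_closed:
      "\<lbrakk>a \<in> carrier R; x \<in> carrier M\<rbrakk> \<Longrightarrow> a \<odot>\<^bsub>M\<^esub> x \<in> carrier M"
    and smult_l_distr:
      "\<lbrakk>a \<in> carrier R; b \<in> carrier R; x \<in> carrier M\<rbrakk> \<Longrightarrow>
        (a \<oplus>\<^bsub>R\<^esub> b) \<odot>\<^bsub>M\<^esub> x = a \<odot>\<^bsub>M\<^esub> x \<oplus>\<^bsub>M\<^esub> b \<odot>\<^bsub>M\<^esub> x"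
    and smult_r_distr:
      "\<lbrakk>a \<in> carrier R; x \<in> carrier M; y \<in> carrier M\<rbrakk> \<Longrightarrow>
        a \<odot>\<^bsub>M\<^esub> (x \<oplus>\<^bsub>M\<^esub> y) = a \<odot>\<^bsub>M\<^esub> x \<oplus>\<^bsub>M\<^esub> a \<odot>\<^bsub>M\<^esub> y"
    and smult_assoc:
      "\<lbrakk>a \<in> carrier R; b \<in> carrier R; x \<in> carrier M\<rbrakk> \<Longrightarrow>
        (a \<otimes>\<^bsub>R\<^esub> b) \<odot>\<^bsub>M\<^esub> x = a \<odot>\<^bsub>M\<^esub> (b \<odot>\<^bsub>M\<^esub> x)"
    and smult_one:
      "x \<in> carrier M \<Longrightarrow> \<one>\<^bsub>R\<^esub> \<odot>\<^bsub>M\<^esub> x = x"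

text \<open>The lifting property along epimorphisms \<open>M \<rightarrow> N\<close>. A formula cannot quantify over the types
  of \<open>M\<close> and \<open>N\<close>; the types chosen here admit the free module on the set \<open>P\<close> as \<open>M\<close> and \<open>P\<close> itself
  as \<open>N\<close>, which is enough to yield the lifting property for \<open>M\<close> and \<open>N\<close> of arbitrary types
  (lemma \<open>projective_lifting\<close> below).\<close>

definition projective :: "('r, 'd) ring_scheme \<Rightarrow> ('r, 'm) module \<Rightarrow> bool" where
  "projective R P \<longleftrightarrow> left_module R P \<and>
     (\<forall>(M :: ('r, 'm \<Rightarrow> 'r) module) (N :: ('r, 'm) module) g f.
        left_module R M \<and> left_module R N \<and> g \<in> module_hom R M N \<and> g ` carrier M = carrier N
          \<and> f \<in> module_hom R P N
        \<longrightarrow> (\<exists>h \<in> module_hom R P M. \<forall>x \<in> carrier P. g (h x) = f x))"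

definition free_module :: "('r, 'd) ring_scheme \<Rightarrow> 'm set \<Rightarrow> ('r, 'm \<Rightarrow> 'r) module" where
  "free_module R S =
     \<lparr>carrier = {\<phi>. range \<phi> \<subseteq> carrier R \<and> finite {m. \<phi> m \<noteq> \<zero>\<^bsub>R\<^esub>} \<and> {m. \<phi> m \<noteq> \<zero>\<^bsub>R\<^esub>} \<subseteq> S},
      monoid.mult = undefined, one = undefined,
      ring.zero = (\<lambda>_. \<zero>\<^bsub>R\<^esub>),
      add = (\<lambda>\<phi> \<psi> m. \<phi> m \<oplus>\<^bsub>R\<^esub> \<psi> m),
      smult = (\<lambda>r \<phi> m. r \<otimes>\<^bsub>R\<^esub> \<phi> m)\<rparr>"

lemma free_module_left_module:
  assumes "ring R"
  shows "left_module R (free_module R S)"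
proof -
  interpret R: ring R by fact
  let ?M = "free_module R S"
  have carr: "\<phi> m \<in> carrier R" if "\<phi> \<in> carrier ?M" for \<phi> m
    using that by (auto simp: free_module_def)
  have supp: "finite {m. \<phi> m \<noteq> \<zero>\<^bsub>R\<^esub>}" "{m. \<phi> m \<noteq> \<zero>\<^bsub>R\<^esub>} \<subseteq> S" if "\<phi> \<in> carrier ?M" for \<phi>
    using that by (auto simp: free_module_def)
  have carrI: "\<phi> \<in> carrier ?M"
    if "\<And>m. \<phi> m \<in> carrier R" "{m. \<phi> m \<noteq> \<zero>\<^bsub>R\<^esub>} \<subseteq> B" "finite B" "B \<subseteq> S" for \<phi> B
    using that finite_subset[of "{m. \<phi> m \<noteq> \<zero>\<^bsub>R\<^esub>}" B] by (auto simp: free_module_def)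
  have ag: "abelian_group ?M"
  proof (rule abelian_groupI)
    fix \<phi> \<psi> assume *: "\<phi> \<in> carrier ?M" "\<psi> \<in> carrier ?M"
    have "(\<lambda>m. \<phi> m \<oplus>\<^bsub>R\<^esub> \<psi> m) \<in> carrier ?M"
      by (rule carrI[of _ "{m. \<phi> m \<noteq> \<zero>\<^bsub>R\<^esub>} \<union> {m. \<psi> m \<noteq> \<zero>\<^bsub>R\<^esub>}"])
         (use * supp carr in auto)
    then show "\<phi> \<oplus>\<^bsub>?M\<^esub> \<psi> \<in> carrier ?M" by (simp add: free_module_def)
  next
    show "\<zero>\<^bsub>?M\<^esub> \<in> carrier ?M" by (auto simp: free_module_def)
  next
    fix \<phi> \<psi> \<chi> assume *: "\<phi> \<in> carrier ?M" "\<psi> \<in> carrier ?M" "\<chi> \<in> carrier ?M"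
    then show "\<phi> \<oplus>\<^bsub>?M\<^esub> \<psi> \<oplus>\<^bsub>?M\<^esub> \<chi> = \<phi> \<oplus>\<^bsub>?M\<^esub> (\<psi> \<oplus>\<^bsub>?M\<^esub> \<chi>)"
      using carr by (simp add: free_module_def R.a_assoc)
  next
    fix \<phi> \<psi> assume *: "\<phi> \<in> carrier ?M" "\<psi> \<in> carrier ?M"
    then show "\<phi> \<oplus>\<^bsub>?M\<^esub> \<psi> = \<psi> \<oplus>\<^bsub>?M\<^esub> \<phi>"
      using carr by (auto simp: free_module_def R.a_comm)
  next
    fix \<phi> assume *: "\<phi> \<in> carrier ?M"
    then show "\<zero>\<^bsub>?M\<^esub> \<oplus>\<^bsub>?M\<^esub> \<phi> = \<phi>" using carr by (auto simp: free_module_def)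
  next
    fix \<phi> assume *: "\<phi> \<in> carrier ?M"
    have "(\<lambda>m. \<ominus>\<^bsub>R\<^esub> \<phi> m) \<in> carrier ?M"
      by (rule carrI[of _ "{m. \<phi> m \<noteq> \<zero>\<^bsub>R\<^esub>}"]) (use * supp carr in auto)
    moreover have "(\<lambda>m. \<ominus>\<^bsub>R\<^esub> \<phi> m) \<oplus>\<^bsub>?M\<^esub> \<phi> = \<zero>\<^bsub>?M\<^esub>"
      using * carr by (auto simp: free_module_def R.l_neg)
    ultimately show "\<exists>y\<in>carrier ?M. y \<oplus>\<^bsub>?M\<^esub> \<phi> = \<zero>\<^bsub>?M\<^esub>" by blast
  qed
  show ?thesis
  proof (rule left_module.intro[OF assms ag], unfold_locales)
    fix r \<phi> assume *: "r \<in> carrier R" "\<phi> \<in> carrier ?M"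
    have "(\<lambda>m. r \<otimes>\<^bsub>R\<^esub> \<phi> m) \<in> carrier ?M"
      by (rule carrI[of _ "{m. \<phi> m \<noteq> \<zero>\<^bsub>R\<^esub>}"]) (use * supp carr in auto)
    then show "r \<odot>\<^bsub>?M\<^esub> \<phi> \<in> carrier ?M" by (simp add: free_module_def)
  next
    fix r s \<phi> assume *: "r \<in> carrier R" "s \<in> carrier R" "\<phi> \<in> carrier ?M"
    then show "(r \<oplus>\<^bsub>R\<^esub> s) \<odot>\<^bsub>?M\<^esub> \<phi> = r \<odot>\<^bsub>?M\<^esub> \<phi> \<oplus>\<^bsub>?M\<^esub> s \<odot>\<^bsub>?M\<^esub> \<phi>"
      using carr by (auto simp: free_module_def R.l_distr)
    show "(r \<otimes>\<^bsub>R\<^esub> s) \<odot>\<^bsub>?M\<^esub> \<phi> = r \<odot>\<^bsub>?M\<^esub> (s \<odot>\<^bsub>?M\<^esub> \<phi>)"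
      using * carr by (auto simp: free_module_def R.m_assoc)
  next
    fix r \<phi> \<psi> assume *: "r \<in> carrier R" "\<phi> \<in> carrier ?M" "\<psi> \<in> carrier ?M"
    then show "r \<odot>\<^bsub>?M\<^esub> (\<phi> \<oplus>\<^bsub>?M\<^esub> \<psi>) = r \<odot>\<^bsub>?M\<^esub> \<phi> \<oplus>\<^bsub>?M\<^esub> r \<odot>\<^bsub>?M\<^esub> \<psi>"
      using carr by (auto simp: free_module_def R.r_distr)
  next
    fix \<phi> assume "\<phi> \<in> carrier ?M"
    then show "\<one>\<^bsub>R\<^esub> \<odot>\<^bsub>?M\<^esub> \<phi> = \<phi>" using carr by (auto simp: free_module_def)
  qed
qed

context left_module
begin

lemma smult_l_null: "x \<in> carrier M \<Longrightarrow> \<zero>\<^bsub>R\<^esub> \<odot>\<^bsub>M\<^esub> x = \<zero>\<^bsub>M\<^esub>"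
  using smult_l_distr[of "\<zero>\<^bsub>R\<^esub>" "\<zero>\<^bsub>R\<^esub>" x] smult_closed[of "\<zero>\<^bsub>R\<^esub>" x] by simp

lemma smult_r_null: "a \<in> carrier R \<Longrightarrow> a \<odot>\<^bsub>M\<^esub> \<zero>\<^bsub>M\<^esub> = \<zero>\<^bsub>M\<^esub>"
  using smult_r_distr[of a "\<zero>\<^bsub>M\<^esub>" "\<zero>\<^bsub>M\<^esub>"] smult_closed[of a "\<zero>\<^bsub>M\<^esub>"] by simp

lemma smult_finsum:
  assumes "finite B" "a \<in> carrier R" "v \<in> B \<rightarrow> carrier M"
  shows "a \<odot>\<^bsub>M\<^esub> (\<Oplus>\<^bsub>M\<^esub>m\<in>B. v m) = (\<Oplus>\<^bsub>M\<^esub>m\<in>B. a \<odot>\<^bsub>M\<^esub> v m)"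
  using assms(1,3)
  by (induction B) (use assms(2) in \<open>auto simp: smult_r_null smult_r_distr smult_closed Pi_def M.finsum_closed\<close>)

lemma hom_zero:
  assumes "left_module R N" "h \<in> module_hom R M N"
  shows "h \<zero>\<^bsub>M\<^esub> = \<zero>\<^bsub>N\<^esub>"
proof -
  interpret N: left_module R N by fact
  have "h \<zero>\<^bsub>M\<^esub> \<in> carrier N" "h (\<zero>\<^bsub>M\<^esub> \<oplus>\<^bsub>M\<^esub> \<zero>\<^bsub>M\<^esub>) = h \<zero>\<^bsub>M\<^esub> \<oplus>\<^bsub>N\<^esub> h \<zero>\<^bsub>M\<^esub>"
    using assms(2) unfolding module_hom_def by blast+
  then show ?thesis by simp
qed

lemma hom_finsum:
  assumes "left_module R N" "h \<in> module_hom R M N" "finite B" "v \<in> B \<rightarrow> carrier M"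
  shows "h (\<Oplus>\<^bsub>M\<^esub>m\<in>B. v m) = (\<Oplus>\<^bsub>N\<^esub>m\<in>B. h (v m))"
  using assms(3,4)
proof (induction B)
  case empty
  interpret N: left_module R N by fact
  show ?case using hom_zero[OF assms(1,2)] by simp
next
  case (insert b B)
  interpret N: left_module R N by fact
  have v: "v b \<in> carrier M" "v \<in> B \<rightarrow> carrier M" using insert.prems by auto
  have h: "h x \<in> carrier N" if "x \<in> carrier M" for x
    using that assms(2) unfolding module_hom_def by blast
  have "h (v b \<oplus>\<^bsub>M\<^esub> (\<Oplus>\<^bsub>M\<^esub>m\<in>B. v m)) = h (v b) \<oplus>\<^bsub>N\<^esub> h (\<Oplus>\<^bsub>M\<^esub>m\<in>B. v m)"
    using assms(2) v M.finsum_closed[OF v(2)] unfolding module_hom_def by blast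
  moreover have "(\<lambda>m. h (v m)) \<in> B \<rightarrow> carrier N" using v(2) h by auto
  ultimately show ?case
    using insert.hyps insert.IH v h by simp
qed

definition free_eval :: "('x \<Rightarrow> 'm) \<Rightarrow> ('x \<Rightarrow> 'r) \<Rightarrow> 'm" where
  "free_eval e \<phi> = (\<Oplus>\<^bsub>M\<^esub>m\<in>{m. \<phi> m \<noteq> \<zero>\<^bsub>R\<^esub>}. \<phi> m \<odot>\<^bsub>M\<^esub> e m)"

lemma free_eval_superset:
  assumes "\<phi> \<in> carrier (free_module R S)" "e \<in> S \<rightarrow> carrier M"
    "finite B" "B \<subseteq> S" "{m. \<phi> m \<noteq> \<zero>\<^bsub>R\<^esub>} \<subseteq> B"
  shows "free_eval e \<phi> = (\<Oplus>\<^bsub>M\<^esub>m\<in>B. \<phi> m \<odot>\<^bsub>M\<^esub> e m)"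
proof -
  have "\<phi> m \<in> carrier R" for m using assms(1) by (auto simp: free_module_def)
  then show ?thesis
    unfolding free_eval_def
    by (intro M.add.finprod_mono_neutral_cong_left)
       (use assms in \<open>auto simp: smult_l_null smult_closed Pi_def subset_iff\<close>)
qed

lemma free_eval_hom:
  assumes e: "e \<in> S \<rightarrow> carrier M"
  shows "free_eval e \<in> module_hom R (free_module R S) M"
proof -
  let ?A = "free_module R S"
  interpret A: left_module R ?A by (rule free_module_left_module[OF R.ring_axioms])
  have carr: "\<phi> m \<in> carrier R" if "\<phi> \<in> carrier ?A" for \<phi> m
    using that by (auto simp: free_module_def)
  have supp: "finite {m. \<phi> m \<noteq> \<zero>\<^bsub>R\<^esub>}" "{m. \<phi> m \<noteq> \<zero>\<^bsub>R\<^esub>} \<subseteq> S" if "\<phi> \<in> carrier ?A" for \<phi>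
    using that by (auto simp: free_module_def)
  have term_closed: "(\<lambda>m. \<phi> m \<odot>\<^bsub>M\<^esub> e m) \<in> B \<rightarrow> carrier M" if "\<phi> \<in> carrier ?A" "B \<subseteq> S" for \<phi> B
    using that carr[OF that(1)] e smult_closed by blast
  have 1: "free_eval e \<phi> \<in> carrier M" if "\<phi> \<in> carrier ?A" for \<phi>
    unfolding free_eval_def using term_closed[OF that supp(2)[OF that]] by (rule M.finsum_closed)
  have 2: "free_eval e (\<phi> \<oplus>\<^bsub>?A\<^esub> \<psi>) = free_eval e \<phi> \<oplus>\<^bsub>M\<^esub> free_eval e \<psi>"
    if *: "\<phi> \<in> carrier ?A" "\<psi> \<in> carrier ?A" for \<phi> \<psi>
  proof -
    let ?B = "{m. \<phi> m \<noteq> \<zero>\<^bsub>R\<^esub>} \<union> {m. \<psi> m \<noteq> \<zero>\<^bsub>R\<^esub>}"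
    have B: "finite ?B" "?B \<subseteq> S" using supp * by auto
    have add: "(\<phi> \<oplus>\<^bsub>?A\<^esub> \<psi>) m = \<phi> m \<oplus>\<^bsub>R\<^esub> \<psi> m" for m by (simp add: free_module_def)
    have "free_eval e (\<phi> \<oplus>\<^bsub>?A\<^esub> \<psi>) = (\<Oplus>\<^bsub>M\<^esub>m\<in>?B. (\<phi> \<oplus>\<^bsub>?A\<^esub> \<psi>) m \<odot>\<^bsub>M\<^esub> e m)"
      by (rule free_eval_superset[OF A.M.a_closed[OF *] e B]) (auto simp: add)
    also have "\<dots> = (\<Oplus>\<^bsub>M\<^esub>m\<in>?B. \<phi> m \<odot>\<^bsub>M\<^esub> e m \<oplus>\<^bsub>M\<^esub> \<psi> m \<odot>\<^bsub>M\<^esub> e m)"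
    proof (rule M.finsum_cong')
      show "(\<lambda>m. \<phi> m \<odot>\<^bsub>M\<^esub> e m \<oplus>\<^bsub>M\<^esub> \<psi> m \<odot>\<^bsub>M\<^esub> e m) \<in> ?B \<rightarrow> carrier M"
        using term_closed[OF *(1) B(2)] term_closed[OF *(2) B(2)] by (blast intro: M.a_closed)
    next
      fix m assume "m \<in> ?B"
      then have "e m \<in> carrier M" using e B(2) by blast
      then show "(\<phi> \<oplus>\<^bsub>?A\<^esub> \<psi>) m \<odot>\<^bsub>M\<^esub> e m = \<phi> m \<odot>\<^bsub>M\<^esub> e m \<oplus>\<^bsub>M\<^esub> \<psi> m \<odot>\<^bsub>M\<^esub> e m"
        using smult_l_distr carr * by (simp add: add)
    qed simp
    also have "\<dots> = (\<Oplus>\<^bsub>M\<^esub>m\<in>?B. \<phi> m \<odot>\<^bsub>M\<^esub> e m) \<oplus>\<^bsub>M\<^esub> (\<Oplus>\<^bsub>M\<^esub>m\<in>?B. \<psi> m \<odot>\<^bsub>M\<^esub> e m)"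
      using term_closed[OF *(1) B(2)] term_closed[OF *(2) B(2)] by (rule M.finsum_addf)
    also have "\<dots> = free_eval e \<phi> \<oplus>\<^bsub>M\<^esub> free_eval e \<psi>"
      using free_eval_superset[OF *(1) e B] free_eval_superset[OF *(2) e B] by auto
    finally show ?thesis .
  qed
  have 3: "free_eval e (r \<odot>\<^bsub>?A\<^esub> \<phi>) = r \<odot>\<^bsub>M\<^esub> free_eval e \<phi>"
    if *: "r \<in> carrier R" "\<phi> \<in> carrier ?A" for r \<phi>
  proof -
    let ?B = "{m. \<phi> m \<noteq> \<zero>\<^bsub>R\<^esub>}"
    have B: "finite ?B" "?B \<subseteq> S" using supp * by auto
    have sm: "(r \<odot>\<^bsub>?A\<^esub> \<phi>) m = r \<otimes>\<^bsub>R\<^esub> \<phi> m" for m by (simp add: free_module_def)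
    have "free_eval e (r \<odot>\<^bsub>?A\<^esub> \<phi>) = (\<Oplus>\<^bsub>M\<^esub>m\<in>?B. (r \<odot>\<^bsub>?A\<^esub> \<phi>) m \<odot>\<^bsub>M\<^esub> e m)"
      by (rule free_eval_superset[OF A.smult_closed[OF *] e B]) (use * in \<open>auto simp: sm\<close>)
    also have "\<dots> = (\<Oplus>\<^bsub>M\<^esub>m\<in>?B. r \<odot>\<^bsub>M\<^esub> (\<phi> m \<odot>\<^bsub>M\<^esub> e m))"
    proof (rule M.finsum_cong')
      show "(\<lambda>m. r \<odot>\<^bsub>M\<^esub> (\<phi> m \<odot>\<^bsub>M\<^esub> e m)) \<in> ?B \<rightarrow> carrier M"
        using term_closed[OF *(2) B(2)] *(1) by (blast intro: smult_closed)
    next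
      fix m assume "m \<in> ?B"
      then have "e m \<in> carrier M" using e B(2) by blast
      then show "(r \<odot>\<^bsub>?A\<^esub> \<phi>) m \<odot>\<^bsub>M\<^esub> e m = r \<odot>\<^bsub>M\<^esub> (\<phi> m \<odot>\<^bsub>M\<^esub> e m)"
        using smult_assoc carr * by (simp add: sm)
    qed simp
    also have "\<dots> = r \<odot>\<^bsub>M\<^esub> free_eval e \<phi>"
      unfolding free_eval_def using smult_finsum[OF B(1) *(1) term_closed[OF *(2) B(2)]] by simp
    finally show ?thesis .
  qed
  show ?thesis unfolding module_hom_def using 1 2 3 by blast
qed

end

lemma projective_lifting:
  fixes R :: "('r, 'd) ring_scheme" and P :: "('r, 'm) module"
    and M :: "('r, 'x) module" and N :: "('r, 'y) module"
  assumes P: "projective R P" and M: "left_module R M" and N: "left_module R N"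
    and g: "g \<in> module_hom R M N" "g ` carrier M = carrier N"
    and f: "f \<in> module_hom R P N"
  shows "\<exists>h \<in> module_hom R P M. \<forall>x \<in> carrier P. g (h x) = f x"
proof -
  interpret P: left_module R P using P by (simp add: projective_def)
  interpret M: left_module R M by fact
  interpret N: left_module R N by fact
  let ?A = "free_module R (carrier P)"
  have A: "left_module R ?A" by (rule free_module_left_module[OF P.R.ring_axioms])
  define \<pi> where "\<pi> = P.free_eval (\<lambda>m. m)"
  have \<pi>: "\<pi> \<in> module_hom R ?A P" unfolding \<pi>_def by (rule P.free_eval_hom) auto
  have "x \<in> \<pi> ` carrier ?A" if x: "x \<in> carrier P" for x
  proof -
    let ?\<delta> = "\<lambda>m. if m = x then \<one>\<^bsub>R\<^esub> else \<zero>\<^bsub>R\<^esub>"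
    have d: "?\<delta> \<in> carrier ?A"
      using x finite_subset[of "{m. ?\<delta> m \<noteq> \<zero>\<^bsub>R\<^esub>}" "{x}"] by (auto simp: free_module_def)
    have "\<pi> ?\<delta> = (\<Oplus>\<^bsub>P\<^esub>m\<in>{x}. ?\<delta> m \<odot>\<^bsub>P\<^esub> m)"
      unfolding \<pi>_def by (rule P.free_eval_superset[OF d]) (use x in auto)
    also have "\<dots> = x" using x P.smult_one by (simp add: P.M.finsum_insert)
    finally show ?thesis using d by (metis imageI)
  qed
  then have surj: "\<pi> ` carrier ?A = carrier P"
    using \<pi> unfolding module_hom_def by blast
  have idP: "(\<lambda>x. x) \<in> module_hom R P P" unfolding module_hom_def by auto
  obtain s where s: "s \<in> module_hom R P ?A" "\<forall>x\<in>carrier P. \<pi> (s x) = x"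
    using P A \<pi> surj idP P.left_module_axioms unfolding projective_def by metis
  have fcl: "f m \<in> carrier N" if "m \<in> carrier P" for m
    using that f unfolding module_hom_def by blast
  have fcarr: "f m \<in> g ` carrier M" if "m \<in> carrier P" for m
    using fcl[OF that] g(2) by simp
  define e where "e m = (SOME y. y \<in> carrier M \<and> g y = f m)" for m
  have e: "e m \<in> carrier M \<and> g (e m) = f m" if "m \<in> carrier P" for m
    unfolding e_def by (rule someI_ex) (use fcarr[OF that] in auto)
  define k where "k = M.free_eval e"
  have k: "k \<in> module_hom R ?A M" unfolding k_def by (rule M.free_eval_hom) (use e in auto)
  have gk: "g (k \<phi>) = f (\<pi> \<phi>)" if \<phi>: "\<phi> \<in> carrier ?A" for \<phi>
  proof -
    let ?B = "{m. \<phi> m \<noteq> \<zero>\<^bsub>R\<^esub>}"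
    have B: "finite ?B" "?B \<subseteq> carrier P" and c: "\<And>m. \<phi> m \<in> carrier R"
      using \<phi> by (auto simp: free_module_def)
    have "g (k \<phi>) = (\<Oplus>\<^bsub>N\<^esub>m\<in>?B. g (\<phi> m \<odot>\<^bsub>M\<^esub> e m))"
      unfolding k_def M.free_eval_def
      by (rule M.hom_finsum[OF N g(1) B(1)]) (use B(2) c e M.smult_closed in blast)
    also have "\<dots> = (\<Oplus>\<^bsub>N\<^esub>m\<in>?B. f (\<phi> m \<odot>\<^bsub>P\<^esub> m))"
    proof (rule N.M.finsum_cong')
      show "(\<lambda>m. f (\<phi> m \<odot>\<^bsub>P\<^esub> m)) \<in> ?B \<rightarrow> carrier N"
        using fcl P.smult_closed[OF c] B(2) by (auto simp: subset_iff)
    next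
      fix m assume "m \<in> ?B"
      then have m: "m \<in> carrier P" using B(2) by blast
      have "g (\<phi> m \<odot>\<^bsub>M\<^esub> e m) = \<phi> m \<odot>\<^bsub>N\<^esub> g (e m)"
        using g(1) e[OF m] c unfolding module_hom_def by blast
      moreover have "f (\<phi> m \<odot>\<^bsub>P\<^esub> m) = \<phi> m \<odot>\<^bsub>N\<^esub> f m"
        using f m c unfolding module_hom_def by blast
      ultimately show "g (\<phi> m \<odot>\<^bsub>M\<^esub> e m) = f (\<phi> m \<odot>\<^bsub>P\<^esub> m)"
        using e[OF m] by simp
    qed simp
    also have "\<dots> = f (\<pi> \<phi>)"
      unfolding \<pi>_def P.free_eval_def
      by (rule P.hom_finsum[OF N f B(1), symmetric]) (use B(2) c P.smult_closed in blast)
    finally show ?thesis .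
  qed
  have scl: "s x \<in> carrier ?A" if "x \<in> carrier P" for x
    using s(1) that unfolding module_hom_def by blast
  have kcl: "k \<phi> \<in> carrier M" if "\<phi> \<in> carrier ?A" for \<phi>
    using k that unfolding module_hom_def by blast
  have "(\<lambda>x. k (s x)) \<in> module_hom R P M"
    using s(1) k scl kcl unfolding module_hom_def by simp
  moreover have "g (k (s x)) = f x" if "x \<in> carrier P" for x
    using gk[OF scl[OF that]] s(2) that by simp
  ultimately show ?thesis by (intro bexI[of _ "\<lambda>x. k (s x)"] ballI)
qed

text \<open>The last clause says that \<open>\<pi>\<close> is essential. \<open>LinearCombinations.submodule\<close> requires a
  commutative ring, hence \<open>Module.submodule\<close>.\<close>

definition projective_cover ::
  "('r, 'd) ring_scheme \<Rightarrow> ('r, 'n) module \<Rightarrow> ('r, 'm) module \<Rightarrow> ('m \<Rightarrow> 'n) \<Rightarrow> bool" where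
  "projective_cover R M P \<pi> \<longleftrightarrow> projective R P \<and> left_module R M
     \<and> \<pi> \<in> module_hom R P M \<and> \<pi> ` carrier P = carrier M
     \<and> (\<forall>N. Module.submodule N R P \<and> \<pi> ` N = carrier M \<longrightarrow> N = carrier P)"

end

theory Submission
  imports Defs
begin

text \<open>Let \<open>T\<close> be a torus of maximal dimension. The product over a basis of \<open>T\<close> of the elements
  \<open>1 - \<Sum>a\<^sub>jt\<^sup>p\<^sup>j\<^sup>-\<^sup>1\<close>, where \<open>t = \<Sum>a\<^sub>jt\<^sup>[\<^sup>p\<^sup>]\<^sup>j\<close> with \<open>j \<ge> 1\<close>, is an idempotent \<open>e\<close> of \<open>u = u(L,0)\<close> with
  \<open>Te = 0\<close> that augments to \<open>1\<close>. By the Poincare-Birkhoff-Witt theorem, obtained here from the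
  diamond lemma, \<open>ue\<close> has dimension \<open>p\<^sup>dim L - dim T\<close>. It remains to see that \<open>ue\<close> is local, i.e. that
  a left ideal containing an element of \<open>ue\<close> of augmentation \<open>1\<close> contains \<open>e\<close>. A solvable \<open>L\<close> has a chain of
  \<open>p\<close>-ideals from \<open>0\<close> to \<open>L\<close> in which each step \<open>I \<subset> J\<close> is either strongly abelian, so that \<open>uJ\<close> is nilpotent
  modulo \<open>uI\<close>, or central modulo \<open>I\<close> with toral quotient; in the second case the maximality of \<open>T\<close> forces
  \<open>J \<subseteq> I + T\<close>, hence \<open>uJe = uIe\<close>. So the augmentation ideal may be replaced by \<open>0\<close> in
  \<open>e \<in> N + uLe\<close>. Uniqueness of projective covers gives the dimension of all of them.\<close>

section \<open>Rewriting systems on words\<close>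

text \<open>The dimension of ue needs both generation and independence of monomials. Generation is
  computation; independence is the obstacle, because u is a quotient of a quotient of a free algebra
  and nothing visible prevents it from collapsing. It is therefore proved dually: the diamond lemma
  produces scalar functions on words that respect the relations and have prescribed values on normal
  words, and these descend to u. Since rewriting knows x^p = x^[p] for basis elements only, while u
  imposes it for every x, Jacobson's formula is needed inside associative rings. In the descent e =
  n + v e, with n in N and v in uJ, a strongly abelian step substitutes the equation into itself
  until a power of v lies in uI. At a toral step uJ need not be nilpotent modulo uI, and J must be
  compared with T: an element of J is corrected within I until it commutes with T, high p-th powers
  of the corrected element lie in T because T is maximal, and such powers span J modulo I because
  J/I is toral.\<close>

locale word_rewriting = cring F for F (structure) +
  fixes rules :: "('l list \<times> 'l list set \<times> ('l list \<Rightarrow> 'a)) set"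
    and ord :: "('l list \<times> 'l list) set"
  assumes wf_ord: "wf ord"
    and trans_ord: "trans ord"
    and rule_finite: "(s, A, c) \<in> rules \<Longrightarrow> finite A"
    and rule_closed: "(s, A, c) \<in> rules \<Longrightarrow> t \<in> A \<Longrightarrow> c t \<in> carrier F"
    and rule_ord: "(s, A, c) \<in> rules \<Longrightarrow> t \<in> A \<Longrightarrow> (u @ t @ v, u @ s @ v) \<in> ord"
begin

text \<open>A rule \<open>(s, A, c)\<close> encodes the relation that the word \<open>s\<close>
  equals the combination of the words \<open>t\<close> in \<open>A\<close> with coefficients
  \<open>c t\<close>. Everything is dual: \<open>f\<close> lists the values of a linear functional
  on words, and \<open>contract\<close> is its value on the right-hand side of the relation placed
  between \<open>u\<close> and \<open>v\<close>.\<close>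

definition contract :: "('l list \<Rightarrow> 'a) \<Rightarrow> 'l list set \<Rightarrow> ('l list \<Rightarrow> 'a) \<Rightarrow> 'l list \<Rightarrow> 'l list \<Rightarrow> 'a" where
  "contract f A c u v = (\<Oplus>t\<in>A. c t \<otimes> f (u @ t @ v))"

definition obeys :: "('l list \<Rightarrow> 'a) \<Rightarrow> 'l list \<Rightarrow> bool" where
  "obeys f w \<longleftrightarrow> (\<forall>u s v A c. (s, A, c) \<in> rules \<and> w = u @ s @ v \<longrightarrow> f w = contract f A c u v)"

lemma obeysD: "obeys f (u @ s @ v) \<Longrightarrow> (s, A, c) \<in> rules \<Longrightarrow> f (u @ s @ v) = contract f A c u v"
  unfolding obeys_def by blast

definition reducible :: "'l list \<Rightarrow> bool" where
  "reducible w \<longleftrightarrow> (\<exists>u s v A c. (s, A, c) \<in> rules \<and> w = u @ s @ v)"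

text \<open>Bergman's confluence condition in dual form: the two reductions of a word are not
  rewritten to a common result; instead, every functional that obeys the rules below that word takes
  the same value on both. The two length conditions say that the second left-hand side starts inside
  the first, which covers overlaps and inclusions.\<close>

definition overlaps_resolve :: bool where
  "overlaps_resolve \<longleftrightarrow> (\<forall>f s1 A1 c1 s2 A2 c2 u1 v1 u2 v2.
     range f \<subseteq> carrier F \<longrightarrow> (s1, A1, c1) \<in> rules \<longrightarrow> (s2, A2, c2) \<in> rules \<longrightarrow>
     u1 @ s1 @ v1 = u2 @ s2 @ v2 \<longrightarrow> length u1 \<le> length u2 \<longrightarrow> length u2 < length u1 + length s1 \<longrightarrow>
     (\<forall>w. (w, u1 @ s1 @ v1) \<in> ord \<longrightarrow> obeys f w) \<longrightarrow>
     contract f A1 c1 u1 v1 = contract f A2 c2 u2 v2)"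

lemma finsum_swap:
  assumes "finite A" "finite B" "\<And>a b. a \<in> A \<Longrightarrow> b \<in> B \<Longrightarrow> g a b \<in> carrier F"
  shows "(\<Oplus>a\<in>A. \<Oplus>b\<in>B. g a b) = (\<Oplus>b\<in>B. \<Oplus>a\<in>A. g a b)"
  using assms(1,3)
proof (induction A)
  case empty
  then show ?case using finsum_zero[of B] by simp
next
  case (insert x A)
  have "(\<Oplus>a\<in>insert x A. \<Oplus>b\<in>B. g a b) = (\<Oplus>b\<in>B. g x b) \<oplus> (\<Oplus>a\<in>A. \<Oplus>b\<in>B. g a b)"
    using insert by (intro finsum_insert) (auto intro!: finsum_closed)
  also have "\<dots> = (\<Oplus>b\<in>B. g x b) \<oplus> (\<Oplus>b\<in>B. \<Oplus>a\<in>A. g a b)" using insert by simp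
  also have "\<dots> = (\<Oplus>b\<in>B. g x b \<oplus> (\<Oplus>a\<in>A. g a b))"
    using insert by (intro finsum_addf[symmetric]) (auto intro!: finsum_closed)
  also have "\<dots> = (\<Oplus>b\<in>B. \<Oplus>a\<in>insert x A. g a b)"
    using insert by (intro finsum_cong') (auto intro!: finsum_closed)
  finally show ?case .
qed

text \<open>Contracting two disjoint factors in either order leads to the same double sum, because
  the words left after one contraction are smaller and \<open>f\<close> obeys the rule for the other
  factor there. This is why \<open>overlaps_resolve\<close> speaks only of factors that
  meet.\<close>

lemma contract_disjoint:
  assumes f: "range f \<subseteq> carrier F"
    and r: "(s1, A1, c1) \<in> rules" "(s2, A2, c2) \<in> rules"
    and smaller: "\<And>w. (w, u @ s1 @ m @ s2 @ v) \<in> ord \<Longrightarrow> obeys f w"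
  shows "contract f A1 c1 u (m @ s2 @ v) = contract f A2 c2 (u @ s1 @ m) v"
proof -
  have fc: "f w \<in> carrier F" for w using f by auto
  have 1: "f (u @ t @ m @ s2 @ v) = (\<Oplus>t'\<in>A2. c2 t' \<otimes> f (u @ t @ m @ t' @ v))" if "t \<in> A1" for t
    using obeysD[of f "u @ t @ m" s2 v, OF _ r(2)] smaller[OF rule_ord[OF r(1) that, of u "m @ s2 @ v"]]
    unfolding contract_def by simp
  have 2: "f (u @ s1 @ m @ t @ v) = (\<Oplus>t'\<in>A1. c1 t' \<otimes> f (u @ t' @ m @ t @ v))" if "t \<in> A2" for t
    using obeysD[of f u s1 "m @ t @ v", OF _ r(1)] smaller[of "u @ s1 @ m @ t @ v"] rule_ord[OF r(2) that, of "u @ s1 @ m" v]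
    unfolding contract_def by simp
  note cl = rule_closed[OF r(1)] rule_closed[OF r(2)] fc
  have "contract f A1 c1 u (m @ s2 @ v) = (\<Oplus>t\<in>A1. \<Oplus>t'\<in>A2. c1 t \<otimes> (c2 t' \<otimes> f (u @ t @ m @ t' @ v)))"
    unfolding contract_def
    by (rule finsum_cong') (use cl 1 rule_finite[OF r(2)] in \<open>auto intro!: finsum_closed finsum_rdistr\<close>)
  also have "\<dots> = (\<Oplus>t'\<in>A2. \<Oplus>t\<in>A1. c1 t \<otimes> (c2 t' \<otimes> f (u @ t @ m @ t' @ v)))"
    by (rule finsum_swap) (use cl rule_finite r in auto)
  also have "\<dots> = (\<Oplus>t'\<in>A2. \<Oplus>t\<in>A1. c2 t' \<otimes> (c1 t \<otimes> f (u @ t @ m @ t' @ v)))"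
    by (intro finsum_cong') (use cl in \<open>auto intro!: finsum_closed m_lcomm\<close>)
  also have "\<dots> = contract f A2 c2 (u @ s1 @ m) v"
    unfolding contract_def
    by (rule finsum_cong') (use cl 2 rule_finite[OF r(1)] in \<open>auto intro!: finsum_closed finsum_rdistr[symmetric]\<close>)
  finally show ?thesis .
qed

text \<open>\<open>f\<close> is defined by well-founded recursion along \<open>ord\<close>, with one
  occurrence of a left-hand side chosen in each reducible word; confluence then shows, again by
  induction, that the choice does not matter. As \<open>g\<close> is free on irreducible words,
  these are linearly independent modulo the relations.\<close>

theorem diamond:
  assumes res: overlaps_resolve and g: "range g \<subseteq> carrier F"
  shows "\<exists>f. range f \<subseteq> carrier F \<and> (\<forall>w. \<not> reducible w \<longrightarrow> f w = g w) \<and> (\<forall>w. obeys f w)"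
proof -
  define occ where "occ w q = (case q of (u, s, A, c, v) \<Rightarrow> (s, A, c) \<in> rules \<and> w = u @ s @ v)"
    for w and q :: "'l list \<times> 'l list \<times> 'l list set \<times> ('l list \<Rightarrow> 'a) \<times> 'l list"
  \<comment> \<open>The summand is restricted to \<open>A\<close> so that replacing the cut-off
    \<open>h\<close> by \<open>f\<close> is an equality of functions. A congruence rule for sums
    would ask for the closure of \<open>f\<close>, which is proved only afterwards.\<close>
  define f where "f = wfrec ord (\<lambda>h w. if reducible w
     then (case (SOME q. occ w q) of (u, s, A, c, v) \<Rightarrow> finsum F (\<lambda>t\<in>A. c t \<otimes> h (u @ t @ v)) A) else g w)"
  have irr: "f w = g w" if "\<not> reducible w" for w
    using that by (simp add: f_def wfrec[OF wf_ord])
  have red: "\<exists>u s A c v. (s, A, c) \<in> rules \<and> w = u @ s @ v \<and> f w = finsum F (\<lambda>t\<in>A. c t \<otimes> f (u @ t @ v)) A"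
    if "reducible w" for w
  proof -
    obtain u s A c v where q: "(SOME q. occ w q) = (u, s, A, c, v)" by (metis prod_cases5)
    have "\<exists>q. occ w q" using that unfolding reducible_def occ_def by force
    then have "occ w (SOME q. occ w q)" by (rule someI_ex)
    then have o: "(s, A, c) \<in> rules" "w = u @ s @ v" using q unfolding occ_def by auto
    have "f w = finsum F (\<lambda>t\<in>A. c t \<otimes> cut f ord w (u @ t @ v)) A"
      unfolding f_def by (subst wfrec[OF wf_ord]) (simp add: that q)
    also have "(\<lambda>t\<in>A. c t \<otimes> cut f ord w (u @ t @ v)) = (\<lambda>t\<in>A. c t \<otimes> f (u @ t @ v))"
      using rule_ord[OF o(1)] o(2) by (auto simp: restrict_def cut_apply)
    finally show ?thesis using o by blast
  qed
  have fc: "f w \<in> carrier F" for w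
  proof (induction w rule: wf_induct_rule[OF wf_ord])
    case (1 w)
    show ?case
    proof (cases "reducible w")
      case False
      then show ?thesis using irr g by auto
    next
      case True
      then obtain u s A c v where q: "(s, A, c) \<in> rules" "w = u @ s @ v"
        "f w = finsum F (\<lambda>t\<in>A. c t \<otimes> f (u @ t @ v)) A" using red by blast
      show ?thesis unfolding q(3)
        by (rule finsum_closed) (use 1 rule_ord[OF q(1)] rule_closed[OF q(1)] q(2) in auto)
    qed
  qed
  then have fr: "range f \<subseteq> carrier F" by auto
  have resp: "obeys f w" for w
  proof (induction w rule: wf_induct_rule[OF wf_ord])
    case (1 w)
    have eq: "contract f A1 c1 u1 v1 = contract f A2 c2 u2 v2"
      if r: "(s1, A1, c1) \<in> rules" "(s2, A2, c2) \<in> rules" and w: "w = u1 @ s1 @ v1" "w = u2 @ s2 @ v2"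
        and le: "length u1 \<le> length u2" for s1 A1 c1 u1 v1 s2 A2 c2 u2 v2
    proof (cases "length u2 < length u1 + length s1")
      case True
      then show ?thesis using res fr r w le 1 unfolding overlaps_resolve_def by blast
    next
      case False
      \<comment> \<open>The second factor starts after the first has ended, so the prefix
        \<open>u2\<close> contains \<open>u1 @ s1\<close>.\<close>
      have "u2 = take (length u2) w" using w(2) by simp
      then obtain m where m: "u2 = u1 @ s1 @ m" using w(1) False le by (auto simp: take_append)
      then have v1: "v1 = m @ s2 @ v2" using w by simp
      show ?thesis unfolding m v1
        by (rule contract_disjoint[OF fr r]) (use 1 w m in auto)
    qed
    show ?case unfolding obeys_def
    proof (intro allI impI, elim conjE)
      fix u s v A c assume a: "(s, A, c) \<in> rules" "w = u @ s @ v"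
      then have "reducible w" unfolding reducible_def by blast
      then obtain u' s' A' c' v' where q: "(s', A', c') \<in> rules" "w = u' @ s' @ v'"
        "f w = finsum F (\<lambda>t\<in>A'. c' t \<otimes> f (u' @ t @ v')) A'" using red by blast
      have "f w = contract f A' c' u' v'"
        unfolding q(3) contract_def by (rule finsum_cong') (use fc rule_closed[OF q(1)] in auto)
      also have "\<dots> = contract f A c u v"
        using eq[OF a(1) q(1) a(2) q(2)] eq[OF q(1) a(1) q(2) a(2)] by (metis nle_le)
      finally show "f w = contract f A c u v" .
    qed
  qed
  show ?thesis using fr irr resp by blast
qed

end

section \<open>Binomial sums in characteristic p\<close>

context abelian_group
begin

text \<open>Pascal's rule for sums of multiples. Extending the first sum to \<open>Suc m\<close>
  adds a term with coefficient \<open>m choose Suc m\<close>, which is 0.\<close>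

lemma finsum_binomial_Suc:
  assumes g: "g \<in> UNIV \<rightarrow> carrier G"
  shows "(\<Oplus>i\<in>{..Suc m}. add_pow G (Suc m choose i) (g i)) =
         (\<Oplus>i\<in>{..m}. add_pow G (m choose i) (g i)) \<oplus> (\<Oplus>i\<in>{..m}. add_pow G (m choose i) (g (Suc i)))"
proof -
  have gc: "g i \<in> carrier G" for i using g by auto
  have "(\<Oplus>i\<in>{..Suc m}. add_pow G (Suc m choose i) (g i)) =
      (\<Oplus>i\<in>{..m}. add_pow G (Suc m choose Suc i) (g (Suc i))) \<oplus> add_pow G (Suc m choose 0) (g 0)"
    by (rule finsum_Suc2) (use gc in auto)
  also have "(\<Oplus>i\<in>{..m}. add_pow G (Suc m choose Suc i) (g (Suc i))) =
      (\<Oplus>i\<in>{..m}. add_pow G (m choose i) (g (Suc i)) \<oplus> add_pow G (m choose Suc i) (g (Suc i)))"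
    by (rule finsum_cong') (use gc in \<open>auto simp: add.nat_pow_mult\<close>)
  also have "\<dots> = (\<Oplus>i\<in>{..m}. add_pow G (m choose i) (g (Suc i))) \<oplus> (\<Oplus>i\<in>{..m}. add_pow G (m choose Suc i) (g (Suc i)))"
    by (rule finsum_addf) (use gc in auto)
  finally have 1: "(\<Oplus>i\<in>{..Suc m}. add_pow G (Suc m choose i) (g i)) =
      (\<Oplus>i\<in>{..m}. add_pow G (m choose i) (g (Suc i))) \<oplus> (\<Oplus>i\<in>{..m}. add_pow G (m choose Suc i) (g (Suc i))) \<oplus> add_pow G (Suc m choose 0) (g 0)" .
  have "(\<Oplus>i\<in>{..Suc m}. add_pow G (m choose i) (g i)) = (\<Oplus>i\<in>{..m}. add_pow G (m choose Suc i) (g (Suc i))) \<oplus> add_pow G (m choose 0) (g 0)"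
    by (rule finsum_Suc2) (use gc in auto)
  moreover have "(\<Oplus>i\<in>{..Suc m}. add_pow G (m choose i) (g i)) = add_pow G (m choose Suc m) (g (Suc m)) \<oplus> (\<Oplus>i\<in>{..m}. add_pow G (m choose i) (g i))"
    by (rule finsum_Suc) (use gc in auto)
  ultimately have 2: "(\<Oplus>i\<in>{..m}. add_pow G (m choose Suc i) (g (Suc i))) \<oplus> add_pow G (m choose 0) (g 0) = (\<Oplus>i\<in>{..m}. add_pow G (m choose i) (g i))"
    using gc by (simp add: binomial_eq_0)
  have c: "(\<Oplus>i\<in>{..m}. add_pow G (m choose i) (g (Suc i))) \<in> carrier G" "(\<Oplus>i\<in>{..m}. add_pow G (m choose Suc i) (g (Suc i))) \<in> carrier G"
    "add_pow G (m choose 0) (g 0) \<in> carrier G" "(\<Oplus>i\<in>{..m}. add_pow G (m choose i) (g i)) \<in> carrier G"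
    by (auto intro!: finsum_closed simp: gc)
  have "(x \<oplus> y) \<oplus> z = w \<oplus> x" if "y \<oplus> z = w" "x \<in> carrier G" "y \<in> carrier G" "z \<in> carrier G" for x y z w
    using that by (auto simp: a_ac)
  from this[OF 2 c(1-3)] show ?thesis unfolding 1 by (simp only: binomial_n_0)
qed

text \<open>With \<open>G k a b = x\<^sup>a (ad x)\<^sup>k(y) x\<^sup>b\<close> this is \<open>(\<Sum>a<p. x\<^sup>a y x\<^sup>p\<^sup>-\<^sup>1\<^sup>-\<^sup>a) = (ad x)\<^sup>p\<^sup>-\<^sup>1(y)\<close>.\<close>

lemma finsum_eq_ad_power:
  assumes p: "Factorial_Ring.prime p" and char: "\<And>x. x \<in> carrier G \<Longrightarrow> add_pow G p x = \<zero>"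
    and cl: "\<And>k a b. H k a b \<in> carrier G"
    and rec: "\<And>k a b. Suc (k + a + b) < p \<Longrightarrow> H k (Suc a) b = H k a (Suc b) \<oplus> H (Suc k) a b"
  shows "(\<Oplus>a\<in>{..<p}. H 0 a (p - 1 - a)) = H (p - 1) 0 0"
proof -
  \<comment> \<open>The binomial expansion of the m-th power of left multiplication, read as right
    multiplication plus commutator. The bound on \<open>k + m + b\<close> keeps every use of
    \<open>rec\<close> within its range.\<close>
  have exp: "H k m b = (\<Oplus>i\<in>{..m}. add_pow G (m choose i) (H (k + i) 0 (b + m - i)))" if "k + m + b < p" for k m b
    using that
  proof (induction m arbitrary: k b)
    case 0
    then show ?case by (simp add: cl)
  next
    case (Suc m)
    let ?g = "\<lambda>i. H (k + i) 0 (b + Suc m - i)"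
    have "H k (Suc m) b = H k m (Suc b) \<oplus> H (Suc k) m b" using Suc.prems by (intro rec) simp
    also have "\<dots> = (\<Oplus>i\<in>{..m}. add_pow G (m choose i) (H (k + i) 0 (Suc b + m - i)))
         \<oplus> (\<Oplus>i\<in>{..m}. add_pow G (m choose i) (H (Suc k + i) 0 (b + m - i)))"
      using Suc.IH[of k "Suc b"] Suc.IH[of "Suc k" b] Suc.prems by simp
    also have "\<dots> = (\<Oplus>i\<in>{..Suc m}. add_pow G (Suc m choose i) (?g i))"
      using finsum_binomial_Suc[of ?g m] cl by simp
    finally show ?case .
  qed
  define h where "h i = H i 0 (p - 1 - i)" for i
  have hc: "h i \<in> carrier G" for i by (simp add: h_def cl)
  have T: "H 0 a (p - 1 - a) = (\<Oplus>i\<in>{..<p}. add_pow G (a choose i) (h i))" if "a < p" for a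
  proof -
    have "H 0 a (p - 1 - a) = (\<Oplus>i\<in>{..a}. add_pow G (a choose i) (h i))"
      using exp[of 0 a "p - 1 - a"] that by (simp add: h_def)
    also have "\<dots> = (\<Oplus>i\<in>{..<p}. add_pow G (a choose i) (h i))"
      by (rule add.finprod_mono_neutral_cong_left) (use that hc in \<open>auto simp: binomial_eq_0\<close>)
    finally show ?thesis .
  qed
  \<comment> \<open>Summing the coefficients \<open>a choose i\<close> over \<open>a < q\<close>
    gives \<open>q choose Suc i\<close>, by Pascal's rule at each step.\<close>
  have "(\<Oplus>a\<in>{..<q}. H 0 a (p - 1 - a)) = (\<Oplus>i\<in>{..<p}. add_pow G (q choose Suc i) (h i))" if "q \<le> p" for q
    using that
  proof (induction q)
    case 0
    then show ?case using add.finprod_one_eqI[of "{..<p}" "\<lambda>i. add_pow G (0 choose Suc i) (h i)"] by simp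
  next
    case (Suc q)
    have "(\<Oplus>a\<in>{..<Suc q}. H 0 a (p - 1 - a)) = H 0 q (p - 1 - q) \<oplus> (\<Oplus>a\<in>{..<q}. H 0 a (p - 1 - a))"
      unfolding lessThan_Suc by (rule finsum_insert) (auto simp: cl)
    also have "\<dots> = (\<Oplus>i\<in>{..<p}. add_pow G (q choose i) (h i)) \<oplus> (\<Oplus>i\<in>{..<p}. add_pow G (q choose Suc i) (h i))"
      using Suc T[of q] by simp
    also have "\<dots> = (\<Oplus>i\<in>{..<p}. add_pow G (q choose i) (h i) \<oplus> add_pow G (q choose Suc i) (h i))"
      by (rule finsum_addf[symmetric]) (auto simp: hc)
    also have "\<dots> = (\<Oplus>i\<in>{..<p}. add_pow G (Suc q choose Suc i) (h i))"
      by (rule finsum_cong') (auto simp: hc add.nat_pow_mult)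
    finally show ?case .
  qed
  from this[of p] have "(\<Oplus>a\<in>{..<p}. H 0 a (p - 1 - a)) = (\<Oplus>i\<in>{..<p}. add_pow G (p choose Suc i) (h i))" by simp
  \<comment> \<open>Below the top index \<open>p choose Suc i\<close> is divisible by
    \<open>p\<close>, so only \<open>i = p - 1\<close> survives.\<close>
  also have "\<dots> = (\<Oplus>i\<in>{..<p}. if i = p - 1 then h i else \<zero>)"
  proof (rule finsum_cong')
    fix i assume i: "i \<in> {..<p}"
    show "add_pow G (p choose Suc i) (h i) = (if i = p - 1 then h i else \<zero>)"
    proof (cases "i = p - 1")
      case True
      then show ?thesis using i hc by simp
    next
      case False
      then have "p dvd p choose Suc i" using i by (intro dvd_choose_prime) (use p in auto)
      then obtain q where "p choose Suc i = p * q" by blast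
      then have "add_pow G (p choose Suc i) (h i) = add_pow G p (add_pow G q (h i))" using hc by (simp add: add.nat_pow_pow mult.commute)
      then show ?thesis using char[of "add_pow G q (h i)"] hc False by simp
    qed
  qed (use hc in auto)
  also have "\<dots> = h (p - 1)"
    using add.finprod_singleton_swap[of "p - 1" "{..<p}" h] hc prime_gt_0_nat[OF p] by (auto simp: Pi_def)
  finally show ?thesis by (simp add: h_def)
qed

end

section \<open>Poincare-Birkhoff-Witt functionals\<close>

context lie_algebra
begin

lemma bracket_zero_left: "x \<in> carrier L \<Longrightarrow> bracket L \<zero>\<^bsub>L\<^esub> x = \<zero>\<^bsub>L\<^esub>"
  using bracket_smult_left[of "\<zero>\<^bsub>F\<^esub>" "\<zero>\<^bsub>L\<^esub>" x] bracket_closed[of "\<zero>\<^bsub>L\<^esub>" x] by simp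

lemma bracket_zero_right: "x \<in> carrier L \<Longrightarrow> bracket L x \<zero>\<^bsub>L\<^esub> = \<zero>\<^bsub>L\<^esub>"
  using bracket_smult_right[of "\<zero>\<^bsub>F\<^esub>" x "\<zero>\<^bsub>L\<^esub>"] bracket_closed[of x "\<zero>\<^bsub>L\<^esub>"] by simp

lemma bracket_swap:
  assumes "x \<in> carrier L" "y \<in> carrier L"
  shows "bracket L y x = \<ominus>\<^bsub>L\<^esub> bracket L x y"
proof -
  have c: "bracket L x x \<in> carrier L" "bracket L x y \<in> carrier L" "bracket L y x \<in> carrier L" "bracket L y y \<in> carrier L"
    using assms bracket_closed by auto
  have "\<zero>\<^bsub>L\<^esub> = bracket L (x \<oplus>\<^bsub>L\<^esub> y) (x \<oplus>\<^bsub>L\<^esub> y)" using assms bracket_self by simp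
  also have "\<dots> = bracket L x x \<oplus>\<^bsub>L\<^esub> bracket L x y \<oplus>\<^bsub>L\<^esub> (bracket L y x \<oplus>\<^bsub>L\<^esub> bracket L y y)"
    using assms c by (simp add: bracket_add_left bracket_add_right M.a_ac)
  also have "\<dots> = bracket L y x \<oplus>\<^bsub>L\<^esub> bracket L x y" using assms c by (simp add: bracket_self M.a_comm)
  finally show ?thesis using c by (metis M.minus_equality)
qed

lemma bracket_neg_left:
  "x \<in> carrier L \<Longrightarrow> y \<in> carrier L \<Longrightarrow> bracket L (\<ominus>\<^bsub>L\<^esub> x) y = \<ominus>\<^bsub>L\<^esub> bracket L x y"
  using bracket_add_left[of "\<ominus>\<^bsub>L\<^esub> x" x y] bracket_zero_left bracket_closed
  by (metis M.a_inv_closed M.l_neg M.minus_equality)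

lemma bracket_neg_right:
  "x \<in> carrier L \<Longrightarrow> y \<in> carrier L \<Longrightarrow> bracket L x (\<ominus>\<^bsub>L\<^esub> y) = \<ominus>\<^bsub>L\<^esub> bracket L x y"
  using bracket_add_right[of x "\<ominus>\<^bsub>L\<^esub> y" y] bracket_zero_right bracket_closed
  by (metis M.a_inv_closed M.l_neg M.minus_equality)

lemma ad_pow_closed: "x \<in> carrier L \<Longrightarrow> y \<in> carrier L \<Longrightarrow> (bracket L x ^^ k) y \<in> carrier L"
  by (induction k) (auto intro: bracket_closed)

lemma ad_pow_neg:
  "x \<in> carrier L \<Longrightarrow> y \<in> carrier L \<Longrightarrow> (bracket L x ^^ k) (\<ominus>\<^bsub>L\<^esub> y) = \<ominus>\<^bsub>L\<^esub> (bracket L x ^^ k) y"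
  by (induction k) (simp_all add: bracket_neg_right ad_pow_closed)

text \<open>The Jacobi identity arranged as the three double brackets left over when the product z y
  x is sorted to x y z in the two possible ways.\<close>

lemma jacobi_left:
  assumes "x \<in> carrier L" "y \<in> carrier L" "z \<in> carrier L"
  shows "bracket L (bracket L z y) x \<oplus>\<^bsub>L\<^esub> bracket L y (bracket L z x) \<oplus>\<^bsub>L\<^esub> bracket L (bracket L y x) z = \<zero>\<^bsub>L\<^esub>"
proof -
  have "bracket L (bracket L z y) x = bracket L x (bracket L y z)"
    using assms by (metis bracket_closed bracket_neg_left bracket_swap)
  moreover have "bracket L (bracket L y x) z = bracket L z (bracket L x y)"
    using assms by (metis bracket_closed bracket_neg_left bracket_swap)
  ultimately show ?thesis using jacobi[OF assms] assms bracket_closed by simp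
qed

end

lemma (in restricted_lie_algebra) two_le_p: "2 \<le> p"
  using prime_p prime_ge_2_nat by blast

text \<open>Bezout gives \<open>a * i = c * p + 1\<close>, so \<open>i\<close> and \<open>p\<close>
  cannot both vanish in \<open>F\<close>. This is what allows the division by \<open>i\<close> in
  Jacobson's elements.\<close>

lemma (in restricted_lie_algebra) char_nonzero:
  assumes "0 < i" "i < p" shows "add_pow F i \<one>\<^bsub>F\<^esub> \<noteq> \<zero>\<^bsub>F\<^esub>"
proof
  assume z: "add_pow F i \<one>\<^bsub>F\<^esub> = \<zero>\<^bsub>F\<^esub>"
  have "coprime i p" using assms prime_p by (metis coprime_commute nat_dvd_not_less prime_imp_coprime_nat)
  then obtain a c where ac: "a * i = c * p + 1" using bezout_nat[of i p] assms by (metis coprime_imp_gcd_eq_1 mult.commute not_gr_zero)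
  have "add_pow F (a * i) \<one>\<^bsub>F\<^esub> = \<zero>\<^bsub>F\<^esub>" using z R.add.nat_pow_pow[of "\<one>\<^bsub>F\<^esub>" a i] by (simp add: mult.commute)
  moreover have "add_pow F (c * p) \<one>\<^bsub>F\<^esub> = \<zero>\<^bsub>F\<^esub>" using char_p R.add.nat_pow_pow[of "\<one>\<^bsub>F\<^esub>" c p] by (simp add: mult.commute)
  ultimately show False unfolding ac by simp
qed

text \<open>A finite basis given together with its dual coordinate functions. It is indexed by
  numbers because the rewriting of words needs an order on the letters.\<close>

locale lie_basis = restricted_lie_algebra F L p
  for F (structure) and L :: "('a, 'b, 'c) restricted_lie_scheme" and p +
  fixes n :: nat and b :: "nat \<Rightarrow> 'b" and coord :: "nat \<Rightarrow> 'b \<Rightarrow> 'a"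
  assumes b_closed: "k < n \<Longrightarrow> b k \<in> carrier L"
    and coord_closed: "x \<in> carrier L \<Longrightarrow> coord k x \<in> carrier F"
    and coord_add: "x \<in> carrier L \<Longrightarrow> y \<in> carrier L \<Longrightarrow> coord k (x \<oplus>\<^bsub>L\<^esub> y) = coord k x \<oplus> coord k y"
    and coord_smult: "a \<in> carrier F \<Longrightarrow> x \<in> carrier L \<Longrightarrow> coord k (a \<odot>\<^bsub>L\<^esub> x) = a \<otimes> coord k x"
    and coord_b: "k < n \<Longrightarrow> l < n \<Longrightarrow> coord k (b l) = (if k = l then \<one> else \<zero>)"
    and coord_expand: "x \<in> carrier L \<Longrightarrow> (\<Oplus>\<^bsub>L\<^esub>k\<in>{..<n}. coord k x \<odot>\<^bsub>L\<^esub> b k) = x"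
begin

definition linear_form :: "('b \<Rightarrow> 'a) \<Rightarrow> bool" where
  "linear_form H \<longleftrightarrow> (\<forall>x\<in>carrier L. H x \<in> carrier F)
     \<and> (\<forall>x\<in>carrier L. \<forall>y\<in>carrier L. H (x \<oplus>\<^bsub>L\<^esub> y) = H x \<oplus> H y)
     \<and> (\<forall>a\<in>carrier F. \<forall>x\<in>carrier L. H (a \<odot>\<^bsub>L\<^esub> x) = a \<otimes> H x)"

definition multilinear :: "('b list \<Rightarrow> 'a) \<Rightarrow> bool" where
  "multilinear G \<longleftrightarrow> (\<forall>us ws. set us \<subseteq> carrier L \<longrightarrow> set ws \<subseteq> carrier L \<longrightarrow> linear_form (\<lambda>x. G (us @ x # ws)))"

lemma linear_form_closed: "linear_form H \<Longrightarrow> x \<in> carrier L \<Longrightarrow> H x \<in> carrier F"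
  by (simp add: linear_form_def)

lemma linear_form_zero: "linear_form H \<Longrightarrow> H \<zero>\<^bsub>L\<^esub> = \<zero>"
  unfolding linear_form_def by (metis M.zero_closed R.zero_closed lmult_0 R.l_null)

lemma linear_form_neg: "linear_form H \<Longrightarrow> x \<in> carrier L \<Longrightarrow> H (\<ominus>\<^bsub>L\<^esub> x) = \<ominus> H x"
  using linear_form_zero[of H] unfolding linear_form_def
  by (metis M.a_inv_closed M.l_neg R.minus_equality)

lemma linear_form_finsum:
  assumes H: "linear_form H" and A: "finite A" and f: "\<And>k. k \<in> A \<Longrightarrow> f k \<in> carrier L"
  shows "H (\<Oplus>\<^bsub>L\<^esub>k\<in>A. f k) = (\<Oplus>k\<in>A. H (f k))"
  using A f
proof (induction A)
  case empty
  then show ?case using linear_form_zero[OF H] by simp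
next
  case (insert a A)
  have "H (\<Oplus>\<^bsub>L\<^esub>k\<in>insert a A. f k) = H (f a \<oplus>\<^bsub>L\<^esub> (\<Oplus>\<^bsub>L\<^esub>k\<in>A. f k))"
    using insert by (subst M.finsum_insert) auto
  also have "\<dots> = H (f a) \<oplus> H (\<Oplus>\<^bsub>L\<^esub>k\<in>A. f k)"
    using H insert unfolding linear_form_def by (simp add: M.finsum_closed Pi_def)
  also have "\<dots> = (\<Oplus>k\<in>insert a A. H (f k))"
    using insert H by (subst R.finsum_insert) (auto simp: linear_form_closed)
  finally show ?case .
qed

lemma linear_form_eqI:
  assumes H: "linear_form H" and H': "linear_form H'" and eq: "\<And>k. k < n \<Longrightarrow> H (b k) = H' (b k)"
    and x: "x \<in> carrier L"
  shows "H x = H' x"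
proof -
  have c: "coord k x \<odot>\<^bsub>L\<^esub> b k \<in> carrier L" if "k < n" for k using that x coord_closed b_closed by simp
  have 1: "G x = (\<Oplus>k\<in>{..<n}. coord k x \<otimes> G (b k))" if G: "linear_form G" for G
  proof -
    have "G x = (\<Oplus>k\<in>{..<n}. G (coord k x \<odot>\<^bsub>L\<^esub> b k))"
      using linear_form_finsum[OF G, of "{..<n}" "\<lambda>k. coord k x \<odot>\<^bsub>L\<^esub> b k"] c coord_expand[OF x] by simp
    also have "\<dots> = (\<Oplus>k\<in>{..<n}. coord k x \<otimes> G (b k))"
      by (rule R.finsum_cong') (use G x in \<open>auto simp: linear_form_def coord_closed b_closed\<close>)
    finally show ?thesis .
  qed
  have "(\<Oplus>k\<in>{..<n}. coord k x \<otimes> H (b k)) = (\<Oplus>k\<in>{..<n}. coord k x \<otimes> H' (b k))"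
    by (rule R.finsum_cong') (use eq H' x in \<open>auto simp: linear_form_closed coord_closed b_closed\<close>)
  then show ?thesis using 1[OF H] 1[OF H'] by simp
qed

lemma linear_form_add:
  assumes "linear_form H" "linear_form H'"
  shows "linear_form (\<lambda>x. H x \<oplus> H' x)"
  using assms unfolding linear_form_def by (auto simp: R.a_ac R.r_distr)

lemma linear_form_scale:
  assumes "a \<in> carrier F" "linear_form H"
  shows "linear_form (\<lambda>x. a \<otimes> H x)"
  using assms unfolding linear_form_def by (simp add: R.r_distr R.m_lcomm)

lemma linear_form_sum:
  assumes A: "finite A" and "\<And>k. k \<in> A \<Longrightarrow> a k \<in> carrier F" "\<And>k. k \<in> A \<Longrightarrow> linear_form (H k)"
  shows "linear_form (\<lambda>x. \<Oplus>k\<in>A. a k \<otimes> H k x)"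
  using assms
proof (induction A)
  case empty
  then show ?case by (simp add: linear_form_def)
next
  case (insert q A)
  have l: "linear_form (\<lambda>x. a q \<otimes> H q x \<oplus> (\<Oplus>k\<in>A. a k \<otimes> H k x))"
    by (intro linear_form_add linear_form_scale insert.IH insert.prems) auto
  have e: "(\<Oplus>k\<in>insert q A. a k \<otimes> H k x) = a q \<otimes> H q x \<oplus> (\<Oplus>k\<in>A. a k \<otimes> H k x)" if "x \<in> carrier L" for x
    using insert that by (intro R.finsum_insert) (auto simp: linear_form_closed)
  show ?case using l unfolding linear_form_def by (simp add: e)
qed

lemma linear_form_bracket_left:
  assumes H: "linear_form H" and y: "y \<in> carrier L" shows "linear_form (\<lambda>x. H (bracket L x y))"
  using assms unfolding linear_form_def by (auto simp: bracket_closed bracket_add_left bracket_smult_left)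

lemma linear_form_bracket_right:
  assumes H: "linear_form H" and y: "y \<in> carrier L" shows "linear_form (\<lambda>x. H (bracket L y x))"
  using assms unfolding linear_form_def by (auto simp: bracket_closed bracket_add_right bracket_smult_right)

text \<open>The arguments are a general prefix followed by a suffix of basis vectors. The last
  general argument is expanded in the basis and joins the suffix, until the prefix is empty.\<close>

lemma multilinear_eqI:
  assumes G: "multilinear G" and G': "multilinear G'"
    and eq: "\<And>w. set w \<subseteq> {..<n} \<Longrightarrow> length w = m \<Longrightarrow> G (map b w) = G' (map b w)"
    and xs: "set xs \<subseteq> carrier L" "length xs = m"
  shows "G xs = G' xs"
proof -
  have "G (us @ map b w) = G' (us @ map b w)"
    if "set us \<subseteq> carrier L" "set w \<subseteq> {..<n}" "length us + length w = m" for us w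
    using that
  proof (induction us arbitrary: w rule: rev_induct)
    case Nil
    then show ?case using eq by simp
  next
    case (snoc x us)
    have w: "set (map b w) \<subseteq> carrier L" using snoc.prems b_closed by auto
    have "G (us @ x # map b w) = G' (us @ x # map b w)"
    proof (rule linear_form_eqI[of "\<lambda>x. G (us @ x # map b w)" "\<lambda>x. G' (us @ x # map b w)" x])
      show "linear_form (\<lambda>x. G (us @ x # map b w))" "linear_form (\<lambda>x. G' (us @ x # map b w))"
        using G G' w snoc.prems unfolding multilinear_def by auto
      show "G (us @ b k # map b w) = G' (us @ b k # map b w)" if "k < n" for k
        using snoc.IH[of "k # w"] snoc.prems that by simp
      show "x \<in> carrier L" using snoc.prems by simp
    qed
    then show ?case by simp
  qed
  from this[of xs "[]"] show ?thesis using xs by simp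
qed

text \<open>The value, on the product of the vectors \<open>xs\<close> in the tensor algebra of
  \<open>L\<close>, of the linear functional whose values on words in the basis are given by
  \<open>f\<close>.\<close>

primrec ml :: "'b list \<Rightarrow> (nat list \<Rightarrow> 'a) \<Rightarrow> 'a" where
  "ml [] f = f []"
| "ml (x # xs) f = (\<Oplus>k\<in>{..<n}. coord k x \<otimes> ml xs (\<lambda>w. f (k # w)))"

lemma ml_closed:
  "range f \<subseteq> carrier F \<Longrightarrow> set xs \<subseteq> carrier L \<Longrightarrow> ml xs f \<in> carrier F"
proof (induction xs arbitrary: f)
  case (Cons x xs)
  then have "ml xs (\<lambda>w. f (k # w)) \<in> carrier F" for k by (intro Cons.IH) auto
  then show ?case using Cons.prems by (auto intro!: R.finsum_closed simp: coord_closed)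
qed auto

lemma linear_form_ml:
  "range f \<subseteq> carrier F \<Longrightarrow> set us \<subseteq> carrier L \<Longrightarrow> set ws \<subseteq> carrier L \<Longrightarrow> linear_form (\<lambda>x. ml (us @ x # ws) f)"
proof (induction us arbitrary: f)
  case Nil
  let ?c = "\<lambda>k. ml ws (\<lambda>w. f (k # w))"
  have c: "?c k \<in> carrier F" for k using Nil by (intro ml_closed) auto
  have l: "linear_form (\<lambda>x. \<Oplus>k\<in>{..<n}. ?c k \<otimes> coord k x)"
    by (rule linear_form_sum) (auto simp: c linear_form_def coord_closed coord_add coord_smult)
  have "(\<Oplus>k\<in>{..<n}. coord k x \<otimes> ?c k) = (\<Oplus>k\<in>{..<n}. ?c k \<otimes> coord k x)" if "x \<in> carrier L" for x
    by (rule R.finsum_cong') (use that c in \<open>auto simp: coord_closed R.m_comm\<close>)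
  then show ?case using l unfolding linear_form_def by simp
next
  case (Cons u us)
  have "linear_form (\<lambda>x. ml (us @ x # ws) (\<lambda>w. f (k # w)))" for k using Cons.prems by (intro Cons.IH) auto
  then have "linear_form (\<lambda>x. \<Oplus>k\<in>{..<n}. coord k u \<otimes> ml (us @ x # ws) (\<lambda>w. f (k # w)))"
    by (intro linear_form_sum) (use Cons.prems coord_closed in auto)
  then show ?case by simp
qed

lemma multilinear_ml:
  assumes "range f \<subseteq> carrier F" "set us \<subseteq> carrier L" "set ws \<subseteq> carrier L"
  shows "multilinear (\<lambda>xs. ml (us @ xs @ ws) f)"
  unfolding multilinear_def
proof (intro allI impI)
  fix us' ws' assume *: "set us' \<subseteq> carrier L" "set ws' \<subseteq> carrier L"
  show "linear_form (\<lambda>x. ml (us @ (us' @ x # ws') @ ws) f)"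
    using linear_form_ml[of f "us @ us'" "ws' @ ws"] assms * by simp
qed

lemma multilinear_add: "multilinear G \<Longrightarrow> multilinear G' \<Longrightarrow> multilinear (\<lambda>xs. G xs \<oplus> G' xs)"
  unfolding multilinear_def using linear_form_add by blast

lemma ml_b_Cons:
  assumes f: "range f \<subseteq> carrier F" and j: "j < n" and xs: "set xs \<subseteq> carrier L"
  shows "ml (b j # xs) f = ml xs (\<lambda>w. f (j # w))"
proof -
  have c: "ml xs (\<lambda>w. f (k # w)) \<in> carrier F" for k using assms by (intro ml_closed) auto
  have "ml (b j # xs) f = (\<Oplus>k\<in>{..<n}. if k = j then ml xs (\<lambda>w. f (k # w)) else \<zero>)"
    unfolding ml.simps
  proof (rule R.finsum_cong')
    show "(\<lambda>k. if k = j then ml xs (\<lambda>w. f (k # w)) else \<zero>) \<in> {..<n} \<rightarrow> carrier F" using c by simp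
    show "coord k (b j) \<otimes> ml xs (\<lambda>w. f (k # w)) = (if k = j then ml xs (\<lambda>w. f (k # w)) else \<zero>)"
      if "k \<in> {..<n}" for k using coord_b[of k j] c[of k] c[of j] that j by simp
  qed simp
  also have "\<dots> = ml xs (\<lambda>w. f (j # w))"
    using R.add.finprod_singleton_swap[of j "{..<n}" "\<lambda>k. ml xs (\<lambda>w. f (k # w))"] j c by (simp add: Pi_def)
  finally show ?thesis .
qed

lemma ml_append_b:
  assumes "range f \<subseteq> carrier F" "set w \<subseteq> {..<n}"
  shows "set zs \<subseteq> carrier L \<Longrightarrow> ml (zs @ map b w) f = ml zs (\<lambda>v. f (v @ w))"
  using assms(1)
proof (induction zs arbitrary: f)
  case Nil
  from assms(2) Nil have "ml (map b w) f = f w"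
  proof (induction w arbitrary: f)
    case (Cons k w)
    then have "ml (map b (k # w)) f = ml (map b w) (\<lambda>w. f (k # w))"
      using ml_b_Cons[of f k "map b w"] b_closed by fastforce
    also have "\<dots> = f (k # w)" using Cons.prems by (intro Cons.IH) auto
    finally show ?case .
  qed simp
  then show ?case by simp
next
  case (Cons z zs)
  have e: "ml (zs @ map b w) (\<lambda>w. f (k # w)) = ml zs (\<lambda>v. f (k # v @ w))" for k
    using Cons.IH[of "\<lambda>w. f (k # w)"] Cons.prems by auto
  show ?case unfolding append_Cons ml.simps e by simp
qed

lemma ml_b: "range f \<subseteq> carrier F \<Longrightarrow> set w \<subseteq> {..<n} \<Longrightarrow> ml (map b w) f = f w"
  using ml_append_b[of f w "[]"] by simp

lemma ml_context:
  assumes "range f \<subseteq> carrier F" "set u \<subseteq> {..<n}" "set v \<subseteq> {..<n}" "set zs \<subseteq> carrier L"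
  shows "ml (map b u @ zs @ map b v) f = ml zs (\<lambda>w. f (u @ w @ v))"
  using assms(1,2)
proof (induction u arbitrary: f)
  case Nil
  then show ?case using ml_append_b[OF Nil(1) assms(3,4)] by simp
next
  case (Cons k u)
  have "set (map b u @ zs @ map b v) \<subseteq> carrier L"
    using Cons.prems assms(3,4) b_closed by (auto simp: subset_iff)
  then have "ml (map b (k # u) @ zs @ map b v) f = ml (map b u @ zs @ map b v) (\<lambda>w. f (k # w))"
    using ml_b_Cons[of f k "map b u @ zs @ map b v"] Cons.prems by simp
  also have "\<dots> = ml zs (\<lambda>w. f ((k # u) @ w @ v))" using Cons.IH[of "\<lambda>w. f (k # w)"] Cons.prems by auto
  finally show ?case .
qed

text \<open>The length bound \<open>d\<close> lets the relations be used inductively in the confluence proof.\<close>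

definition lie_functional :: "nat \<Rightarrow> (nat list \<Rightarrow> 'a) \<Rightarrow> bool" where
  "lie_functional d f \<longleftrightarrow> (\<forall>us x y ws. set us \<subseteq> carrier L \<longrightarrow> x \<in> carrier L \<longrightarrow> y \<in> carrier L \<longrightarrow>
     set ws \<subseteq> carrier L \<longrightarrow> length us + 2 + length ws \<le> d \<longrightarrow>
     ml (us @ x # y # ws) f = ml (us @ y # x # ws) f \<oplus> ml (us @ bracket L x y # ws) f)"

text \<open>The relation is given only for two basis letters in decreasing order between basis
  words. The bracket being alternating supplies the other orders, and linearity extends it first to
  the two middle letters, then to the prefix and to the suffix. No extension changes a length, so
  the bound \<open>d\<close> survives.\<close>

lemma lie_functionalI:
  assumes f: "range f \<subseteq> carrier F"
    and rel: "\<And>u i j v. set u \<subseteq> {..<n} \<Longrightarrow> set v \<subseteq> {..<n} \<Longrightarrow> i < j \<Longrightarrow> j < n \<Longrightarrow> length u + 2 + length v \<le> d \<Longrightarrow>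
       f (u @ j # i # v) = f (u @ i # j # v) \<oplus> ml [bracket L (b j) (b i)] (\<lambda>w. f (u @ w @ v))"
  shows "lie_functional d f"
proof -
  have lf: "linear_form (\<lambda>x. ml (us @ x # ws) f)" if "set us \<subseteq> carrier L" "set ws \<subseteq> carrier L" for us ws
    using linear_form_ml[OF f that] .
  have 1: "ml (map b u @ b j # b i # map b v) f
      = ml (map b u @ b i # b j # map b v) f \<oplus> ml (map b u @ bracket L (b j) (b i) # map b v) f"
    if w: "set u \<subseteq> {..<n}" "set v \<subseteq> {..<n}" "length u + 2 + length v \<le> d" and ij: "i < n" "j < n" for u v i j
  proof -
    have U: "set (map b u) \<subseteq> carrier L" "set (map b v) \<subseteq> carrier L" using w b_closed by auto
    have B: "bracket L (b i) (b j) \<in> carrier L" if "i < n" "j < n" for i j using that bracket_closed b_closed by simp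
    have c: "ml (map b u @ x # map b v) f \<in> carrier F" "ml (map b u @ x # y # map b v) f \<in> carrier F"
      if "x \<in> carrier L" "y \<in> carrier L" for x y
      using that U f by (auto intro!: ml_closed simp: image_subset_iff)
    have lt: "ml (map b u @ b j # b i # map b v) f
      = ml (map b u @ b i # b j # map b v) f \<oplus> ml (map b u @ bracket L (b j) (b i) # map b v) f"
      if "i < j" "j < n" for i j
    proof -
      have "ml (map b (u @ j # i # v)) f = f (u @ j # i # v)" "ml (map b (u @ i # j # v)) f = f (u @ i # j # v)"
        using w that ml_b[OF f, of "u @ j # i # v"] ml_b[OF f, of "u @ i # j # v"] by auto
      moreover have "ml (map b u @ [bracket L (b j) (b i)] @ map b v) f = ml [bracket L (b j) (b i)] (\<lambda>w. f (u @ w @ v))"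
        using w f B that by (intro ml_context) auto
      ultimately show ?thesis using rel[of u v i j] w that by simp
    qed
    consider "i < j" | "i = j" | "j < i" by linarith
    then show ?thesis
    proof cases
      case 1
      then show ?thesis using lt ij by simp
    next
      case 2
      then show ?thesis
        using linear_form_zero[OF lf[OF U]] bracket_self[of "b j"] c[of "b j" "b j"] b_closed ij by simp
    next
      case 3
      have e: "ml (map b u @ bracket L (b j) (b i) # map b v) f = \<ominus> ml (map b u @ bracket L (b i) (b j) # map b v) f"
        using bracket_swap[of "b i" "b j"] linear_form_neg[OF lf[OF U], of "bracket L (b i) (b j)"] ij B b_closed by simp
      show ?thesis using lt[OF 3 ij(1)] c[OF b_closed[OF ij(1)] b_closed[OF ij(2)]]
        c[OF b_closed[OF ij(2)] b_closed[OF ij(1)]] c(1)[OF B[OF ij] B[OF ij]]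
        unfolding e by (simp add: R.a_assoc R.r_neg)
    qed
  qed
  have 2: "ml (map b u @ x # y # map b v) f
      = ml (map b u @ y # x # map b v) f \<oplus> ml (map b u @ bracket L x y # map b v) f"
    if w: "set u \<subseteq> {..<n}" "set v \<subseteq> {..<n}" "length u + 2 + length v \<le> d" and x: "x \<in> carrier L" and y: "y \<in> carrier L"
    for u v x y
  proof -
    have U: "set (map b u) \<subseteq> carrier L" "set (map b v) \<subseteq> carrier L" using w b_closed by auto
    have A: "ml (map b u @ x # b i # map b v) f
       = ml (map b u @ b i # x # map b v) f \<oplus> ml (map b u @ bracket L x (b i) # map b v) f"
      if i: "i < n" for i
    proof (rule linear_form_eqI[of "\<lambda>x. ml (map b u @ x # b i # map b v) f"
          "\<lambda>x. ml (map b u @ b i # x # map b v) f \<oplus> ml (map b u @ bracket L x (b i) # map b v) f" x])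
      show "linear_form (\<lambda>x. ml (map b u @ x # b i # map b v) f)" using lf[of "map b u" "b i # map b v"] U i b_closed by simp
      show "linear_form (\<lambda>x. ml (map b u @ b i # x # map b v) f \<oplus> ml (map b u @ bracket L x (b i) # map b v) f)"
        using linear_form_add[OF lf[of "map b u @ [b i]" "map b v"] linear_form_bracket_left[OF lf[of "map b u" "map b v"], of "b i"]]
          U i b_closed by simp
      show "x \<in> carrier L" by fact
      show "ml (map b u @ b k # b i # map b v) f
        = ml (map b u @ b i # b k # map b v) f \<oplus> ml (map b u @ bracket L (b k) (b i) # map b v) f" if "k < n" for k
        by (rule 1[OF w i that])
    qed
    show ?thesis
    proof (rule linear_form_eqI[of "\<lambda>y. ml (map b u @ x # y # map b v) f"
          "\<lambda>y. ml (map b u @ y # x # map b v) f \<oplus> ml (map b u @ bracket L x y # map b v) f" y])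
      show "linear_form (\<lambda>y. ml (map b u @ x # y # map b v) f)" using lf[of "map b u @ [x]" "map b v"] U x by simp
      show "linear_form (\<lambda>y. ml (map b u @ y # x # map b v) f \<oplus> ml (map b u @ bracket L x y # map b v) f)"
        using linear_form_add[OF lf[of "map b u" "x # map b v"] linear_form_bracket_right[OF lf[of "map b u" "map b v"], of x]]
          U x by simp
      show "y \<in> carrier L" by fact
    qed (rule A)
  qed
  have 3: "ml (us @ x # y # map b v) f = ml (us @ y # x # map b v) f \<oplus> ml (us @ bracket L x y # map b v) f"
    if v: "set v \<subseteq> {..<n}" and us: "set us \<subseteq> carrier L" and d: "length us + 2 + length v \<le> d" and x: "x \<in> carrier L" and y: "y \<in> carrier L"
    for us v x y
  proof (rule multilinear_eqI[of "\<lambda>us. ml (us @ x # y # map b v) f"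
        "\<lambda>us. ml (us @ y # x # map b v) f \<oplus> ml (us @ bracket L x y # map b v) f" "length us"])
    have V: "set (map b v) \<subseteq> carrier L" using v b_closed by auto
    note ml = multilinear_ml[OF f, of "[]", simplified]
    show "multilinear (\<lambda>us. ml (us @ x # y # map b v) f)"
      using ml[of "x # y # map b v"] V x y by simp
    show "multilinear (\<lambda>us. ml (us @ y # x # map b v) f \<oplus> ml (us @ bracket L x y # map b v) f)"
      using multilinear_add[OF ml[of "y # x # map b v"] ml[of "bracket L x y # map b v"]] V x y bracket_closed by simp
    show "ml (map b w @ x # y # map b v) f = ml (map b w @ y # x # map b v) f \<oplus> ml (map b w @ bracket L x y # map b v) f"
      if "set w \<subseteq> {..<n}" "length w = length us" for w
      by (rule 2[OF that(1) v _ x y]) (use d that in simp)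
  qed (use us in simp_all)
  show ?thesis unfolding lie_functional_def
  proof (intro allI impI)
    fix us x y ws
    assume us: "set us \<subseteq> carrier L" and x: "x \<in> carrier L" and y: "y \<in> carrier L" and ws: "set ws \<subseteq> carrier L"
      and d: "length us + 2 + length ws \<le> d"
    show "ml (us @ x # y # ws) f = ml (us @ y # x # ws) f \<oplus> ml (us @ bracket L x y # ws) f"
    proof (rule multilinear_eqI[of "\<lambda>ws. ml (us @ x # y # ws) f"
        "\<lambda>ws. ml (us @ y # x # ws) f \<oplus> ml (us @ bracket L x y # ws) f" "length ws"])
      note ml = multilinear_ml[OF f, of _ "[]", simplified]
      show "multilinear (\<lambda>ws. ml (us @ x # y # ws) f)"
        using ml[of "us @ [x, y]"] us x y by simp
      show "multilinear (\<lambda>ws. ml (us @ y # x # ws) f \<oplus> ml (us @ bracket L x y # ws) f)"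
        using multilinear_add[OF ml[of "us @ [y, x]"] ml[of "us @ [bracket L x y]"]] us x y bracket_closed by simp
      show "ml (us @ x # y # map b w) f = ml (us @ y # x # map b w) f \<oplus> ml (us @ bracket L x y # map b w) f"
        if "set w \<subseteq> {..<n}" "length w = length ws" for w
        by (rule 3[OF that(1) us _ x y]) (use d that in simp)
    qed (use ws in simp_all)
  qed
qed

lemma lie_functionalD:
  "lie_functional d f \<Longrightarrow> set us \<subseteq> carrier L \<Longrightarrow> x \<in> carrier L \<Longrightarrow> y \<in> carrier L \<Longrightarrow>
     set ws \<subseteq> carrier L \<Longrightarrow> length us + 2 + length ws \<le> d \<Longrightarrow>
     ml (us @ x # y # ws) f = ml (us @ y # x # ws) f \<oplus> ml (us @ bracket L x y # ws) f"
  unfolding lie_functional_def by blast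

lemma add_pow_p_zero: "x \<in> carrier F \<Longrightarrow> add_pow F p x = \<zero>"
  using R.add_pow_ldistr[of \<one> x p] char_p by simp

text \<open>All words involved have length at most \<open>p\<close>, so the commutation relations up
  to that length make \<open>finsum_eq_ad_power\<close> applicable, the index \<open>k\<close>
  counting the commutators already taken.\<close>

lemma ml_ad_power:
  assumes f: "range f \<subseteq> carrier F" and lf: "lie_functional p f" and x: "x \<in> carrier L" and y: "y \<in> carrier L"
  shows "(\<Oplus>a\<in>{..<p}. ml (replicate a x @ y # replicate (p - 1 - a) x) f) = ml [(bracket L x ^^ (p - 1)) y] f"
proof -
  define H where "H k a c = ml (replicate a x @ (bracket L x ^^ k) y # replicate c x) f" for k a c
  have "(\<Oplus>a\<in>{..<p}. H 0 a (p - 1 - a)) = H (p - 1) 0 0"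
  proof (rule R.finsum_eq_ad_power[OF prime_p add_pow_p_zero])
    show "H k a c \<in> carrier F" for k a c
      unfolding H_def using x ad_pow_closed[OF x y] f by (intro ml_closed) auto
    show "H k (Suc a) c = H k a (Suc c) \<oplus> H (Suc k) a c" if "Suc (k + a + c) < p" for k a c
    proof -
      have "ml (replicate a x @ x # (bracket L x ^^ k) y # replicate c x) f
        = ml (replicate a x @ (bracket L x ^^ k) y # x # replicate c x) f
         \<oplus> ml (replicate a x @ bracket L x ((bracket L x ^^ k) y) # replicate c x) f"
        by (rule lie_functionalD[OF lf]) (use that x ad_pow_closed[OF x y] in auto)
      moreover have "replicate a x @ x # zs = replicate (Suc a) x @ zs" for zs
        by (simp add: replicate_app_Cons_same)
      ultimately show ?thesis unfolding H_def by simp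
    qed
  qed
  then show ?thesis by (simp add: H_def)
qed

end

section \<open>Termination order and normal words\<close>

primrec inversions :: "nat list \<Rightarrow> nat" where
  "inversions [] = 0"
| "inversions (x # w) = length (filter (\<lambda>y. y < x) w) + inversions w"

text \<open>The relations decrease different quantities: exchanging two letters keeps the length and
  lowers the number of inversions, while the bracket and p-map terms are shorter words.\<close>

definition word_ord :: "(nat list \<times> nat list) set" where
  "word_ord = inv_image (less_than <*lex*> less_than) (\<lambda>w. (length w, inversions w))"

lemma inversions_swap: "i < j \<Longrightarrow> inversions (u @ i # j # v) < inversions (u @ j # i # v)"
  by (induction u) auto

lemma word_ord_swap: "i < j \<Longrightarrow> (u @ i # j # v, u @ j # i # v) \<in> word_ord"
  by (simp add: word_ord_def inversions_swap)

lemma word_ord_shorter: "length w < length w' \<Longrightarrow> (w, w') \<in> word_ord"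
  by (simp add: word_ord_def)

lemma replicate_diff: "a < m \<Longrightarrow> replicate (m - a) x = x # replicate (m - Suc a) x"
  by (metis Suc_diff_Suc replicate_Suc)

lemma wf_word_ord: "wf word_ord"
  unfolding word_ord_def by (intro wf_inv_image wf_lex_prod wf_less_than)

lemma trans_word_ord: "trans word_ord"
  unfolding word_ord_def by (intro trans_inv_image trans_lex_prod trans_less_than)

text \<open>The exponent words of the Poincare-Birkhoff-Witt monomials of u(L,0): weakly increasing
  letters, every exponent below \<open>p\<close>.\<close>

definition normal_word :: "nat \<Rightarrow> nat list \<Rightarrow> bool" where
  "normal_word p w \<longleftrightarrow> sorted w \<and> (\<forall>i. count_list w i < p)"

lemma count_list_replicate: "count_list (replicate m i) j = (if i = j then m else 0)"
  by (induction m) auto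

lemma sorted_split_count:
  fixes w :: "nat list"
  shows "sorted w \<Longrightarrow> w = filter (\<lambda>x. x < i) w @ replicate (count_list w i) i @ filter (\<lambda>x. i < x) w"
proof (induction w)
  case (Cons a w)
  then have IH: "w = filter (\<lambda>x. x < i) w @ replicate (count_list w i) i @ filter (\<lambda>x. i < x) w" by simp
  consider "a < i" | "a = i" | "i < a" by linarith
  then show ?case
  proof cases
    case 1
    then show ?thesis using IH by simp
  next
    case 2
    have "filter (\<lambda>x. x < i) w = []" using Cons.prems 2 by (auto simp: filter_empty_conv)
    then show ?thesis using 2 IH by simp
  next
    case 3
    have "filter (\<lambda>x. x < i) w = []" "count_list w i = 0" "filter (\<lambda>x. i < x) w = w"
      using Cons.prems 3 by (auto simp: filter_empty_conv count_list_0_iff filter_id_conv)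
    then show ?thesis using 3 by simp
  qed
qed simp

text \<open>An unsorted word has a descent between neighbours, and in a sorted word equal letters
  are contiguous. Hence a word that is not normal contains the left-hand side of a swap or of a
  power rule.\<close>

lemma not_normal_word:
  assumes "\<not> normal_word p w"
  shows "(\<exists>u j i v. w = u @ [j, i] @ v \<and> i < j) \<or> (\<exists>u i v. w = u @ replicate p i @ v)"
proof (cases "sorted w")
  case False
  then obtain k where k: "Suc k < length w" "w ! Suc k < w ! k" unfolding sorted_iff_nth_Suc by (auto simp: not_le)
  have "w = take k w @ [w ! k, w ! Suc k] @ drop (Suc (Suc k)) w"
    using k(1) by (simp add: Cons_nth_drop_Suc)
  then show ?thesis using k(2) by blast
next
  case True
  then obtain i where i: "p \<le> count_list w i" using assms by (auto simp: normal_word_def not_less)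
  have "replicate (count_list w i) i = replicate p i @ replicate (count_list w i - p) i"
    using i by (simp flip: replicate_add)
  then show ?thesis using sorted_split_count[OF True, of i] by (metis append.assoc)
qed

lemma normal_word_no_swap: "normal_word p (u @ [j, i] @ v) \<Longrightarrow> j \<le> i"
  by (simp add: normal_word_def sorted_append)

lemma normal_word_no_power: "\<not> normal_word p (u @ replicate p i @ v)"
proof
  assume "normal_word p (u @ replicate p i @ v)"
  then have "count_list (u @ replicate p i @ v) i < p" unfolding normal_word_def by blast
  then show False by (simp add: count_list_replicate)
qed

section \<open>The rewriting rules of u(L,0) and their confluence\<close>

context lie_basis
begin

definition letters :: "nat list set" where "letters = (\<lambda>k. [k]) ` {..<n}"

text \<open>Coefficients in x_j x_i = x_i x_j + [x_j, x_i]. The word \<open>[i, j]\<close> has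
  length two and cannot be confused with the one-letter words, whose letter is read off with
  \<open>hd\<close>.\<close>

definition swap_coeff :: "nat \<Rightarrow> nat \<Rightarrow> nat list \<Rightarrow> 'a" where
  "swap_coeff j i t = (if t = [i, j] then \<one> else coord (hd t) (bracket L (b j) (b i)))"

definition power_coeff :: "nat \<Rightarrow> nat list \<Rightarrow> 'a" where
  "power_coeff i t = coord (hd t) (pmap L (b i))"

definition lie_rules :: "(nat list \<times> nat list set \<times> (nat list \<Rightarrow> 'a)) set" where
  "lie_rules = {([j, i], insert [i, j] letters, swap_coeff j i) | i j. i < j \<and> j < n}
     \<union> {(replicate p i, letters, power_coeff i) | i. i < n}"

sublocale W: word_rewriting F lie_rules word_ord
proof (unfold_locales)
  show "wf word_ord" "trans word_ord" by (rule wf_word_ord trans_word_ord)+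
  fix s A c assume r: "(s, A, c) \<in> lie_rules"
  show "finite A" using r by (auto simp: lie_rules_def letters_def)
  fix t assume t: "t \<in> A"
  show "c t \<in> carrier F"
    using r t by (auto simp: lie_rules_def letters_def swap_coeff_def power_coeff_def coord_closed bracket_closed pmap_closed b_closed)
  fix u v
  show "(u @ t @ v, u @ s @ v) \<in> word_ord"
    using r t two_le_p by (auto simp: lie_rules_def letters_def intro: word_ord_shorter word_ord_swap)
qed

lemma swap_rule: "i < j \<Longrightarrow> j < n \<Longrightarrow> ([j, i], insert [i, j] letters, swap_coeff j i) \<in> lie_rules"
  by (auto simp: lie_rules_def)

lemma power_rule: "i < n \<Longrightarrow> (replicate p i, letters, power_coeff i) \<in> lie_rules"
  by (auto simp: lie_rules_def)

lemma letters_sum: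
  assumes f: "range f \<subseteq> carrier F" and z: "z \<in> carrier L" and c: "\<And>k. k < n \<Longrightarrow> c [k] = coord k z"
  shows "(\<Oplus>t\<in>letters. c t \<otimes> f (u @ t @ v)) = ml [z] (\<lambda>w. f (u @ w @ v))"
proof -
  have fc: "f w \<in> carrier F" for w using f by auto
  have "(\<Oplus>t\<in>letters. c t \<otimes> f (u @ t @ v)) = (\<Oplus>k\<in>{..<n}. c [k] \<otimes> f (u @ [k] @ v))"
    unfolding letters_def by (subst R.finsum_reindex) (auto simp: inj_on_def c z fc coord_closed)
  also have "\<dots> = (\<Oplus>k\<in>{..<n}. coord k z \<otimes> f (u @ [k] @ v))"
    by (rule R.finsum_cong') (auto simp: c z fc coord_closed)
  finally show ?thesis by simp
qed

lemma contract_swap: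
  assumes f: "range f \<subseteq> carrier F" and ij: "i < j" "j < n"
  shows "W.contract f (insert [i, j] letters) (swap_coeff j i) u v
    = f (u @ i # j # v) \<oplus> ml [bracket L (b j) (b i)] (\<lambda>w. f (u @ w @ v))"
proof -
  have fc: "f w \<in> carrier F" for w using f by auto
  have B: "bracket L (b j) (b i) \<in> carrier L" using ij b_closed bracket_closed by simp
  have "[i, j] \<notin> letters" "finite letters" by (auto simp: letters_def)
  then have "W.contract f (insert [i, j] letters) (swap_coeff j i) u v =
     swap_coeff j i [i, j] \<otimes> f (u @ [i, j] @ v) \<oplus> (\<Oplus>t\<in>letters. swap_coeff j i t \<otimes> f (u @ t @ v))"
    unfolding W.contract_def
    by (intro R.finsum_insert) (auto simp: swap_coeff_def letters_def fc B coord_closed)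
  also have "(\<Oplus>t\<in>letters. swap_coeff j i t \<otimes> f (u @ t @ v)) = ml [bracket L (b j) (b i)] (\<lambda>w. f (u @ w @ v))"
    by (rule letters_sum[OF f B]) (simp add: swap_coeff_def)
  finally show ?thesis using fc by (simp add: swap_coeff_def[of j i "[i, j]"])
qed

lemma contract_power:
  assumes f: "range f \<subseteq> carrier F" and i: "i < n"
  shows "W.contract f letters (power_coeff i) u v = ml [pmap L (b i)] (\<lambda>w. f (u @ w @ v))"
  unfolding W.contract_def
  by (rule letters_sum[OF f]) (use i in \<open>auto simp: power_coeff_def pmap_closed b_closed\<close>)

lemma map_b_closed: "set u \<subseteq> {..<n} \<Longrightarrow> set (map b u) \<subseteq> carrier L"
  using b_closed by auto

text \<open>Inside a fixed outer context \<open>u\<close>, \<open>v\<close> a contraction becomes an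
  evaluation of the multilinear extension of \<open>\<lambda>w. f (u @ w @ v)\<close>. There
  brackets and p-th powers can be inserted as elements of \<open>L\<close>, which words in the basis
  do not allow.\<close>

lemma contract_swap_ml:
  assumes f: "range f \<subseteq> carrier F" and ij: "i < j" "j < n" and x: "set x \<subseteq> {..<n}" and y: "set y \<subseteq> {..<n}"
  shows "W.contract f (insert [i, j] letters) (swap_coeff j i) (u @ x) (y @ v)
    = ml (map b x @ b i # b j # map b y) (\<lambda>w. f (u @ w @ v))
     \<oplus> ml (map b x @ bracket L (b j) (b i) # map b y) (\<lambda>w. f (u @ w @ v))"
proof -
  have g: "range (\<lambda>w. f (u @ w @ v)) \<subseteq> carrier F" using f by auto
  have "ml (map b x @ [bracket L (b j) (b i)] @ map b y) (\<lambda>w. f (u @ w @ v))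
    = ml [bracket L (b j) (b i)] (\<lambda>w. f (u @ (x @ w @ y) @ v))"
    using ij b_closed bracket_closed by (intro ml_context[OF g x y]) simp
  moreover have "ml (map b (x @ i # j # y)) (\<lambda>w. f (u @ w @ v)) = f (u @ (x @ i # j # y) @ v)"
    using ij x y by (intro ml_b[OF g]) auto
  ultimately show ?thesis using contract_swap[OF f ij, of "u @ x" "y @ v"] by simp
qed

lemma contract_power_ml:
  assumes f: "range f \<subseteq> carrier F" and i: "i < n" and x: "set x \<subseteq> {..<n}" and y: "set y \<subseteq> {..<n}"
  shows "W.contract f letters (power_coeff i) (u @ x) (y @ v)
    = ml (map b x @ pmap L (b i) # map b y) (\<lambda>w. f (u @ w @ v))"
proof -
  have g: "range (\<lambda>w. f (u @ w @ v)) \<subseteq> carrier F" using f by auto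
  have "ml (map b x @ [pmap L (b i)] @ map b y) (\<lambda>w. f (u @ w @ v))
    = ml [pmap L (b i)] (\<lambda>w. f (u @ (x @ w @ y) @ v))"
    using i b_closed pmap_closed by (intro ml_context[OF g x y]) simp
  then show ?thesis using contract_power[OF f i, of "u @ x" "y @ v"] by simp
qed

lemma obeys_swap_ml:
  assumes f: "range f \<subseteq> carrier F" and ij: "i < j" "j < n" and x: "set x \<subseteq> {..<n}" and y: "set y \<subseteq> {..<n}"
    and o: "W.obeys f (u @ x @ [j, i] @ y @ v)"
  shows "ml (map b x @ b j # b i # map b y) (\<lambda>w. f (u @ w @ v))
    = ml (map b x @ b i # b j # map b y) (\<lambda>w. f (u @ w @ v))
     \<oplus> ml (map b x @ bracket L (b j) (b i) # map b y) (\<lambda>w. f (u @ w @ v))"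
proof -
  have g: "range (\<lambda>w. f (u @ w @ v)) \<subseteq> carrier F" using f by auto
  have "ml (map b (x @ j # i # y)) (\<lambda>w. f (u @ w @ v)) = f (u @ (x @ j # i # y) @ v)"
    using ij x y by (intro ml_b[OF g]) auto
  moreover have "f ((u @ x) @ [j, i] @ y @ v) = W.contract f (insert [i, j] letters) (swap_coeff j i) (u @ x) (y @ v)"
    by (rule W.obeysD[OF _ swap_rule[OF ij]]) (use o in simp)
  ultimately show ?thesis using contract_swap_ml[OF f ij x y] by simp
qed

lemma obeys_power_ml:
  assumes f: "range f \<subseteq> carrier F" and i: "i < n" and x: "set x \<subseteq> {..<n}" and y: "set y \<subseteq> {..<n}"
    and o: "W.obeys f (u @ x @ replicate p i @ y @ v)"
  shows "ml (map b x @ replicate p (b i) @ map b y) (\<lambda>w. f (u @ w @ v))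
    = ml (map b x @ pmap L (b i) # map b y) (\<lambda>w. f (u @ w @ v))"
proof -
  have g: "range (\<lambda>w. f (u @ w @ v)) \<subseteq> carrier F" using f by auto
  have "ml (map b (x @ replicate p i @ y)) (\<lambda>w. f (u @ w @ v)) = f (u @ (x @ replicate p i @ y) @ v)"
    using i x y by (intro ml_b[OF g]) auto
  moreover have "f ((u @ x) @ replicate p i @ y @ v) = W.contract f letters (power_coeff i) (u @ x) (y @ v)"
    by (rule W.obeysD[OF _ power_rule[OF i]]) (use o in simp)
  ultimately show ?thesis using contract_power_ml[OF f i x y] by simp
qed

text \<open>Used with \<open>d\<close> below the length of an overlap: all words that short precede
  the overlap in \<open>word_ord\<close>, so the commutation relation holds on them for all elements
  of \<open>L\<close> and not only for basis letters.\<close>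

lemma obeys_lie_functional:
  assumes f: "range f \<subseteq> carrier F" and o: "\<And>w. length w \<le> d \<Longrightarrow> W.obeys f (u @ w @ v)"
  shows "lie_functional d (\<lambda>w. f (u @ w @ v))"
proof (rule lie_functionalI)
  show g: "range (\<lambda>w. f (u @ w @ v)) \<subseteq> carrier F" using f by auto
  fix u' v' i j assume a: "set u' \<subseteq> {..<n}" "set v' \<subseteq> {..<n}" "i < j" "j < n" "length u' + 2 + length v' \<le> d"
  have "f ((u @ u') @ [j, i] @ v' @ v) = W.contract f (insert [i, j] letters) (swap_coeff j i) (u @ u') (v' @ v)"
    by (rule W.obeysD[OF _ swap_rule[OF a(3,4)]]) (use o[of "u' @ [j, i] @ v'"] a in simp)
  then show "f (u @ (u' @ j # i # v') @ v) = f (u @ (u' @ i # j # v') @ v)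
     \<oplus> ml [bracket L (b j) (b i)] (\<lambda>w. f (u @ (u' @ w @ v') @ v))"
    using contract_swap[OF f a(3,4), of "u @ u'" "v' @ v"] by simp
qed

text \<open>Both ways of sorting the letters \<open>k\<close>, \<open>j\<close>, \<open>i\<close>
  end in the sorted word plus three words containing a bracket. Each bracket stands on opposite
  sides of the third letter in the two results; the differences are the three double brackets, which
  cancel by the Jacobi identity.\<close>

lemma resolve_swap_swap:
  assumes f: "range f \<subseteq> carrier F" and ijk: "i < j" "j < k" "k < n"
    and o: "\<And>w. (w, u @ [k, j, i] @ v) \<in> word_ord \<Longrightarrow> W.obeys f w"
  shows "W.contract f (insert [j, k] letters) (swap_coeff k j) u (i # v)
    = W.contract f (insert [i, j] letters) (swap_coeff j i) (u @ [k]) v"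
proof -
  define g where "g = (\<lambda>w. f (u @ w @ v))"
  have g: "range g \<subseteq> carrier F" using f by (auto simp: g_def)
  have jn: "j < n" and In: "i < n" using ijk by auto
  have X: "b i \<in> carrier L" "b j \<in> carrier L" "b k \<in> carrier L" using b_closed ijk by auto
  let ?I = "b i" and ?J = "b j" and ?K = "b k"
  note Bc = bracket_closed
  have cl: "ml xs g \<in> carrier F" if "set xs \<subseteq> carrier L" for xs using ml_closed[OF g that] .
  have o1: "W.obeys f (u @ [j, k, i] @ v)" using o[of "u @ [j, k, i] @ v"] word_ord_swap[OF ijk(2), of u "i # v"] by simp
  have o2: "W.obeys f (u @ [j, i, k] @ v)"
    using o[of "u @ [j, i, k] @ v"] word_ord_swap[of i k "u @ [j]" v] word_ord_swap[OF ijk(2), of u "i # v"] ijk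
      transD[OF trans_word_ord, of "u @ [j, i, k] @ v" "u @ [j, k, i] @ v" "u @ [k, j, i] @ v"] by simp
  have o3: "W.obeys f (u @ [k, i, j] @ v)" using o[of "u @ [k, i, j] @ v"] word_ord_swap[OF ijk(1), of "u @ [k]" v] by simp
  have o4: "W.obeys f (u @ [i, k, j] @ v)"
    using o[of "u @ [i, k, j] @ v"] word_ord_swap[of i k "u" "j # v"] word_ord_swap[OF ijk(1), of "u @ [k]" v] ijk
      transD[OF trans_word_ord, of "u @ [i, k, j] @ v" "u @ [k, i, j] @ v" "u @ [k, j, i] @ v"] by simp
  have L1: "W.contract f (insert [j, k] letters) (swap_coeff k j) u (i # v) = ml [?J, ?K, ?I] g \<oplus> ml [bracket L ?K ?J, ?I] g"
    using contract_swap_ml[OF f ijk(2,3), of "[]" "[i]" u v] In by (simp add: g_def)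
  have L2: "ml [?J, ?K, ?I] g = ml [?J, ?I, ?K] g \<oplus> ml [?J, bracket L ?K ?I] g"
    using obeys_swap_ml[OF f _ ijk(3), of i "[j]" "[]" u v] o1 ijk jn by (simp add: g_def)
  have L3: "ml [?J, ?I, ?K] g = ml [?I, ?J, ?K] g \<oplus> ml [bracket L ?J ?I, ?K] g"
    using obeys_swap_ml[OF f ijk(1) jn, of "[]" "[k]" u v] o2 ijk by (simp add: g_def)
  have R1: "W.contract f (insert [i, j] letters) (swap_coeff j i) (u @ [k]) v = ml [?K, ?I, ?J] g \<oplus> ml [?K, bracket L ?J ?I] g"
    using contract_swap_ml[OF f ijk(1) jn, of "[k]" "[]" u v] ijk by (simp add: g_def)
  have R2: "ml [?K, ?I, ?J] g = ml [?I, ?K, ?J] g \<oplus> ml [bracket L ?K ?I, ?J] g"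
    using obeys_swap_ml[OF f _ ijk(3), of i "[]" "[j]" u v] o3 ijk jn by (simp add: g_def)
  have R3: "ml [?I, ?K, ?J] g = ml [?I, ?J, ?K] g \<oplus> ml [?I, bracket L ?K ?J] g"
    using obeys_swap_ml[OF f ijk(2,3), of "[i]" "[]" u v] o4 In by (simp add: g_def)
  have lf: "lie_functional 2 g" unfolding g_def
    by (rule obeys_lie_functional[OF f]) (auto intro!: o word_ord_shorter)
  have D: "ml [x, y] g = ml [y, x] g \<oplus> ml [bracket L x y] g" if "x \<in> carrier L" "y \<in> carrier L" for x y
    using lie_functionalD[OF lf, of "[]" x y "[]"] that by simp
  have lin: "linear_form (\<lambda>x. ml [x] g)" using linear_form_ml[OF g, of "[]" "[]"] by simp
  have Z: "ml [bracket L (bracket L ?K ?J) ?I] g \<oplus> ml [bracket L ?J (bracket L ?K ?I)] g \<oplus> ml [bracket L (bracket L ?J ?I) ?K] g = \<zero>"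
    using jacobi_left[of ?I ?J ?K] linear_form_zero[OF lin] lin X Bc unfolding linear_form_def by (metis M.a_closed)
  define a q1 q2 q3 r1 r2 r3 d1 d2 d3 where defs: "a = ml [?I, ?J, ?K] g"
     "q1 = ml [?J, bracket L ?K ?I] g" "q2 = ml [bracket L ?J ?I, ?K] g" "q3 = ml [bracket L ?K ?J, ?I] g"
     "r1 = ml [?K, bracket L ?J ?I] g" "r2 = ml [bracket L ?K ?I, ?J] g" "r3 = ml [?I, bracket L ?K ?J] g"
     "d1 = ml [bracket L ?J (bracket L ?K ?I)] g" "d2 = ml [bracket L (bracket L ?J ?I) ?K] g"
     "d3 = ml [bracket L (bracket L ?K ?J) ?I] g"
  have c: "a \<in> carrier F" "q1 \<in> carrier F" "q2 \<in> carrier F" "q3 \<in> carrier F" "r1 \<in> carrier F" "r2 \<in> carrier F"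
     "r3 \<in> carrier F" "d1 \<in> carrier F" "d2 \<in> carrier F" "d3 \<in> carrier F"
    unfolding defs by (rule cl; simp add: X Bc)+
  have q: "q3 = r3 \<oplus> d3" "q2 = r1 \<oplus> d2" "q1 = r2 \<oplus> d1"
    unfolding defs by (rule D; simp add: X Bc)+
  have z: "d3 \<oplus> d1 \<oplus> d2 = \<zero>" unfolding defs by (rule Z)
  have "a \<oplus> q2 \<oplus> q1 \<oplus> q3 = (a \<oplus> r3 \<oplus> r2 \<oplus> r1) \<oplus> (d3 \<oplus> d1 \<oplus> d2)"
    unfolding q using c by (simp add: R.a_ac)
  also have "\<dots> = a \<oplus> r3 \<oplus> r2 \<oplus> r1" unfolding z using c by simp
  finally show ?thesis unfolding L1 L2 L3 R1 R2 R3 defs .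
qed

text \<open>Moving z to the left through x^p costs the sum of all x^a [x, z] x^(p-1-a). By
  \<open>ml_ad_power\<close> and \<open>ad_pmap\<close> this is (ad x)^(p-1) [x, z] = (ad x)^p z =
  [x^[p], z], exactly the cost of moving z through x^[p].\<close>

lemma resolve_power_swap:
  assumes f: "range f \<subseteq> carrier F" and ij: "i < j" "j < n"
    and o: "\<And>w. (w, u @ (replicate p j @ [i]) @ v) \<in> word_ord \<Longrightarrow> W.obeys f w"
  shows "W.contract f letters (power_coeff j) u (i # v)
    = W.contract f (insert [i, j] letters) (swap_coeff j i) (u @ replicate (p - 1) j) v"
proof -
  define g where "g = (\<lambda>w. f (u @ w @ v))"
  have g: "range g \<subseteq> carrier F" using f by (auto simp: g_def)
  have In: "i < n" using ij by auto
  define bx bz where xz: "bx = b j" "bz = b i"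
  have bx: "bx \<in> carrier L" "bz \<in> carrier L" "bracket L bx bz \<in> carrier L" "pmap L bx \<in> carrier L"
    using b_closed ij bracket_closed pmap_closed by (auto simp: xz)
  have cl: "ml xs g \<in> carrier F" if "set xs \<subseteq> carrier L" for xs using ml_closed[OF g that] .
  have lf: "lie_functional p g" unfolding g_def
    by (rule obeys_lie_functional[OF f]) (auto intro!: o word_ord_shorter)
  define H where "H a = ml (replicate a bx @ bz # replicate (p - a) bx) g" for a
  define T where "T a = ml (replicate a bx @ bracket L bx bz # replicate (p - 1 - a) bx) g" for a
  have Hc: "H a \<in> carrier F" and Tc: "T a \<in> carrier F" for a unfolding H_def T_def by (rule cl; use bx in auto)+
  have rep: "replicate (Suc m) x = replicate m x @ [x]" for m and x :: 'x by (simp add: replicate_append_same)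
  have ord: "(u @ (replicate a j @ i # replicate (p - a) j) @ v, u @ (replicate p j @ [i]) @ v) \<in> word_ord" if "a < p" for a
    using that
  proof (induction "p - a" arbitrary: a)
    case (Suc m)
    have s: "(u @ (replicate a j @ i # replicate (p - a) j) @ v, u @ (replicate (Suc a) j @ i # replicate (p - Suc a) j) @ v) \<in> word_ord"
      using word_ord_swap[OF ij(1), of "u @ replicate a j" "replicate (p - Suc a) j @ v"] Suc.prems
        rep[of a j] replicate_diff[of a p j] by simp
    show ?case
    proof (cases "Suc a = p")
      case True
      then show ?thesis using s by simp
    next
      case False
      then have "(u @ (replicate (Suc a) j @ i # replicate (p - Suc a) j) @ v, u @ (replicate p j @ [i]) @ v) \<in> word_ord"
        using Suc.hyps(1)[of "Suc a"] Suc.hyps(2) Suc.prems by simp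
      then show ?thesis using s transD[OF trans_word_ord] by blast
    qed
  qed simp
  have step: "H (Suc a) = H a \<oplus> T a" if "Suc a < p" for a
  proof -
    have "W.obeys f (u @ replicate a j @ [j, i] @ replicate (p - Suc a) j @ v)"
      using o[OF ord[OF that]] unfolding rep by simp
    from obeys_swap_ml[OF f ij _ _ this] ij
    have "ml (replicate a bx @ bx # bz # replicate (p - Suc a) bx) g
       = ml (replicate a bx @ bz # bx # replicate (p - Suc a) bx) g \<oplus> ml (replicate a bx @ bracket L bx bz # replicate (p - Suc a) bx) g"
      by (simp add: g_def xz set_replicate_conv_if)
    moreover have "replicate (p - a) bx = bx # replicate (p - Suc a) bx" using that by (simp add: replicate_diff)
    ultimately show ?thesis unfolding H_def T_def using rep[of a bx] by simp
  qed
  have sum: "H q = H 0 \<oplus> (\<Oplus>a\<in>{..<q}. T a)" if "q < p" for q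
    using that
  proof (induction q)
    case (Suc q)
    have "(\<Oplus>a\<in>{..<Suc q}. T a) = T q \<oplus> (\<Oplus>a\<in>{..<q}. T a)"
      unfolding lessThan_Suc by (rule R.finsum_insert) (auto simp: Tc)
    moreover have "(\<Oplus>a\<in>{..<q}. T a) \<in> carrier F" by (rule R.finsum_closed) (simp add: Tc)
    ultimately show ?case using step[OF Suc.prems] Suc Hc Tc by (simp add: R.a_ac)
  qed (simp add: Hc)
  obtain q where q: "p = Suc q" using two_le_p by (cases p) auto
  \<comment> \<open>The exchange at position \<open>p - 1\<close> starts from the overlap itself,
    where \<open>f\<close> is not yet known to obey. It is the swap contraction under comparison and
    supplies the last term of the sum.\<close>
  have R: "W.contract f (insert [i, j] letters) (swap_coeff j i) (u @ replicate (p - 1) j) v = H (p - 1) \<oplus> T (p - 1)"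
    using contract_swap_ml[OF f ij, of "replicate (p - 1) j" "[]" u v] ij unfolding H_def T_def q by (simp add: g_def xz set_replicate_conv_if)
  have S: "(\<Oplus>a\<in>{..<p}. T a) = (\<Oplus>a\<in>{..<q}. T a) \<oplus> T (p - 1)"
    unfolding q lessThan_Suc using R.finsum_insert[of "{..<q}" q T] R.finsum_closed[of T "{..<q}"] Tc by (simp add: R.a_comm Pi_def)
  have R': "H (p - 1) \<oplus> T (p - 1) = H 0 \<oplus> (\<Oplus>a\<in>{..<p}. T a)"
    unfolding S using sum[of q] q R.finsum_closed[of T "{..<q}"] Tc Hc by (simp add: R.a_assoc Pi_def)
  have "(\<Oplus>a\<in>{..<p}. T a) = ml [(bracket L bx ^^ (p - 1)) (bracket L bx bz)] g"
    unfolding T_def by (rule ml_ad_power[OF g lf bx(1,3)])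
  also have "(bracket L bx ^^ (p - 1)) (bracket L bx bz) = bracket L (pmap L bx) bz"
    unfolding ad_pmap[OF bx(1,2)] q by (simp add: funpow_swap1)
  finally have T: "(\<Oplus>a\<in>{..<p}. T a) = ml [bracket L (pmap L bx) bz] g" .
  have "W.obeys f (u @ [i] @ replicate p j @ [] @ v)" using o[OF ord[of 0]] q by simp
  from obeys_power_ml[OF f ij(2) _ _ this] In have H0: "H 0 = ml [bz, pmap L bx] g"
    unfolding H_def by (simp add: g_def xz set_replicate_conv_if)
  have "W.contract f letters (power_coeff j) u (i # v) = ml [pmap L bx, bz] g"
    using contract_power_ml[OF f ij(2), of "[]" "[i]" u v] In by (simp add: g_def xz set_replicate_conv_if)
  also have "\<dots> = ml [bz, pmap L bx] g \<oplus> ml [bracket L (pmap L bx) bz] g"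
    using lie_functionalD[OF lf, of "[]" "pmap L bx" bz "[]"] bx two_le_p by simp
  finally show ?thesis unfolding R R' T H0 .
qed

text \<open>The mirror image: z stands to the left of x^p and moves right. The brackets are now
  [z, x], so the sum acquires a sign and cancels the commutator of x^[p] with z.\<close>

lemma resolve_swap_power:
  assumes f: "range f \<subseteq> carrier F" and ij: "i < j" "j < n"
    and o: "\<And>w. (w, u @ (j # replicate p i) @ v) \<in> word_ord \<Longrightarrow> W.obeys f w"
  shows "W.contract f (insert [i, j] letters) (swap_coeff j i) u (replicate (p - 1) i @ v)
    = W.contract f letters (power_coeff i) (u @ [j]) v"
proof -
  define g where "g = (\<lambda>w. f (u @ w @ v))"
  have g: "range g \<subseteq> carrier F" using f by (auto simp: g_def)
  have In: "i < n" using ij by auto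
  define bx bz where xz: "bx = b i" "bz = b j"
  have bx: "bx \<in> carrier L" "bz \<in> carrier L" "bracket L bz bx \<in> carrier L" "pmap L bx \<in> carrier L" "bracket L bx bz \<in> carrier L"
    using b_closed ij bracket_closed pmap_closed by (auto simp: xz)
  have cl: "ml xs g \<in> carrier F" if "set xs \<subseteq> carrier L" for xs using ml_closed[OF g that] .
  have lf: "lie_functional p g" unfolding g_def
    by (rule obeys_lie_functional[OF f]) (auto intro!: o word_ord_shorter)
  define H where "H a = ml (replicate a bx @ bz # replicate (p - a) bx) g" for a
  define T where "T a = ml (replicate a bx @ bracket L bz bx # replicate (p - 1 - a) bx) g" for a
  have Hc: "H a \<in> carrier F" and Tc: "T a \<in> carrier F" for a unfolding H_def T_def by (rule cl; use bx in auto)+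
  have rep: "replicate (Suc m) x = replicate m x @ [x]" for m and x :: 'x by (simp add: replicate_append_same)
  have ord: "0 < a \<Longrightarrow> a \<le> p \<Longrightarrow> (u @ (replicate a i @ j # replicate (p - a) i) @ v, u @ (j # replicate p i) @ v) \<in> word_ord" for a
  proof (induction a)
    case (Suc a)
    have s: "(u @ (replicate (Suc a) i @ j # replicate (p - Suc a) i) @ v, u @ (replicate a i @ j # replicate (p - a) i) @ v) \<in> word_ord"
      using word_ord_swap[OF ij(1), of "u @ replicate a i" "replicate (p - Suc a) i @ v"] Suc.prems
        rep[of a i] replicate_diff[of a p i] by simp
    show ?case
    proof (cases "a = 0")
      case True
      then show ?thesis using s by simp
    next
      case False
      then show ?thesis using transD[OF trans_word_ord s Suc.IH] Suc.prems by simp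
    qed
  qed simp
  have step: "H a = H (Suc a) \<oplus> T a" if "0 < a" "a < p" for a
  proof -
    have r: "replicate (p - a) x = x # replicate (p - Suc a) x" for x :: 'x using that by (simp add: replicate_diff)
    have "W.obeys f (u @ replicate a i @ [j, i] @ replicate (p - Suc a) i @ v)"
      using o[OF ord[of a]] that r[of i] by simp
    from obeys_swap_ml[OF f ij _ _ this] ij
    have "ml (replicate a bx @ bz # bx # replicate (p - Suc a) bx) g
       = ml (replicate a bx @ bx # bz # replicate (p - Suc a) bx) g \<oplus> ml (replicate a bx @ bracket L bz bx # replicate (p - Suc a) bx) g"
      by (simp add: g_def xz set_replicate_conv_if)
    then show ?thesis unfolding H_def T_def using rep[of a bx] r[of bx] by simp
  qed
  have sum: "H 1 = H (Suc q) \<oplus> (\<Oplus>a\<in>{1..<Suc q}. T a)" if "q < p" for q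
    using that
  proof (induction q)
    case (Suc q)
    show ?case
    proof (cases "q = 0")
      case True
      then show ?thesis using step[of 1] Suc.prems Tc by simp
    next
      case False
      have "(\<Oplus>a\<in>{1..<Suc (Suc q)}. T a) = T (Suc q) \<oplus> (\<Oplus>a\<in>{1..<Suc q}. T a)"
        using R.finsum_insert[of "{1..<Suc q}" "Suc q" T] Tc by (simp add: atLeastLessThanSuc)
      moreover have "(\<Oplus>a\<in>{1..<Suc q}. T a) \<in> carrier F" by (rule R.finsum_closed) (simp add: Tc)
      ultimately show ?thesis using step[of "Suc q"] Suc Hc Tc by (simp add: R.a_ac)
    qed
  qed (simp add: Hc)
  obtain q where q: "p = Suc q" using two_le_p by (cases p) auto
  \<comment> \<open>Again the exchange that starts from the overlap itself, here at position 0, is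
    the contraction under comparison; it contributes the term \<open>T 0\<close>.\<close>
  have R: "W.contract f (insert [i, j] letters) (swap_coeff j i) u (replicate (p - 1) i @ v) = H 1 \<oplus> T 0"
    using contract_swap_ml[OF f ij, of "[]" "replicate (p - 1) i" u v] In unfolding H_def T_def by (simp add: g_def xz set_replicate_conv_if)
  have e: "{..<Suc q} = insert 0 {1..<Suc q}" by auto
  have S: "(\<Oplus>a\<in>{..<p}. T a) = T 0 \<oplus> (\<Oplus>a\<in>{1..<Suc q}. T a)"
    unfolding q e by (rule R.finsum_insert) (auto simp: Tc)
  have R': "H 1 \<oplus> T 0 = H p \<oplus> (\<Oplus>a\<in>{..<p}. T a)"
    unfolding S using sum[of q] q R.finsum_closed[of T "{1..<Suc q}"] Tc Hc by (simp add: R.a_ac Pi_def)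
  have "(\<Oplus>a\<in>{..<p}. T a) = ml [(bracket L bx ^^ (p - 1)) (bracket L bz bx)] g"
    unfolding T_def by (rule ml_ad_power[OF g lf bx(1,3)])
  also have "(bracket L bx ^^ (p - 1)) (bracket L bz bx) = \<ominus>\<^bsub>L\<^esub> bracket L (pmap L bx) bz"
    unfolding ad_pmap[OF bx(1,2)] bracket_swap[OF bx(1,2)] ad_pow_neg[OF bx(1,5)] q by (simp add: funpow_swap1)
  also have "ml [\<ominus>\<^bsub>L\<^esub> bracket L (pmap L bx) bz] g = \<ominus> ml [bracket L (pmap L bx) bz] g"
    using linear_form_neg[OF linear_form_ml[OF g, of "[]" "[]"], of "bracket L (pmap L bx) bz"] bx bracket_closed by simp
  finally have T: "(\<Oplus>a\<in>{..<p}. T a) = \<ominus> ml [bracket L (pmap L bx) bz] g" .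
  have "W.obeys f (u @ [] @ replicate p i @ [j] @ v)" using o[OF ord[of p]] q by simp
  from obeys_power_ml[OF f In _ _ this] ij have H0: "H p = ml [pmap L bx, bz] g"
    unfolding H_def by (simp add: g_def xz set_replicate_conv_if)
  have "ml [pmap L bx, bz] g = ml [bz, pmap L bx] g \<oplus> ml [bracket L (pmap L bx) bz] g"
    using lie_functionalD[OF lf, of "[]" "pmap L bx" bz "[]"] bx two_le_p by simp
  then have "H p \<oplus> (\<Oplus>a\<in>{..<p}. T a) = ml [bz, pmap L bx] g"
    unfolding T H0 using cl[of "[bz, pmap L bx]"] cl[of "[bracket L (pmap L bx) bz]"] bx bracket_closed
    by (simp add: R.a_assoc R.r_neg del: ml.simps)
  moreover have "W.contract f letters (power_coeff i) (u @ [j]) v = ml [bz, pmap L bx] g"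
    using contract_power_ml[OF f In, of "[j]" "[]" u v] ij by (simp add: g_def xz set_replicate_conv_if)
  ultimately show ?thesis unfolding R R' by simp
qed

text \<open>x^[p] passes through the remaining \<open>a\<close> copies of x, because [x^[p], x] =
  (ad x)^p x = 0.\<close>

lemma resolve_power_power:
  assumes f: "range f \<subseteq> carrier F" and i: "i < n" and a: "a < p"
    and o: "\<And>w. (w, u @ replicate (a + p) i @ v) \<in> word_ord \<Longrightarrow> W.obeys f w"
  shows "W.contract f letters (power_coeff i) u (replicate a i @ v)
    = W.contract f letters (power_coeff i) (u @ replicate a i) v"
proof -
  define g where "g = (\<lambda>w. f (u @ w @ v))"
  have g: "range g \<subseteq> carrier F" using f by (auto simp: g_def)
  define bx where bx_def: "bx = b i"
  have bx: "bx \<in> carrier L" "pmap L bx \<in> carrier L" using b_closed i pmap_closed by (auto simp: bx_def)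
  \<comment> \<open>For \<open>a = 0\<close> both sides are the same contraction; for
    \<open>a > 0\<close> the words of length \<open>p\<close> are shorter than the overlap.\<close>
  have lf: "lie_functional p g" if "a > 0" unfolding g_def
    by (rule obeys_lie_functional[OF f]) (use that in \<open>auto intro!: o word_ord_shorter\<close>)
  have cl: "ml xs g \<in> carrier F" if "set xs \<subseteq> carrier L" for xs using ml_closed[OF g that] .
  obtain q where q: "p = Suc q" using two_le_p by (cases p) auto
  have z: "bracket L (pmap L bx) bx = \<zero>\<^bsub>L\<^esub>"
  proof -
    have "(bracket L bx ^^ Suc m) bx = \<zero>\<^bsub>L\<^esub>" for m
      by (induction m) (simp_all add: bracket_self bracket_zero_right bx)
    then show ?thesis using ad_pmap[OF bx(1) bx(1)] q by simp
  qed
  have "c \<le> a \<Longrightarrow> ml (replicate c bx @ pmap L bx # replicate (a - c) bx) g = ml (pmap L bx # replicate a bx) g" for c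
  proof (induction c)
    case (Suc c)
    have "ml (replicate c bx @ pmap L bx # bx # replicate (a - Suc c) bx) g
       = ml (replicate c bx @ bx # pmap L bx # replicate (a - Suc c) bx) g
         \<oplus> ml (replicate c bx @ bracket L (pmap L bx) bx # replicate (a - Suc c) bx) g"
      by (rule lie_functionalD[OF lf]) (use bx a Suc.prems in auto)
    also have "ml (replicate c bx @ bracket L (pmap L bx) bx # replicate (a - Suc c) bx) g = \<zero>"
      unfolding z using linear_form_zero[OF linear_form_ml[OF g, of "replicate c bx" "replicate (a - Suc c) bx"]] bx
      by (simp add: set_replicate_conv_if)
    finally have "ml (replicate c bx @ pmap L bx # bx # replicate (a - Suc c) bx) g
       = ml (replicate c bx @ bx # pmap L bx # replicate (a - Suc c) bx) g"
      using cl[of "replicate c bx @ bx # pmap L bx # replicate (a - Suc c) bx"] bx by (simp add: set_replicate_conv_if)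
    moreover have "bx # replicate (a - Suc c) bx = replicate (a - c) bx"
      using Suc.prems replicate_diff[of c a bx] by simp
    moreover have "replicate c bx @ bx # zs = replicate (Suc c) bx @ zs" for zs by (simp add: replicate_app_Cons_same)
    ultimately show ?case using Suc by simp
  qed simp
  from this[of a] have "ml (replicate a bx @ [pmap L bx]) g = ml (pmap L bx # replicate a bx) g" by simp
  then show ?thesis
    using contract_power_ml[OF f i, of "[]" "replicate a i" u v] contract_power_ml[OF f i, of "replicate a i" "[]" u v] i
    by (simp add: g_def bx_def set_replicate_conv_if)
qed

lemma lie_rules_cases:
  assumes "(s, A, c) \<in> lie_rules"
  obtains (swap) i j where "i < j" "j < n" "s = [j, i]" "A = insert [i, j] letters" "c = swap_coeff j i"
  | (power) i where "i < n" "s = replicate p i" "A = letters" "c = power_coeff i"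
  using assms unfolding lie_rules_def by blast

text \<open>\<open>x\<close> is the part of the first left-hand side that precedes the second one. A
  swap has two distinct letters and a power only one, so a swap rule meets a power rule in a single
  letter; what remains is the coincidence of two swap rules and the four situations resolved
  above.\<close>

lemma overlaps_resolve: W.overlaps_resolve
  unfolding W.overlaps_resolve_def
proof (intro allI impI)
  fix f s1 A1 c1 s2 A2 c2 u1 v1 u2 v2
  assume f: "range f \<subseteq> carrier F" and r1: "(s1, A1, c1) \<in> lie_rules" and r2: "(s2, A2, c2) \<in> lie_rules"
    and eq: "u1 @ s1 @ v1 = u2 @ s2 @ v2" and le: "length u1 \<le> length u2" "length u2 < length u1 + length s1"
    and sm: "\<forall>w. (w, u1 @ s1 @ v1) \<in> word_ord \<longrightarrow> W.obeys f w"
  obtain x where x: "u2 = u1 @ x" "s1 @ v1 = x @ s2 @ v2"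
  proof
    have "take (length u1) u2 = take (length u1) (u2 @ s2 @ v2)" using le(1) by simp
    also have "\<dots> = u1" unfolding eq[symmetric] by simp
    finally show e: "u2 = u1 @ drop (length u1) u2" by (metis append_take_drop_id)
    then show "s1 @ v1 = drop (length u1) u2 @ s2 @ v2" using eq by (metis append.assoc same_append_eq)
  qed
  have lx: "length x < length s1" using le(2) x by simp
  obtain q where q: "p = Suc (Suc q)" using two_le_p by (metis add_2_eq_Suc le_iff_add)
  from r1 show "W.contract f A1 c1 u1 v1 = W.contract f A2 c2 u2 v2"
  proof (cases rule: lie_rules_cases)
    case s1: (swap i j)
    from lx s1 x consider "x = []" | "x = [j]" by (cases x) auto
    then show ?thesis
    proof cases
      case 1
      from r2 show ?thesis
      proof (cases rule: lie_rules_cases)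
        case (swap i' j')
        then show ?thesis using s1 x 1 by simp
      next
        case (power k)
        then show ?thesis using s1 x 1 q by simp
      qed
    next
      case 2
      from r2 show ?thesis
      proof (cases rule: lie_rules_cases)
        case (swap i' j')
        then have "j' = i" "v1 = i' # v2" using s1 x 2 by auto
        then show ?thesis using resolve_swap_swap[OF f, of i' i j u1 v2] swap s1 x 2 sm by simp
      next
        case (power k)
        then have "k = i" "v1 = replicate (p - 1) i @ v2" using s1 x 2 q by auto
        then show ?thesis using resolve_swap_power[OF f s1(1,2), of u1 v2] power s1 x 2 sm q by simp
      qed
    qed
  next
    case s1: (power k)
    have xr: "x = replicate (length x) k"
    proof -
      have "x = take (length x) (replicate p k @ v1)" using x s1 by simp
      then show ?thesis using lx s1 by (simp add: min_def)
    qed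
    have dr: "replicate (p - length x) k @ v1 = s2 @ v2"
    proof -
      have "drop (length x) (replicate p k @ v1) = s2 @ v2" using x s1 by simp
      then show ?thesis using lx s1 by simp
    qed
    from r2 show ?thesis
    proof (cases rule: lie_rules_cases)
      case (swap i j)
      \<comment> \<open>If two or more copies of \<open>k\<close> remained, the left-hand side of
        the swap rule would consist of two equal letters.\<close>
      have "p - length x = 1"
      proof (rule ccontr)
        assume "p - length x \<noteq> 1"
        then obtain m where "p - length x = Suc (Suc m)" using lx s1 by (metis One_nat_def Suc_pred length_replicate not0_implies_Suc zero_less_diff)
        then show False using dr swap by simp
      qed
      then have "length x = p - 1" "k = j" "v1 = i # v2" using dr swap lx s1 by auto
      then show ?thesis using resolve_power_swap[OF f swap(1,2), of u1 v2] swap s1 x xr sm by simp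
    next
      case (power k')
      have "0 < p - length x" using lx s1 by simp
      then have k: "k' = k" using dr power q by (cases "p - length x") auto
      have "replicate p k = replicate (p - length x) k @ replicate (length x) k"
        using lx s1 by (simp flip: replicate_add)
      then have v: "v1 = replicate (length x) k @ v2" using dr power k by simp
      have "W.contract f letters (power_coeff k) u1 (replicate (length x) k @ v2)
        = W.contract f letters (power_coeff k) (u1 @ replicate (length x) k) v2"
      proof (rule resolve_power_power[OF f s1(1)])
        show "length x < p" using lx s1 by simp
        show "W.obeys f w" if "(w, u1 @ replicate (length x + p) k @ v2) \<in> word_ord" for w
          using that sm s1 v by (simp add: replicate_add add.commute[of "length x"])
      qed
      then show ?thesis using power s1 k v x xr by simp
    qed
  qed
qed

lemma normal_word_irreducible: "normal_word p w \<Longrightarrow> \<not> W.reducible w"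
  unfolding W.reducible_def using normal_word_no_power normal_word_no_swap
  by (auto elim!: lie_rules_cases) (metis append_Cons append_Nil not_le)

text \<open>The coefficient functional of the PBW monomial \<open>\<gamma>\<close>.\<close>

theorem pbw_functional:
  obtains f where "range f \<subseteq> carrier F" "\<And>w. normal_word p w \<Longrightarrow> f w = (if w = \<gamma> then \<one> else \<zero>)"
    "\<And>d. lie_functional d f"
    "\<And>us i ws. set us \<subseteq> carrier L \<Longrightarrow> set ws \<subseteq> carrier L \<Longrightarrow> i < n \<Longrightarrow>
       ml (us @ replicate p (b i) @ ws) f = ml (us @ pmap L (b i) # ws) f"
    "\<And>w. W.obeys f w"
proof -
  obtain f where f: "range f \<subseteq> carrier F" "\<And>w. \<not> W.reducible w \<Longrightarrow> f w = (if w = \<gamma> then \<one> else \<zero>)" "\<And>w. W.obeys f w"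
  proof -
    have "range (\<lambda>w. if w = \<gamma> then \<one> else \<zero>) \<subseteq> carrier F" by auto
    from W.diamond[OF overlaps_resolve this] show thesis using that by blast
  qed
  \<comment> \<open>The rules speak of basis words around the power; multilinearity extends this to
    arbitrary \<open>ws\<close> and then to arbitrary \<open>us\<close>.\<close>
  have pow: "ml (us @ replicate p (b i) @ ws) f = ml (us @ pmap L (b i) # ws) f"
    if us: "set us \<subseteq> carrier L" and ws: "set ws \<subseteq> carrier L" and i: "i < n" for us i ws
  proof (rule multilinear_eqI[of "\<lambda>ws. ml (us @ replicate p (b i) @ ws) f" "\<lambda>ws. ml (us @ pmap L (b i) # ws) f" "length ws"])
    have B: "b i \<in> carrier L" "pmap L (b i) \<in> carrier L" using i b_closed pmap_closed by auto
    note ml = multilinear_ml[OF f(1), of _ "[]", simplified]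
    show "multilinear (\<lambda>ws. ml (us @ replicate p (b i) @ ws) f)"
      using ml[of "us @ replicate p (b i)"] us B by (simp add: set_replicate_conv_if)
    show "multilinear (\<lambda>ws. ml (us @ pmap L (b i) # ws) f)" using ml[of "us @ [pmap L (b i)]"] us B by simp
    fix w assume w: "set w \<subseteq> {..<n}" "length w = length ws"
    show "ml (us @ replicate p (b i) @ map b w) f = ml (us @ pmap L (b i) # map b w) f"
    proof (rule multilinear_eqI[of "\<lambda>us. ml (us @ replicate p (b i) @ map b w) f" "\<lambda>us. ml (us @ pmap L (b i) # map b w) f" "length us"])
      have W: "set (map b w) \<subseteq> carrier L" using w map_b_closed by simp
      note ml = multilinear_ml[OF f(1), of "[]", simplified]
      show "multilinear (\<lambda>us. ml (us @ replicate p (b i) @ map b w) f)"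
        using ml[of "replicate p (b i) @ map b w"] W B by (simp add: set_replicate_conv_if)
      show "multilinear (\<lambda>us. ml (us @ pmap L (b i) # map b w) f)" using ml[of "pmap L (b i) # map b w"] W B by simp
      fix u assume "set u \<subseteq> {..<n}" "length u = length us"
      then show "ml (map b u @ replicate p (b i) @ map b w) f = ml (map b u @ pmap L (b i) # map b w) f"
        using obeys_power_ml[OF f(1) i _ w(1) f(3), of u "[]" "[]"] by simp
    qed (use us in simp_all)
  qed (use ws in simp_all)
  have "lie_functional d f" for d using obeys_lie_functional[OF f(1), of d "[]" "[]"] f(3) by simp
  then show thesis using that[of f] f pow normal_word_irreducible by blast
qed

lemma ml_eq_zero:
  assumes "range f \<subseteq> carrier F" "set ts \<subseteq> carrier L" "\<And>t k. t \<in> set ts \<Longrightarrow> k < r \<Longrightarrow> coord k t = \<zero>"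
    and "\<And>w. set w \<subseteq> {r..<n} \<Longrightarrow> length w = length ts \<Longrightarrow> f w = \<zero>"
  shows "ml ts f = \<zero>"
  using assms
proof (induction ts arbitrary: f)
  case (Cons t ts)
  have "(\<Oplus>k\<in>{..<n}. coord k t \<otimes> ml ts (\<lambda>w. f (k # w))) = \<zero>"
  proof (rule R.add.finprod_one_eqI)
    fix k assume k: "k \<in> {..<n}"
    have g: "range (\<lambda>w. f (k # w)) \<subseteq> carrier F" using Cons.prems by auto
    show "coord k t \<otimes> ml ts (\<lambda>w. f (k # w)) = \<zero>"
    proof (cases "k < r")
      case True
      then show ?thesis using Cons.prems ml_closed[OF g, of ts] by simp
    next
      case False
      then have "ml ts (\<lambda>w. f (k # w)) = \<zero>" using Cons.prems g k by (intro Cons.IH) auto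
      then show ?thesis using Cons.prems by (simp add: coord_closed)
    qed
  qed
  then show ?case by simp
qed auto

text \<open>Torus letters are those with index at least \<open>r\<close>. Rewriting a tail of torus
  letters stays within such tails, since their brackets and p-th powers have torus coordinates only,
  and never empties it. The normal words reached are therefore \<open>u\<close> followed by a
  nonempty torus word, and differ from \<open>\<gamma>\<close>, which contains no torus
  letter.\<close>

lemma pbw_functional_torus:
  assumes f: "range f \<subseteq> carrier F" "\<And>w. normal_word p w \<Longrightarrow> f w = (if w = \<gamma> then \<one> else \<zero>)" "\<And>w. W.obeys f w"
    and \<gamma>: "set \<gamma> \<subseteq> {..<r}" and u: "normal_word p u" "set u \<subseteq> {..<r}"
    and br: "\<And>i j k. i < n \<Longrightarrow> j < n \<Longrightarrow> r \<le> i \<Longrightarrow> r \<le> j \<Longrightarrow> k < r \<Longrightarrow> coord k (bracket L (b j) (b i)) = \<zero>"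
    and pm: "\<And>i k. i < n \<Longrightarrow> r \<le> i \<Longrightarrow> k < r \<Longrightarrow> coord k (pmap L (b i)) = \<zero>"
    and rn: "r \<le> n" and w: "set w \<subseteq> {r..<n}" "w \<noteq> []"
  shows "f (u @ w) = \<zero>"
  using w
proof (induction w rule: wf_induct_rule[OF wf_inv_image[OF wf_word_ord, of "\<lambda>w. u @ w"]])
  case (1 w)
  have fc: "f v \<in> carrier F" for v using f by auto
  show ?case
  proof (cases "normal_word p w")
    case True
    have "count_list (u @ w) i < p" for i
    proof (cases "i < r")
      case True
      then have "count_list w i = 0" using 1 by (auto simp: count_list_0_iff)
      then show ?thesis using u by (simp add: normal_word_def)
    next
      case False
      then have "count_list u i = 0" using u by (auto simp: count_list_0_iff)
      then show ?thesis using True by (simp add: normal_word_def)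
    qed
    moreover have "sorted (u @ w)" using True u 1 unfolding normal_word_def sorted_append
      by (metis (no_types, lifting) atLeastLessThan_iff le_trans less_imp_le lessThan_iff subsetD)
    ultimately have "normal_word p (u @ w)" by (simp add: normal_word_def)
    moreover have "u @ w \<noteq> \<gamma>"
    proof
      assume "u @ w = \<gamma>"
      then have "set w \<subseteq> {..<r}" using \<gamma> by auto
      then show False using 1 by (cases w) auto
    qed
    ultimately show ?thesis using f(2) by simp
  next
    case False
    have less: "(u @ w', u @ w) \<in> word_ord \<Longrightarrow> set w' \<subseteq> {r..<n} \<Longrightarrow> w' \<noteq> [] \<Longrightarrow> f (u @ w') = \<zero>" for w'
      using 1(1) by simp
    have sum0: "ml [z] (\<lambda>v. f ((u @ x) @ v @ y)) = \<zero>"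
      if z: "z \<in> carrier L" "\<And>k. k < r \<Longrightarrow> coord k z = \<zero>" and xy: "set x \<subseteq> {r..<n}" "set y \<subseteq> {r..<n}"
        and l: "length x + length y + 1 < length w" for x y z
    proof (rule ml_eq_zero)
      fix v assume "set v \<subseteq> {r..<n}" "length v = length [z]"
      then show "f ((u @ x) @ v @ y) = \<zero>"
        using less[of "x @ v @ y"] xy l word_ord_shorter[of "u @ x @ v @ y" "u @ w"] by (cases v) auto
    qed (use z fc in auto)
    from not_normal_word[OF False] consider
      (s) x j i y where "w = x @ [j, i] @ y" "i < j" | (q) x i y where "w = x @ replicate p i @ y" by blast
    then show ?thesis
    proof cases
      case s
      then have ij: "r \<le> i" "i < n" "r \<le> j" "j < n" and xy: "set x \<subseteq> {r..<n}" "set y \<subseteq> {r..<n}" using 1 by auto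
      have "f (u @ w) = f ((u @ x) @ i # j # y) \<oplus> ml [bracket L (b j) (b i)] (\<lambda>v. f ((u @ x) @ v @ y))"
        using W.obeysD[OF _ swap_rule[OF s(2) ij(4)], of f "u @ x" y] f(3) contract_swap[OF f(1) s(2) ij(4), of "u @ x" y] s by simp
      moreover have "f (u @ (x @ i # j # y)) = \<zero>"
        using less[of "x @ i # j # y"] word_ord_swap[OF s(2), of "u @ x" y] s ij xy by simp
      moreover have "ml [bracket L (b j) (b i)] (\<lambda>v. f ((u @ x) @ v @ y)) = \<zero>"
        by (rule sum0) (use ij xy br s bracket_closed b_closed in auto)
      ultimately show ?thesis by simp
    next
      case q
      then have i: "r \<le> i" "i < n" and xy: "set x \<subseteq> {r..<n}" "set y \<subseteq> {r..<n}" using 1 two_le_p by auto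
      have "f (u @ w) = ml [pmap L (b i)] (\<lambda>v. f ((u @ x) @ v @ y))"
        using W.obeysD[OF _ power_rule[OF i(2)], of f "u @ x" y] f(3) contract_power[OF f(1) i(2), of "u @ x" y] q by simp
      also have "\<dots> = \<zero>"
        by (rule sum0) (use i xy pm q pmap_closed b_closed two_le_p in auto)
      finally show ?thesis .
    qed
  qed
qed

end

section \<open>The free algebra\<close>

lemma range_app: "range f \<subseteq> C \<Longrightarrow> f x \<in> C"
  by auto

context cring
begin

abbreviation conv :: "('x list \<Rightarrow> 'a) \<Rightarrow> ('x list \<Rightarrow> 'a) \<Rightarrow> 'x list \<Rightarrow> 'a" where
  "conv f g \<equiv> (\<lambda>w. \<Oplus>k\<in>{..length w}. f (take k w) \<otimes> g (drop k w))"

definition free_mon :: "'x list \<Rightarrow> 'x list \<Rightarrow> 'a" where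
  "free_mon u = (\<lambda>w. if w = u then \<one> else \<zero>)"

lemma conv_Nil: "range f \<subseteq> carrier R \<Longrightarrow> range g \<subseteq> carrier R \<Longrightarrow> conv f g [] = f [] \<otimes> g []"
  by (simp add: range_app)

text \<open>Splitting off the cut before the first letter makes the product of the free algebra
  recursive in the word, with \<open>f\<close> replaced by its shift under that letter.
  Associativity then becomes an induction on the word.\<close>

lemma conv_Cons:
  assumes f: "range f \<subseteq> carrier R" and g: "range g \<subseteq> carrier R"
  shows "conv f g (x # w) = f [] \<otimes> g (x # w) \<oplus> conv (\<lambda>w. f (x # w)) g w"
proof -
  have c: "f v \<in> carrier R" "g v \<in> carrier R" for v using f g by auto
  have "conv f g (x # w) = (\<Oplus>k\<in>{..length w}. f (take (Suc k) (x # w)) \<otimes> g (drop (Suc k) (x # w)))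
      \<oplus> f (take 0 (x # w)) \<otimes> g (drop 0 (x # w))"
    unfolding list.size(4) One_nat_def add_Suc_right add_0_right
    by (rule finsum_Suc2) (use c in auto)
  moreover have "conv (\<lambda>w. f (x # w)) g w \<in> carrier R" by (rule finsum_closed) (use c in auto)
  ultimately show ?thesis using c by (simp add: a_comm)
qed

lemma conv_closed: "range f \<subseteq> carrier R \<Longrightarrow> range g \<subseteq> carrier R \<Longrightarrow> conv f g w \<in> carrier R"
  by (rule finsum_closed) (simp add: range_app)

lemma conv_add_left:
  assumes "range f \<subseteq> carrier R" "range f' \<subseteq> carrier R" "range g \<subseteq> carrier R"
  shows "conv (\<lambda>w. f w \<oplus> f' w) g w = conv f g w \<oplus> conv f' g w"
proof -
  have c: "f v \<in> carrier R" "f' v \<in> carrier R" "g v \<in> carrier R" for v using assms by auto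
  have "(\<Oplus>k\<in>{..length w}. (f (take k w) \<oplus> f' (take k w)) \<otimes> g (drop k w))
     = (\<Oplus>k\<in>{..length w}. f (take k w) \<otimes> g (drop k w) \<oplus> f' (take k w) \<otimes> g (drop k w))"
    by (rule finsum_cong') (use c in \<open>auto simp: l_distr\<close>)
  also have "\<dots> = conv f g w \<oplus> conv f' g w" by (rule finsum_addf) (use c in auto)
  finally show ?thesis .
qed

lemma conv_add_right:
  assumes "range f \<subseteq> carrier R" "range g' \<subseteq> carrier R" "range g \<subseteq> carrier R"
  shows "conv f (\<lambda>w. g w \<oplus> g' w) w = conv f g w \<oplus> conv f g' w"
proof -
  have c: "f v \<in> carrier R" "g' v \<in> carrier R" "g v \<in> carrier R" for v using assms by auto
  have "(\<Oplus>k\<in>{..length w}. f (take k w) \<otimes> (g (drop k w) \<oplus> g' (drop k w)))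
     = (\<Oplus>k\<in>{..length w}. f (take k w) \<otimes> g (drop k w) \<oplus> f (take k w) \<otimes> g' (drop k w))"
    by (rule finsum_cong') (use c in \<open>auto simp: r_distr\<close>)
  also have "\<dots> = conv f g w \<oplus> conv f g' w" by (rule finsum_addf) (use c in auto)
  finally show ?thesis .
qed

lemma conv_smult_left:
  assumes "range f \<subseteq> carrier R" "range g \<subseteq> carrier R" "a \<in> carrier R"
  shows "conv (\<lambda>w. a \<otimes> f w) g w = a \<otimes> conv f g w"
proof -
  have c: "f v \<in> carrier R" "g v \<in> carrier R" for v using assms by auto
  have "(\<Oplus>k\<in>{..length w}. a \<otimes> f (take k w) \<otimes> g (drop k w))
     = (\<Oplus>k\<in>{..length w}. a \<otimes> (f (take k w) \<otimes> g (drop k w)))"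
    by (rule finsum_cong') (use c assms(3) in \<open>auto simp: m_assoc\<close>)
  also have "\<dots> = a \<otimes> conv f g w" by (rule finsum_rdistr[symmetric]) (use c assms(3) in auto)
  finally show ?thesis .
qed

lemma conv_assoc:
  assumes "range f \<subseteq> carrier R" "range g \<subseteq> carrier R" "range h \<subseteq> carrier R"
  shows "conv (conv f g) h w = conv f (conv g h) w"
  using assms
proof (induction w arbitrary: f g)
  case Nil
  have "range (conv f g) \<subseteq> carrier R" "range (conv g h) \<subseteq> carrier R" using Nil conv_closed by auto
  moreover have "f [] \<in> carrier R" "g [] \<in> carrier R" "h [] \<in> carrier R" using Nil by auto
  ultimately show ?case using Nil by (simp add: m_assoc)
next
  case (Cons x w)
  let ?f = "\<lambda>w. f (x # w)" and ?g = "\<lambda>w. g (x # w)"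
  have r: "range ?f \<subseteq> carrier R" "range ?g \<subseteq> carrier R" using Cons.prems by auto
  have fg: "range (conv f g) \<subseteq> carrier R" "range (conv g h) \<subseteq> carrier R" "range (conv ?f g) \<subseteq> carrier R"
    "range (conv ?g h) \<subseteq> carrier R"
    using Cons.prems r conv_closed by auto
  have c: "f v \<in> carrier R" "g v \<in> carrier R" "h v \<in> carrier R" for v using Cons.prems by auto
  have s: "range (\<lambda>w. f [] \<otimes> g (x # w)) \<subseteq> carrier R" using c by auto
  have "conv (conv f g) h (x # w) = conv f g [] \<otimes> h (x # w) \<oplus> conv (\<lambda>w. conv f g (x # w)) h w"
    by (rule conv_Cons[OF fg(1) Cons.prems(3)])
  also have "(\<lambda>w. conv f g (x # w)) = (\<lambda>w. f [] \<otimes> g (x # w) \<oplus> conv ?f g w)"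
    using conv_Cons[OF Cons.prems(1,2)] by blast
  also have "conv (\<lambda>w. f [] \<otimes> g (x # w) \<oplus> conv ?f g w) h w = conv (\<lambda>w. f [] \<otimes> g (x # w)) h w \<oplus> conv (conv ?f g) h w"
    by (rule conv_add_left[OF s fg(3) Cons.prems(3)])
  also have "conv (\<lambda>w. f [] \<otimes> g (x # w)) h w = f [] \<otimes> conv ?g h w"
    by (rule conv_smult_left[OF r(2) Cons.prems(3) c(1)])
  also have "conv (conv ?f g) h w = conv ?f (conv g h) w" by (rule Cons.IH[OF r(1) Cons.prems(2,3)])
  also have "conv f g [] = f [] \<otimes> g []" by (rule conv_Nil[OF Cons.prems(1,2)])
  finally have 1: "conv (conv f g) h (x # w) =
     f [] \<otimes> g [] \<otimes> h (x # w) \<oplus> (f [] \<otimes> conv ?g h w \<oplus> conv ?f (conv g h) w)" .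
  have "conv f (conv g h) (x # w) = f [] \<otimes> conv g h (x # w) \<oplus> conv ?f (conv g h) w"
    by (rule conv_Cons[OF Cons.prems(1) fg(2)])
  also have "conv g h (x # w) = g [] \<otimes> h (x # w) \<oplus> conv ?g h w" by (rule conv_Cons[OF Cons.prems(2,3)])
  finally have 2: "conv f (conv g h) (x # w) = f [] \<otimes> (g [] \<otimes> h (x # w) \<oplus> conv ?g h w) \<oplus> conv ?f (conv g h) w" .
  have cc: "conv ?g h w \<in> carrier R" "conv ?f (conv g h) w \<in> carrier R"
    by (rule conv_closed[OF r(2) Cons.prems(3)], rule conv_closed[OF r(1) fg(2)])
  have "\<And>C D. C \<in> carrier R \<Longrightarrow> D \<in> carrier R \<Longrightarrow> f [] \<otimes> g [] \<otimes> h (x # w) \<oplus> (f [] \<otimes> C \<oplus> D) = f [] \<otimes> (g [] \<otimes> h (x # w) \<oplus> C) \<oplus> D"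
    using c by (simp add: r_distr m_assoc a_assoc)
  from this[OF cc] show ?case unfolding 1 2 .
qed

lemma conv_one_left:
  assumes g: "range g \<subseteq> carrier R" shows "conv (\<lambda>w. if w = [] then \<one> else \<zero>) g w = g w"
proof (cases w)
  case Nil
  then show ?thesis using g by (auto simp: image_subset_iff)
next
  case (Cons x v)
  have r: "range (\<lambda>w. if w = [] then \<one> else \<zero>) \<subseteq> carrier R" by auto
  have z: "conv (\<lambda>w. \<zero>) g v = \<zero>" by (rule add.finprod_one_eqI) (simp add: range_app[OF g])
  have "g w \<in> carrier R" using g by auto
  then show ?thesis using conv_Cons[OF r g, of x v] z Cons by simp
qed

lemma conv_one_right:
  assumes "range f \<subseteq> carrier R" shows "conv f (\<lambda>w. if w = [] then \<one> else \<zero>) w = f w"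
  using assms
proof (induction w arbitrary: f)
  case Nil
  then show ?case by (auto simp: image_subset_iff)
next
  case (Cons x v)
  have r: "range (\<lambda>w. if w = [] then \<one> else \<zero>) \<subseteq> carrier R" by auto
  have "f v \<in> carrier R" for v using Cons.prems by auto
  then show ?case using conv_Cons[OF Cons.prems r, of x v] Cons.IH[of "\<lambda>w. f (x # w)"] by auto
qed

lemma free_alg_carrier_iff:
  "f \<in> carrier (free_alg R S) \<longleftrightarrow> range f \<subseteq> carrier R \<and> finite {w. f w \<noteq> \<zero>} \<and> {w. f w \<noteq> \<zero>} \<subseteq> lists S"
  by (simp add: free_alg_def)

lemma free_alg_ring: "ring (free_alg R S)"
proof -
  let ?A = "free_alg R S"
  have carr: "f w \<in> carrier R" if "f \<in> carrier ?A" for f w using that by (auto simp: free_alg_def)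
  have rng: "range f \<subseteq> carrier R" if "f \<in> carrier ?A" for f using that by (simp add: free_alg_def)
  have supp: "finite {w. f w \<noteq> \<zero>}" "{w. f w \<noteq> \<zero>} \<subseteq> lists S" if "f \<in> carrier ?A" for f
    using that by (simp_all add: free_alg_def)
  have carrI: "f \<in> carrier ?A" if "\<And>w. f w \<in> carrier R" "{w. f w \<noteq> \<zero>} \<subseteq> B" "finite B" "B \<subseteq> lists S" for f B
    using that finite_subset[of "{w. f w \<noteq> \<zero>}" B] by (auto simp: free_alg_def)
  have ops: "f \<oplus>\<^bsub>?A\<^esub> g = (\<lambda>w. f w \<oplus> g w)" "\<zero>\<^bsub>?A\<^esub> = (\<lambda>w. \<zero>)" "f \<otimes>\<^bsub>?A\<^esub> g = conv f g"
    "\<one>\<^bsub>?A\<^esub> = (\<lambda>w. if w = [] then \<one> else \<zero>)" for f g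
    by (simp_all add: free_alg_def)
  have add: "(\<lambda>w. f w \<oplus> g w) \<in> carrier ?A" if "f \<in> carrier ?A" "g \<in> carrier ?A" for f g
    by (rule carrI[of _ "{w. f w \<noteq> \<zero>} \<union> {w. g w \<noteq> \<zero>}"]) (use that supp carr in auto)
  have mult: "conv f g \<in> carrier ?A" if fg: "f \<in> carrier ?A" "g \<in> carrier ?A" for f g
  proof (rule carrI)
    show "conv f g w \<in> carrier R" for w by (rule conv_closed[OF rng[OF fg(1)] rng[OF fg(2)]])
    let ?B = "(\<lambda>(u, v). u @ v) ` ({w. f w \<noteq> \<zero>} \<times> {w. g w \<noteq> \<zero>})"
    show "{w. conv f g w \<noteq> \<zero>} \<subseteq> ?B"
    proof (rule subsetI, rule ccontr)
      fix w assume w: "w \<in> {w. conv f g w \<noteq> \<zero>}" "w \<notin> ?B"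
      have "f (take k w) \<otimes> g (drop k w) = \<zero>" for k
      proof -
        have "f (take k w) = \<zero> \<or> g (drop k w) = \<zero>" using w(2) append_take_drop_id[of k w] by (force simp: image_iff)
        then show ?thesis using carr[OF fg(1)] carr[OF fg(2)] by auto
      qed
      then have "conv f g w = \<zero>" by (intro add.finprod_one_eqI) auto
      then show False using w(1) by simp
    qed
    show "finite ?B" using supp fg by blast
    show "?B \<subseteq> lists S" using supp(2)[OF fg(1)] supp(2)[OF fg(2)] by (auto simp: lists_eq_set) blast+
  qed
  show ?thesis
  proof (rule ringI)
    show "abelian_group ?A"
    proof (rule abelian_groupI)
      fix f assume f: "f \<in> carrier ?A"
      have "(\<lambda>w. \<ominus> f w) \<in> carrier ?A"
        by (rule carrI[of _ "{w. f w \<noteq> \<zero>}"]) (use f supp carr in auto)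
      moreover have "(\<lambda>w. \<ominus> f w) \<oplus>\<^bsub>?A\<^esub> f = \<zero>\<^bsub>?A\<^esub>" using f carr by (auto simp: ops l_neg)
      ultimately show "\<exists>g\<in>carrier ?A. g \<oplus>\<^bsub>?A\<^esub> f = \<zero>\<^bsub>?A\<^esub>" by blast
    qed (use add carr in \<open>auto simp: ops a_ac\<close>, auto simp: free_alg_def)
    show "Group.monoid ?A"
    proof (rule Group.monoidI)
      show "\<one>\<^bsub>?A\<^esub> \<in> carrier ?A" unfolding ops by (rule carrI[of _ "{[]}"]) auto
      fix f g h assume *: "f \<in> carrier ?A" "g \<in> carrier ?A" "h \<in> carrier ?A"
      show "f \<otimes>\<^bsub>?A\<^esub> g \<in> carrier ?A" unfolding ops using mult * by blast
      show "f \<otimes>\<^bsub>?A\<^esub> g \<otimes>\<^bsub>?A\<^esub> h = f \<otimes>\<^bsub>?A\<^esub> (g \<otimes>\<^bsub>?A\<^esub> h)"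
        unfolding ops by (rule ext, rule conv_assoc[OF rng[OF *(1)] rng[OF *(2)] rng[OF *(3)]])
      show "\<one>\<^bsub>?A\<^esub> \<otimes>\<^bsub>?A\<^esub> f = f" unfolding ops by (rule ext, rule conv_one_left[OF rng[OF *(1)]])
      show "f \<otimes>\<^bsub>?A\<^esub> \<one>\<^bsub>?A\<^esub> = f" unfolding ops by (rule ext, rule conv_one_right[OF rng[OF *(1)]])
    qed
    fix f g h assume *: "f \<in> carrier ?A" "g \<in> carrier ?A" "h \<in> carrier ?A"
    show "(f \<oplus>\<^bsub>?A\<^esub> g) \<otimes>\<^bsub>?A\<^esub> h = f \<otimes>\<^bsub>?A\<^esub> h \<oplus>\<^bsub>?A\<^esub> g \<otimes>\<^bsub>?A\<^esub> h"
      unfolding ops by (rule ext, rule conv_add_left[OF rng[OF *(1)] rng[OF *(2)] rng[OF *(3)]])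
    show "h \<otimes>\<^bsub>?A\<^esub> (f \<oplus>\<^bsub>?A\<^esub> g) = h \<otimes>\<^bsub>?A\<^esub> f \<oplus>\<^bsub>?A\<^esub> h \<otimes>\<^bsub>?A\<^esub> g"
      unfolding ops by (rule ext, rule conv_add_right[OF rng[OF *(3)] rng[OF *(2)] rng[OF *(1)]])
  qed
qed

end

locale free_algebra = cring F for F (structure) +
  fixes S :: "'x set" and A
  assumes A_def: "A = free_alg F S"
begin

sublocale A: ring A
  unfolding A_def by (rule free_alg_ring)

lemma add_eq: "f \<oplus>\<^bsub>A\<^esub> g = (\<lambda>w. f w \<oplus> g w)" and zero_eq: "\<zero>\<^bsub>A\<^esub> = (\<lambda>w. \<zero>)"
  and mult_eq: "f \<otimes>\<^bsub>A\<^esub> g = conv f g" and one_eq: "\<one>\<^bsub>A\<^esub> = free_mon []"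
  by (simp_all add: A_def free_alg_def free_mon_def)

lemma app_closed: "f \<in> carrier A \<Longrightarrow> f w \<in> carrier F"
  by (auto simp: A_def free_alg_carrier_iff)

lemma supp_finite: "f \<in> carrier A \<Longrightarrow> finite {w. f w \<noteq> \<zero>}" and supp_lists: "f \<in> carrier A \<Longrightarrow> {w. f w \<noteq> \<zero>} \<subseteq> lists S"
  by (simp_all add: A_def free_alg_carrier_iff)

lemma free_mon_closed: "set u \<subseteq> S \<Longrightarrow> free_mon u \<in> carrier A"
  by (auto simp: A_def free_alg_carrier_iff free_mon_def split: if_splits)

lemma free_const_closed: "a \<in> carrier F \<Longrightarrow> free_const F a \<in> carrier A"
  by (auto simp: A_def free_alg_carrier_iff free_const_def split: if_splits)

lemma free_gen_eq: "free_gen F x = free_mon [x]"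
  by (simp add: free_gen_def free_mon_def)

lemma const_mult:
  assumes a: "a \<in> carrier F" and g: "g \<in> carrier A"
  shows "free_const F a \<otimes>\<^bsub>A\<^esub> g = (\<lambda>w. a \<otimes> g w)"
proof
  fix w
  have r: "range (\<lambda>w. if w = [] then \<one> else \<zero>) \<subseteq> carrier F" "range g \<subseteq> carrier F" using app_closed[OF g] by auto
  have e: "free_const F a = (\<lambda>w. a \<otimes> (if w = [] then \<one> else \<zero>))" using a by (auto simp: free_const_def)
  show "(free_const F a \<otimes>\<^bsub>A\<^esub> g) w = a \<otimes> g w"
    unfolding mult_eq e conv_smult_left[OF r a] conv_one_left[OF r(2)] ..
qed

lemma mult_const:
  assumes a: "a \<in> carrier F" and g: "g \<in> carrier A"
  shows "g \<otimes>\<^bsub>A\<^esub> free_const F a = (\<lambda>w. a \<otimes> g w)"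
proof
  fix w
  have gc: "g w \<in> carrier F" for w using app_closed[OF g] by simp
  have "conv g (free_const F a) w = (\<Oplus>k\<in>{..length w}. if k = length w then a \<otimes> g w else \<zero>)"
    by (rule finsum_cong') (use a gc in \<open>auto simp: free_const_def m_comm\<close>)
  also have "\<dots> = a \<otimes> g w"
    using add.finprod_singleton_swap[of "length w" "{..length w}" "\<lambda>_. a \<otimes> g w"] a gc by simp
  finally show "(g \<otimes>\<^bsub>A\<^esub> free_const F a) w = a \<otimes> g w" unfolding mult_eq .
qed

lemma mon_mult:
  assumes g: "g \<in> carrier A"
  shows "free_mon [x] \<otimes>\<^bsub>A\<^esub> g = (\<lambda>w. case w of [] \<Rightarrow> \<zero> | y # v \<Rightarrow> if y = x then g v else \<zero>)"
proof
  fix w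
  have gc: "g w \<in> carrier F" for w using app_closed[OF g] by simp
  have r: "range (free_mon [x]) \<subseteq> carrier F" "range g \<subseteq> carrier F" using gc by (auto simp: free_mon_def)
  show "(free_mon [x] \<otimes>\<^bsub>A\<^esub> g) w = (case w of [] \<Rightarrow> \<zero> | y # v \<Rightarrow> if y = x then g v else \<zero>)"
  proof (cases w)
    case Nil
    then show ?thesis unfolding mult_eq using conv_Nil[OF r] gc by (simp add: free_mon_def)
  next
    case (Cons y v)
    have e: "(\<lambda>w. free_mon [x] (y # w)) = (if y = x then (\<lambda>w. if w = [] then \<one> else \<zero>) else (\<lambda>w. \<zero>))"
      by (auto simp: free_mon_def)
    have z: "conv (\<lambda>w. \<zero>) g v = \<zero>" by (rule add.finprod_one_eqI) (use gc in auto)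
    have "conv (\<lambda>w. free_mon [x] (y # w)) g v = (if y = x then g v else \<zero>)"
      using arg_cong[OF e, of "\<lambda>h. conv h g v"] conv_one_left[OF r(2), of v] z by (cases "y = x") simp_all
    then show ?thesis unfolding mult_eq Cons using conv_Cons[OF r, of y v] gc by (simp add: free_mon_def)
  qed
qed

lemma free_mon_Cons: "set u \<subseteq> S \<Longrightarrow> free_mon (x # u) = free_gen F x \<otimes>\<^bsub>A\<^esub> free_mon u"
  unfolding free_gen_eq mon_mult[OF free_mon_closed]
  by (auto simp: free_mon_def split: list.splits)

lemma free_mon_append: "set u \<subseteq> S \<Longrightarrow> set v \<subseteq> S \<Longrightarrow> free_mon (u @ v) = free_mon u \<otimes>\<^bsub>A\<^esub> free_mon v"
proof (induction u)
  case Nil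
  then show ?case using free_mon_closed[of v] A.l_one by (simp add: one_eq)
next
  case (Cons x u)
  then have "free_mon (x # u @ v) = free_gen F x \<otimes>\<^bsub>A\<^esub> (free_mon u \<otimes>\<^bsub>A\<^esub> free_mon v)"
    by (subst free_mon_Cons) auto
  also have "\<dots> = free_mon (x # u) \<otimes>\<^bsub>A\<^esub> free_mon v"
    using Cons.prems by (subst free_mon_Cons) (auto simp: A.m_assoc free_mon_closed free_gen_eq)
  finally show ?case by simp
qed

lemma const_hom: "free_const F \<in> ring_hom F A"
proof (rule ring_hom_memI)
  show "free_const F a \<in> carrier A" if "a \<in> carrier F" for a using that by (rule free_const_closed)
  fix a c assume *: "a \<in> carrier F" "c \<in> carrier F"
  show "free_const F (a \<otimes> c) = free_const F a \<otimes>\<^bsub>A\<^esub> free_const F c"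
    unfolding const_mult[OF *(1) free_const_closed[OF *(2)]] using * by (auto simp: free_const_def)
  show "free_const F (a \<oplus> c) = free_const F a \<oplus>\<^bsub>A\<^esub> free_const F c" by (auto simp: free_const_def add_eq)
qed (simp add: free_const_def one_eq free_mon_def)

text \<open>The induction runs over the size of the support, one monomial being split off at a
  time.\<close>

lemma free_induct [consumes 1, case_names zero add monomial]:
  assumes g: "g \<in> carrier A" and z: "P \<zero>\<^bsub>A\<^esub>"
    and add: "\<And>f g. f \<in> carrier A \<Longrightarrow> g \<in> carrier A \<Longrightarrow> P f \<Longrightarrow> P g \<Longrightarrow> P (f \<oplus>\<^bsub>A\<^esub> g)"
    and mon: "\<And>a u. a \<in> carrier F \<Longrightarrow> set u \<subseteq> S \<Longrightarrow> P (free_const F a \<otimes>\<^bsub>A\<^esub> free_mon u)"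
  shows "P g"
  using g
proof (induction "card {w. g w \<noteq> \<zero>}" arbitrary: g)
  case 0
  then have "{w. g w \<noteq> \<zero>} = {}" using supp_finite by (metis card_0_eq)
  then have "g = \<zero>\<^bsub>A\<^esub>" by (auto simp: zero_eq)
  then show ?case using z by simp
next
  case (Suc m)
  then obtain u where u: "g u \<noteq> \<zero>" by (metis (mono_tags, lifting) Collect_empty_eq Zero_not_Suc card.empty)
  have us: "set u \<subseteq> S" using supp_lists[OF Suc.prems] u by auto
  define h where "h = (\<lambda>w. if w = u then \<zero> else g w)"
  have hs: "{w. h w \<noteq> \<zero>} = {w. g w \<noteq> \<zero>} - {u}" by (auto simp: h_def)
  have h: "h \<in> carrier A" using Suc.prems hs unfolding A_def free_alg_carrier_iff
    by (auto simp: h_def image_subset_iff)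
  have "m = card {w. h w \<noteq> \<zero>}" unfolding hs using Suc.hyps(2) u supp_finite[OF Suc.prems] by simp
  then have Ph: "P h" using Suc.hyps(1) h by blast
  have gu: "g u \<in> carrier F" using app_closed[OF Suc.prems] .
  have t: "free_const F (g u) \<otimes>\<^bsub>A\<^esub> free_mon u \<in> carrier A"
    using gu us free_const_closed free_mon_closed by simp
  have "g = (free_const F (g u) \<otimes>\<^bsub>A\<^esub> free_mon u) \<oplus>\<^bsub>A\<^esub> h"
    unfolding const_mult[OF gu free_mon_closed[OF us]] add_eq
    using app_closed[OF Suc.prems] by (auto simp: h_def free_mon_def)
  then show ?case using add[OF t h mon[OF gu us] Ph] by simp
qed

definition free_form :: "('x list \<Rightarrow> 'a) \<Rightarrow> ('x list \<Rightarrow> 'a) \<Rightarrow> 'a" where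
  "free_form \<phi> g = (\<Oplus>w\<in>{w. g w \<noteq> \<zero>}. g w \<otimes> \<phi> w)"

lemma free_form_zero: "free_form \<phi> \<zero>\<^bsub>A\<^esub> = \<zero>"
  by (simp add: free_form_def zero_eq)

context
  fixes \<phi> :: "'x list \<Rightarrow> 'a" assumes \<phi>: "\<And>w. set w \<subseteq> S \<Longrightarrow> \<phi> w \<in> carrier F"
begin

lemma free_form_superset:
  assumes g: "g \<in> carrier A" and B: "finite B" "{w. g w \<noteq> \<zero>} \<subseteq> B" "B \<subseteq> lists S"
  shows "free_form \<phi> g = (\<Oplus>w\<in>B. g w \<otimes> \<phi> w)"
proof -
  have c: "\<phi> w \<in> carrier F" if "w \<in> B" for w using B(3) \<phi> that by (auto simp: lists_eq_set)
  show ?thesis unfolding free_form_def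
    by (rule add.finprod_mono_neutral_cong_left) (use B c app_closed[OF g] in \<open>auto simp: subset_iff\<close>)
qed

lemma free_form_closed:
  assumes g: "g \<in> carrier A" shows "free_form \<phi> g \<in> carrier F"
proof -
  have "\<phi> w \<in> carrier F" if "g w \<noteq> \<zero>" for w using supp_lists[OF g] that \<phi> by (auto simp: lists_eq_set)
  then show ?thesis unfolding free_form_def using app_closed[OF g] by (intro finsum_closed) auto
qed

lemma free_form_add:
  assumes f: "f \<in> carrier A" and g: "g \<in> carrier A"
  shows "free_form \<phi> (f \<oplus>\<^bsub>A\<^esub> g) = free_form \<phi> f \<oplus> free_form \<phi> g"
proof -
  let ?B = "{w. f w \<noteq> \<zero>} \<union> {w. g w \<noteq> \<zero>}"
  have B: "finite ?B" "?B \<subseteq> lists S" using supp_finite supp_lists f g by auto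
  have c: "\<phi> w \<in> carrier F" if "w \<in> ?B" for w using B(2) \<phi> that unfolding lists_eq_set by blast
  note fg = app_closed[OF f] app_closed[OF g]
  have "free_form \<phi> (f \<oplus>\<^bsub>A\<^esub> g) = (\<Oplus>w\<in>?B. (f \<oplus>\<^bsub>A\<^esub> g) w \<otimes> \<phi> w)"
    by (rule free_form_superset[OF A.a_closed[OF f g] B(1) _ B(2)]) (auto simp: add_eq)
  also have "\<dots> = (\<Oplus>w\<in>?B. f w \<otimes> \<phi> w \<oplus> g w \<otimes> \<phi> w)"
    by (rule finsum_cong') (use c fg in \<open>auto simp: add_eq l_distr\<close>)
  also have "\<dots> = (\<Oplus>w\<in>?B. f w \<otimes> \<phi> w) \<oplus> (\<Oplus>w\<in>?B. g w \<otimes> \<phi> w)"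
    by (rule finsum_addf) (use c fg in auto)
  also have "\<dots> = free_form \<phi> f \<oplus> free_form \<phi> g"
    using free_form_superset[OF f B(1) _ B(2)] free_form_superset[OF g B(1) _ B(2)] by auto
  finally show ?thesis .
qed

lemma free_form_monomial:
  assumes a: "a \<in> carrier F" and u: "set u \<subseteq> S"
  shows "free_form \<phi> (free_const F a \<otimes>\<^bsub>A\<^esub> free_mon u) = a \<otimes> \<phi> u"
proof -
  have t: "free_const F a \<otimes>\<^bsub>A\<^esub> free_mon u \<in> carrier A" using a u free_const_closed free_mon_closed by simp
  have e: "free_const F a \<otimes>\<^bsub>A\<^esub> free_mon u = (\<lambda>w. if w = u then a else \<zero>)"
    unfolding const_mult[OF a free_mon_closed[OF u]] using a by (auto simp: free_mon_def)
  have "free_form \<phi> (free_const F a \<otimes>\<^bsub>A\<^esub> free_mon u) = (\<Oplus>w\<in>{u}. (free_const F a \<otimes>\<^bsub>A\<^esub> free_mon u) w \<otimes> \<phi> w)"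
    by (rule free_form_superset[OF t]) (use u in \<open>auto simp: e\<close>)
  then show ?thesis using a u \<phi> by (simp add: e)
qed

lemma free_form_mon: "set u \<subseteq> S \<Longrightarrow> free_form \<phi> (free_mon u) = \<phi> u"
  using free_form_monomial[of \<one> u] const_mult[of \<one> "free_mon u"] free_mon_closed[of u] app_closed[of "free_mon u"] \<phi>[of u]
  by simp

end

lemma free_form_mult_left:
  assumes \<phi>: "\<And>w. set w \<subseteq> S \<Longrightarrow> \<phi> w \<in> carrier F" and a: "a \<in> carrier F" and u: "set u \<subseteq> S" and g: "g \<in> carrier A"
  shows "free_form \<phi> ((free_const F a \<otimes>\<^bsub>A\<^esub> free_mon u) \<otimes>\<^bsub>A\<^esub> g) = a \<otimes> free_form (\<lambda>w. \<phi> (u @ w)) g"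
  using g
proof (induction g rule: free_induct)
  case zero
  then show ?case using a u by (simp add: free_form_zero free_const_closed free_mon_closed)
next
  case (add f g)
  have p: "\<And>w. set w \<subseteq> S \<Longrightarrow> \<phi> (u @ w) \<in> carrier F" using \<phi> u by auto
  have m: "free_const F a \<otimes>\<^bsub>A\<^esub> free_mon u \<in> carrier A" using a u free_const_closed free_mon_closed by simp
  show ?case using add m a p
    by (simp add: A.r_distr free_form_add[OF \<phi>] free_form_add[OF p] r_distr free_form_closed)
next
  case (monomial c v)
  have p: "\<And>w. set w \<subseteq> S \<Longrightarrow> \<phi> (u @ w) \<in> carrier F" using \<phi> u by auto
  have cl: "free_const F a \<in> carrier A" "free_const F c \<in> carrier A" "free_mon u \<in> carrier A" "free_mon v \<in> carrier A"
    using a u monomial free_const_closed free_mon_closed by auto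
  have comm: "free_mon u \<otimes>\<^bsub>A\<^esub> free_const F c = free_const F c \<otimes>\<^bsub>A\<^esub> free_mon u"
    using const_mult mult_const monomial(1) cl by simp
  have "(free_const F a \<otimes>\<^bsub>A\<^esub> free_mon u) \<otimes>\<^bsub>A\<^esub> (free_const F c \<otimes>\<^bsub>A\<^esub> free_mon v)
    = free_const F a \<otimes>\<^bsub>A\<^esub> ((free_mon u \<otimes>\<^bsub>A\<^esub> free_const F c) \<otimes>\<^bsub>A\<^esub> free_mon v)"
    using cl by (simp add: A.m_assoc)
  also have "\<dots> = (free_const F a \<otimes>\<^bsub>A\<^esub> free_const F c) \<otimes>\<^bsub>A\<^esub> (free_mon u \<otimes>\<^bsub>A\<^esub> free_mon v)"
    unfolding comm using cl by (simp add: A.m_assoc)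
  also have "\<dots> = free_const F (a \<otimes> c) \<otimes>\<^bsub>A\<^esub> free_mon (u @ v)"
    using ring_hom_mult[OF const_hom a monomial(1)] free_mon_append[OF u monomial(2)] by simp
  finally show ?case
    using free_form_monomial[OF \<phi>, where a = "a \<otimes> c" and u = "u @ v"] free_form_monomial[OF p monomial] a u monomial \<phi>[of "u @ v"]
    by (simp add: m_assoc)
qed

lemma free_form_mult_right:
  assumes \<phi>: "\<And>w. set w \<subseteq> S \<Longrightarrow> \<phi> w \<in> carrier F" and a: "a \<in> carrier F" and u: "set u \<subseteq> S" and g: "g \<in> carrier A"
  shows "free_form \<phi> (g \<otimes>\<^bsub>A\<^esub> (free_const F a \<otimes>\<^bsub>A\<^esub> free_mon u)) = a \<otimes> free_form (\<lambda>w. \<phi> (w @ u)) g"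
  using g
proof (induction g rule: free_induct)
  case zero
  then show ?case using a u by (simp add: free_form_zero free_const_closed free_mon_closed)
next
  case (add f g)
  have p: "\<And>w. set w \<subseteq> S \<Longrightarrow> \<phi> (w @ u) \<in> carrier F" using \<phi> u by auto
  have m: "free_const F a \<otimes>\<^bsub>A\<^esub> free_mon u \<in> carrier A" using a u free_const_closed free_mon_closed by simp
  show ?case using add m a p
    by (simp add: A.l_distr free_form_add[OF \<phi>] free_form_add[OF p] r_distr free_form_closed)
next
  case (monomial c v)
  have p: "\<And>w. set w \<subseteq> S \<Longrightarrow> \<phi> (w @ u) \<in> carrier F" using \<phi> u by auto
  have q: "\<And>w. set w \<subseteq> S \<Longrightarrow> \<phi> (v @ w) \<in> carrier F" using \<phi> monomial by auto
  have t: "free_const F a \<otimes>\<^bsub>A\<^esub> free_mon u \<in> carrier A" using a u free_const_closed free_mon_closed by simp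
  show ?case
    using free_form_mult_left[OF \<phi> monomial t] free_form_monomial[OF q a u] free_form_monomial[OF p monomial] a u monomial \<phi>[of "v @ u"]
    by (simp add: m_lcomm)
qed

text \<open>The largest two-sided ideal in the kernel of \<open>free_form \<phi>\<close>.\<close>

definition form_ideal :: "('x list \<Rightarrow> 'a) \<Rightarrow> ('x list \<Rightarrow> 'a) set" where
  "form_ideal \<phi> = {g \<in> carrier A. \<forall>u v. set u \<subseteq> S \<longrightarrow> set v \<subseteq> S \<longrightarrow> free_form (\<lambda>w. \<phi> (u @ w @ v)) g = \<zero>}"

lemma form_idealD:
  "g \<in> form_ideal \<phi> \<Longrightarrow> set u \<subseteq> S \<Longrightarrow> set v \<subseteq> S \<Longrightarrow> free_form (\<lambda>w. \<phi> (u @ w @ v)) g = \<zero>"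
  by (simp add: form_ideal_def)

text \<open>Multiplication by a monomial is absorbed into the contexts: it lengthens
  \<open>u\<close> or \<open>v\<close>, over which the definition quantifies. General multipliers
  are sums of monomials.\<close>

lemma form_ideal:
  assumes \<phi>: "\<And>w. set w \<subseteq> S \<Longrightarrow> \<phi> w \<in> carrier F"
  shows "ideal (form_ideal \<phi>) A"
proof -
  let ?K = "form_ideal \<phi>"
  have p: "\<And>w. set w \<subseteq> S \<Longrightarrow> \<phi> (u @ w @ v) \<in> carrier F" if "set u \<subseteq> S" "set v \<subseteq> S" for u v using \<phi> that by auto
  have zero: "\<zero>\<^bsub>A\<^esub> \<in> ?K" unfolding form_ideal_def by (auto simp: free_form_zero)
  have add: "f \<oplus>\<^bsub>A\<^esub> g \<in> ?K" if "f \<in> ?K" "g \<in> ?K" for f g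
    using that unfolding form_ideal_def by (auto simp: free_form_add[OF p])
  have left: "a \<otimes>\<^bsub>A\<^esub> g \<in> ?K" if a: "a \<in> carrier A" and g: "g \<in> ?K" for a g
    using a
  proof (induction a rule: free_induct)
    case zero
    then show ?case using g \<open>\<zero>\<^bsub>A\<^esub> \<in> ?K\<close> by (simp add: form_ideal_def)
  next
    case (add a c)
    then show ?case using \<open>\<And>f g. f \<in> ?K \<Longrightarrow> g \<in> ?K \<Longrightarrow> f \<oplus>\<^bsub>A\<^esub> g \<in> ?K\<close> g
      by (simp add: form_ideal_def A.l_distr)
  next
    case (monomial c t)
    have gc: "g \<in> carrier A" using g by (simp add: form_ideal_def)
    have "free_form (\<lambda>w. \<phi> (u @ w @ v)) ((free_const F c \<otimes>\<^bsub>A\<^esub> free_mon t) \<otimes>\<^bsub>A\<^esub> g) = \<zero>"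
      if uv: "set u \<subseteq> S" "set v \<subseteq> S" for u v
    proof -
      have "free_form (\<lambda>w. \<phi> (u @ w @ v)) ((free_const F c \<otimes>\<^bsub>A\<^esub> free_mon t) \<otimes>\<^bsub>A\<^esub> g)
         = c \<otimes> free_form (\<lambda>w. \<phi> (u @ (t @ w) @ v)) g"
        by (rule free_form_mult_left[OF p[OF uv] monomial gc])
      also have "free_form (\<lambda>w. \<phi> (u @ (t @ w) @ v)) g = \<zero>"
        using form_idealD[OF g, of "u @ t" v] uv monomial by simp
      finally show ?thesis using monomial by simp
    qed
    then show ?case using monomial gc by (simp add: form_ideal_def free_const_closed free_mon_closed)
  qed
  have right: "g \<otimes>\<^bsub>A\<^esub> a \<in> ?K" if a: "a \<in> carrier A" and g: "g \<in> ?K" for a g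
    using a
  proof (induction a rule: free_induct)
    case zero
    then show ?case using g \<open>\<zero>\<^bsub>A\<^esub> \<in> ?K\<close> by (simp add: form_ideal_def)
  next
    case (add a c)
    then show ?case using \<open>\<And>f g. f \<in> ?K \<Longrightarrow> g \<in> ?K \<Longrightarrow> f \<oplus>\<^bsub>A\<^esub> g \<in> ?K\<close> g
      by (simp add: form_ideal_def A.r_distr)
  next
    case (monomial c t)
    have gc: "g \<in> carrier A" using g by (simp add: form_ideal_def)
    have "free_form (\<lambda>w. \<phi> (u @ w @ v)) (g \<otimes>\<^bsub>A\<^esub> (free_const F c \<otimes>\<^bsub>A\<^esub> free_mon t)) = \<zero>"
      if uv: "set u \<subseteq> S" "set v \<subseteq> S" for u v
    proof -
      have "free_form (\<lambda>w. \<phi> (u @ w @ v)) (g \<otimes>\<^bsub>A\<^esub> (free_const F c \<otimes>\<^bsub>A\<^esub> free_mon t))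
         = c \<otimes> free_form (\<lambda>w. \<phi> (u @ (w @ t) @ v)) g"
        by (rule free_form_mult_right[OF p[OF uv] monomial gc])
      also have "free_form (\<lambda>w. \<phi> (u @ (w @ t) @ v)) g = \<zero>"
        using form_idealD[OF g, of u "t @ v"] uv monomial by simp
      finally show ?thesis using monomial by simp
    qed
    then show ?case using monomial gc by (simp add: form_ideal_def free_const_closed free_mon_closed)
  qed
  show ?thesis
  proof (rule idealI[OF A.ring_axioms])
    show "subgroup ?K (add_monoid A)"
    proof (rule A.add.subgroupI)
      show "?K \<subseteq> carrier A" "?K \<noteq> {}" using zero by (auto simp: form_ideal_def)
      fix g assume g: "g \<in> ?K"
      then have "(\<ominus>\<^bsub>A\<^esub> \<one>\<^bsub>A\<^esub>) \<otimes>\<^bsub>A\<^esub> g \<in> ?K" by (intro left) auto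
      then show "\<ominus>\<^bsub>A\<^esub> g \<in> ?K" using g A.l_minus by (simp add: form_ideal_def)
    qed (use add in auto)
  qed (use left right in auto)
qed

end

section \<open>Jacobson's formula\<close>

context ring
begin

text \<open>A sequence stands for the polynomial with these coefficients; \<open>seq_l x y\<close>, \<open>seq_r x y\<close> and
  \<open>seq_ad x y\<close> are left multiplication, right multiplication and commutator with \<open>x X + y\<close>.\<close>

definition seq_l :: "'a \<Rightarrow> 'a \<Rightarrow> (nat \<Rightarrow> 'a) \<Rightarrow> nat \<Rightarrow> 'a" where
  "seq_l x y s = (\<lambda>n. (case n of 0 \<Rightarrow> \<zero> | Suc m \<Rightarrow> x \<otimes> s m) \<oplus> y \<otimes> s n)"

definition seq_r :: "'a \<Rightarrow> 'a \<Rightarrow> (nat \<Rightarrow> 'a) \<Rightarrow> nat \<Rightarrow> 'a" where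
  "seq_r x y s = (\<lambda>n. (case n of 0 \<Rightarrow> \<zero> | Suc m \<Rightarrow> s m \<otimes> x) \<oplus> s n \<otimes> y)"

definition seq_ad :: "'a \<Rightarrow> 'a \<Rightarrow> (nat \<Rightarrow> 'a) \<Rightarrow> nat \<Rightarrow> 'a" where
  "seq_ad x y s = (\<lambda>n. (case n of 0 \<Rightarrow> \<zero> | Suc m \<Rightarrow> x \<otimes> s m \<ominus> s m \<otimes> x) \<oplus> (y \<otimes> s n \<ominus> s n \<otimes> y))"

definition seq_const :: "'a \<Rightarrow> nat \<Rightarrow> 'a" where
  "seq_const a = (\<lambda>n. if n = 0 then a else \<zero>)"

context
  fixes x y assumes x: "x \<in> carrier R" and y: "y \<in> carrier R"
begin

lemma seq_closed:
  assumes "\<And>n. s n \<in> carrier R"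
  shows "seq_l x y s n \<in> carrier R" "seq_r x y s n \<in> carrier R" "seq_ad x y s n \<in> carrier R"
  unfolding seq_l_def seq_r_def seq_ad_def by (cases n; simp add: assms x y)+

lemma seq_pow_closed:
  assumes "\<And>n. s n \<in> carrier R"
  shows "(seq_l x y ^^ i) s n \<in> carrier R" "(seq_r x y ^^ i) s n \<in> carrier R" "(seq_ad x y ^^ i) s n \<in> carrier R"
  by (induction i arbitrary: n) (simp_all add: assms seq_closed)

lemma seq_l_r:
  assumes s: "\<And>n. s n \<in> carrier R"
  shows "seq_l x y (seq_r x y s) = seq_r x y (seq_l x y s)"
proof
  fix n
  show "seq_l x y (seq_r x y s) n = seq_r x y (seq_l x y s) n"
  proof (cases n)
    case 0
    then show ?thesis using s x y by (simp add: seq_l_def seq_r_def m_assoc)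
  next
    case (Suc m)
    then show ?thesis using s x y by (cases m) (simp_all add: seq_l_def seq_r_def m_assoc r_distr l_distr a_ac)
  qed
qed

lemma seq_l_eq:
  assumes s: "\<And>n. s n \<in> carrier R"
  shows "seq_l x y s = (\<lambda>n. seq_r x y s n \<oplus> seq_ad x y s n)"
proof
  have e: "u = v \<oplus> (u \<ominus> v)" if "u \<in> carrier R" "v \<in> carrier R" for u v
    using that by (simp add: a_minus_def a_lcomm r_neg)
  fix n
  show "seq_l x y s n = seq_r x y s n \<oplus> seq_ad x y s n"
  proof (cases n)
    case 0
    then show ?thesis using e[of "y \<otimes> s 0" "s 0 \<otimes> y"] s y by (simp add: seq_l_def seq_r_def seq_ad_def)
  next
    case (Suc m)
    have "(u \<oplus> v) = (u' \<oplus> v') \<oplus> ((u \<ominus> u') \<oplus> (v \<ominus> v'))"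
      if "u \<in> carrier R" "v \<in> carrier R" "u' \<in> carrier R" "v' \<in> carrier R" for u v u' v'
    proof -
      have "(u' \<oplus> v') \<oplus> ((u \<ominus> u') \<oplus> (v \<ominus> v')) = (u' \<oplus> (u \<ominus> u')) \<oplus> (v' \<oplus> (v \<ominus> v'))"
        using that by (simp add: a_ac)
      then show ?thesis using e that by metis
    qed
    from this[of "x \<otimes> s m" "y \<otimes> s n" "s m \<otimes> x" "s n \<otimes> y"] show ?thesis
      using Suc s x y unfolding seq_l_def seq_r_def seq_ad_def by simp
  qed
qed

lemma seq_add:
  assumes "\<And>n. s n \<in> carrier R" "\<And>n. t n \<in> carrier R"
  shows "seq_l x y (\<lambda>n. s n \<oplus> t n) = (\<lambda>n. seq_l x y s n \<oplus> seq_l x y t n)"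
    "seq_r x y (\<lambda>n. s n \<oplus> t n) = (\<lambda>n. seq_r x y s n \<oplus> seq_r x y t n)"
  unfolding seq_l_def seq_r_def by (rule ext; simp add: assms x y r_distr l_distr a_ac split: nat.split)+

lemma seq_pow_add:
  assumes "\<And>n. s n \<in> carrier R" "\<And>n. t n \<in> carrier R"
  shows "(seq_l x y ^^ i) (\<lambda>n. s n \<oplus> t n) = (\<lambda>n. (seq_l x y ^^ i) s n \<oplus> (seq_l x y ^^ i) t n)"
    "(seq_r x y ^^ i) (\<lambda>n. s n \<oplus> t n) = (\<lambda>n. (seq_r x y ^^ i) s n \<oplus> (seq_r x y ^^ i) t n)"
  by (induction i) (simp_all add: assms seq_add seq_pow_closed)

lemma seq_l_r_pow:
  assumes s: "\<And>n. s n \<in> carrier R"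
  shows "seq_l x y ((seq_r x y ^^ j) s) = (seq_r x y ^^ j) (seq_l x y s)"
  by (induction j) (simp_all add: seq_l_r seq_pow_closed s)

text \<open>Left and right multiplication by x X + y commute and differ by the commutator, so
  \<open>finsum_eq_ad_power\<close> applies to each coefficient separately.\<close>

lemma seq_ad_power:
  assumes p: "Factorial_Ring.prime p" and char: "\<And>a. a \<in> carrier R \<Longrightarrow> add_pow R p a = \<zero>"
    and s: "\<And>n. s n \<in> carrier R"
  shows "(\<Oplus>i\<in>{..<p}. (seq_l x y ^^ i) ((seq_r x y ^^ (p - 1 - i)) s) n) = (seq_ad x y ^^ (p - 1)) s n"
proof -
  define H where "H k i j = (seq_l x y ^^ i) ((seq_r x y ^^ j) ((seq_ad x y ^^ k) s)) n" for k i j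
  have "(\<Oplus>i\<in>{..<p}. H 0 i (p - 1 - i)) = H (p - 1) 0 0"
  proof (rule finsum_eq_ad_power[OF p char])
    show "H k i j \<in> carrier R" for k i j unfolding H_def by (intro seq_pow_closed s)
    show "H k (Suc i) j = H k i (Suc j) \<oplus> H (Suc k) i j" for k i j
    proof -
      let ?z = "(seq_ad x y ^^ k) s"
      have z: "?z n \<in> carrier R" for n by (intro seq_pow_closed s)
      have "(seq_l x y ^^ Suc i) ((seq_r x y ^^ j) ?z) = (seq_l x y ^^ i) ((seq_r x y ^^ j) (seq_l x y ?z))"
        by (simp add: funpow_swap1 seq_l_r_pow z)
      also have "seq_l x y ?z = (\<lambda>n. seq_r x y ?z n \<oplus> seq_ad x y ?z n)" by (rule seq_l_eq[OF z])
      also have "(seq_r x y ^^ j) \<dots> = (\<lambda>n. (seq_r x y ^^ j) (seq_r x y ?z) n \<oplus> (seq_r x y ^^ j) (seq_ad x y ?z) n)"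
        by (rule seq_pow_add) (intro seq_closed z)+
      also have "(seq_l x y ^^ i) \<dots> = (\<lambda>n. (seq_l x y ^^ i) ((seq_r x y ^^ j) (seq_r x y ?z)) n
            \<oplus> (seq_l x y ^^ i) ((seq_r x y ^^ j) (seq_ad x y ?z)) n)"
        by (rule seq_pow_add) (intro seq_closed seq_pow_closed z)+
      finally show ?thesis unfolding H_def by (simp add: funpow_swap1)
    qed
  qed simp
  then show ?thesis by (simp add: H_def)
qed

text \<open>The coefficients of (x X + y)^m. For \<open>m = p\<close> those strictly between the
  ends are the images of Jacobson's elements.\<close>

definition binom_seq :: "nat \<Rightarrow> nat \<Rightarrow> 'a" where
  "binom_seq m = (seq_l x y ^^ m) (seq_const \<one>)"

lemma seq_const_closed: "a \<in> carrier R \<Longrightarrow> seq_const a n \<in> carrier R"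
  by (simp add: seq_const_def)

lemma binom_seq_closed: "binom_seq m n \<in> carrier R"
  unfolding binom_seq_def by (intro seq_pow_closed seq_const_closed) simp

lemma binom_seq_Suc: "binom_seq (Suc m) = seq_l x y (binom_seq m)"
  by (simp add: binom_seq_def)

lemma seq_r_scale:
  assumes s: "\<And>n. s n \<in> carrier R"
  shows "(seq_r x y ^^ m) (\<lambda>n. x \<otimes> s n) = (\<lambda>n. x \<otimes> (seq_r x y ^^ m) s n)"
proof (induction m)
  case (Suc m)
  have "seq_r x y (\<lambda>n. x \<otimes> t n) = (\<lambda>n. x \<otimes> seq_r x y t n)" if "\<And>n. t n \<in> carrier R" for t
    using that by (simp add: seq_r_def fun_eq_iff x y m_assoc r_distr split: nat.split)
  from this[OF seq_pow_closed(2)[OF s]] show ?case by (simp add: Suc)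
qed simp

text \<open>Left and right multiplication by x X + y commute and agree on the constant 1, so the
  power may be built from either side.\<close>

lemma binom_seq_right: "binom_seq m = (seq_r x y ^^ m) (seq_const \<one>)"
proof (induction m)
  case (Suc m)
  have "seq_l x y (seq_const \<one>) = seq_r x y (seq_const \<one>)"
    by (rule ext) (auto simp: seq_l_def seq_r_def seq_const_def x y split: nat.split)
  then show ?case unfolding binom_seq_Suc Suc
    by (simp add: seq_l_r_pow seq_const_closed funpow_swap1)
qed (simp add: binom_seq_def)

text \<open>The derivative of \<open>(x X + y)\<^sup>m\<close>.\<close>

lemma binom_seq_deriv:
  "add_pow R (Suc n) (binom_seq m (Suc n)) = (\<Oplus>i\<in>{..<m}. (seq_l x y ^^ i) ((seq_r x y ^^ (m - 1 - i)) (seq_const x)) n)"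
proof (induction m arbitrary: n)
  case 0
  then show ?case by (simp add: binom_seq_def seq_const_def)
next
  case (Suc m)
  define s where "s i = (seq_l x y ^^ i) ((seq_r x y ^^ (m - 1 - i)) (seq_const x))" for i
  have sc: "s i n \<in> carrier R" for i n unfolding s_def by (intro seq_pow_closed seq_const_closed x)
  have lin: "seq_l x y (\<lambda>n. \<Oplus>i\<in>K. s i n) = (\<lambda>n. \<Oplus>i\<in>K. seq_l x y (s i) n)" if "finite K" for K
    using that
  proof (induction K)
    case empty
    then show ?case by (simp add: seq_l_def x y fun_eq_iff split: nat.split)
  next
    case (insert a K)
    have ins: "(\<Oplus>i\<in>insert a K. f i) = f a \<oplus> (\<Oplus>i\<in>K. f i)" if "\<And>i. f i \<in> carrier R" for f
      using that insert.hyps by (intro finsum_insert) simp_all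
    have "seq_l x y (\<lambda>n. \<Oplus>i\<in>insert a K. s i n) = seq_l x y (\<lambda>n. s a n \<oplus> (\<Oplus>i\<in>K. s i n))"
      by (simp only: ins[OF sc])
    also have "\<dots> = (\<lambda>n. seq_l x y (s a) n \<oplus> seq_l x y (\<lambda>n. \<Oplus>i\<in>K. s i n) n)"
      by (rule seq_add(1)[OF sc finsum_closed]) (simp add: sc)
    also have "\<dots> = (\<lambda>n. \<Oplus>i\<in>insert a K. seq_l x y (s i) n)"
      unfolding insert.IH by (simp only: ins[OF seq_closed(1)[OF sc]])
    finally show ?case .
  qed
  have d: "add_pow R (Suc n) (binom_seq m (Suc n)) = (\<Oplus>i\<in>{..<m}. s i n)" for n using Suc by (simp add: s_def)
  have bc: "binom_seq m n \<in> carrier R" for n by (rule binom_seq_closed)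
  \<comment> \<open>x (x X + y)^m arises from the constant x by \<open>m\<close> right
    multiplications; it is the term \<open>i = 0\<close> of the derivative of the next
    power.\<close>
  have xb: "x \<otimes> binom_seq m n = (seq_r x y ^^ m) (seq_const x) n" for n
  proof -
    have "seq_const x = (\<lambda>n. x \<otimes> seq_const \<one> n)" by (auto simp: seq_const_def x)
    then show ?thesis using seq_r_scale[of "seq_const \<one>" m] by (simp add: binom_seq_right seq_const_closed)
  qed
  have "add_pow R (Suc n) (binom_seq (Suc m) (Suc n)) =
     add_pow R (Suc n) (x \<otimes> binom_seq m n) \<oplus> add_pow R (Suc n) (y \<otimes> binom_seq m (Suc n))"
    unfolding binom_seq_Suc by (simp add: seq_l_def add.nat_pow_distrib x y bc del: add.nat_pow_Suc)
  also have "add_pow R (Suc n) (y \<otimes> binom_seq m (Suc n)) = y \<otimes> add_pow R (Suc n) (binom_seq m (Suc n))"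
    by (rule add_pow_rdistr[symmetric]) (use y bc in auto)
  also have "add_pow R (Suc n) (x \<otimes> binom_seq m n) = x \<otimes> binom_seq m n \<oplus> x \<otimes> add_pow R n (binom_seq m n)"
    using x bc by (simp add: add_pow_rdistr a_comm)
  also have "x \<otimes> binom_seq m n \<oplus> x \<otimes> add_pow R n (binom_seq m n) \<oplus> y \<otimes> add_pow R (Suc n) (binom_seq m (Suc n))
     = (seq_r x y ^^ m) (seq_const x) n \<oplus> seq_l x y (\<lambda>n. \<Oplus>i\<in>{..<m}. s i n) n"
  proof (cases n)
    case 0
    then show ?thesis using xb[of 0] d[of 0] x y bc seq_pow_closed(2)[OF seq_const_closed[OF x], where i = m and n = 0]
        finsum_closed[of "\<lambda>i. s i 0" "{..<m}"] sc by (simp add: seq_l_def Pi_def)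
  next
    case (Suc k)
    show ?thesis unfolding Suc d xb using x y seq_pow_closed(2)[OF seq_const_closed[OF x], where i = m]
        finsum_closed[of "\<lambda>i. s i k" "{..<m}"] finsum_closed[of "\<lambda>i. s i (Suc k)" "{..<m}"] sc
      by (simp add: seq_l_def Pi_def a_assoc)
  qed
  also have "\<dots> = (seq_r x y ^^ m) (seq_const x) n \<oplus> (\<Oplus>i\<in>{..<m}. (seq_l x y ^^ Suc i) ((seq_r x y ^^ (m - Suc i)) (seq_const x)) n)"
    unfolding lin[OF finite_lessThan] by (simp add: s_def)
  also have "\<dots> = (\<Oplus>i\<in>{..<Suc m}. (seq_l x y ^^ i) ((seq_r x y ^^ (m - i)) (seq_const x)) n)"
  proof -
    have c: "(seq_l x y ^^ i) ((seq_r x y ^^ (m - i)) (seq_const x)) n \<in> carrier R" for i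
      by (intro seq_pow_closed seq_const_closed x)
    show ?thesis
    proof (cases m)
      case 0
      then show ?thesis using c[of 0] by (simp add: lessThan_Suc)
    next
      case (Suc q)
      have "(\<Oplus>i\<in>{..Suc q}. (seq_l x y ^^ i) ((seq_r x y ^^ (m - i)) (seq_const x)) n)
        = (\<Oplus>i\<in>{..q}. (seq_l x y ^^ Suc i) ((seq_r x y ^^ (m - Suc i)) (seq_const x)) n)
          \<oplus> (seq_l x y ^^ 0) ((seq_r x y ^^ (m - 0)) (seq_const x)) n"
        by (rule finsum_Suc2) (use c in blast)
      moreover have "(\<Oplus>i\<in>{..q}. (seq_l x y ^^ Suc i) ((seq_r x y ^^ (m - Suc i)) (seq_const x)) n) \<in> carrier R"
        by (rule finsum_closed) (use c in blast)
      ultimately show ?thesis using Suc c[of 0] by (simp add: lessThan_Suc_atMost a_comm)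
    qed
  qed
  finally show ?case by simp
qed

lemma binom_seq_ends: "binom_seq m 0 = y [^] m" "binom_seq m m = x [^] m" "m < n \<Longrightarrow> binom_seq m n = \<zero>"
proof -
  have z: "m < n \<Longrightarrow> binom_seq m n = \<zero>" for m n
    by (induction m arbitrary: n) (auto simp: binom_seq_def seq_const_def seq_l_def x y split: nat.split)
  then show "m < n \<Longrightarrow> binom_seq m n = \<zero>" .
  show "binom_seq m 0 = y [^] m"
    by (induction m) (auto simp: binom_seq_def seq_const_def seq_l_def x y nat_pow_Suc2[symmetric])
  show "binom_seq m m = x [^] m"
  proof (induction m)
    case (Suc m)
    then show ?case using z[of m "Suc m"]
      by (simp add: binom_seq_Suc seq_l_def x y nat_pow_Suc2[symmetric])
  qed (simp add: binom_seq_def seq_const_def)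
qed

text \<open>This is the substitution of 1 for X in (x X + y)^m.\<close>

lemma binom_seq_sum: "(\<Oplus>n\<in>{..m}. binom_seq m n) = (x \<oplus> y) [^] m"
proof (induction m)
  case 0
  then show ?case by (simp add: binom_seq_def seq_const_def)
next
  case (Suc m)
  have bc: "binom_seq m n \<in> carrier R" for n by (rule binom_seq_closed)
  have S: "(\<Oplus>n\<in>{..m}. binom_seq m n) \<in> carrier R" by (rule finsum_closed) (simp add: bc)
  have "(\<Oplus>n\<in>{..Suc m}. binom_seq (Suc m) n)
     = (\<Oplus>n\<in>{..Suc m}. (case n of 0 \<Rightarrow> \<zero> | Suc k \<Rightarrow> x \<otimes> binom_seq m k) \<oplus> y \<otimes> binom_seq m n)"
    by (simp only: binom_seq_Suc seq_l_def)
  also have "\<dots> = (\<Oplus>n\<in>{..Suc m}. case n of 0 \<Rightarrow> \<zero> | Suc k \<Rightarrow> x \<otimes> binom_seq m k) \<oplus> (\<Oplus>n\<in>{..Suc m}. y \<otimes> binom_seq m n)"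
    by (rule finsum_addf) (auto simp: x y bc split: nat.split)
  also have "(\<Oplus>n\<in>{..Suc m}. case n of 0 \<Rightarrow> \<zero> | Suc k \<Rightarrow> x \<otimes> binom_seq m k)
     = (\<Oplus>n\<in>{..m}. case Suc n of 0 \<Rightarrow> \<zero> | Suc k \<Rightarrow> x \<otimes> binom_seq m k) \<oplus> (case 0 of 0 \<Rightarrow> \<zero> | Suc k \<Rightarrow> x \<otimes> binom_seq m k)"
    by (rule finsum_Suc2) (auto simp: x y bc split: nat.split)
  also have "\<dots> = (\<Oplus>n\<in>{..m}. x \<otimes> binom_seq m n)"
    using finsum_closed[of "\<lambda>n. x \<otimes> binom_seq m n" "{..m}"] x bc by simp
  also have "\<dots> = x \<otimes> (\<Oplus>n\<in>{..m}. binom_seq m n)" by (rule finsum_rdistr[symmetric]) (use x bc in auto)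
  also have "(\<Oplus>n\<in>{..Suc m}. y \<otimes> binom_seq m n) = y \<otimes> (\<Oplus>n\<in>{..Suc m}. binom_seq m n)"
    by (rule finsum_rdistr[symmetric]) (use y bc in auto)
  also have "(\<Oplus>n\<in>{..Suc m}. binom_seq m n) = binom_seq m (Suc m) \<oplus> (\<Oplus>n\<in>{..m}. binom_seq m n)"
    by (rule finsum_Suc) (use bc in auto)
  also have "\<dots> = (\<Oplus>n\<in>{..m}. binom_seq m n)" using binom_seq_ends(3)[of m "Suc m"] S by simp
  finally show ?case using Suc S x y nat_pow_Suc2[of "x \<oplus> y" m] by (simp add: l_distr)
qed

lemma binom_seq_expand:
  assumes "2 \<le> p"
  shows "(x \<oplus> y) [^] p = x [^] p \<oplus> y [^] p \<oplus> (\<Oplus>i\<in>{1..p - 1}. binom_seq p i)"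
proof -
  have bc: "binom_seq p n \<in> carrier R" for n by (rule binom_seq_closed)
  have e: "{..p} = insert 0 (insert p {1..p - 1})" using assms by auto
  have S: "(\<Oplus>n\<in>{1..p - 1}. binom_seq p n) \<in> carrier R" by (rule finsum_closed) (simp add: bc)
  have "(x \<oplus> y) [^] p = binom_seq p 0 \<oplus> (binom_seq p p \<oplus> (\<Oplus>i\<in>{1..p - 1}. binom_seq p i))"
    unfolding binom_seq_sum[symmetric] e using assms bc by (simp add: Pi_def)
  then show ?thesis using S x y by (simp add: binom_seq_ends a_ac)
qed

end
end

text \<open>An associative ring receiving \<open>F\<close> through \<open>\<sigma>\<close> and
  \<open>L\<close> through \<open>\<iota>\<close>. Compatibility with the p-map is left out on
  purpose: in the quotient constructed for the functionals it is first known for basis elements and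
  is extended to all of \<open>L\<close> by means of this locale.\<close>

locale lie_envelope = restricted_lie_algebra F L p + A: ring A
  for F and L :: "('a, 'b, 'c) restricted_lie_scheme" and p and A :: "('r, 'e) ring_scheme" (structure) +
  fixes \<sigma> :: "'a \<Rightarrow> 'r" and \<iota> :: "'b \<Rightarrow> 'r"
  assumes sigma_hom: "\<sigma> \<in> ring_hom F A"
    and iota_closed: "x \<in> carrier L \<Longrightarrow> \<iota> x \<in> carrier A"
    and iota_add: "x \<in> carrier L \<Longrightarrow> y \<in> carrier L \<Longrightarrow> \<iota> (x \<oplus>\<^bsub>L\<^esub> y) = \<iota> x \<oplus> \<iota> y"
    and iota_smult: "a \<in> carrier F \<Longrightarrow> x \<in> carrier L \<Longrightarrow> \<iota> (a \<odot>\<^bsub>L\<^esub> x) = \<sigma> a \<otimes> \<iota> x"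
    and iota_central: "a \<in> carrier F \<Longrightarrow> x \<in> carrier L \<Longrightarrow> \<sigma> a \<otimes> \<iota> x = \<iota> x \<otimes> \<sigma> a"
    and iota_bracket: "x \<in> carrier L \<Longrightarrow> y \<in> carrier L \<Longrightarrow> \<iota> (bracket L x y) = \<iota> x \<otimes> \<iota> y \<ominus> \<iota> y \<otimes> \<iota> x"
begin

lemma sigma_closed: "a \<in> carrier F \<Longrightarrow> \<sigma> a \<in> carrier A"
  using ring_hom_closed[OF sigma_hom] .

lemma sigma_one: "\<sigma> \<one>\<^bsub>F\<^esub> = \<one>"
  using ring_hom_one[OF sigma_hom] .

lemma sigma_add_pow: "\<sigma> (add_pow F (m :: nat) \<one>\<^bsub>F\<^esub>) = add_pow A m \<one>"
proof (induction m)
  case 0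
  then show ?case using ring_hom_zero[OF sigma_hom R.ring_axioms A.ring_axioms] by simp
next
  case (Suc m)
  then show ?case using ring_hom_add[OF sigma_hom, of "add_pow F m \<one>\<^bsub>F\<^esub>" "\<one>\<^bsub>F\<^esub>"] sigma_one by simp
qed

lemma A_char:
  assumes "a \<in> carrier A" shows "add_pow A p a = \<zero>"
proof -
  have "add_pow A p \<one> = \<zero>" using sigma_add_pow[of p] char_p ring_hom_zero[OF sigma_hom R.ring_axioms A.ring_axioms] by simp
  then show ?thesis using A.add_pow_ldistr[of \<one> a p] assms by simp
qed

lemma iota_zero: "\<iota> \<zero>\<^bsub>L\<^esub> = \<zero>"
  using iota_add[of "\<zero>\<^bsub>L\<^esub>" "\<zero>\<^bsub>L\<^esub>"] iota_closed[of "\<zero>\<^bsub>L\<^esub>"] by simp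

lemma iota_finsum:
  "finite K \<Longrightarrow> (\<And>i. i \<in> K \<Longrightarrow> f i \<in> carrier L) \<Longrightarrow> \<iota> (\<Oplus>\<^bsub>L\<^esub>i\<in>K. f i) = (\<Oplus>i\<in>K. \<iota> (f i))"
proof (induction K rule: finite_induct)
  case empty
  then show ?case by (simp add: iota_zero)
next
  case (insert a K)
  have "\<iota> (\<Oplus>\<^bsub>L\<^esub>i\<in>insert a K. f i) = \<iota> (f a \<oplus>\<^bsub>L\<^esub> (\<Oplus>\<^bsub>L\<^esub>i\<in>K. f i))"
    using insert by (subst M.finsum_insert) auto
  also have "\<dots> = \<iota> (f a) \<oplus> \<iota> (\<Oplus>\<^bsub>L\<^esub>i\<in>K. f i)"
    by (rule iota_add) (use insert.prems in \<open>auto intro!: M.finsum_closed\<close>)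
  also have "\<dots> = (\<Oplus>i\<in>insert a K. \<iota> (f i))"
    using insert iota_closed by (subst A.finsum_insert) auto
  finally show ?case .
qed

lemma ad_poly_closed:
  "x \<in> carrier L \<Longrightarrow> y \<in> carrier L \<Longrightarrow> (\<And>n. s n \<in> carrier L) \<Longrightarrow> ad_poly L x y s n \<in> carrier L"
  unfolding ad_poly_def by (auto simp: bracket_closed split: nat.split)

lemma ad_poly_pow_closed:
  "x \<in> carrier L \<Longrightarrow> y \<in> carrier L \<Longrightarrow> (\<And>n. s n \<in> carrier L) \<Longrightarrow> (ad_poly L x y ^^ k) s n \<in> carrier L"
  by (induction k arbitrary: n) (simp_all add: ad_poly_closed)

lemma iota_ad_poly:
  assumes x: "x \<in> carrier L" and y: "y \<in> carrier L"
  shows "\<iota> ((ad_poly L x y ^^ k) (\<lambda>n. if n = 0 then x else \<zero>\<^bsub>L\<^esub>) n)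
    = (A.seq_ad (\<iota> x) (\<iota> y) ^^ k) (A.seq_const (\<iota> x)) n"
proof (induction k arbitrary: n)
  case 0
  then show ?case by (simp add: A.seq_const_def iota_zero)
next
  case (Suc k)
  let ?s = "(ad_poly L x y ^^ k) (\<lambda>n. if n = 0 then x else \<zero>\<^bsub>L\<^esub>)"
  have s: "?s n \<in> carrier L" for n by (rule ad_poly_pow_closed[OF x y]) (simp add: x)
  have "\<iota> (ad_poly L x y t n) = A.seq_ad (\<iota> x) (\<iota> y) (\<lambda>n. \<iota> (t n)) n" if "\<And>n. t n \<in> carrier L" for t n
    unfolding ad_poly_def A.seq_ad_def using x y that
    by (cases n) (simp_all add: iota_add iota_zero iota_bracket bracket_closed iota_closed)
  from this[OF s] show ?case using Suc by simp
qed

text \<open>In characteristic p the derivative of (x X + y)^p is (ad (x X + y))^(p-1) (x). At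
  X^(i-1) the left side has \<open>i\<close> times the coefficient of X^i and the right side the
  image of \<open>i\<close> times Jacobson's element, and \<open>i\<close> is invertible.\<close>

lemma iota_jacobson_s:
  assumes x: "x \<in> carrier L" and y: "y \<in> carrier L" and i: "i \<in> {1..p - 1}"
  shows "\<iota> (jacobson_s F L p x y i) = A.binom_seq (\<iota> x) (\<iota> y) p i"
proof -
  obtain m where m: "i = Suc m" using i by (cases i) auto
  let ?c = "add_pow F i \<one>\<^bsub>F\<^esub>"
  have "0 < i" "i < p" using i by auto
  then have c: "?c \<in> carrier F" "?c \<noteq> \<zero>\<^bsub>F\<^esub>" using char_nonzero[of i] by auto
  then have ci: "inv\<^bsub>F\<^esub> ?c \<in> carrier F" "inv\<^bsub>F\<^esub> ?c \<otimes>\<^bsub>F\<^esub> ?c = \<one>\<^bsub>F\<^esub>"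
    using field_Units by auto
  have X: "\<iota> x \<in> carrier A" "\<iota> y \<in> carrier A" using x y iota_closed by auto
  have bc: "A.binom_seq (\<iota> x) (\<iota> y) p i \<in> carrier A" by (rule A.binom_seq_closed[OF X])
  have "(ad_poly L x y ^^ (p - 1)) (\<lambda>n. if n = 0 then x else \<zero>\<^bsub>L\<^esub>) m \<in> carrier L"
    by (rule ad_poly_pow_closed[OF x y]) (simp add: x)
  then have "\<iota> (jacobson_s F L p x y i) = \<sigma> (inv\<^bsub>F\<^esub> ?c) \<otimes> (A.seq_ad (\<iota> x) (\<iota> y) ^^ (p - 1)) (A.seq_const (\<iota> x)) m"
    unfolding jacobson_s_def using ci iota_smult iota_ad_poly[OF x y] m by simp
  also have "(A.seq_ad (\<iota> x) (\<iota> y) ^^ (p - 1)) (A.seq_const (\<iota> x)) m = add_pow A i (A.binom_seq (\<iota> x) (\<iota> y) p i)"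
    unfolding m A.binom_seq_deriv[OF X]
    using A.seq_ad_power[OF X prime_p A_char, of "A.seq_const (\<iota> x)" m] X A.seq_const_closed by simp
  also have "\<dots> = \<sigma> ?c \<otimes> A.binom_seq (\<iota> x) (\<iota> y) p i"
    unfolding sigma_add_pow using A.add_pow_ldistr[of \<one> "A.binom_seq (\<iota> x) (\<iota> y) p i" i] bc by simp
  also have "\<sigma> (inv\<^bsub>F\<^esub> ?c) \<otimes> (\<sigma> ?c \<otimes> A.binom_seq (\<iota> x) (\<iota> y) p i) = \<sigma> (inv\<^bsub>F\<^esub> ?c \<otimes>\<^bsub>F\<^esub> ?c) \<otimes> A.binom_seq (\<iota> x) (\<iota> y) p i"
    using ring_hom_mult[OF sigma_hom ci(1) c(1)] bc sigma_closed c ci by (simp add: A.m_assoc)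
  finally show ?thesis using ci bc sigma_one by simp
qed

text \<open>The mixed terms of (x + y)^p are the images of Jacobson's elements, which are the
  correction terms in \<open>pmap_add\<close>. So the elements with x^p = x^[p] are closed under
  addition; together with multiples this reduces the relation to a basis.\<close>

lemma iota_pmap_add:
  assumes x: "x \<in> carrier L" and y: "y \<in> carrier L"
    and ix: "\<iota> x [^] p = \<iota> (pmap L x)" and iy: "\<iota> y [^] p = \<iota> (pmap L y)"
  shows "\<iota> (x \<oplus>\<^bsub>L\<^esub> y) [^] p = \<iota> (pmap L (x \<oplus>\<^bsub>L\<^esub> y))"
proof -
  have X: "\<iota> x \<in> carrier A" "\<iota> y \<in> carrier A" using x y iota_closed by auto
  have j: "jacobson_s F L p x y i \<in> carrier L" if i: "i \<in> {1..p - 1}" for i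
  proof -
    have "0 < i" "i < p" using i by auto
    then have "add_pow F i \<one>\<^bsub>F\<^esub> \<in> Units F" using char_nonzero[of i] field_Units by auto
    then show ?thesis unfolding jacobson_s_def
      by (intro smult_closed ad_poly_pow_closed[OF x y]) (simp_all add: x)
  qed
  have "\<iota> (pmap L (x \<oplus>\<^bsub>L\<^esub> y)) = \<iota> (pmap L x) \<oplus> \<iota> (pmap L y) \<oplus> \<iota> (\<Oplus>\<^bsub>L\<^esub>i\<in>{1..p - 1}. jacobson_s F L p x y i)"
    using pmap_add[OF x y] pmap_closed x y j by (simp add: iota_add M.finsum_closed Pi_def)
  also have "\<iota> (\<Oplus>\<^bsub>L\<^esub>i\<in>{1..p - 1}. jacobson_s F L p x y i) = (\<Oplus>i\<in>{1..p - 1}. A.binom_seq (\<iota> x) (\<iota> y) p i)"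
  proof -
    have "\<iota> (\<Oplus>\<^bsub>L\<^esub>i\<in>{1..p - 1}. jacobson_s F L p x y i) = (\<Oplus>i\<in>{1..p - 1}. \<iota> (jacobson_s F L p x y i))"
      by (rule iota_finsum) (simp_all only: finite_atLeastAtMost j)
    also have "\<dots> = (\<Oplus>i\<in>{1..p - 1}. A.binom_seq (\<iota> x) (\<iota> y) p i)"
      by (rule A.finsum_cong') (simp_all add: iota_jacobson_s[OF x y] A.binom_seq_closed[OF X])
    finally show ?thesis .
  qed
  finally show ?thesis using A.binom_seq_expand[OF X two_le_p] ix iy iota_add[OF x y] by simp
qed

lemma iota_pmap_smult:
  assumes a: "a \<in> carrier F" and x: "x \<in> carrier L" and ix: "\<iota> x [^] p = \<iota> (pmap L x)"
  shows "\<iota> (a \<odot>\<^bsub>L\<^esub> x) [^] p = \<iota> (pmap L (a \<odot>\<^bsub>L\<^esub> x))"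
proof -
  have c: "\<sigma> a \<in> carrier A" "\<iota> x \<in> carrier A" using a x sigma_closed iota_closed by auto
  have "(\<sigma> a \<otimes> \<iota> x) [^] m = \<sigma> (a [^]\<^bsub>F\<^esub> m) \<otimes> \<iota> x [^] m" for m :: nat
  proof (induction m)
    case 0
    then show ?case by (simp add: sigma_one)
  next
    case (Suc m)
    have k: "\<sigma> (a [^]\<^bsub>F\<^esub> m) \<in> carrier A" using a sigma_closed by simp
    have "\<iota> x [^] m \<otimes> \<sigma> a = \<sigma> a \<otimes> \<iota> x [^] m"
      using c iota_central[OF a x] by (intro A.group_commutes_pow) simp_all
    then have "(\<sigma> a \<otimes> \<iota> x) [^] Suc m = \<sigma> (a [^]\<^bsub>F\<^esub> m) \<otimes> \<sigma> a \<otimes> (\<iota> x [^] m \<otimes> \<iota> x)"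
      unfolding A.nat_pow_Suc Suc using c k by (simp add: A.m_assoc) (simp flip: A.m_assoc)
    then show ?case using a ring_hom_mult[OF sigma_hom, of "a [^]\<^bsub>F\<^esub> m" a] by simp
  qed
  then show ?thesis using iota_smult a x pmap_smult pmap_closed ix by simp
qed

end

section \<open>The restricted universal enveloping algebra\<close>

lemma (in ideal) coset_zeroD:
  assumes "x \<in> carrier R" "I +> x = \<zero>\<^bsub>R Quot I\<^esub>" shows "x \<in> I"
  using a_rcos_self[of x] assms by (simp add: FactRing_def)

lemma (in ideal) coset_zeroI: "x \<in> I \<Longrightarrow> I +> x = \<zero>\<^bsub>R Quot I\<^esub>"
  by (simp add: FactRing_def a_rcos_const)

text \<open>The factored map is written with \<open>the_elem\<close> because the augmentation of
  u(L,0) is defined in that form.\<close>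

lemma (in ideal) quotient_lift:
  assumes B: "ring B" and h: "h \<in> ring_hom R B" and z: "\<forall>e\<in>I. h e = \<zero>\<^bsub>B\<^esub>"
  shows "\<And>f. f \<in> carrier R \<Longrightarrow> the_elem (h ` (I +> f)) = h f"
    and "(\<lambda>C. the_elem (h ` C)) \<in> ring_hom (R Quot I) B"
proof -
  interpret B: ring B by fact
  interpret Q: ring "R Quot I" by (rule quotient_is_ring)
  note q = rcos_ring_hom
  show 1: "the_elem (h ` (I +> f)) = h f" if f: "f \<in> carrier R" for f
  proof -
    have "h (e \<oplus> f) = h f" if "e \<in> I" for e
      using ring_hom_add[OF h, of e f] bspec[OF z that] f that ring_hom_closed[OF h f] by simp
    moreover have "I +> f = (\<lambda>e. e \<oplus> f) ` I" unfolding a_r_coset_def' by blast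
    ultimately have "h ` (I +> f) = (\<lambda>e. h f) ` I" unfolding image_image by (simp only: image_image cong: image_cong)
    also have "\<dots> = {h f}" using additive_subgroup.zero_closed[OF additive_subgroup_axioms] by blast
    finally show ?thesis by simp
  qed
  have rep: "\<exists>f\<in>carrier R. C = I +> f" if "C \<in> carrier (R Quot I)" for C
    using that by (auto simp: FactRing_def A_RCOSETS_def')
  show "(\<lambda>C. the_elem (h ` C)) \<in> ring_hom (R Quot I) B"
  proof (rule ring_hom_memI)
    show "the_elem (h ` C) \<in> carrier B" if "C \<in> carrier (R Quot I)" for C
      using rep[OF that] 1 ring_hom_closed[OF h] by auto
    show "the_elem (h ` \<one>\<^bsub>R Quot I\<^esub>) = \<one>\<^bsub>B\<^esub>"
      using ring_hom_one[OF q] 1[of \<one>] ring_hom_one[OF h] by simp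
    fix C D assume "C \<in> carrier (R Quot I)" "D \<in> carrier (R Quot I)"
    then obtain f g where fg: "f \<in> carrier R" "g \<in> carrier R" "C = I +> f" "D = I +> g" using rep by metis
    show "the_elem (h ` (C \<otimes>\<^bsub>R Quot I\<^esub> D)) = the_elem (h ` C) \<otimes>\<^bsub>B\<^esub> the_elem (h ` D)"
      using fg ring_hom_mult[OF q fg(1,2)] ring_hom_mult[OF h fg(1,2)] by (simp add: 1 flip: ring_hom_mult[OF q])
    show "the_elem (h ` (C \<oplus>\<^bsub>R Quot I\<^esub> D)) = the_elem (h ` C) \<oplus>\<^bsub>B\<^esub> the_elem (h ` D)"
      using fg ring_hom_add[OF q fg(1,2)] ring_hom_add[OF h fg(1,2)] by (simp add: 1 flip: ring_hom_add[OF q])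
  qed
qed

lemma (in ring) hom_kills_genideal:
  assumes B: "ring B" and h: "h \<in> ring_hom R B" and S: "S \<subseteq> carrier R" and z: "\<forall>s\<in>S. h s = \<zero>\<^bsub>B\<^esub>"
    and e: "e \<in> Idl S"
  shows "h e = \<zero>\<^bsub>B\<^esub>"
proof -
  interpret h: ring_hom_ring R B h by (rule ring_hom_ringI2[OF ring_axioms B h])
  have "Idl S \<subseteq> a_kernel R B h"
    by (rule genideal_minimal[OF h.kernel_is_ideal]) (use S z in \<open>unfold a_kernel_def', blast\<close>)
  then show ?thesis using e unfolding a_kernel_def' by blast
qed

context lie_envelope
begin

definition iprod :: "'b list \<Rightarrow> 'r" where
  "iprod xs = foldr (\<lambda>x r. \<iota> x \<otimes> r) xs \<one>"

lemma iprod_simps [simp]: "iprod [] = \<one>" "iprod (x # xs) = \<iota> x \<otimes> iprod xs"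
  by (simp_all add: iprod_def)

lemma iprod_closed: "set xs \<subseteq> carrier L \<Longrightarrow> iprod xs \<in> carrier A"
  by (induction xs) (auto simp: iota_closed)

lemma iprod_append: "set xs \<subseteq> carrier L \<Longrightarrow> set ys \<subseteq> carrier L \<Longrightarrow> iprod (xs @ ys) = iprod xs \<otimes> iprod ys"
  by (induction xs) (auto simp: iota_closed iprod_closed A.m_assoc)

lemma iprod_replicate: "x \<in> carrier L \<Longrightarrow> iprod (replicate m x) = \<iota> x [^] m"
  by (induction m) (auto simp: iota_closed A.nat_pow_Suc2[symmetric] simp del: A.nat_pow_Suc)

end

context restricted_lie_algebra
begin

abbreviation "FA \<equiv> free_alg F (carrier L)"
abbreviation "U \<equiv> restricted_env F L p"
abbreviation "U_proj f \<equiv> restricted_env_ideal F L p +>\<^bsub>env_alg F L\<^esub> env_proj F L f"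
abbreviation "U_gen x \<equiv> U_proj (free_gen F x)"

lemma free_algebra: "free_algebra F (carrier L) FA"
  by unfold_locales simp

lemma gen_closed: "x \<in> carrier L \<Longrightarrow> free_gen F x \<in> carrier FA"
  using free_algebra.free_mon_closed[OF free_algebra, of "[x]"] by (simp add: free_algebra.free_gen_eq[OF free_algebra])

lemma const_closed: "a \<in> carrier F \<Longrightarrow> free_const F a \<in> carrier FA"
  by (rule free_algebra.free_const_closed[OF free_algebra])

lemma env_relations_cases:
  assumes "r \<in> env_relations F L"
  obtains (add) x y where "x \<in> carrier L" "y \<in> carrier L"
      "r = free_gen F (x \<oplus>\<^bsub>L\<^esub> y) \<ominus>\<^bsub>FA\<^esub> (free_gen F x \<oplus>\<^bsub>FA\<^esub> free_gen F y)"
    | (smult) a x where "a \<in> carrier F" "x \<in> carrier L"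
      "r = free_gen F (a \<odot>\<^bsub>L\<^esub> x) \<ominus>\<^bsub>FA\<^esub> (free_const F a \<otimes>\<^bsub>FA\<^esub> free_gen F x)"
    | (bracket) x y where "x \<in> carrier L" "y \<in> carrier L"
      "r = (free_gen F x \<otimes>\<^bsub>FA\<^esub> free_gen F y \<ominus>\<^bsub>FA\<^esub> free_gen F y \<otimes>\<^bsub>FA\<^esub> free_gen F x) \<ominus>\<^bsub>FA\<^esub> free_gen F (bracket L x y)"
  using assms unfolding env_relations_def Let_def by blast

lemma env_relations_intros:
  shows "x \<in> carrier L \<Longrightarrow> y \<in> carrier L \<Longrightarrow>
      free_gen F (x \<oplus>\<^bsub>L\<^esub> y) \<ominus>\<^bsub>FA\<^esub> (free_gen F x \<oplus>\<^bsub>FA\<^esub> free_gen F y) \<in> env_relations F L"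
    and "a \<in> carrier F \<Longrightarrow> x \<in> carrier L \<Longrightarrow>
      free_gen F (a \<odot>\<^bsub>L\<^esub> x) \<ominus>\<^bsub>FA\<^esub> (free_const F a \<otimes>\<^bsub>FA\<^esub> free_gen F x) \<in> env_relations F L"
    and "x \<in> carrier L \<Longrightarrow> y \<in> carrier L \<Longrightarrow>
      (free_gen F x \<otimes>\<^bsub>FA\<^esub> free_gen F y \<ominus>\<^bsub>FA\<^esub> free_gen F y \<otimes>\<^bsub>FA\<^esub> free_gen F x) \<ominus>\<^bsub>FA\<^esub> free_gen F (bracket L x y) \<in> env_relations F L"
  unfolding env_relations_def Let_def by blast+

lemma env_relations_closed: "env_relations F L \<subseteq> carrier FA"
proof
  interpret A: ring FA by (rule R.free_alg_ring)
  fix r assume "r \<in> env_relations F L"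
  then show "r \<in> carrier FA"
    by (cases rule: env_relations_cases) (simp_all add: gen_closed const_closed bracket_closed)
qed

lemma env_ideal: "ideal (env_ideal F L) FA"
  unfolding env_ideal_def by (rule ring.genideal_ideal[OF R.free_alg_ring env_relations_closed])

lemma env_alg_ring: "ring (env_alg F L)"
  unfolding env_alg_def by (rule ideal.quotient_is_ring[OF env_ideal])

lemma env_proj_hom: "env_proj F L \<in> ring_hom FA (env_alg F L)"
  unfolding env_proj_def env_alg_def by (rule ideal.rcos_ring_hom[OF env_ideal])

lemma env_proj_surj: "C \<in> carrier (env_alg F L) \<Longrightarrow> \<exists>f\<in>carrier FA. C = env_proj F L f"
  by (auto simp: env_alg_def env_proj_def FactRing_def A_RCOSETS_def')

lemma restricted_relations_closed:
  "{(env_proj F L (free_gen F x) [^]\<^bsub>env_alg F L\<^esub> p)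
        \<ominus>\<^bsub>env_alg F L\<^esub> env_proj F L (free_gen F (pmap L x)) | x. x \<in> carrier L} \<subseteq> carrier (env_alg F L)"
proof -
  interpret E: ring "env_alg F L" by (rule env_alg_ring)
  have "env_proj F L (free_gen F x) \<in> carrier (env_alg F L)" if "x \<in> carrier L" for x
    using ring_hom_closed[OF env_proj_hom gen_closed[OF that]] .
  then show ?thesis by (auto intro!: E.minus_closed simp: pmap_closed)
qed

lemma restricted_env_ideal: "ideal (restricted_env_ideal F L p) (env_alg F L)"
  unfolding restricted_env_ideal_def by (rule ring.genideal_ideal[OF env_alg_ring restricted_relations_closed])

lemma U_ring: "ring U"
  unfolding restricted_env_def by (rule ideal.quotient_is_ring[OF restricted_env_ideal])

lemma U_proj_hom: "(\<lambda>f. U_proj f) \<in> ring_hom FA U"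
  using ring_hom_trans[OF env_proj_hom ideal.rcos_ring_hom[OF restricted_env_ideal]]
  by (simp add: restricted_env_def comp_def)

lemma U_proj_surj: "c \<in> carrier U \<Longrightarrow> \<exists>f\<in>carrier FA. c = U_proj f"
  using env_proj_surj by (fastforce simp: restricted_env_def FactRing_def A_RCOSETS_def')

text \<open>The universal property of u(L,0), for its two quotients in succession: \<open>h\<close>
  kills the generators of the first ideal, and the map it induces on the enveloping algebra kills
  those of the second.\<close>

lemma U_lift:
  assumes B: "ring B" and h: "h \<in> ring_hom FA B" and z: "\<forall>r\<in>env_relations F L. h r = \<zero>\<^bsub>B\<^esub>"
    and pz: "\<forall>x\<in>carrier L. h (free_gen F x) [^]\<^bsub>B\<^esub> p = h (free_gen F (pmap L x))"
  shows "(\<lambda>C. the_elem ((\<lambda>D. the_elem (h ` D)) ` C)) \<in> ring_hom U B"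
    and "\<And>f. f \<in> carrier FA \<Longrightarrow> the_elem ((\<lambda>D. the_elem (h ` D)) ` (U_proj f)) = h f"
proof -
  interpret B: ring B by fact
  have kill: "\<forall>e\<in>env_ideal F L. h e = \<zero>\<^bsub>B\<^esub>"
    using ring.hom_kills_genideal[OF R.free_alg_ring B h env_relations_closed z] unfolding env_ideal_def by blast
  define h1 where "h1 = (\<lambda>D. the_elem (h ` D))"
  note l1 = ideal.quotient_lift[OF env_ideal B h kill, folded env_alg_def env_proj_def h1_def]
  have h1: "h1 \<in> ring_hom (env_alg F L) B" by (rule l1(2))
  interpret h1: ring_hom_ring "env_alg F L" B h1 by (rule ring_hom_ringI2[OF env_alg_ring B h1])
  have h1p: "h1 (env_proj F L f) = h f" if "f \<in> carrier FA" for f using l1(1)[OF that] by (simp add: env_proj_def h1_def)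
  have pc: "env_proj F L (free_gen F x) \<in> carrier (env_alg F L)" if "x \<in> carrier L" for x
    using ring_hom_closed[OF env_proj_hom gen_closed[OF that]] .
  have kill1: "\<forall>e\<in>restricted_env_ideal F L p. h1 e = \<zero>\<^bsub>B\<^esub>"
  proof (rule ballI, rule ring.hom_kills_genideal[OF env_alg_ring B h1 restricted_relations_closed ballI])
    show "e \<in> Idl\<^bsub>env_alg F L\<^esub> {(env_proj F L (free_gen F x) [^]\<^bsub>env_alg F L\<^esub> p)
        \<ominus>\<^bsub>env_alg F L\<^esub> env_proj F L (free_gen F (pmap L x)) | x. x \<in> carrier L}"
      if "e \<in> restricted_env_ideal F L p" for e
      using that unfolding restricted_env_ideal_def .
    fix s assume "s \<in> {(env_proj F L (free_gen F x) [^]\<^bsub>env_alg F L\<^esub> p)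
        \<ominus>\<^bsub>env_alg F L\<^esub> env_proj F L (free_gen F (pmap L x)) | x. x \<in> carrier L}"
    then obtain x where x: "x \<in> carrier L" "s = (env_proj F L (free_gen F x) [^]\<^bsub>env_alg F L\<^esub> p)
        \<ominus>\<^bsub>env_alg F L\<^esub> env_proj F L (free_gen F (pmap L x))" by blast
    have "h1 s = h1 (env_proj F L (free_gen F x)) [^]\<^bsub>B\<^esub> p \<ominus>\<^bsub>B\<^esub> h1 (env_proj F L (free_gen F (pmap L x)))"
      unfolding x(2) a_minus_def using x(1) pc pmap_closed by (simp add: h1.hom_nat_pow)
    also have "\<dots> = \<zero>\<^bsub>B\<^esub>"
      using h1p[OF gen_closed] x(1) pmap_closed bspec[OF pz x(1)] ring_hom_closed[OF h gen_closed] by (simp add: B.r_neg a_minus_def)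
    finally show "h1 s = \<zero>\<^bsub>B\<^esub>" .
  qed
  note l2 = ideal.quotient_lift[OF restricted_env_ideal B h1 kill1]
  show "(\<lambda>C. the_elem ((\<lambda>D. the_elem (h ` D)) ` C)) \<in> ring_hom U B"
    using l2(2) unfolding restricted_env_def h1_def .
  show "the_elem ((\<lambda>D. the_elem (h ` D)) ` (U_proj f)) = h f" if f: "f \<in> carrier FA" for f
    using l2(1)[OF ring_hom_closed[OF env_proj_hom f]] h1p[OF f] unfolding h1_def by simp
qed

text \<open>Centrality of the scalars is inherited from the free algebra, and the laws for sums,
  multiples and brackets are relations killed by \<open>h\<close>. It serves both u(L,0) and the
  quotient by a form ideal.\<close>

lemma envelope_of_hom:
  assumes B: "ring B" and h: "h \<in> ring_hom FA B" and z: "\<forall>r\<in>env_relations F L. h r = \<zero>\<^bsub>B\<^esub>"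
  shows "lie_envelope F L p B (\<lambda>a. h (free_const F a)) (\<lambda>x. h (free_gen F x))"
proof -
  interpret B: ring B by fact
  interpret A: ring FA by (rule R.free_alg_ring)
  interpret h: ring_hom_ring FA B h by (rule ring_hom_ringI2[OF R.free_alg_ring B h])
  note gc = gen_closed const_closed bracket_closed
  have eq: "h f = h g" if "f \<in> carrier FA" "g \<in> carrier FA" "f \<ominus>\<^bsub>FA\<^esub> g \<in> env_relations F L" for f g
  proof -
    have "h f \<ominus>\<^bsub>B\<^esub> h g = \<zero>\<^bsub>B\<^esub>" using bspec[OF z that(3)] that(1,2) by (simp add: a_minus_def)
    then show ?thesis using that(1,2) by simp
  qed
  show ?thesis
  proof (unfold_locales)
    show "(\<lambda>a. h (free_const F a)) \<in> ring_hom F B"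
      using ring_hom_trans[OF free_algebra.const_hom[OF free_algebra] h] by (simp add: comp_def)
    show "h (free_gen F x) \<in> carrier B" if "x \<in> carrier L" for x using that gc by simp
    show "h (free_gen F (x \<oplus>\<^bsub>L\<^esub> y)) = h (free_gen F x) \<oplus>\<^bsub>B\<^esub> h (free_gen F y)" if "x \<in> carrier L" "y \<in> carrier L" for x y
      using eq[OF _ _ env_relations_intros(1)[OF that]] that gc by simp
    show "h (free_gen F (a \<odot>\<^bsub>L\<^esub> x)) = h (free_const F a) \<otimes>\<^bsub>B\<^esub> h (free_gen F x)" if "a \<in> carrier F" "x \<in> carrier L" for a x
      using eq[OF _ _ env_relations_intros(2)[OF that]] that gc by simp
    show "h (free_const F a) \<otimes>\<^bsub>B\<^esub> h (free_gen F x) = h (free_gen F x) \<otimes>\<^bsub>B\<^esub> h (free_const F a)"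
      if "a \<in> carrier F" "x \<in> carrier L" for a x
    proof -
      have "free_const F a \<otimes>\<^bsub>FA\<^esub> free_gen F x = free_gen F x \<otimes>\<^bsub>FA\<^esub> free_const F a"
        by (simp only: free_algebra.const_mult[OF free_algebra that(1) gen_closed[OF that(2)]]
          free_algebra.mult_const[OF free_algebra that(1) gen_closed[OF that(2)]])
      from arg_cong[OF this, of h] show ?thesis using that gc by simp
    qed
    show "h (free_gen F (bracket L x y)) = h (free_gen F x) \<otimes>\<^bsub>B\<^esub> h (free_gen F y) \<ominus>\<^bsub>B\<^esub> h (free_gen F y) \<otimes>\<^bsub>B\<^esub> h (free_gen F x)"
      if "x \<in> carrier L" "y \<in> carrier L" for x y
      using eq[OF _ _ env_relations_intros(3)[OF that]] that gc by (simp add: a_minus_def)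
  qed
qed

lemma U_proj_zero: "\<forall>r\<in>env_relations F L. U_proj r = \<zero>\<^bsub>U\<^esub>"
proof
  fix r assume r: "r \<in> env_relations F L"
  interpret E: ring "env_alg F L" by (rule env_alg_ring)
  have rE: "r \<in> env_ideal F L"
    unfolding env_ideal_def using ring.genideal_self[OF R.free_alg_ring env_relations_closed] r by blast
  have "env_proj F L r = \<zero>\<^bsub>env_alg F L\<^esub>"
    unfolding env_proj_def env_alg_def by (rule ideal.coset_zeroI[OF env_ideal rE])
  moreover have "restricted_env_ideal F L p +>\<^bsub>env_alg F L\<^esub> \<zero>\<^bsub>env_alg F L\<^esub> = \<zero>\<^bsub>U\<^esub>"
    using ring_hom_zero[OF ideal.rcos_ring_hom[OF restricted_env_ideal] env_alg_ring] U_ring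
    unfolding restricted_env_def by simp
  ultimately show "U_proj r = \<zero>\<^bsub>U\<^esub>" by simp
qed

theorem U_envelope: "lie_envelope F L p U (restricted_env_scalar F L p) (\<lambda>x. U_gen x)"
proof -
  have "restricted_env_scalar F L p = (\<lambda>a. U_proj (free_const F a))" by (simp add: restricted_env_scalar_def fun_eq_iff)
  then show ?thesis using envelope_of_hom[OF U_ring U_proj_hom U_proj_zero] by simp
qed

theorem U_pmap:
  assumes x: "x \<in> carrier L" shows "U_gen x [^]\<^bsub>U\<^esub> p = U_gen (pmap L x)"
proof -
  interpret E: ring "env_alg F L" by (rule env_alg_ring)
  interpret U: ring U by (rule U_ring)
  define t where "t = (\<lambda>C. restricted_env_ideal F L p +>\<^bsub>env_alg F L\<^esub> C)"
  have t: "t \<in> ring_hom (env_alg F L) U"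
    unfolding t_def restricted_env_def using ideal.rcos_ring_hom[OF restricted_env_ideal] .
  interpret t: ring_hom_ring "env_alg F L" U t by (rule ring_hom_ringI2[OF env_alg_ring U_ring t])
  have pc: "env_proj F L (free_gen F x) \<in> carrier (env_alg F L)" if "x \<in> carrier L" for x
    using ring_hom_closed[OF env_proj_hom gen_closed[OF that]] .
  let ?r = "(env_proj F L (free_gen F x) [^]\<^bsub>env_alg F L\<^esub> p) \<ominus>\<^bsub>env_alg F L\<^esub> env_proj F L (free_gen F (pmap L x))"
  have "?r \<in> restricted_env_ideal F L p"
    unfolding restricted_env_ideal_def using ring.genideal_self[OF env_alg_ring restricted_relations_closed] x by blast
  then have "t ?r = \<zero>\<^bsub>U\<^esub>"
    unfolding t_def restricted_env_def by (rule ideal.coset_zeroI[OF restricted_env_ideal])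
  then have "t (env_proj F L (free_gen F x)) [^]\<^bsub>U\<^esub> p \<ominus>\<^bsub>U\<^esub> t (env_proj F L (free_gen F (pmap L x))) = \<zero>\<^bsub>U\<^esub>"
    using x pc pmap_closed unfolding a_minus_def by (simp add: t.hom_nat_pow)
  then show ?thesis using x pc pmap_closed unfolding t_def[symmetric] by simp
qed

lemma U_proj_mon:
  assumes "set xs \<subseteq> carrier L"
  shows "U_proj (R.free_mon xs) = lie_envelope.iprod U (\<lambda>x. U_gen x) xs"
  using assms
proof (induction xs)
  interpret E: lie_envelope F L p U "restricted_env_scalar F L p" "\<lambda>x. U_gen x" by (rule U_envelope)
  case Nil
  show ?case using ring_hom_one[OF U_proj_hom] free_algebra.one_eq[OF free_algebra] by simp
next
  interpret E: lie_envelope F L p U "restricted_env_scalar F L p" "\<lambda>x. U_gen x" by (rule U_envelope)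
  case (Cons x xs)
  then show ?case
    using free_algebra.free_mon_Cons[OF free_algebra, of xs x] free_algebra.free_mon_closed[OF free_algebra, of xs]
      ring_hom_mult[OF U_proj_hom gen_closed[of x], of "R.free_mon xs"] by simp
qed

theorem U_induct [consumes 1, case_names zero add monomial]:
  assumes c: "c \<in> carrier U" and z: "P \<zero>\<^bsub>U\<^esub>"
    and add: "\<And>a b. a \<in> carrier U \<Longrightarrow> b \<in> carrier U \<Longrightarrow> P a \<Longrightarrow> P b \<Longrightarrow> P (a \<oplus>\<^bsub>U\<^esub> b)"
    and mon: "\<And>a xs. a \<in> carrier F \<Longrightarrow> set xs \<subseteq> carrier L \<Longrightarrow>
      P (restricted_env_scalar F L p a \<otimes>\<^bsub>U\<^esub> lie_envelope.iprod U (\<lambda>x. U_gen x) xs)"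
  shows "P c"
proof -
  obtain f where f: "f \<in> carrier FA" "c = U_proj f" using U_proj_surj[OF c] by blast
  interpret A: free_algebra F "carrier L" FA by (rule free_algebra)
  from f(1) have "P (U_proj f)"
  proof (induction f rule: A.free_induct)
    case zero
    show ?case using ring_hom_zero[OF U_proj_hom R.free_alg_ring U_ring] z by simp
  next
    case (add f g)
    then show ?case using ring_hom_add[OF U_proj_hom add.hyps(1,2)] ring_hom_closed[OF U_proj_hom] assms(3) by simp
  next
    case 3: (monomial a u)
    then show ?case
      using mon[OF 3] U_proj_mon[OF 3(2)] ring_hom_mult[OF U_proj_hom const_closed[OF 3(1)], of "R.free_mon u"]
        free_algebra.free_mon_closed[OF free_algebra 3(2)]
      by (simp add: restricted_env_scalar_def)
  qed
  then show ?thesis using f(2) by simp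
qed

text \<open>The constant coefficient is multiplicative and vanishes on the generators, so it factors
  through both quotients.\<close>

theorem U_augmentation:
  shows "restricted_env_augmentation \<in> ring_hom U F"
    and "a \<in> carrier F \<Longrightarrow> restricted_env_augmentation (restricted_env_scalar F L p a) = a"
    and "x \<in> carrier L \<Longrightarrow> restricted_env_augmentation (U_gen x) = \<zero>\<^bsub>F\<^esub>"
proof -
  interpret A: free_algebra F "carrier L" FA by (rule free_algebra)
  define h where "h = (\<lambda>f :: 'b list \<Rightarrow> 'a. f [])"
  have h: "h \<in> ring_hom FA F"
    by (rule ring_hom_memI)
      (auto simp: h_def A.app_closed A.add_eq A.mult_eq A.one_eq R.free_mon_def)
  interpret h: ring_hom_ring FA F h by (rule ring_hom_ringI2[OF R.free_alg_ring R.ring_axioms h])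
  have hg: "h (free_gen F x) = \<zero>\<^bsub>F\<^esub>" for x by (simp add: h_def free_gen_def)
  have p: "0 < p" using prime_p prime_gt_0_nat by blast
  have z: "\<forall>r\<in>env_relations F L. h r = \<zero>\<^bsub>F\<^esub>"
  proof
    fix r assume "r \<in> env_relations F L"
    then show "h r = \<zero>\<^bsub>F\<^esub>"
    by (cases rule: env_relations_cases) (simp_all add: a_minus_def gen_closed const_closed bracket_closed hg)
  qed
  have pz: "\<forall>x\<in>carrier L. h (free_gen F x) [^]\<^bsub>F\<^esub> p = h (free_gen F (pmap L x))"
    using p by (simp add: hg R.nat_pow_zero)
  have e: "restricted_env_augmentation = (\<lambda>C. the_elem ((\<lambda>D. the_elem (h ` D)) ` C))"
    unfolding restricted_env_augmentation_def env_augmentation_def h_def by blast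
  note l = U_lift[OF R.ring_axioms h z pz]
  show "restricted_env_augmentation \<in> ring_hom U F" unfolding e by (rule l(1))
  show "a \<in> carrier F \<Longrightarrow> restricted_env_augmentation (restricted_env_scalar F L p a) = a"
    unfolding restricted_env_scalar_def e by (subst l(2)[OF const_closed]) (simp_all add: h_def free_const_def)
  show "x \<in> carrier L \<Longrightarrow> restricted_env_augmentation (U_gen x) = \<zero>\<^bsub>F\<^esub>"
    unfolding e by (subst l(2)[OF gen_closed]) (simp_all add: hg)
qed

end

section \<open>Functionals on u(L,0)\<close>

context lie_basis
begin

text \<open>\<open>f\<close> extends to a functional on the free algebra, and \<open>K\<close> is
  the largest ideal in its kernel. The ideals defining u(L,0) are not followed element by element;
  instead the quotient by \<open>K\<close> is shown to satisfy their relations. By the universal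
  property u(L,0) maps to it, so representatives of one element of u(L,0) have equal values.\<close>

theorem U_functional:
  assumes f: "range f \<subseteq> carrier F" and lf: "\<And>d. lie_functional d f"
    and pow: "\<And>us i ws. set us \<subseteq> carrier L \<Longrightarrow> set ws \<subseteq> carrier L \<Longrightarrow> i < n \<Longrightarrow>
       ml (us @ replicate p (b i) @ ws) f = ml (us @ pmap L (b i) # ws) f"
  obtains \<Psi> where "\<And>c d. c \<in> carrier U \<Longrightarrow> d \<in> carrier U \<Longrightarrow> \<Psi> (c \<oplus>\<^bsub>U\<^esub> d) = \<Psi> c \<oplus> \<Psi> d"
    "\<And>c. c \<in> carrier U \<Longrightarrow> \<Psi> c \<in> carrier F"
    "\<And>a xs. a \<in> carrier F \<Longrightarrow> set xs \<subseteq> carrier L \<Longrightarrow>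
       \<Psi> (restricted_env_scalar F L p a \<otimes>\<^bsub>U\<^esub> lie_envelope.iprod U (\<lambda>x. U_gen x) xs) = a \<otimes> ml xs f"
proof -
  interpret A: free_algebra F "carrier L" FA by (rule free_algebra)
  define \<phi> where "\<phi> = (\<lambda>w. ml w f)"
  have \<phi>: "\<phi> w \<in> carrier F" if "set w \<subseteq> carrier L" for w unfolding \<phi>_def by (rule ml_closed[OF f that])
  define K where "K = A.form_ideal \<phi>"
  interpret K: ideal K FA unfolding K_def by (rule A.form_ideal[OF \<phi>])
  have form_minus: "A.free_form \<psi> (g \<ominus>\<^bsub>FA\<^esub> h) = A.free_form \<psi> g \<ominus> A.free_form \<psi> h"
    if \<psi>: "\<And>w. set w \<subseteq> carrier L \<Longrightarrow> \<psi> w \<in> carrier F" and g: "g \<in> carrier FA" and h: "h \<in> carrier FA" for \<psi> g h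
  proof -
    have c: "A.free_form \<psi> (g \<ominus>\<^bsub>FA\<^esub> h) \<in> carrier F" "A.free_form \<psi> h \<in> carrier F" "A.free_form \<psi> g \<in> carrier F"
      using A.free_form_closed[OF \<psi>] g h by auto
    have "A.free_form \<psi> g = A.free_form \<psi> ((g \<ominus>\<^bsub>FA\<^esub> h) \<oplus>\<^bsub>FA\<^esub> h)"
      using g h by (simp add: a_minus_def A.A.a_assoc A.A.l_neg)
    also have "\<dots> = A.free_form \<psi> (g \<ominus>\<^bsub>FA\<^esub> h) \<oplus> A.free_form \<psi> h" using g h by (intro A.free_form_add[OF \<psi>]) simp_all
    finally show ?thesis using c by (simp add: a_minus_def R.a_assoc R.r_neg)
  qed
  have KI: "g \<ominus>\<^bsub>FA\<^esub> h \<in> K" if g: "g \<in> carrier FA" and h: "h \<in> carrier FA"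
    and eq: "\<And>u v. set u \<subseteq> carrier L \<Longrightarrow> set v \<subseteq> carrier L \<Longrightarrow>
       A.free_form (\<lambda>w. \<phi> (u @ w @ v)) g = A.free_form (\<lambda>w. \<phi> (u @ w @ v)) h" for g h
  proof -
    have "A.free_form (\<lambda>w. \<phi> (u @ w @ v)) (g \<ominus>\<^bsub>FA\<^esub> h) = \<zero>" if uv: "set u \<subseteq> carrier L" "set v \<subseteq> carrier L" for u v
    proof -
      have \<psi>: "\<And>w. set w \<subseteq> carrier L \<Longrightarrow> \<phi> (u @ w @ v) \<in> carrier F" using \<phi> uv by simp
      show ?thesis using form_minus[OF \<psi> g h] eq[OF uv] A.free_form_closed[OF \<psi> h] by (simp add: R.r_neg a_minus_def)
    qed
    moreover have "g \<ominus>\<^bsub>FA\<^esub> h \<in> carrier FA" using g h by simp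
    ultimately show ?thesis unfolding K_def A.form_ideal_def by blast
  qed
  have mon: "R.free_mon u \<in> carrier FA" if "set u \<subseteq> carrier L" for u using A.free_mon_closed[OF that] .
  have fm: "A.free_form (\<lambda>w. \<phi> (u @ w @ v)) (R.free_mon s) = \<phi> (u @ s @ v)"
    if "set u \<subseteq> carrier L" "set v \<subseteq> carrier L" "set s \<subseteq> carrier L" for u v s
    by (rule A.free_form_mon) (use \<phi> that in simp_all)
  have lin: "linear_form (\<lambda>x. \<phi> (u @ [x] @ v))" if "set u \<subseteq> carrier L" "set v \<subseteq> carrier L" for u v
    using linear_form_ml[OF f that] by (simp add: \<phi>_def)
  have rel: "r \<in> K" if "r \<in> env_relations F L" for r
    using that
  proof (cases rule: env_relations_cases)
    case (add x y)
    show ?thesis unfolding add(3)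
    proof (rule KI)
      fix u v assume uv: "set u \<subseteq> carrier L" "set v \<subseteq> carrier L"
      have \<psi>: "\<And>w. set w \<subseteq> carrier L \<Longrightarrow> \<phi> (u @ w @ v) \<in> carrier F" using \<phi> uv by simp
      show "A.free_form (\<lambda>w. \<phi> (u @ w @ v)) (free_gen F (x \<oplus>\<^bsub>L\<^esub> y))
        = A.free_form (\<lambda>w. \<phi> (u @ w @ v)) (free_gen F x \<oplus>\<^bsub>FA\<^esub> free_gen F y)"
        using lin[OF uv] add(1,2) fm[OF uv] A.free_form_add[OF \<psi> mon[of "[x]"] mon[of "[y]"]]
        by (simp add: A.free_gen_eq linear_form_def)
    qed (use add gen_closed in simp_all)
  next
    case (smult a x)
    show ?thesis unfolding smult(3)
    proof (rule KI)
      fix u v assume uv: "set u \<subseteq> carrier L" "set v \<subseteq> carrier L"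
      have \<psi>: "\<And>w. set w \<subseteq> carrier L \<Longrightarrow> \<phi> (u @ w @ v) \<in> carrier F" using \<phi> uv by simp
      show "A.free_form (\<lambda>w. \<phi> (u @ w @ v)) (free_gen F (a \<odot>\<^bsub>L\<^esub> x))
        = A.free_form (\<lambda>w. \<phi> (u @ w @ v)) (free_const F a \<otimes>\<^bsub>FA\<^esub> free_gen F x)"
        using lin[OF uv] smult(1,2) fm[OF uv] A.free_form_monomial[OF \<psi> smult(1), where u = "[x]"]
        by (simp add: A.free_gen_eq linear_form_def)
    qed (use smult gen_closed const_closed in simp_all)
  next
    case (bracket x y)
    have m: "R.free_mon [x] \<otimes>\<^bsub>FA\<^esub> R.free_mon [y] = R.free_mon [x, y]" if "x \<in> carrier L" "y \<in> carrier L" for x y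
      using A.free_mon_Cons[of "[y]" x] that by (simp add: A.free_gen_eq)
    show ?thesis unfolding bracket(3)
    proof (rule KI)
      fix u v assume uv: "set u \<subseteq> carrier L" "set v \<subseteq> carrier L"
      have \<psi>: "\<And>w. set w \<subseteq> carrier L \<Longrightarrow> \<phi> (u @ w @ v) \<in> carrier F" using \<phi> uv by simp
      have "\<phi> (u @ x # y # v) = \<phi> (u @ y # x # v) \<oplus> \<phi> (u @ bracket L x y # v)"
        unfolding \<phi>_def by (rule lie_functionalD[OF lf uv(1) bracket(1,2) uv(2) order_refl])
      moreover have "\<phi> (u @ y # x # v) \<in> carrier F" "\<phi> (u @ bracket L x y # v) \<in> carrier F"
        using \<phi> uv bracket(1,2) bracket_closed by simp_all
      ultimately have "\<phi> (u @ x # y # v) \<ominus> \<phi> (u @ y # x # v) = \<phi> (u @ bracket L x y # v)"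
        by (simp add: a_minus_def R.a_comm[of "\<phi> (u @ y # x # v)"] R.a_assoc R.r_neg)
      moreover have "A.free_form (\<lambda>w. \<phi> (u @ w @ v)) (R.free_mon [x, y] \<ominus>\<^bsub>FA\<^esub> R.free_mon [y, x])
        = \<phi> (u @ x # y # v) \<ominus> \<phi> (u @ y # x # v)"
        using form_minus[OF \<psi> mon[of "[x, y]"] mon[of "[y, x]"]] fm[OF uv] bracket(1,2) by simp
      ultimately show "A.free_form (\<lambda>w. \<phi> (u @ w @ v)) (free_gen F x \<otimes>\<^bsub>FA\<^esub> free_gen F y \<ominus>\<^bsub>FA\<^esub> free_gen F y \<otimes>\<^bsub>FA\<^esub> free_gen F x)
        = A.free_form (\<lambda>w. \<phi> (u @ w @ v)) (free_gen F (bracket L x y))"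
        using fm[OF uv, of "[bracket L x y]"] bracket(1,2) bracket_closed by (simp add: m A.free_gen_eq)
    qed (use bracket gen_closed bracket_closed in simp_all)
  qed
  let ?B = "FA Quot K"
  have Bring: "ring ?B" by (rule K.quotient_is_ring)
  interpret B: ring ?B by (rule Bring)
  note h = K.rcos_ring_hom
  interpret h: ring_hom_ring FA ?B "(+>\<^bsub>FA\<^esub>) K" by (rule ring_hom_ringI2[OF R.free_alg_ring Bring h])
  have hK: "K +>\<^bsub>FA\<^esub> r = \<zero>\<^bsub>?B\<^esub>" if "r \<in> K" for r
    using that by (rule K.coset_zeroI)
  interpret E: lie_envelope F L p ?B "\<lambda>a. K +>\<^bsub>FA\<^esub> free_const F a" "\<lambda>x. K +>\<^bsub>FA\<^esub> free_gen F x"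
    by (rule envelope_of_hom[OF Bring h]) (intro ballI hK rel)
  have powb: "(K +>\<^bsub>FA\<^esub> free_gen F (b i)) [^]\<^bsub>?B\<^esub> p = K +>\<^bsub>FA\<^esub> free_gen F (pmap L (b i))" if i: "i < n" for i
  proof -
    have B: "b i \<in> carrier L" "pmap L (b i) \<in> carrier L" using i b_closed pmap_closed by auto
    have g: "free_gen F (b i) [^]\<^bsub>FA\<^esub> m = R.free_mon (replicate m (b i))" for m :: nat
    proof (induction m)
      case (Suc m)
      have "free_gen F (b i) [^]\<^bsub>FA\<^esub> Suc m = free_gen F (b i) \<otimes>\<^bsub>FA\<^esub> free_gen F (b i) [^]\<^bsub>FA\<^esub> m"
        using A.A.nat_pow_Suc2 gen_closed B by blast
      then show ?case using Suc A.free_mon_Cons[of "replicate m (b i)" "b i"] B by (simp add: set_replicate_conv_if)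
    qed (simp add: A.one_eq)
    have "free_gen F (b i) [^]\<^bsub>FA\<^esub> p \<ominus>\<^bsub>FA\<^esub> free_gen F (pmap L (b i)) \<in> K"
    proof (rule KI)
      fix u v assume uv: "set u \<subseteq> carrier L" "set v \<subseteq> carrier L"
      have \<psi>: "\<And>w. set w \<subseteq> carrier L \<Longrightarrow> \<phi> (u @ w @ v) \<in> carrier F" using \<phi> uv by simp
      show "A.free_form (\<lambda>w. \<phi> (u @ w @ v)) (free_gen F (b i) [^]\<^bsub>FA\<^esub> p) = A.free_form (\<lambda>w. \<phi> (u @ w @ v)) (free_gen F (pmap L (b i)))"
        using pow[OF uv i] B fm[OF uv, of "replicate p (b i)"] fm[OF uv, of "[pmap L (b i)]"] unfolding g
        by (simp add: A.free_gen_eq set_replicate_conv_if \<phi>_def)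
    qed (use B gen_closed in simp_all)
    from hK[OF this] have "(K +>\<^bsub>FA\<^esub> free_gen F (b i)) [^]\<^bsub>?B\<^esub> p \<ominus>\<^bsub>?B\<^esub> (K +>\<^bsub>FA\<^esub> free_gen F (pmap L (b i))) = \<zero>\<^bsub>?B\<^esub>"
      using gen_closed[OF B(1)] gen_closed[OF B(2)] unfolding a_minus_def by (simp add: h.hom_nat_pow)
    then show ?thesis using gen_closed[OF B(1)] gen_closed[OF B(2)] by simp
  qed
  \<comment> \<open>u(L,0) imposes x^p = x^[p] for all x, while \<open>pow\<close> gives it on the
    basis. The quotient is a \<open>lie_envelope\<close>, so Jacobson's formula propagates the
    relation through sums and multiples.\<close>
  have powx: "(K +>\<^bsub>FA\<^esub> free_gen F x) [^]\<^bsub>?B\<^esub> p = K +>\<^bsub>FA\<^esub> free_gen F (pmap L x)" if x: "x \<in> carrier L" for x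
  proof -
    let ?P = "\<lambda>x. (K +>\<^bsub>FA\<^esub> free_gen F x) [^]\<^bsub>?B\<^esub> p = K +>\<^bsub>FA\<^esub> free_gen F (pmap L x)"
    have c: "coord k x \<odot>\<^bsub>L\<^esub> b k \<in> carrier L" if "k < n" for k using that x b_closed coord_closed by simp
    have "finite S \<Longrightarrow> S \<noteq> {} \<Longrightarrow> S \<subseteq> {..<n} \<Longrightarrow> ?P (\<Oplus>\<^bsub>L\<^esub>k\<in>S. coord k x \<odot>\<^bsub>L\<^esub> b k)" for S
    proof (induction S rule: finite_ne_induct)
      case (singleton k)
      then show ?case using E.iota_pmap_smult[OF coord_closed[OF x] b_closed powb] c[of k] by simp
    next
      case (insert k S)
      have cS: "(\<Oplus>\<^bsub>L\<^esub>k\<in>S. coord k x \<odot>\<^bsub>L\<^esub> b k) \<in> carrier L"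
        by (rule M.finsum_closed) (use insert.prems c in auto)
      have "(\<Oplus>\<^bsub>L\<^esub>k\<in>insert k S. coord k x \<odot>\<^bsub>L\<^esub> b k) = coord k x \<odot>\<^bsub>L\<^esub> b k \<oplus>\<^bsub>L\<^esub> (\<Oplus>\<^bsub>L\<^esub>k\<in>S. coord k x \<odot>\<^bsub>L\<^esub> b k)"
        by (rule M.finsum_insert) (use insert c in auto)
      then show ?case
        using E.iota_pmap_add[OF c cS E.iota_pmap_smult[OF coord_closed[OF x] b_closed powb]] insert by simp
    qed
    from this[of "{..<n}"] show ?thesis
    proof (cases "n = 0")
      \<comment> \<open>The induction runs over nonempty index sets; for \<open>n = 0\<close> every
        element of \<open>L\<close> is zero and 0^p = 0.\<close>
      case True
      have "x = \<zero>\<^bsub>L\<^esub>" "pmap L x = \<zero>\<^bsub>L\<^esub>" using coord_expand[OF x] coord_expand[OF pmap_closed[OF x]] True by auto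
      then show ?thesis using E.iota_zero two_le_p by (simp add: B.nat_pow_zero)
    qed (use coord_expand[OF x] in auto)
  qed
  have "\<forall>r\<in>env_relations F L. K +>\<^bsub>FA\<^esub> r = \<zero>\<^bsub>?B\<^esub>"
    "\<forall>x\<in>carrier L. (K +>\<^bsub>FA\<^esub> free_gen F x) [^]\<^bsub>?B\<^esub> p = K +>\<^bsub>FA\<^esub> free_gen F (pmap L x)"
    by (intro ballI hK rel, assumption) (intro ballI powx)
  note lift = U_lift[OF Bring h this]
  have wd: "A.free_form \<phi> g = A.free_form \<phi> g'" if g: "g \<in> carrier FA" "g' \<in> carrier FA" and e: "U_proj g = U_proj g'" for g g'
  proof -
    have "K +>\<^bsub>FA\<^esub> g = K +>\<^bsub>FA\<^esub> g'"
      by (rule trans[OF sym[OF lift(2)[OF g(1), unfolded e]] lift(2)[OF g(2)]])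
    moreover have "K +>\<^bsub>FA\<^esub> (g \<ominus>\<^bsub>FA\<^esub> g') = (K +>\<^bsub>FA\<^esub> g) \<ominus>\<^bsub>?B\<^esub> (K +>\<^bsub>FA\<^esub> g')"
      using g by (simp add: a_minus_def)
    moreover have "K +>\<^bsub>FA\<^esub> g' \<in> carrier ?B" using g by simp
    ultimately have "K +>\<^bsub>FA\<^esub> (g \<ominus>\<^bsub>FA\<^esub> g') = \<zero>\<^bsub>?B\<^esub>" by (simp add: a_minus_def B.r_neg)
    moreover have "g \<ominus>\<^bsub>FA\<^esub> g' \<in> carrier FA" using g by simp
    ultimately have "g \<ominus>\<^bsub>FA\<^esub> g' \<in> A.form_ideal \<phi>" unfolding K_def[symmetric] by (intro K.coset_zeroD)
    from A.form_idealD[OF this, of "[]" "[]"] have z: "A.free_form \<phi> (g \<ominus>\<^bsub>FA\<^esub> g') = \<zero>" by simp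
    have c: "A.free_form \<phi> g \<in> carrier F" "A.free_form \<phi> g' \<in> carrier F"
      by (rule A.free_form_closed[OF \<phi> g(1)], assumption, rule A.free_form_closed[OF \<phi> g(2)], assumption)
    have "A.free_form \<phi> g \<ominus> A.free_form \<phi> g' = \<zero>" using form_minus[OF \<phi> g] z by simp
    then show ?thesis using c by simp
  qed
  \<comment> \<open>A representative is chosen arbitrarily; \<open>wd\<close> shows that the value
    does not depend on it.\<close>
  define \<Psi> where "\<Psi> c = A.free_form \<phi> (SOME g. g \<in> carrier FA \<and> c = U_proj g)" for c
  have \<Psi>: "\<Psi> (U_proj g) = A.free_form \<phi> g" if g: "g \<in> carrier FA" for g
  proof -
    define g' where "g' = (SOME g'. g' \<in> carrier FA \<and> U_proj g = U_proj g')"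
    have "g' \<in> carrier FA \<and> U_proj g = U_proj g'"
      unfolding g'_def by (rule someI[of _ g]) (intro conjI g refl)
    then show ?thesis unfolding \<Psi>_def g'_def[symmetric] using wd[of g' g] g by simp
  qed
  show thesis
  proof (rule that)
    fix c d assume cd: "c \<in> carrier U" "d \<in> carrier U"
    obtain g where g1: "g \<in> carrier FA" "c = U_proj g" using U_proj_surj[OF cd(1)] by blast
    obtain g' where g2: "g' \<in> carrier FA" "d = U_proj g'" using U_proj_surj[OF cd(2)] by blast
    note g = g1 g2
    show "\<Psi> (c \<oplus>\<^bsub>U\<^esub> d) = \<Psi> c \<oplus> \<Psi> d"
      using ring_hom_add[OF U_proj_hom g(1,3)] \<Psi>[OF g(1)] \<Psi>[OF g(3)] \<Psi>[OF A.A.a_closed[OF g(1,3)]]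
        A.free_form_add[OF \<phi> g(1,3)] g(2,4) by simp
  next
    show "\<Psi> c \<in> carrier F" if "c \<in> carrier U" for c using U_proj_surj[OF that] \<Psi> A.free_form_closed[OF \<phi>] by auto
  next
    fix a xs assume *: "a \<in> carrier F" "set xs \<subseteq> carrier L"
    have "restricted_env_scalar F L p a \<otimes>\<^bsub>U\<^esub> lie_envelope.iprod U (\<lambda>x. U_gen x) xs
      = U_proj (free_const F a \<otimes>\<^bsub>FA\<^esub> R.free_mon xs)"
      using ring_hom_mult[OF U_proj_hom const_closed[OF *(1)] mon[OF *(2)]] U_proj_mon[OF *(2)]
      by (simp add: restricted_env_scalar_def)
    then show "\<Psi> (restricted_env_scalar F L p a \<otimes>\<^bsub>U\<^esub> lie_envelope.iprod U (\<lambda>x. U_gen x) xs) = a \<otimes> ml xs f"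
      using \<Psi>[of "free_const F a \<otimes>\<^bsub>FA\<^esub> R.free_mon xs"] const_closed[OF *(1)] mon[OF *(2)]
        A.free_form_monomial[OF \<phi> *] by (simp add: \<phi>_def)
  qed
qed

end

section \<open>Chains of ideals and maximal tori\<close>

context vectorspace
begin

lemma subspaceI:
  assumes "W \<subseteq> carrier V" "\<zero>\<^bsub>V\<^esub> \<in> W" "\<And>x y. x \<in> W \<Longrightarrow> y \<in> W \<Longrightarrow> x \<oplus>\<^bsub>V\<^esub> y \<in> W"
    "\<And>a x. a \<in> carrier K \<Longrightarrow> x \<in> W \<Longrightarrow> a \<odot>\<^bsub>V\<^esub> x \<in> W"
  shows "subspace K W V"
  using assms module_axioms vectorspace_axioms by (simp add: subspace_def LinearCombinations.submodule_def)

lemma subspaceD: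
  assumes "subspace K W V"
  shows "W \<subseteq> carrier V" "\<zero>\<^bsub>V\<^esub> \<in> W" "\<And>x y. x \<in> W \<Longrightarrow> y \<in> W \<Longrightarrow> x \<oplus>\<^bsub>V\<^esub> y \<in> W"
    "\<And>a x. a \<in> carrier K \<Longrightarrow> x \<in> W \<Longrightarrow> a \<odot>\<^bsub>V\<^esub> x \<in> W" "\<And>x. x \<in> W \<Longrightarrow> \<ominus>\<^bsub>V\<^esub> x \<in> W"
proof -
  show *: "W \<subseteq> carrier V" "\<zero>\<^bsub>V\<^esub> \<in> W" "\<And>x y. x \<in> W \<Longrightarrow> y \<in> W \<Longrightarrow> x \<oplus>\<^bsub>V\<^esub> y \<in> W"
    "\<And>a x. a \<in> carrier K \<Longrightarrow> x \<in> W \<Longrightarrow> a \<odot>\<^bsub>V\<^esub> x \<in> W"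
    using assms by (simp_all add: subspace_def LinearCombinations.submodule_def)
  show "\<ominus>\<^bsub>V\<^esub> x \<in> W" if "x \<in> W" for x
    using *(4)[of "\<ominus>\<^bsub>K\<^esub> \<one>\<^bsub>K\<^esub>" x] *(1) that smult_minus_1[of x] by auto
qed

lemma subspace_finsum:
  assumes W: "subspace K W V" and "finite A" "\<And>i. i \<in> A \<Longrightarrow> f i \<in> W"
  shows "(\<Oplus>\<^bsub>V\<^esub>i\<in>A. f i) \<in> W"
  using assms(2,3)
proof (induction A rule: finite_induct)
  case empty
  then show ?case using subspaceD[OF W] by simp
next
  case (insert a A)
  have "(\<Oplus>\<^bsub>V\<^esub>i\<in>insert a A. f i) = f a \<oplus>\<^bsub>V\<^esub> (\<Oplus>\<^bsub>V\<^esub>i\<in>A. f i)"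
    by (rule M.finsum_insert) (use insert subspaceD(1)[OF W] in auto)
  then show ?case using insert subspaceD(3)[OF W] by simp
qed

lemma span_subset: "subspace K W V \<Longrightarrow> A \<subseteq> W \<Longrightarrow> span A \<subseteq> W"
  by (rule span_is_subset) simp_all

lemma span_superset: "A \<subseteq> carrier V \<Longrightarrow> A \<subseteq> span A"
  by (rule in_own_span)

lemma span_mono: "A \<subseteq> B \<Longrightarrow> span A \<subseteq> span B"
  by (rule span_is_monotone)

lemma trivial_subspace: "subspace K {\<zero>\<^bsub>V\<^esub>} V"
  by (rule subspaceI) auto

lemma whole_subspace: "subspace K (carrier V) V"
  by (rule subspaceI) auto

abbreviation sdim :: "'c set \<Rightarrow> nat" where
  "sdim W \<equiv> vectorspace.dim K (V\<lparr>carrier := W\<rparr>)"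

lemma li_card_le:
  assumes "finite A" "lin_indpt A" "finite B" "B \<subseteq> carrier V" "A \<subseteq> span B"
  shows "card A \<le> card B"
  using replacement[OF assms(1,3,4,2,5)] by fastforce

lemma subspace_basis_extend:
  assumes fd: fin_dim and W: "subspace K W V" and A: "A \<subseteq> W" "lin_indpt A"
  obtains B where "finite B" "A \<subseteq> B" "B \<subseteq> W" "lin_indpt B" "span B = W" "card B = sdim W"
proof -
  note Wc = subspaceD(1)[OF W]
  let ?P = "\<lambda>S. A \<subseteq> S \<and> S \<subseteq> W \<and> lin_indpt S"
  have "\<And>S. ?P S \<Longrightarrow> finite S \<and> card S \<le> dim" using li_le_dim[OF fd] Wc by blast
  then obtain B where B: "finite B" "maximal B ?P"
    using maximal_exists[of ?P dim A] A by blast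
  then have B': "A \<subseteq> B" "B \<subseteq> W" "lin_indpt B" by (auto simp: maximal_def)
  have "W \<subseteq> span B"
  proof
    fix w assume w: "w \<in> W"
    show "w \<in> span B"
    proof (rule ccontr)
      assume n: "w \<notin> span B"
      have Bc: "B \<subseteq> carrier V" using B' Wc by blast
      have wB: "w \<notin> B" using n span_superset[OF Bc] by blast
      have "lin_indpt (B \<union> {w})" using lin_dep_iff_in_span[OF Bc B'(3) _ wB] n w Wc by blast
      then have "B \<union> {w} = B" using B(2) B' w unfolding maximal_def by blast
      then show False using wB by blast
    qed
  qed
  then have sp: "span B = W" using span_subset[OF W B'(2)] by blast
  interpret W: vectorspace K "V\<lparr>carrier := W\<rparr>" by (rule subspace_is_vs[OF W])
  have sub: "submodule K W V" using W by simp
  have "W.basis B"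
    unfolding W.basis_def using span_li_not_depend[OF B'(2) sub] sp B' by simp
  then have "W.dim = card B" using W.dim_basis B(1) by simp
  then show thesis using that B(1) B' sp by simp
qed

lemma lin_indpt_empty: "lin_indpt {}"
  by (simp add: lin_dep_def)

lemma subspace_basis:
  assumes "fin_dim" "subspace K W V"
  obtains B where "finite B" "B \<subseteq> W" "lin_indpt B" "span B = W" "card B = sdim W"
  by (rule subspace_basis_extend[OF assms empty_subsetI lin_indpt_empty]) (rule that)

lemma sdim_mono:
  assumes fd: fin_dim and W: "subspace K W V" and W': "subspace K W' V" and le: "W \<subseteq> W'"
  shows "sdim W \<le> sdim W'"
proof -
  obtain B where B: "finite B" "B \<subseteq> W" "lin_indpt B" "span B = W" "card B = sdim W" by (rule subspace_basis[OF fd W])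
  obtain B' where B': "finite B'" "B' \<subseteq> W'" "lin_indpt B'" "span B' = W'" "card B' = sdim W'" by (rule subspace_basis[OF fd W'])
  have "card B \<le> card B'" by (rule li_card_le) (use B B' le subspaceD(1)[OF W'] in auto)
  then show ?thesis using B B' by simp
qed

lemma li_generates:
  assumes fd: fin_dim and W: "subspace K W V" and A: "A \<subseteq> W" "lin_indpt A" "sdim W \<le> card A" and fA: "finite A"
  shows "span A = W"
proof -
  obtain B where B: "finite B" "A \<subseteq> B" "B \<subseteq> W" "lin_indpt B" "span B = W" "card B = sdim W"
    by (rule subspace_basis_extend[OF fd W A(1,2)])
  then have "A = B" using A(3) by (simp add: card_seteq)
  then show ?thesis using B by simp
qed

lemma sdim_eq:
  assumes fd: fin_dim and W: "subspace K W V" and W': "subspace K W' V" and le: "W \<subseteq> W'" "sdim W' \<le> sdim W"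
  shows "W = W'"
proof -
  obtain B where B: "finite B" "B \<subseteq> W" "lin_indpt B" "span B = W" "card B = sdim W" by (rule subspace_basis[OF fd W])
  then show ?thesis using li_generates[OF fd W' _ B(3) _ B(1)] le by auto
qed

lemma sdim_carrier: "sdim (carrier V) = dim"
  by simp

end

section \<open>Ideals, and the p-map modulo an ideal\<close>

context restricted_lie_algebra
begin

definition lie_ideal :: "'b set \<Rightarrow> bool" where
  "lie_ideal I \<longleftrightarrow> subspace F I L \<and> (\<forall>x\<in>carrier L. \<forall>y\<in>I. bracket L x y \<in> I)"

definition p_ideal :: "'b set \<Rightarrow> bool" where
  "p_ideal I \<longleftrightarrow> lie_ideal I \<and> (\<forall>x\<in>I. pmap L x \<in> I)"

lemma lie_idealD:
  assumes "lie_ideal I"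
  shows "subspace F I L" "I \<subseteq> carrier L" "\<And>x y. x \<in> carrier L \<Longrightarrow> y \<in> I \<Longrightarrow> bracket L x y \<in> I"
    "\<And>x y. x \<in> carrier L \<Longrightarrow> y \<in> I \<Longrightarrow> bracket L y x \<in> I"
proof -
  show *: "subspace F I L" "I \<subseteq> carrier L" "\<And>x y. x \<in> carrier L \<Longrightarrow> y \<in> I \<Longrightarrow> bracket L x y \<in> I"
    using assms subspaceD(1) by (auto simp: lie_ideal_def)
  show "bracket L y x \<in> I" if "x \<in> carrier L" "y \<in> I" for x y
    using bracket_swap[of x y] *(3)[OF that] subspaceD(5)[OF *(1)] *(2) that by auto
qed

lemma trivial_ideal: "lie_ideal {\<zero>}"
  unfolding lie_ideal_def using trivial_subspace bracket_zero_right by simp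

lemma pmap_zero: "pmap L \<zero> = \<zero>"
proof -
  have "pmap L (\<zero>\<^bsub>F\<^esub> \<odot> \<zero>) = (\<zero>\<^bsub>F\<^esub> [^]\<^bsub>F\<^esub> p) \<odot> pmap L \<zero>" by (rule pmap_smult) simp_all
  then show ?thesis using two_le_p pmap_closed[of \<zero>] by (simp add: R.nat_pow_zero)
qed

text \<open>Jacobson's elements are multiples of coefficients of (ad (x X + y))^(p-1) (x). The first
  step already produces [y, x], which lies in \<open>I\<close>, and the ideal absorbs all later
  brackets.\<close>

lemma pmap_add_mod:
  assumes I: "lie_ideal I" and x: "x \<in> carrier L" and y: "y \<in> carrier L" and xy: "bracket L x y \<in> I"
  obtains z where "z \<in> I" "pmap L (x \<oplus> y) = pmap L x \<oplus> pmap L y \<oplus> z"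
proof -
  note sI = lie_idealD[OF I]
  have yx: "bracket L y x \<in> I" using bracket_swap[OF x y] subspaceD(5)[OF sI(1) xy] by simp
  have step: "ad_poly L x y s n \<in> I" if s: "\<And>n. s n \<in> I" for s n
    unfolding ad_poly_def using s sI(3)[OF x] sI(3)[OF y] subspaceD(2,3)[OF sI(1)] by (cases n) auto
  have first: "ad_poly L x y (\<lambda>n. if n = 0 then x else \<zero>) n \<in> I" for n
    using yx x y subspaceD(2)[OF sI(1)] sI(2)
    by (cases n) (auto simp: ad_poly_def bracket_self bracket_zero_right)
  have it: "(ad_poly L x y ^^ Suc k) (\<lambda>n. if n = 0 then x else \<zero>) n \<in> I" for k n
    by (induction k arbitrary: n) (simp_all add: first step)
  \<comment> \<open>At least one bracket is taken because \<open>p - 1\<close> is positive.\<close>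
  obtain q where q: "p - 1 = Suc q" using two_le_p by (cases "p - 1") auto
  have "jacobson_s F L p x y i \<in> I" if i: "i \<in> {1..p - 1}" for i
  proof -
    have "0 < i" "i < p" using i by auto
    then have "add_pow F i \<one>\<^bsub>F\<^esub> \<in> Units F" using char_nonzero[of i] field_Units by auto
    then have "inv\<^bsub>F\<^esub> (add_pow F i \<one>\<^bsub>F\<^esub>) \<in> carrier F" by simp
    then show ?thesis unfolding jacobson_s_def q by (intro subspaceD(4)[OF sI(1)] it)
  qed
  then have "(\<Oplus>i\<in>{1..p - 1}. jacobson_s F L p x y i) \<in> I" by (intro subspace_finsum[OF sI(1)]) simp_all
  then show thesis using that pmap_add[OF x y] by blast
qed

text \<open>On \<open>J\<close> the p-map is p-semilinear modulo \<open>I\<close>, since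
  \<open>J\<close> is abelian modulo \<open>I\<close>. This lets inclusions of p-th powers be
  checked on spanning sets.\<close>

lemma pmap_preimage_subspace:
  assumes I: "lie_ideal I" and W: "subspace F W L" and IW: "I \<subseteq> W" and J: "subspace F J L"
    and JJ: "\<And>x y. x \<in> J \<Longrightarrow> y \<in> J \<Longrightarrow> bracket L x y \<in> I"
  shows "subspace F {x \<in> J. pmap L x \<in> W} L"
proof (rule subspaceI)
  note J' = subspaceD[OF J] and W' = subspaceD[OF W]
  show "{x \<in> J. pmap L x \<in> W} \<subseteq> carrier L" using J'(1) by blast
  show "\<zero> \<in> {x \<in> J. pmap L x \<in> W}" using J'(2) W'(2) pmap_zero by simp
  show "a \<odot> x \<in> {x \<in> J. pmap L x \<in> W}" if "a \<in> carrier F" "x \<in> {x \<in> J. pmap L x \<in> W}" for a x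
    using that J'(1,4) W'(4) pmap_smult[of a x] by auto
  fix x y assume xy: "x \<in> {x \<in> J. pmap L x \<in> W}" "y \<in> {x \<in> J. pmap L x \<in> W}"
  then obtain z where "z \<in> I" "pmap L (x \<oplus> y) = pmap L x \<oplus> pmap L y \<oplus> z"
    using pmap_add_mod[OF I, of x y] JJ[of x y] J'(1) by blast
  then show "x \<oplus> y \<in> {x \<in> J. pmap L x \<in> W}" using xy J'(3) W'(3) IW by auto
qed

text \<open>Ideals reachable from \<open>0\<close> by strongly abelian steps (\<open>nil\<close>) and by central extensions with
  toral quotient (\<open>toral\<close>).\<close>

inductive tower :: "'b set \<Rightarrow> bool" where
  zero: "tower {\<zero>}"
| nil: "tower I \<Longrightarrow> p_ideal J \<Longrightarrow> I \<subseteq> J \<Longrightarrow> \<forall>x\<in>J. \<forall>y\<in>J. bracket L x y \<in> I \<Longrightarrow> \<forall>x\<in>J. pmap L x \<in> I \<Longrightarrow> tower J"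
| toral: "tower I \<Longrightarrow> p_ideal J \<Longrightarrow> I \<subseteq> J \<Longrightarrow> \<forall>x\<in>carrier L. \<forall>y\<in>J. bracket L x y \<in> I \<Longrightarrow>
    J \<subseteq> span (I \<union> pmap L ` J) \<Longrightarrow> tower J"

lemma tower_p_ideal: "tower I \<Longrightarrow> p_ideal I"
  by (induction rule: tower.induct) (auto simp: p_ideal_def trivial_ideal pmap_zero)

lemma brackets_closed: "S \<subseteq> carrier L \<Longrightarrow> {bracket L x y | x y. x \<in> S \<and> y \<in> S} \<subseteq> carrier L"
  using bracket_closed by blast

lemma derived_lie_subset:
  assumes "S \<subseteq> carrier L" "x \<in> S" "y \<in> S" shows "bracket L x y \<in> derived_lie F L S"
  unfolding derived_lie_def by (rule subsetD[OF span_superset[OF brackets_closed[OF assms(1)]]]) (use assms in blast)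

text \<open>By the Jacobi identity [l, [x, y]] is, up to sign, the sum of [x, [y, l]] and [y,
  [l, x]], whose entries lie in \<open>I\<close> again.\<close>

lemma derived_ideal:
  assumes I: "lie_ideal I" shows "lie_ideal (derived_lie F L I)"
proof -
  note sI = lie_idealD[OF I]
  let ?S = "{bracket L x y | x y. x \<in> I \<and> y \<in> I}"
  have Sc: "?S \<subseteq> carrier L" using sI(2) bracket_closed by blast
  have sub: "subspace F (span ?S) L" by (rule span_is_subspace[OF Sc])
  note sD = subspaceD[OF sub]
  have m: "bracket L u v \<in> span ?S" if "u \<in> I" "v \<in> I" for u v
    by (rule subsetD[OF span_superset[OF Sc]]) (use that in blast)
  have "bracket L l v \<in> span ?S" if l: "l \<in> carrier L" and v: "v \<in> span ?S" for l v
  proof -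
    have "subspace F {v \<in> carrier L. bracket L l v \<in> span ?S} L"
      by (rule subspaceI) (use l sD(2,3,4) in \<open>auto simp: bracket_zero_right bracket_add_right bracket_smult_right\<close>)
    moreover have "?S \<subseteq> {v \<in> carrier L. bracket L l v \<in> span ?S}"
    proof
      fix s assume "s \<in> ?S"
      then obtain x y where s: "s = bracket L x y" "x \<in> I" "y \<in> I" by blast
      have c: "x \<in> carrier L" "y \<in> carrier L" using s sI(2) by auto
      have "bracket L l (bracket L x y) \<oplus> bracket L x (bracket L y l) \<oplus> bracket L y (bracket L l x) = \<zero>"
        by (rule jacobi[OF l c])
      then have e: "bracket L l s = \<ominus> (bracket L x (bracket L y l) \<oplus> bracket L y (bracket L l x))"
        using s c l bracket_closed by (simp add: M.a_assoc M.minus_equality)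
      have "bracket L x (bracket L y l) \<in> span ?S" "bracket L y (bracket L l x) \<in> span ?S"
        by (rule m[OF s(2) sI(4)[OF l s(3)]], rule m[OF s(3) sI(3)[OF l s(2)]])
      then have "bracket L l s \<in> span ?S" unfolding e by (intro sD(5) sD(3))
      then show "s \<in> {v \<in> carrier L. bracket L l v \<in> span ?S}" using s c bracket_closed by simp
    qed
    ultimately have "span ?S \<subseteq> {v \<in> carrier L. bracket L l v \<in> span ?S}" by (rule span_subset)
    then show ?thesis using v by blast
  qed
  then show ?thesis unfolding lie_ideal_def derived_lie_def using sub by (intro conjI ballI)
qed

lemma derived_series_ideal: "lie_ideal ((derived_lie F L ^^ k) (carrier L))"
proof (induction k)
  case 0
  then show ?case using whole_subspace bracket_closed by (simp add: lie_ideal_def)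
next
  case (Suc k)
  then show ?case by (simp add: derived_ideal)
qed

lemma subspace_add_set:
  assumes "subspace F A L" "subspace F B L"
  shows "subspace F {a \<oplus> b | a b. a \<in> A \<and> b \<in> B} L"
proof (rule subspaceI)
  note A = subspaceD[OF assms(1)] and B = subspaceD[OF assms(2)]
  show "{a \<oplus> b | a b. a \<in> A \<and> b \<in> B} \<subseteq> carrier L" using A(1) B(1) by blast
  have "\<zero> = \<zero> \<oplus> \<zero>" by simp
  then show "\<zero> \<in> {a \<oplus> b | a b. a \<in> A \<and> b \<in> B}" using A(2) B(2) by blast
  fix x assume "x \<in> {a \<oplus> b | a b. a \<in> A \<and> b \<in> B}"
  then obtain a b where x: "x = a \<oplus> b" "a \<in> A" "b \<in> B" by blast
  have c: "a \<in> carrier L" "b \<in> carrier L" using x A(1) B(1) by auto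
  show "k \<odot> x \<in> {a \<oplus> b | a b. a \<in> A \<and> b \<in> B}" if k: "k \<in> carrier F" for k
  proof -
    have "k \<odot> x = k \<odot> a \<oplus> k \<odot> b" unfolding x(1) by (rule smult_r_distr[OF k c])
    then show ?thesis using A(4)[OF k x(2)] B(4)[OF k x(3)] by blast
  qed
  fix y assume "y \<in> {a \<oplus> b | a b. a \<in> A \<and> b \<in> B}"
  then obtain a' b' where y: "y = a' \<oplus> b'" "a' \<in> A" "b' \<in> B" by blast
  have c': "a' \<in> carrier L" "b' \<in> carrier L" using y A(1) B(1) by auto
  have "x \<oplus> y = (a \<oplus> a') \<oplus> (b \<oplus> b')" using x y c c' by (simp add: M.a_ac)
  then show "x \<oplus> y \<in> {a \<oplus> b | a b. a \<in> A \<and> b \<in> B}" using x y A(3) B(3) by blast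
qed

lemma ad_pow_ideal:
  assumes I: "lie_ideal I" and x: "x \<in> carrier L" and y: "y \<in> I" shows "(bracket L x ^^ k) y \<in> I"
  by (induction k) (simp_all add: y lie_idealD(3)[OF I x])

text \<open>Let Z be the centre modulo \<open>I\<close>. If Z exceeds \<open>I\<close>, take a
  minimal p-closed subspace J of Z strictly above \<open>I\<close>: with \<open>I\<close>, its p-th
  powers span either \<open>I\<close> or J, and these are the two kinds of steps. If Z =
  \<open>I\<close>, the last derived ideal outside \<open>I\<close> gives an ideal J abelian modulo
  \<open>I\<close>; for x in J the operator (ad x)^2 maps L into \<open>I\<close>, so x^[p] lies in
  Z = \<open>I\<close>.\<close>

lemma tower_extend:
  assumes fd: "fin_dim" and sol: "solvable_lie F L" and I: "tower I" and ne: "I \<noteq> carrier L"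
  shows "\<exists>J. tower J \<and> I \<subset> J"
proof -
  have pI: "p_ideal I" by (rule tower_p_ideal[OF I])
  then have lI: "lie_ideal I" by (simp add: p_ideal_def)
  note sI = lie_idealD[OF lI]
  define Z where "Z = {x \<in> carrier L. \<forall>l\<in>carrier L. bracket L x l \<in> I}"
  have Zs: "subspace F Z L"
  proof (rule subspaceI)
    show "Z \<subseteq> carrier L" "\<zero> \<in> Z" unfolding Z_def using subspaceD(2)[OF sI(1)] bracket_zero_left by auto
    show "x \<oplus> y \<in> Z" if "x \<in> Z" "y \<in> Z" for x y
      using that subspaceD(3)[OF sI(1)] unfolding Z_def by (simp add: bracket_add_left)
    show "a \<odot> x \<in> Z" if "a \<in> carrier F" "x \<in> Z" for a x
      using that subspaceD(4)[OF sI(1)] unfolding Z_def by (simp add: bracket_smult_left)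
  qed
  have IZ: "I \<subseteq> Z" using sI(2,4) by (auto simp: Z_def)
  have Zr: "bracket L l x \<in> I" if "x \<in> Z" "l \<in> carrier L" for x l
    using that bracket_swap[of x l] subspaceD(5)[OF sI(1)] by (auto simp: Z_def)
  \<comment> \<open>Since \<open>p\<close> is at least 2, (ad x)^p contains the two brackets that
    lead into \<open>I\<close> under the hypothesis of \<open>Zp\<close>.\<close>
  obtain q where q: "p = Suc (Suc q)" using two_le_p by (metis add_2_eq_Suc le_iff_add)
  have Zp: "pmap L x \<in> Z" if x: "x \<in> carrier L" and "\<And>l. l \<in> carrier L \<Longrightarrow> bracket L x (bracket L x l) \<in> I" for x
  proof -
    have "bracket L (pmap L x) l \<in> I" if l: "l \<in> carrier L" for l
      unfolding ad_pmap[OF x l] q using ad_pow_ideal[OF lI x, of "bracket L x (bracket L x l)" q]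
        \<open>\<And>l. l \<in> carrier L \<Longrightarrow> bracket L x (bracket L x l) \<in> I\<close>[OF l] by (simp add: funpow_swap1)
    then show ?thesis using x pmap_closed by (simp add: Z_def)
  qed
  show ?thesis
  proof (cases "Z \<subseteq> I")
    case False
    define P where "P J \<longleftrightarrow> subspace F J L \<and> I \<subset> J \<and> J \<subseteq> Z \<and> (\<forall>x\<in>J. pmap L x \<in> J)" for J
    have "P Z" unfolding P_def
    proof (intro conjI ballI)
      show "subspace F Z L" by (rule Zs)
      show "I \<subset> Z" using False IZ by blast
      fix x assume "x \<in> Z"
      then have x: "x \<in> carrier L" "\<And>l. l \<in> carrier L \<Longrightarrow> bracket L x l \<in> I" unfolding Z_def by blast+
      show "pmap L x \<in> Z" by (rule Zp[OF x(1) sI(3)[OF x(1) x(2)]])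
    qed simp
    from ex_has_least_nat[of P Z sdim, OF this]
    obtain J where J: "P J" and Jmin: "\<forall>J'. P J' \<longrightarrow> sdim J \<le> sdim J'" by (elim exE conjE)
    have Js: "subspace F J L" and IJ: "I \<subset> J" and JZ: "J \<subseteq> Z" and Jp: "\<forall>x\<in>J. pmap L x \<in> J"
      using J unfolding P_def by simp_all
    have Jc: "J \<subseteq> carrier L" using subspaceD(1)[OF Js] .
    have br: "bracket L l x \<in> I" "bracket L x l \<in> I" if "x \<in> J" "l \<in> carrier L" for x l
      using Zr[of x l] that JZ by (auto simp: Z_def)
    \<comment> \<open>Every subspace between \<open>I\<close> and \<open>Z\<close> is a Lie ideal,
      as brackets with \<open>Z\<close> fall into \<open>I\<close>.\<close>
    have pJ: "p_ideal J" unfolding p_ideal_def lie_ideal_def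
      by (intro conjI ballI Js) (use br(1) IJ Jp in auto)
    let ?S = "I \<union> pmap L ` J"
    have Sc: "?S \<subseteq> carrier L" using sI(2) Jc pmap_closed by blast
    have SJ: "span ?S \<subseteq> J" by (rule span_subset[OF Js]) (use IJ Jp in blast)
    have Ss: "?S \<subseteq> span ?S" by (rule span_superset[OF Sc])
    show ?thesis
    proof (cases "span ?S = I")
      case True
      have "tower J"
      proof (rule tower.nil[OF I pJ])
        show "I \<subseteq> J" using IJ by simp
        show "\<forall>x\<in>J. \<forall>y\<in>J. bracket L x y \<in> I" using br(2) Jc by auto
        show "\<forall>x\<in>J. pmap L x \<in> I" using Ss True by auto
      qed
      then show ?thesis using IJ by (intro exI[of _ J] conjI)
    next
      case False
      \<comment> \<open>Being again p-closed and strictly above \<open>I\<close>, this span cannot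
        have smaller dimension than the minimal \<open>J\<close>.\<close>
      have "P (span ?S)" unfolding P_def
      proof (intro conjI ballI)
        show "subspace F (span ?S) L" by (rule span_is_subspace[OF Sc])
        show "I \<subset> span ?S" using False Ss by auto
        show "span ?S \<subseteq> Z" using SJ JZ by (rule subset_trans)
        fix x assume "x \<in> span ?S"
        then have "x \<in> J" using SJ by (rule rev_subsetD)
        then have "pmap L x \<in> ?S" by simp
        then show "pmap L x \<in> span ?S" using Ss by (rule rev_subsetD)
      qed
      then have "sdim J \<le> sdim (span ?S)" by (rule mp[OF spec[OF Jmin]])
      then have "span ?S = J" using sdim_eq[OF fd span_is_subspace[OF Sc] Js SJ] by blast
      have "tower J"
      proof (rule tower.toral[OF I pJ])
        show "I \<subseteq> J" using IJ by simp
        show "\<forall>x\<in>carrier L. \<forall>y\<in>J. bracket L x y \<in> I" using br(1) by simp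
        show "J \<subseteq> span ?S" using \<open>span ?S = J\<close> by simp
      qed
      then show ?thesis using IJ by (intro exI[of _ J] conjI)
    qed
  next
    case True
    let ?D = "\<lambda>k. (derived_lie F L ^^ k) (carrier L)"
    from sol obtain m where m: "?D m = {\<zero>}" unfolding solvable_lie_def by (elim exE)
    have Dm: "?D m \<subseteq> I" unfolding m using subspaceD(2)[OF sI(1)] by simp
    have D0: "\<not> ?D 0 \<subseteq> I" using ne sI(2) by (metis funpow_0 subset_antisym)
    from ex_least_nat_less[of "\<lambda>k. ?D k \<subseteq> I" m, OF Dm D0]
    obtain k where k': "\<forall>i\<le>k. \<not> ?D i \<subseteq> I" and k2: "?D (Suc k) \<subseteq> I" by (elim exE conjE)
    have k1: "\<not> ?D k \<subseteq> I" using k' by (rule allE[of _ k]) (erule mp, rule order_refl)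
    have D: "lie_ideal (?D k)" by (rule derived_series_ideal)
    note sD = lie_idealD[OF D]
    have DD: "bracket L x y \<in> I" if "x \<in> ?D k" "y \<in> ?D k" for x y
      using derived_lie_subset[OF sD(2) that] k2 by (simp add: subset_iff)
    let ?J = "{a \<oplus> d | a d. a \<in> I \<and> d \<in> ?D k}"
    have Js: "subspace F ?J L" by (rule subspace_add_set[OF sI(1) sD(1)])
    have IJ: "I \<subseteq> ?J"
    proof
      fix x assume "x \<in> I"
      then have "x = x \<oplus> \<zero>" using sI(2) by auto
      then show "x \<in> ?J" using \<open>x \<in> I\<close> subspaceD(2)[OF sD(1)] by blast
    qed
    have DJ: "?D k \<subseteq> ?J"
    proof
      fix x assume "x \<in> ?D k"
      then have "x = \<zero> \<oplus> x" using sD(2) by auto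
      then show "x \<in> ?J" using \<open>x \<in> ?D k\<close> subspaceD(2)[OF sI(1)] by blast
    qed
    have lJ: "lie_ideal ?J" unfolding lie_ideal_def
    proof (intro conjI ballI Js)
      fix l x assume l: "l \<in> carrier L" and "x \<in> ?J"
      then obtain a d where x: "x = a \<oplus> d" "a \<in> I" "d \<in> ?D k" by blast
      have "bracket L l x = bracket L l a \<oplus> bracket L l d" using x l sI(2) sD(2) by (auto intro: bracket_add_right)
      then show "bracket L l x \<in> ?J" using x sI(3)[OF l] sD(3)[OF l] by blast
    qed
    have JJ: "bracket L x y \<in> I" if xy: "x \<in> ?J" "y \<in> ?J" for x y
    proof -
      obtain a d where x: "x = a \<oplus> d" "a \<in> I" "d \<in> ?D k" using xy(1) by blast
      obtain a' d' where y: "y = a' \<oplus> d'" "a' \<in> I" "d' \<in> ?D k" using xy(2) by blast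
      have c: "a \<in> carrier L" "d \<in> carrier L" "a' \<in> carrier L" "d' \<in> carrier L" "y \<in> carrier L"
        using x y sI(2) sD(2) by auto
      have "bracket L x y = bracket L a y \<oplus> bracket L d y" unfolding x(1) by (rule bracket_add_left[OF c(1,2,5)])
      moreover have "bracket L d y = bracket L d a' \<oplus> bracket L d d'" unfolding y(1) by (rule bracket_add_right[OF c(2,3,4)])
      ultimately show ?thesis using sI(3)[OF c(2) y(2)] sI(4)[OF c(5) x(2)] DD[OF x(3) y(3)] subspaceD(3)[OF sI(1)] by simp
    qed
    have Jp: "pmap L x \<in> I" if x: "x \<in> ?J" for x
    proof -
      have xc: "x \<in> carrier L" using x subspaceD(1)[OF Js] by blast
      have "pmap L x \<in> Z" by (rule Zp[OF xc], rule JJ[OF x], rule lie_idealD(4)[OF lJ _ x])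
      then show ?thesis using True by (rule rev_subsetD)
    qed
    have "tower ?J"
    proof (rule tower.nil[OF I])
      show "p_ideal ?J" unfolding p_ideal_def by (intro conjI ballI lJ subsetD[OF IJ Jp])
      show "I \<subseteq> ?J" by (rule IJ)
      show "\<forall>x\<in>?J. \<forall>y\<in>?J. bracket L x y \<in> I" by (intro ballI JJ)
      show "\<forall>x\<in>?J. pmap L x \<in> I" by (intro ballI Jp)
    qed
    moreover have "I \<subset> ?J"
    proof (rule psubsetI[OF IJ notI])
      assume "I = ?J"
      then have "?D k \<subseteq> I" using DJ by simp
      then show False using k1 by contradiction
    qed
    ultimately show ?thesis by (intro exI[of _ ?J] conjI)
  qed
qed

text \<open>Dimensions are bounded, so a tower ideal of largest dimension exists, and
  \<open>tower_extend\<close> would enlarge it if it were proper.\<close>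

lemma tower_carrier:
  assumes fd: "fin_dim" and sol: "solvable_lie F L"
  shows "tower (carrier L)"
proof -
  have s: "subspace F I L" if "tower I" for I using tower_p_ideal[OF that] by (simp add: p_ideal_def lie_ideal_def)
  have "\<exists>I. tower I \<and> (\<forall>J. tower J \<longrightarrow> sdim J \<le> sdim I)"
  proof (rule ex_has_greatest_nat[of tower "{\<zero>}" sdim "Suc dim"])
    show "tower {\<zero>}" by (rule tower.zero)
    show "\<forall>J. tower J \<longrightarrow> sdim J < Suc dim"
    proof (intro allI impI)
      fix J assume "tower J"
      then show "sdim J < Suc dim" using sdim_mono[OF fd s whole_subspace] subspaceD(1)[OF s] sdim_carrier
        by (simp add: less_Suc_eq_le)
    qed
  qed
  then obtain I where I: "tower I" "\<forall>J. tower J \<longrightarrow> sdim J \<le> sdim I" by (elim exE conjE)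
  show ?thesis
  proof (cases "I = carrier L")
    case False
    then obtain J where J: "tower J" "I \<subset> J" using tower_extend[OF fd sol I(1)] by blast
    then have "I = J" using sdim_eq[OF fd s[OF I(1)] s[OF J(1)]] mp[OF spec[OF I(2)] J(1)] by simp
    then show ?thesis using J by simp
  qed (use I in simp)
qed

end

section \<open>Iterated p-th powers and tori\<close>

context restricted_lie_algebra
begin

abbreviation ppow :: "'b \<Rightarrow> nat \<Rightarrow> 'b" where
  "ppow x i \<equiv> (pmap L ^^ i) x"

lemma ppow_closed: "x \<in> carrier L \<Longrightarrow> ppow x i \<in> carrier L"
  by (induction i) (simp_all add: pmap_closed)

lemma bracket_ppow:
  assumes x: "x \<in> carrier L" and y: "y \<in> carrier L"
  shows "bracket L (ppow x i) y = (bracket L x ^^ (p ^ i)) y"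
proof -
  have "(bracket L (ppow x i) ^^ m) y = (bracket L x ^^ (m * p ^ i)) y" for m
  proof (induction i arbitrary: m)
    case (Suc i)
    have s: "(bracket L (ppow x (Suc i)) ^^ m) y = (bracket L (ppow x i) ^^ (p * m)) y" for m
    proof (induction m)
      case (Suc m)
      have "(bracket L (ppow x i) ^^ (p * m)) y \<in> carrier L" by (rule ad_pow_closed[OF ppow_closed[OF x] y])
      then show ?case using Suc ad_pmap[OF ppow_closed[OF x], of "(bracket L (ppow x i) ^^ (p * m)) y" i]
        by (simp add: funpow_add)
    qed simp
    show ?case unfolding s Suc by (simp add: mult_ac)
  qed simp
  from this[of 1] show ?thesis by simp
qed

lemma commute_ppow:
  assumes x: "x \<in> carrier L" and y: "y \<in> carrier L" and c: "bracket L x y = \<zero>"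
  shows "bracket L (ppow x i) y = \<zero>" "bracket L y (ppow x i) = \<zero>"
proof -
  have "0 < p ^ i" using two_le_p by simp
  then obtain q where q: "p ^ i = Suc q" by (cases "p ^ i") auto
  have "(bracket L x ^^ k) \<zero> = \<zero>" for k by (induction k) (simp_all add: bracket_zero_right x)
  then show 1: "bracket L (ppow x i) y = \<zero>" using bracket_ppow[OF x y, of i] c by (simp add: q funpow_swap1)
  show "bracket L y (ppow x i) = \<zero>" using bracket_swap[OF ppow_closed[OF x] y, of i] 1 by simp
qed

lemma ppow_commute:
  assumes x: "x \<in> carrier L" shows "bracket L (ppow x i) (ppow x j) = \<zero>"
proof -
  have "bracket L x (ppow x j) = \<zero>" by (rule commute_ppow(2)[OF x x bracket_self[OF x]])
  then show ?thesis by (rule commute_ppow(1)[OF x ppow_closed[OF x]])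
qed

definition commuting :: "'b set \<Rightarrow> bool" where
  "commuting A \<longleftrightarrow> (\<forall>x\<in>A. \<forall>y\<in>A. bracket L x y = \<zero>)"

lemma centralizer_subspace:
  assumes x: "x \<in> carrier L" shows "subspace F {y \<in> carrier L. bracket L x y = \<zero>} L"
  by (rule subspaceI) (simp_all add: x bracket_zero_right bracket_add_right bracket_smult_right)

lemma span_centralizes:
  assumes x: "x \<in> carrier L" and A: "A \<subseteq> carrier L" "\<And>a. a \<in> A \<Longrightarrow> bracket L x a = \<zero>" and y: "y \<in> span A"
  shows "bracket L x y = \<zero>"
proof -
  have "A \<subseteq> {y \<in> carrier L. bracket L x y = \<zero>}" using A by auto
  from span_subset[OF centralizer_subspace[OF x] this] show ?thesis using y by blast
qed

lemma commuting_span: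
  assumes A: "A \<subseteq> carrier L" and c: "commuting A" shows "commuting (span A)"
  unfolding commuting_def
proof (intro ballI)
  have sc: "span A \<subseteq> carrier L" by (rule span_is_subset2[OF A])
  fix x y assume x: "x \<in> span A" and y: "y \<in> span A"
  have xc: "x \<in> carrier L" using x sc by blast
  show "bracket L x y = \<zero>"
  proof (rule span_centralizes[OF xc A _ y])
    fix a assume a: "a \<in> A"
    have ac: "a \<in> carrier L" using a A by blast
    have "bracket L a x = \<zero>" by (rule span_centralizes[OF ac A _ x]) (use c a in \<open>simp add: commuting_def\<close>)
    then show "bracket L x a = \<zero>" using bracket_swap[OF ac xc] by simp
  qed
qed

text \<open>The case of the zero ideal in \<open>pmap_preimage_subspace\<close>: on the span of a
  commuting set the p-map is p-semilinear, so its image is controlled by the generators.\<close>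

lemma pmap_span_commuting:
  assumes A: "A \<subseteq> carrier L" and c: "commuting A" and W: "subspace F W L" and AW: "pmap L ` A \<subseteq> W"
  shows "pmap L ` span A \<subseteq> W"
proof -
  have "subspace F {x \<in> span A. pmap L x \<in> W} L"
  proof (rule pmap_preimage_subspace[OF trivial_ideal W])
    show "{\<zero>} \<subseteq> W" using subspaceD(2)[OF W] by simp
    show "subspace F (span A) L" by (rule span_is_subspace[OF A])
    show "bracket L x y \<in> {\<zero>}" if "x \<in> span A" "y \<in> span A" for x y
      using commuting_span[OF A c] that by (simp add: commuting_def)
  qed
  moreover have "A \<subseteq> {x \<in> span A. pmap L x \<in> W}" using AW span_superset[OF A] by auto
  ultimately have "span A \<subseteq> {x \<in> span A. pmap L x \<in> W}" by (rule span_subset)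
  then show ?thesis by blast
qed

lemma p_subalgebra_span:
  assumes A: "A \<subseteq> carrier L" and c: "commuting A" and p: "pmap L ` A \<subseteq> span A"
  shows "p_subalgebra F L (span A)"
  unfolding p_subalgebra_def
proof (intro conjI ballI)
  show s: "subspace F (span A) L" by (rule span_is_subspace[OF A])
  show "bracket L x y \<in> span A" if "x \<in> span A" "y \<in> span A" for x y
    using commuting_span[OF A c] that subspaceD(2)[OF s] by (simp add: commuting_def)
  show "pmap L x \<in> span A" if "x \<in> span A" for x
    using pmap_span_commuting[OF A c s p] that by blast
qed

text \<open>For \<open>i = 0\<close> and \<open>i = 1\<close> these are the p-subalgebras generated
  by x and by x^[p]. Letting \<open>i\<close> grow gives the descending chain in which a torus is
  found.\<close>

definition ppow_span :: "'b \<Rightarrow> nat \<Rightarrow> 'b set" where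
  "ppow_span x i = span {ppow x j | j. i \<le> j}"

lemma ppow_set_closed: "x \<in> carrier L \<Longrightarrow> {ppow x j | j. i \<le> j} \<subseteq> carrier L"
  using ppow_closed by auto

lemma ppow_span_subspace: "x \<in> carrier L \<Longrightarrow> subspace F (ppow_span x i) L"
  unfolding ppow_span_def by (rule span_is_subspace[OF ppow_set_closed])

lemma ppow_in_span: "x \<in> carrier L \<Longrightarrow> i \<le> j \<Longrightarrow> ppow x j \<in> ppow_span x i"
  unfolding ppow_span_def by (rule subsetD[OF span_superset[OF ppow_set_closed]]) auto

lemma ppow_span_antimono: "i \<le> j \<Longrightarrow> ppow_span x j \<subseteq> ppow_span x i"
  unfolding ppow_span_def by (rule span_mono) auto

lemma ppow_set_commuting: "x \<in> carrier L \<Longrightarrow> commuting {ppow x j | j. i \<le> j}"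
  unfolding commuting_def using ppow_commute by auto

lemma pmap_ppow_span:
  assumes x: "x \<in> carrier L" shows "pmap L ` ppow_span x i \<subseteq> ppow_span x (Suc i)"
  unfolding ppow_span_def[of x i]
proof (rule pmap_span_commuting[OF ppow_set_closed[OF x] ppow_set_commuting[OF x] ppow_span_subspace[OF x]])
  show "pmap L ` {ppow x j | j. i \<le> j} \<subseteq> ppow_span x (Suc i)"
  proof
    fix z assume "z \<in> pmap L ` {ppow x j | j. i \<le> j}"
    then obtain j where "i \<le> j" "z = ppow x (Suc j)" by auto
    then show "z \<in> ppow_span x (Suc i)" using ppow_in_span[OF x, of "Suc i" "Suc j"] by simp
  qed
qed

lemma ppow_span_p_subalgebra:
  assumes x: "x \<in> carrier L" shows "p_subalgebra F L (ppow_span x i)"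
proof -
  have "pmap L ` {ppow x j | j. i \<le> j} \<subseteq> ppow_span x i"
  proof (rule subset_trans[OF image_mono subset_trans[OF pmap_ppow_span[OF x] ppow_span_antimono]])
    show "{ppow x j | j. i \<le> j} \<subseteq> ppow_span x i"
      unfolding ppow_span_def by (rule span_superset[OF ppow_set_closed[OF x]])
  qed simp
  then show ?thesis unfolding ppow_span_def
    by (rule p_subalgebra_span[OF ppow_set_closed[OF x] ppow_set_commuting[OF x]])
qed

lemma p_subalgebraD:
  assumes "p_subalgebra F L S"
  shows "subspace F S L" "\<And>x. x \<in> S \<Longrightarrow> pmap L x \<in> S"
  using assms by (simp_all add: p_subalgebra_def)

lemma semisimple_iff:
  assumes x: "x \<in> carrier L" shows "semisimple F L x \<longleftrightarrow> x \<in> ppow_span x 1"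
proof
  assume "semisimple F L x"
  moreover have "p_subalgebra F L (ppow_span x 1)" by (rule ppow_span_p_subalgebra[OF x])
  moreover have "{pmap L x} \<subseteq> ppow_span x 1" using ppow_in_span[OF x, of 1 1] by simp
  ultimately show "x \<in> ppow_span x 1" unfolding semisimple_def p_generated_def by blast
next
  assume s: "x \<in> ppow_span x 1"
  have "x \<in> S" if S: "p_subalgebra F L S" "{pmap L x} \<subseteq> S" for S
  proof -
    note Ss = p_subalgebraD(1)[OF S(1)] and Sp = p_subalgebraD(2)[OF S(1)]
    have Suc: "ppow x (Suc j) \<in> S" for j by (induction j) (use S(2) in \<open>simp_all add: Sp\<close>)
    have "ppow x j \<in> S" if "1 \<le> j" for j using that Suc[of "j - 1"] by simp
    then have "{ppow x j | j. 1 \<le> j} \<subseteq> S" by auto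
    then have "ppow_span x 1 \<subseteq> S" unfolding ppow_span_def by (rule span_subset[OF Ss])
    then show ?thesis using s by blast
  qed
  then show "semisimple F L x" unfolding semisimple_def p_generated_def by blast
qed

text \<open>The \<open>p\<close>-semilinear map \<open>[p]\<close> takes bases of \<open>S\<close> to bases, so \<open>span {x, x\<^sup>[\<^sup>p\<^sup>], \<dots>}\<close> and
  \<open>span {x\<^sup>[\<^sup>p\<^sup>], \<dots>}\<close> have equal dimension.\<close>

lemma torusI:
  assumes fd: "fin_dim" and S: "p_subalgebra F L S" and c: "commuting S" and sp: "S \<subseteq> span (pmap L ` S)"
  shows "torus F L S"
proof -
  note Ss = p_subalgebraD(1)[OF S] and Sp = p_subalgebraD(2)[OF S]
  note Sc = subspaceD(1)[OF Ss]
  have "semisimple F L x" if x: "x \<in> S" for x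
  proof -
    have xc: "x \<in> carrier L" using x Sc by blast
    let ?W = "ppow_span x 0"
    have Ws: "subspace F ?W L" by (rule ppow_span_subspace[OF xc])
    have pS: "ppow x j \<in> S" for j by (induction j) (simp_all add: x Sp)
    then have "{ppow x j | j. 0 \<le> j} \<subseteq> S" by blast
    then have WS: "?W \<subseteq> S" unfolding ppow_span_def by (rule span_subset[OF Ss])
    obtain B0 where B0: "finite B0" "B0 \<subseteq> ?W" "lin_indpt B0" "span B0 = ?W" "card B0 = sdim ?W"
      by (rule subspace_basis[OF fd Ws])
    have B0S: "B0 \<subseteq> S" using B0(2) WS by (rule subset_trans)
    \<comment> \<open>\<open>B\<close> extends a basis of the span of the powers of x, so that
      independence of the images of \<open>B\<close> passes to the images of
      \<open>B0\<close>.\<close>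
    obtain B where B: "finite B" "B0 \<subseteq> B" "B \<subseteq> S" "lin_indpt B" "span B = S" "card B = sdim S"
      by (rule subspace_basis_extend[OF fd Ss B0S B0(3)])
    have Bc: "B \<subseteq> carrier L" using B(3) Sc by (rule subset_trans)
    have cB: "commuting B" using c B(3) by (simp add: commuting_def subset_iff)
    have pBc: "pmap L ` B \<subseteq> carrier L" using Bc pmap_closed by (auto simp only: image_subset_iff subset_iff)
    have pBS: "pmap L ` B \<subseteq> S" using B(3) Sp by (auto simp only: image_subset_iff subset_iff)
    have "pmap L ` span B \<subseteq> span (pmap L ` B)"
      by (rule pmap_span_commuting[OF Bc cB span_is_subspace[OF pBc] span_superset[OF pBc]])
    then have "span (pmap L ` S) \<subseteq> span (pmap L ` B)"
      unfolding B(5) by (rule span_subset[OF span_is_subspace[OF pBc]])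
    with sp have gen: "S \<subseteq> span (pmap L ` B)" by (rule subset_trans)
    have gen': "span (pmap L ` B) = S" by (rule subset_antisym[OF span_subset[OF Ss pBS] gen])
    \<comment> \<open>The images of the basis still generate \<open>S\<close>, so there are at least
      as many of them. Hence the p-map is injective on \<open>B\<close> and the images form a basis
      of \<open>S\<close>.\<close>
    have "card B \<le> card (pmap L ` B)"
      by (rule li_card_le[OF B(1,4) finite_imageI[OF B(1)] pBc subset_trans[OF B(3) gen]])
    then have card: "card (pmap L ` B) = card B" using card_image_le[OF B(1), of "pmap L"] by simp
    then have inj: "inj_on (pmap L) B" using B(1) by (metis eq_card_imp_inj_on)
    interpret V: vectorspace F "L\<lparr>carrier := S\<rparr>" by (rule subspace_is_vs[OF Ss])
    have subS: "submodule F S L" using Ss by simp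
    have "V.basis (pmap L ` B)"
    proof (rule V.dim_gen_is_basis)
      show "finite (pmap L ` B)" using B(1) by simp
      show "pmap L ` B \<subseteq> carrier (L\<lparr>carrier := S\<rparr>)" using pBS by simp
      show "V.span (pmap L ` B) = carrier (L\<lparr>carrier := S\<rparr>)" using span_li_not_depend(1)[OF pBS subS] gen' by simp
      show "card (pmap L ` B) \<le> V.dim" using card B(6) by simp
    qed
    then have li: "lin_indpt (pmap L ` B)" using span_li_not_depend(2)[OF pBS subS] by (simp add: V.basis_def)
    have W1s: "subspace F (ppow_span x 1) L" by (rule ppow_span_subspace[OF xc])
    have "lin_indpt (pmap L ` B0)" using subset_li_is_li[OF li] B(2) by (simp add: image_mono)
    moreover have "pmap L ` B0 \<subseteq> ppow_span x 1" using pmap_ppow_span[OF xc, of 0] B0(2) by (auto simp: image_subset_iff)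
    moreover have "card (pmap L ` B0) = card B0" using inj_on_subset[OF inj B(2)] by (rule card_image)
    ultimately have "sdim ?W \<le> sdim (ppow_span x 1)"
    proof -
      assume a: "lin_indpt (pmap L ` B0)" "pmap L ` B0 \<subseteq> ppow_span x 1" "card (pmap L ` B0) = card B0"
      obtain B1 where B1: "finite B1" "pmap L ` B0 \<subseteq> B1" "B1 \<subseteq> ppow_span x 1" "card B1 = sdim (ppow_span x 1)"
        by (rule subspace_basis_extend[OF fd W1s a(2,1)])
      have "card (pmap L ` B0) \<le> card B1" by (rule card_mono[OF B1(1,2)])
      then show ?thesis using a(3) B0(5) B1(4) by simp
    qed
    then have "ppow_span x 1 = ?W"
      by (intro sdim_eq[OF fd W1s Ws ppow_span_antimono]) simp_all
    then show ?thesis using semisimple_iff[OF xc] ppow_in_span[OF xc, of 0 0] by simp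
  qed
  then show ?thesis unfolding torus_def using S c by (simp add: commuting_def)
qed

lemma torusD:
  assumes "torus F L T"
  shows "subspace F T L" "T \<subseteq> carrier L" "commuting T" "\<And>x. x \<in> T \<Longrightarrow> pmap L x \<in> T" "\<And>x. x \<in> T \<Longrightarrow> x \<in> ppow_span x 1"
proof -
  show 1: "subspace F T L" "commuting T" "\<And>x. x \<in> T \<Longrightarrow> pmap L x \<in> T"
    using assms by (auto simp: torus_def p_subalgebra_def commuting_def)
  show 2: "T \<subseteq> carrier L" by (rule subspaceD(1)[OF 1(1)])
  show "x \<in> ppow_span x 1" if "x \<in> T" for x
  proof -
    have "semisimple F L x" using assms that by (simp add: torus_def)
    then show ?thesis using semisimple_iff[of x] that 2 by blast
  qed
qed

lemma ppow_in_torus: "torus F L T \<Longrightarrow> x \<in> T \<Longrightarrow> ppow x i \<in> T"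
  by (induction i) (simp_all add: torusD(4))

lemma trivial_torus: "torus F L {\<zero>}"
proof -
  have "ppow \<zero> 1 \<in> ppow_span \<zero> 1" by (rule ppow_in_span) simp_all
  then have "semisimple F L \<zero>" using semisimple_iff[of \<zero>] by (simp add: pmap_zero)
  then show ?thesis unfolding torus_def p_subalgebra_def
    by (simp add: trivial_subspace bracket_self pmap_zero)
qed

text \<open>\<open>Max\<close> in the definition of \<open>MT\<close> is attained only if the set is
  finite and nonempty: dimensions of tori are bounded by that of \<open>L\<close>, and the zero
  torus exists.\<close>

lemma max_torus_exists:
  assumes fd: "fin_dim"
  obtains T where "torus F L T" "sdim T = MT F L" "\<And>T'. torus F L T' \<Longrightarrow> sdim T' \<le> sdim T"
proof -
  let ?D = "{sdim T | T. torus F L T}"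
  have le: "sdim T \<le> dim" if "torus F L T" for T
    using sdim_mono[OF fd torusD(1)[OF that] whole_subspace torusD(2)[OF that]] sdim_carrier by simp
  then have fin: "finite ?D" by (intro finite_subset[of ?D "{..dim}"]) auto
  moreover have "?D \<noteq> {}" using trivial_torus by blast
  ultimately have "Max ?D \<in> ?D" by (rule Max_in)
  then obtain T where T: "torus F L T" "sdim T = Max ?D" by auto
  have "sdim T' \<le> sdim T" if "torus F L T'" for T' unfolding T(2) by (rule Max_ge[OF fin]) (use that in blast)
  then show thesis using that[of T] T by (simp add: MT_def)
qed

text \<open>The descending chain of spans of high p-th powers of \<open>x\<close> becomes
  stationary, and from there on the p-map regenerates the span. As these powers commute with
  \<open>T\<close>, they span a torus together with \<open>T\<close>, which by maximality is
  \<open>T\<close> itself.\<close>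

lemma ppow_in_max_torus:
  assumes fd: "fin_dim" and T: "torus F L T" and max: "\<And>T'. torus F L T' \<Longrightarrow> sdim T' \<le> sdim T"
    and x: "x \<in> carrier L" and c: "\<And>t. t \<in> T \<Longrightarrow> bracket L t x = \<zero>"
  obtains N where "\<And>i. N \<le> i \<Longrightarrow> ppow x i \<in> T"
proof -
  note T' = torusD[OF T]
  from ex_has_least_nat[of "\<lambda>_. True" 0 "\<lambda>i. sdim (ppow_span x i)", OF TrueI]
  obtain N where "\<forall>i. True \<longrightarrow> sdim (ppow_span x N) \<le> sdim (ppow_span x i)" by (elim exE conjE)
  then have N: "sdim (ppow_span x N) \<le> sdim (ppow_span x i)" for i by simp
  let ?W = "{ppow x j | j. N \<le> j}"
  have Wc: "?W \<subseteq> carrier L" by (rule ppow_set_closed[OF x])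
  have stab: "ppow_span x (Suc N) = ppow_span x N"
    by (rule sdim_eq[OF fd ppow_span_subspace[OF x] ppow_span_subspace[OF x] ppow_span_antimono N]) simp
  let ?A = "T \<union> ?W"
  have Ac: "?A \<subseteq> carrier L" using T'(2) Wc by simp
  have xt: "bracket L x t = \<zero>" if "t \<in> T" for t
    using bracket_swap[of t x] c[OF that] that T'(2) x by auto
  have cA: "commuting ?A" unfolding commuting_def
  proof (intro ballI)
    fix a d assume "a \<in> ?A" "d \<in> ?A"
    then consider "a \<in> T" "d \<in> T" | j where "a \<in> T" "d = ppow x j" | j where "a = ppow x j" "d \<in> T"
      | i j where "a = ppow x i" "d = ppow x j" by blast
    then show "bracket L a d = \<zero>"
    proof cases
      case 1
      then show ?thesis using T'(3) by (simp add: commuting_def)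
    next
      case 2
      then show ?thesis using commute_ppow(2)[OF x _ xt] T'(2) by auto
    next
      case 3
      then show ?thesis using commute_ppow(1)[OF x _ xt] T'(2) by auto
    next
      case 4
      then show ?thesis using ppow_commute[OF x] by simp
    qed
  qed
  have sup: "?A \<subseteq> span ?A" by (rule span_superset[OF Ac])
  have sub: "subspace F (span ?A) L" by (rule span_is_subspace[OF Ac])
  have pA: "pmap L ` ?A \<subseteq> ?A"
  proof
    fix z assume "z \<in> pmap L ` ?A"
    then consider t where "t \<in> T" "z = pmap L t" | j where "N \<le> j" "z = ppow x (Suc j)" by auto
    then show "z \<in> ?A"
    proof cases
      case 1
      then show ?thesis using T'(4) by simp
    next
      case 2
      then show ?thesis using le_SucI[of N j] by blast
    qed
  qed
  have psub: "p_subalgebra F L (span ?A)"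
    by (rule p_subalgebra_span[OF Ac cA subset_trans[OF pA sup]])
  have cS: "commuting (span ?A)" by (rule commuting_span[OF Ac cA])
  have pAc: "pmap L ` span ?A \<subseteq> carrier L" using span_is_subset2[OF Ac] pmap_closed by auto
  let ?R = "span (pmap L ` span ?A)"
  have Rs: "subspace F ?R L" by (rule span_is_subspace[OF pAc])
  have pin: "pmap L a \<in> ?R" if "a \<in> ?A" for a
    by (rule subsetD[OF span_superset[OF pAc]]) (use that sup in blast)
  have "?A \<subseteq> ?R"
  proof
    fix a assume "a \<in> ?A"
    then consider "a \<in> T" | "a \<in> ?W" by blast
    then show "a \<in> ?R"
    proof cases
      case 1
      have "ppow a j \<in> ?R" if j: "1 \<le> j" for j
      proof -
        obtain i where "j = Suc i" using j by (cases j) auto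
        then show ?thesis using pin[of "ppow a i"] ppow_in_torus[OF T 1] by simp
      qed
      then have "ppow_span a 1 \<subseteq> ?R" unfolding ppow_span_def by (intro span_subset[OF Rs]) auto
      then show ?thesis using T'(5)[OF 1] by blast
    next
      case 2
      have "ppow x j \<in> ?R" if j: "Suc N \<le> j" for j
      proof -
        obtain i where i: "j = Suc i" "N \<le> i" using j by (cases j) auto
        then have "ppow x i \<in> ?A" by blast
        then show ?thesis using pin[of "ppow x i"] i(1) by simp
      qed
      then have "ppow_span x (Suc N) \<subseteq> ?R" unfolding ppow_span_def by (intro span_subset[OF Rs]) auto
      moreover have "a \<in> ppow_span x N" using 2 ppow_in_span[OF x] by auto
      ultimately show ?thesis unfolding stab by blast
    qed
  qed
  then have "span ?A \<subseteq> ?R" by (rule span_subset[OF Rs])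
  then have "torus F L (span ?A)" by (rule torusI[OF fd psub cS])
  then have "sdim (span ?A) \<le> sdim T" by (rule max)
  then have "T = span ?A" using sdim_eq[OF fd T'(1) sub] sup by simp
  then have "?A \<subseteq> T" using sup by simp
  then show thesis using that[of N] by blast
qed

end

section \<open>Splitting along a torus and the toral steps\<close>

context restricted_lie_algebra
begin

lemma bracket_finsum_right:
  assumes "finite A" "x \<in> carrier L" "\<And>i. i \<in> A \<Longrightarrow> f i \<in> carrier L"
  shows "bracket L x (\<Oplus>i\<in>A. f i) = (\<Oplus>i\<in>A. bracket L x (f i))"
  using assms(1,3)
proof (induction A rule: finite_induct)
  case empty
  then show ?case by (simp add: bracket_zero_right assms(2))
next
  case (insert a A)
  have "(\<Oplus>i\<in>insert a A. f i) = f a \<oplus> (\<Oplus>i\<in>A. f i)"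
    by (rule M.finsum_insert) (use insert in auto)
  moreover have "(\<Oplus>i\<in>insert a A. bracket L x (f i)) = bracket L x (f a) \<oplus> (\<Oplus>i\<in>A. bracket L x (f i))"
    by (rule M.finsum_insert) (use insert assms(2) bracket_closed in auto)
  moreover have "(\<Oplus>i\<in>A. f i) \<in> carrier L" by (rule M.finsum_closed) (use insert in auto)
  ultimately show ?case using insert assms(2) by (simp add: bracket_add_right)
qed

lemma bracket_finsum_left:
  assumes "finite A" "x \<in> carrier L" "\<And>i. i \<in> A \<Longrightarrow> f i \<in> carrier L"
  shows "bracket L (\<Oplus>i\<in>A. f i) x = (\<Oplus>i\<in>A. bracket L (f i) x)"
  using assms(1,3)
proof (induction A rule: finite_induct)
  case empty
  then show ?case by (simp add: bracket_zero_left assms(2))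
next
  case (insert a A)
  have "(\<Oplus>i\<in>insert a A. f i) = f a \<oplus> (\<Oplus>i\<in>A. f i)"
    by (rule M.finsum_insert) (use insert in auto)
  moreover have "(\<Oplus>i\<in>insert a A. bracket L (f i) x) = bracket L (f a) x \<oplus> (\<Oplus>i\<in>A. bracket L (f i) x)"
    by (rule M.finsum_insert) (use insert assms(2) bracket_closed in auto)
  moreover have "(\<Oplus>i\<in>A. f i) \<in> carrier L" by (rule M.finsum_closed) (use insert in auto)
  ultimately show ?case using insert assms(2) by (simp add: bracket_add_left)
qed

lemma torus_element_expand:
  assumes T: "torus F L T" and t: "t \<in> T"
  obtains A :: "'b set" and a j where "finite A" "\<And>v. v \<in> A \<Longrightarrow> a v \<in> carrier F" "\<And>v. v \<in> A \<Longrightarrow> 1 \<le> j v"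
    "t = (\<Oplus>v\<in>A. a v \<odot> ppow t (j v))"
proof -
  note T' = torusD[OF T]
  have tc: "t \<in> carrier L" using T'(2) t by blast
  from T'(5)[OF t] obtain A a where A: "finite A" "A \<subseteq> {ppow t j | j. 1 \<le> j}" "a \<in> A \<rightarrow> carrier F"
    "t = lincomb a A" unfolding ppow_span_def span_def by blast
  have "\<forall>v\<in>A. \<exists>j. 1 \<le> j \<and> v = ppow t j" using A(2) by blast
  then obtain j where j: "\<And>v. v \<in> A \<Longrightarrow> 1 \<le> j v" "\<And>v. v \<in> A \<Longrightarrow> v = ppow t (j v)" by metis
  have "t = (\<Oplus>v\<in>A. a v \<odot> v)" using A(4) by (simp add: lincomb_def)
  also have "\<dots> = (\<Oplus>v\<in>A. a v \<odot> ppow t (j v))"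
    by (rule M.finsum_cong') (use A(3) tc ppow_closed in \<open>auto simp flip: j(2)\<close>)
  finally have "t = (\<Oplus>v\<in>A. a v \<odot> ppow t (j v))" .
  then show thesis using A(1,3) j(1) by (intro that[of A a j]) auto
qed

lemma bracket_ad_pow_zero:
  assumes "s \<in> carrier L" "t \<in> carrier L" "z \<in> carrier L" "bracket L s t = \<zero>" "bracket L s z = \<zero>"
  shows "bracket L s ((bracket L t ^^ k) z) = \<zero>"
proof (induction k)
  case (Suc k)
  have c: "(bracket L t ^^ k) z \<in> carrier L" by (rule ad_pow_closed[OF assms(2,3)])
  have "bracket L ((bracket L t ^^ k) z) s = \<zero>" using bracket_swap[OF assms(1) c] Suc by simp
  then show ?case using jacobi[OF assms(1,2) c] assms c bracket_closed by (simp add: bracket_zero_right)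
qed (simp add: assms)

text \<open>Fitting decomposition: \<open>z - \<Sum> a\<^sub>v (ad t)\<^sup>p\<^sup>j\<^sup>-\<^sup>1 z\<close> is the component of \<open>z\<close> killed by the
  semisimple operator \<open>ad t\<close>, where \<open>t = \<Sum> a\<^sub>v t\<^sup>[\<^sup>p\<^sup>]\<^sup>j\<close>.\<close>

lemma torus_element_split:
  assumes T: "torus F L T" and t: "t \<in> T" and I: "lie_ideal I" and z: "z \<in> carrier L"
    and tz: "bracket L t z \<in> I"
  obtains c where "c \<in> carrier L" "bracket L t c = \<zero>" "z \<ominus> c \<in> I"
    "\<And>s. s \<in> T \<Longrightarrow> bracket L s z = \<zero> \<Longrightarrow> bracket L s c = \<zero>"
proof -
  note T' = torusD[OF T] and I' = lie_idealD[OF I]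
  note sI = subspaceD[OF I'(1)]
  have tc: "t \<in> carrier L" using T'(2) t by blast
  obtain A :: "'b set" and a j where A: "finite A" "\<And>v. v \<in> A \<Longrightarrow> a v \<in> carrier F" "\<And>v. v \<in> A \<Longrightarrow> 1 \<le> j v"
    "t = (\<Oplus>v\<in>A. a v \<odot> ppow t (j v))" by (rule torus_element_expand[OF T t]) (rule that)
  define g where "g v = a v \<odot> (bracket L t ^^ (p ^ j v - 1)) z" for v
  have gc: "g v \<in> carrier L" if "v \<in> A" for v
    unfolding g_def using A(2)[OF that] ad_pow_closed[OF tc z] by simp
  define w where "w = (\<Oplus>v\<in>A. g v)"
  have wc: "w \<in> carrier L" unfolding w_def by (rule M.finsum_closed) (use gc in auto)
  have pj: "p ^ j v = Suc (p ^ j v - 1)" if "v \<in> A" for v using two_le_p by simp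
  \<comment> \<open>The power (ad t)^(p^j) is ad of the j-th p-power of t. Summed over the expansion
    of t, this makes [t, w] equal to [t, z].\<close>
  have tg: "bracket L t (g v) = bracket L (a v \<odot> ppow t (j v)) z" if v: "v \<in> A" for v
  proof -
    have "bracket L t (g v) = a v \<odot> (bracket L t ^^ Suc (p ^ j v - 1)) z"
      unfolding g_def using A(2)[OF v] tc ad_pow_closed[OF tc z] by (simp add: bracket_smult_right)
    also have "\<dots> = a v \<odot> bracket L (ppow t (j v)) z"
      using bracket_ppow[OF tc z, of "j v"] pj[OF v] by simp
    finally show ?thesis using A(2)[OF v] ppow_closed[OF tc] z by (simp add: bracket_smult_left)
  qed
  have "bracket L t w = (\<Oplus>v\<in>A. bracket L t (g v))" unfolding w_def
    by (rule bracket_finsum_right[OF A(1) tc gc])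
  also have "\<dots> = (\<Oplus>v\<in>A. bracket L (a v \<odot> ppow t (j v)) z)"
    by (rule M.finsum_cong') (use tg A(2) z ppow_closed[OF tc] bracket_closed in auto)
  also have "\<dots> = bracket L (\<Oplus>v\<in>A. a v \<odot> ppow t (j v)) z"
    by (rule bracket_finsum_left[symmetric, OF A(1) z]) (use A(2) ppow_closed[OF tc] in auto)
  finally have tw: "bracket L t w = bracket L t z" using A(4) by simp
  have sub: "bracket L s (z \<ominus> w) = bracket L s z \<ominus> bracket L s w" if "s \<in> carrier L" for s
    using that z wc by (simp add: M.minus_eq bracket_add_right bracket_neg_right)
  \<comment> \<open>As \<open>j v\<close> is at least 1, the exponent \<open>p ^ j v - 1\<close> is
    positive, so every summand contains the bracket [t, z], which lies in \<open>I\<close>.\<close>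
  have wI: "w \<in> I" unfolding w_def
  proof (rule subspace_finsum[OF I'(1) A(1)])
    fix v assume v: "v \<in> A"
    have "p ^ 1 \<le> p ^ j v" by (rule power_increasing) (use A(3)[OF v] two_le_p in auto)
    then have "2 \<le> p ^ j v" using two_le_p by simp
    then have "p ^ j v - 1 = Suc (p ^ j v - 2)" by simp
    then have "(bracket L t ^^ (p ^ j v - 1)) z = (bracket L t ^^ (p ^ j v - 2)) (bracket L t z)"
      by (simp only: funpow_Suc_right o_apply)
    then show "g v \<in> I" unfolding g_def using sI(4)[OF A(2)[OF v]] ad_pow_ideal[OF I tc tz] by simp
  qed
  show thesis
  proof
    show "z \<ominus> w \<in> carrier L" using z wc by simp
    show "bracket L t (z \<ominus> w) = \<zero>" using sub[OF tc] tw bracket_closed[OF tc z] by (simp add: M.r_neg M.minus_eq)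
    have "z \<ominus> (z \<ominus> w) = (z \<oplus> \<ominus> z) \<oplus> w" using z wc by (simp only: M.minus_eq M.minus_add M.minus_minus M.a_assoc M.a_inv_closed)
    then show "z \<ominus> (z \<ominus> w) \<in> I" using wI wc z by (simp add: M.r_neg)
    fix s assume s: "s \<in> T" "bracket L s z = \<zero>"
    have sc: "s \<in> carrier L" using s T'(2) by blast
    have st: "bracket L s t = \<zero>" using T'(3) s t by (simp add: commuting_def)
    have "bracket L s (g v) = \<zero>" if v: "v \<in> A" for v
      unfolding g_def using bracket_ad_pow_zero[OF sc tc z st s(2)] A(2)[OF v] sc ad_pow_closed[OF tc z]
      by (simp add: bracket_smult_right)
    then have "(\<Oplus>v\<in>A. bracket L s (g v)) = (\<Oplus>v\<in>A. \<zero>)" by (intro M.finsum_cong') auto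
    moreover have "bracket L s w = (\<Oplus>v\<in>A. bracket L s (g v))" unfolding w_def
      by (rule bracket_finsum_right[OF A(1) sc gc])
    ultimately have "bracket L s w = \<zero>" by simp
    then show "bracket L s (z \<ominus> w) = \<zero>" using sub[OF sc] s(2) by (simp add: M.minus_eq)
  qed
qed

text \<open>The vectors of a basis of \<open>T\<close> are treated one after the other. Correcting
  the element for one of them changes it inside \<open>I\<close> only and keeps it centralized by
  the earlier ones, by the last clause of \<open>torus_element_split\<close>.\<close>

lemma torus_split:
  assumes fd: "fin_dim" and T: "torus F L T" and I: "lie_ideal I" and y: "y \<in> carrier L"
    and ty: "\<And>t. t \<in> T \<Longrightarrow> bracket L t y \<in> I"
  obtains c where "c \<in> carrier L" "y \<ominus> c \<in> I" "\<And>t. t \<in> T \<Longrightarrow> bracket L t c = \<zero>"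
proof -
  note T' = torusD[OF T] and I' = lie_idealD[OF I]
  note sI = subspaceD[OF I'(1)]
  obtain B where B: "finite B" "B \<subseteq> T" "span B = T" using subspace_basis[OF fd T'(1)] by metis
  have "\<exists>c. c \<in> carrier L \<and> y \<ominus> c \<in> I \<and> (\<forall>t\<in>B'. bracket L t c = \<zero>)" if "B' \<subseteq> T" "finite B'" for B'
    using that(2,1)
  proof (induction B' rule: finite_induct)
    case empty
    have "y \<ominus> y = \<zero>" unfolding M.minus_eq by (rule M.r_neg[OF y])
    then show ?case using y sI(2) by (intro exI[of _ y]) (simp only: empty_iff ball_empty)
  next
    case (insert t B')
    then obtain c where c: "c \<in> carrier L" "y \<ominus> c \<in> I" "\<forall>t\<in>B'. bracket L t c = \<zero>" by auto
    have t: "t \<in> T" and tc: "t \<in> carrier L" using insert.prems T'(2) by auto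
    have "bracket L t y \<ominus> bracket L t (y \<ominus> c) = bracket L t c"
    proof -
      have "bracket L t (y \<ominus> c) = bracket L t y \<oplus> \<ominus> bracket L t c"
        using c y tc by (simp add: M.minus_eq bracket_add_right bracket_neg_right)
      then show ?thesis using bracket_closed[OF tc y] bracket_closed[OF tc c(1)]
        by (simp add: M.minus_eq M.minus_add M.r_neg flip: M.a_assoc)
    qed
    moreover have "bracket L t y \<ominus> bracket L t (y \<ominus> c) \<in> I"
      unfolding M.minus_eq[of "bracket L t y"] by (rule sI(3)[OF ty[OF t] sI(5)[OF I'(3)[OF tc c(2)]]])
    ultimately have "bracket L t c \<in> I" by simp
    then obtain d where d: "d \<in> carrier L" "bracket L t d = \<zero>" "c \<ominus> d \<in> I"
      "\<And>s. s \<in> T \<Longrightarrow> bracket L s c = \<zero> \<Longrightarrow> bracket L s d = \<zero>"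
      using torus_element_split[OF T t I c(1)] by metis
    have "y \<ominus> d = (y \<ominus> c) \<oplus> (c \<ominus> d)"
      using y c(1) d(1) by (simp add: M.minus_eq M.a_assoc M.r_neg2 M.r_neg1)
    then have "y \<ominus> d \<in> I" using sI(3)[OF c(2) d(3)] by simp
    moreover have "bracket L s d = \<zero>" if "s \<in> insert t B'" for s
      using that d(2) d(4)[of s] c(3) insert.prems by auto
    ultimately show ?case using d(1) by blast
  qed
  from this[OF B(2,1)] obtain c where c: "c \<in> carrier L" "y \<ominus> c \<in> I" "\<forall>t\<in>B. bracket L t c = \<zero>" by auto
  have Bc: "B \<subseteq> carrier L" using B(2) T'(2) by blast
  have cb: "bracket L c t = \<zero>" if "t \<in> B" for t using bracket_swap[of t c] c that Bc by auto
  have "bracket L t c = \<zero>" if t: "t \<in> T" for t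
  proof -
    have "bracket L c t = \<zero>" by (rule span_centralizes[OF c(1) Bc cb]) (use t B(3) in simp_all)
    then show ?thesis using bracket_swap[of c t] c(1) t T'(2) by auto
  qed
  then show thesis using that c by blast
qed

lemma ppow_ideal: "p_ideal I \<Longrightarrow> x \<in> I \<Longrightarrow> ppow x k \<in> I"
  by (induction k) (simp_all add: p_ideal_def)

text \<open>Write x = y + i with i in \<open>I\<close>. As [y, i] lies in \<open>I\<close>, the
  p-map is additive on this sum modulo \<open>I\<close>, and i^[p] lies in \<open>I\<close>.\<close>

lemma ppow_cong_ideal:
  assumes I: "p_ideal I" and x: "x \<in> carrier L" and y: "y \<in> carrier L" and xy: "x \<ominus> y \<in> I"
  shows "ppow x k \<ominus> ppow y k \<in> I"
proof (induction k)
  case (Suc k)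
  have lI: "lie_ideal I" using I by (simp add: p_ideal_def)
  note I' = lie_idealD[OF lI]
  note sI = subspaceD[OF I'(1)]
  let ?x = "ppow x k" and ?y = "ppow y k"
  let ?i = "?x \<ominus> ?y"
  have c: "?x \<in> carrier L" "?y \<in> carrier L" "?i \<in> carrier L" using ppow_closed x y by auto
  have e: "?y \<oplus> ?i = ?x" using c(1,2) by (metis M.minus_eq M.a_comm M.r_neg1 M.a_inv_closed M.minus_minus M.a_assoc M.l_neg M.r_zero)
  obtain z where z: "z \<in> I" "pmap L (?y \<oplus> ?i) = pmap L ?y \<oplus> pmap L ?i \<oplus> z"
    using pmap_add_mod[OF lI c(2,3) I'(3)[OF c(2) Suc]] .
  have pi: "pmap L ?i \<in> I" using I Suc by (simp add: p_ideal_def)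
  have s: "pmap L ?i \<oplus> z \<in> I" by (rule sI(3)[OF pi z(1)])
  have cc: "pmap L ?y \<in> carrier L" "pmap L ?i \<in> carrier L" "z \<in> carrier L" using c pmap_closed z I'(2) by auto
  have "pmap L ?x = pmap L ?y \<oplus> (pmap L ?i \<oplus> z)" using z(2) e cc by (simp add: M.a_assoc)
  then have "pmap L ?x \<ominus> pmap L ?y = pmap L ?i \<oplus> z"
    using cc by (simp add: M.minus_eq M.a_comm[of "pmap L ?y"] M.a_assoc M.r_neg)
  then show ?case using s by simp
qed (simp add: xy)

text \<open>Modulo \<open>I\<close> the p-map is semilinear on \<open>J\<close>, and by
  \<open>gen\<close> its image spans \<open>J\<close>. So it turns spanning sets into spanning sets,
  and this can be iterated.\<close>

lemma toral_step_span:
  assumes I: "p_ideal I" and J: "p_ideal J" and IJ: "I \<subseteq> J"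
    and JJ: "\<And>x y. x \<in> J \<Longrightarrow> y \<in> J \<Longrightarrow> bracket L x y \<in> I" and gen: "J \<subseteq> span (I \<union> pmap L ` J)"
    and Y: "Y \<subseteq> J" "J \<subseteq> span Y"
  shows "J \<subseteq> span (I \<union> (\<lambda>y. ppow y m) ` Y)"
proof (induction m)
  case 0
  have "span Y \<subseteq> span (I \<union> Y)" by (rule span_mono) simp
  then show ?case using Y(2) by simp
next
  case (Suc m)
  have lI: "lie_ideal I" and lJ: "lie_ideal J" using I J by (simp_all add: p_ideal_def)
  note J' = lie_idealD[OF lJ]
  let ?G = "I \<union> (\<lambda>y. ppow y (Suc m)) ` Y"
  have Gc: "?G \<subseteq> carrier L" using IJ J'(2) Y(1) ppow_ideal[OF J] by blast
  let ?W = "span ?G"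
  have W: "subspace F ?W L" by (rule span_is_subspace[OF Gc])
  have GW: "?G \<subseteq> ?W" by (rule span_superset[OF Gc])
  have s: "subspace F {x \<in> J. pmap L x \<in> ?W} L"
    by (rule pmap_preimage_subspace[OF lI W _ J'(1) JJ]) (use GW in auto)
  have "I \<union> (\<lambda>y. ppow y m) ` Y \<subseteq> {x \<in> J. pmap L x \<in> ?W}"
  proof
    fix v assume "v \<in> I \<union> (\<lambda>y. ppow y m) ` Y"
    then consider "v \<in> I" | y where "y \<in> Y" "v = ppow y m" by blast
    then show "v \<in> {x \<in> J. pmap L x \<in> ?W}"
    proof cases
      case 1
      then have "pmap L v \<in> I" using I by (simp add: p_ideal_def)
      then show ?thesis using 1 IJ GW by auto
    next
      case 2
      then have "pmap L v \<in> ?G" by auto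
      then show ?thesis using 2 GW Y(1) ppow_ideal[OF J] by auto
    qed
  qed
  then have "span (I \<union> (\<lambda>y. ppow y m) ` Y) \<subseteq> {x \<in> J. pmap L x \<in> ?W}" by (rule span_subset[OF s])
  then have "pmap L ` J \<subseteq> ?W" using Suc by auto
  then have "I \<union> pmap L ` J \<subseteq> ?W" using GW by simp
  then have "span (I \<union> pmap L ` J) \<subseteq> ?W" by (rule span_subset[OF W])
  then show ?case using gen by simp
qed

text \<open>Up to an element of \<open>I\<close>, each y in \<open>J\<close> can be replaced by one
  that centralizes \<open>T\<close>, whose high p-th powers lie in \<open>T\<close> by maximality.
  So high p-th powers of elements of \<open>J\<close> lie in \<open>I\<close> + \<open>T\<close>,
  and by \<open>toral_step_span\<close> they span \<open>J\<close> modulo \<open>I\<close>.\<close>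

lemma toral_step_in_max_torus:
  assumes fd: "fin_dim" and T: "torus F L T" and max: "\<And>T'. torus F L T' \<Longrightarrow> sdim T' \<le> sdim T"
    and I: "p_ideal I" and J: "p_ideal J" and IJ: "I \<subseteq> J"
    and LJ: "\<forall>x\<in>carrier L. \<forall>y\<in>J. bracket L x y \<in> I" and gen: "J \<subseteq> span (I \<union> pmap L ` J)"
    and x: "x \<in> J"
  obtains i t where "i \<in> I" "t \<in> T" "x = i \<oplus> t"
proof -
  note T' = torusD[OF T]
  have lI: "lie_ideal I" and lJ: "lie_ideal J" using I J by (simp_all add: p_ideal_def)
  note I' = lie_idealD[OF lI] and J' = lie_idealD[OF lJ]
  let ?S = "{i \<oplus> t | i t. i \<in> I \<and> t \<in> T}"
  have S: "subspace F ?S L" by (rule subspace_add_set[OF I'(1) T'(1)])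
  obtain Y where Y: "finite Y" "Y \<subseteq> J" "span Y = J" using subspace_basis[OF fd J'(1)] by metis
  have ev: "\<exists>N. \<forall>m\<ge>N. ppow y m \<in> ?S" if y: "y \<in> J" for y
  proof -
    have yc: "y \<in> carrier L" using y J'(2) by blast
    have ty: "bracket L t y \<in> I" if "t \<in> T" for t using LJ y that T'(2) by blast
    obtain c where c: "c \<in> carrier L" "y \<ominus> c \<in> I" "\<And>t. t \<in> T \<Longrightarrow> bracket L t c = \<zero>"
      by (rule torus_split[OF fd T lI yc ty]) (assumption | rule that)+
    obtain N where N: "\<And>m. N \<le> m \<Longrightarrow> ppow c m \<in> T"
      by (rule ppow_in_max_torus[OF fd T max c(1) c(3)]) (assumption | rule that)+
    have "ppow y m \<in> ?S" if m: "N \<le> m" for m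
    proof -
      have "ppow y m = (ppow y m \<ominus> ppow c m) \<oplus> ppow c m"
        using ppow_closed[OF yc] ppow_closed[OF c(1)] by (simp add: M.minus_eq M.a_assoc M.l_neg)
      then show ?thesis using ppow_cong_ideal[OF I yc c(1,2)] N[OF m] by blast
    qed
    then show ?thesis by blast
  qed
  \<comment> \<open>One exponent must serve all vectors of the basis, since
    \<open>toral_step_span\<close> raises them to the same power.\<close>
  have "\<exists>N. \<forall>y\<in>Y'. \<forall>m\<ge>N. ppow y m \<in> ?S" if "finite Y'" "Y' \<subseteq> J" for Y'
    using that
  proof (induction Y' rule: finite_induct)
    case (insert y Y')
    then obtain N N' where N: "\<forall>y\<in>Y'. \<forall>m\<ge>N. ppow y m \<in> ?S" and N': "\<forall>m\<ge>N'. ppow y m \<in> ?S"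
      using ev[of y] by (meson insert_subset)
    have "\<forall>z\<in>insert y Y'. \<forall>m\<ge>max N N'. ppow z m \<in> ?S"
    proof (intro ballI allI impI)
      fix z m assume z: "z \<in> insert y Y'" and m: "max N N' \<le> m"
      have "N \<le> m" "N' \<le> m" using m by simp_all
      then show "ppow z m \<in> ?S" using z N N' by (elim insertE) (simp_all only: mp)
    qed
    then show ?case by (rule exI)
  qed simp
  from this[OF Y(1,2)] obtain N where N: "\<forall>y\<in>Y. \<forall>m\<ge>N. ppow y m \<in> ?S" by (elim exE)
  have "I \<subseteq> ?S"
  proof
    fix i assume i: "i \<in> I"
    have "i = i \<oplus> \<zero>" using i I'(2) by auto
    then show "i \<in> ?S" using i subspaceD(2)[OF T'(1)] by blast
  qed
  moreover have "(\<lambda>y. ppow y N) ` Y \<subseteq> ?S"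
  proof
    fix v assume "v \<in> (\<lambda>y. ppow y N) ` Y"
    then obtain y where "y \<in> Y" "v = ppow y N" by (elim imageE)
    then show "v \<in> ?S" using N by (simp only: order_refl)
  qed
  ultimately have "span (I \<union> (\<lambda>y. ppow y N) ` Y) \<subseteq> ?S" by (intro span_subset[OF S] Un_least)
  moreover have "J \<subseteq> span (I \<union> (\<lambda>y. ppow y N) ` Y)"
    by (rule toral_step_span[OF I J IJ _ gen Y(2)]) (use LJ J'(2) Y(3) in auto)
  ultimately have "x \<in> ?S" using x by (meson subsetD)
  then show thesis using that by (elim CollectE exE conjE)
qed

end

section \<open>Left ideals of the enveloping algebra\<close>

context ring
begin

text \<open>The left ideal generated by \<open>S\<close>, as an inductive set so that proofs can add
  one multiple of a generator at a time.\<close>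

inductive_set lspan :: "'a set \<Rightarrow> 'a set" for S where
  zero: "\<zero> \<in> lspan S"
| add: "a \<in> carrier R \<Longrightarrow> x \<in> S \<Longrightarrow> u \<in> lspan S \<Longrightarrow> a \<otimes> x \<oplus> u \<in> lspan S"

definition left_ideal :: "'a set \<Rightarrow> bool" where
  "left_ideal N \<longleftrightarrow> N \<subseteq> carrier R \<and> \<zero> \<in> N \<and> (\<forall>x\<in>N. \<forall>y\<in>N. x \<oplus> y \<in> N) \<and> (\<forall>a\<in>carrier R. \<forall>x\<in>N. a \<otimes> x \<in> N)"

lemma left_idealD:
  assumes "left_ideal N"
  shows "N \<subseteq> carrier R" "\<zero> \<in> N" "\<And>x y. x \<in> N \<Longrightarrow> y \<in> N \<Longrightarrow> x \<oplus> y \<in> N"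
    "\<And>a x. a \<in> carrier R \<Longrightarrow> x \<in> N \<Longrightarrow> a \<otimes> x \<in> N"
  using assms by (auto simp: left_ideal_def)

lemma lspan_subset:
  assumes "left_ideal N" "S \<subseteq> N" shows "lspan S \<subseteq> N"
proof
  fix u assume "u \<in> lspan S" then show "u \<in> N"
    by induction (use assms left_idealD[OF assms(1)] in auto)
qed

lemma lspan_closed: "S \<subseteq> carrier R \<Longrightarrow> lspan S \<subseteq> carrier R"
  by (rule lspan_subset) (auto simp: left_ideal_def)

lemma lspan_add:
  assumes S: "S \<subseteq> carrier R" and u: "u \<in> lspan S" and v: "v \<in> lspan S"
  shows "u \<oplus> v \<in> lspan S"
  using u
proof induction
  case zero
  show ?case using v lspan_closed[OF S] by auto
next
  case (add a x u)
  have "a \<otimes> x \<oplus> u \<oplus> v = a \<otimes> x \<oplus> (u \<oplus> v)"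
    using add lspan_closed[OF S] S v by (intro a_assoc) auto
  then show ?case using lspan.add[OF add(1,2) add.IH] by simp
qed

lemma lspan_mult:
  assumes S: "S \<subseteq> carrier R" and c: "c \<in> carrier R" and u: "u \<in> lspan S"
  shows "c \<otimes> u \<in> lspan S"
  using u
proof induction
  case zero
  show ?case using c lspan.zero by simp
next
  case (add a x u)
  have "c \<otimes> (a \<otimes> x \<oplus> u) = (c \<otimes> a) \<otimes> x \<oplus> c \<otimes> u"
    using add lspan_closed[OF S] S c by (simp add: r_distr m_assoc subset_iff)
  then show ?case using lspan.add[OF _ add(2) add.IH, of "c \<otimes> a"] add(1) c by simp
qed

lemma lspan_left_ideal: "S \<subseteq> carrier R \<Longrightarrow> left_ideal (lspan S)"
  unfolding left_ideal_def by (intro conjI ballI lspan_closed lspan_add lspan_mult lspan.zero)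

lemma lspan_gen:
  assumes "S \<subseteq> carrier R" "x \<in> S" shows "x \<in> lspan S"
  using lspan.add[OF one_closed assms(2) lspan.zero] assms by auto

lemma lspan_mult_right:
  assumes S: "S \<subseteq> carrier R" and N: "left_ideal N" and c: "c \<in> carrier R"
    and g: "\<And>x. x \<in> S \<Longrightarrow> x \<otimes> c \<in> N" and u: "u \<in> lspan S"
  shows "u \<otimes> c \<in> N"
  using u
proof induction
  case zero
  show ?case using c left_idealD(2)[OF N] by simp
next
  case (add a x u)
  have "(a \<otimes> x \<oplus> u) \<otimes> c = a \<otimes> (x \<otimes> c) \<oplus> u \<otimes> c"
    using add lspan_closed[OF S] S c by (simp add: l_distr m_assoc subset_iff)
  then show ?case using left_idealD(3)[OF N left_idealD(4)[OF N add(1) g[OF add(2)]] add.IH] by simp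
qed

end

text \<open>What is used of u(L,0): the p-map relation, generation by the scalars and
  \<open>L\<close>, and the augmentation. Generation is phrased as an induction principle: an
  additively closed set containing 0 and all scaled monomials is everything.\<close>

locale restricted_envelope = lie_envelope F L p A \<sigma> \<iota>
  for F and L :: "('a, 'b, 'c) restricted_lie_scheme" and p and A :: "('r, 'e) ring_scheme" (structure)
    and \<sigma> :: "'a \<Rightarrow> 'r" and \<iota> :: "'b \<Rightarrow> 'r" +
  fixes \<epsilon> :: "'r \<Rightarrow> 'a"
  assumes iota_pow: "x \<in> carrier L \<Longrightarrow> \<iota> x [^] p = \<iota> (pmap L x)"
    and generated: "\<zero> \<in> G \<Longrightarrow> (\<And>c d. c \<in> G \<Longrightarrow> d \<in> G \<Longrightarrow> c \<oplus> d \<in> G) \<Longrightarrow>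
      (\<And>a xs. a \<in> carrier F \<Longrightarrow> set xs \<subseteq> carrier L \<Longrightarrow> \<sigma> a \<otimes> iprod xs \<in> G) \<Longrightarrow> carrier A \<subseteq> G"
    and eps_hom: "\<epsilon> \<in> ring_hom A F"
    and eps_sigma: "a \<in> carrier F \<Longrightarrow> \<epsilon> (\<sigma> a) = a"
    and eps_iota: "x \<in> carrier L \<Longrightarrow> \<epsilon> (\<iota> x) = \<zero>\<^bsub>F\<^esub>"
begin

abbreviation "lideal I \<equiv> A.lspan (\<iota> ` I)"

lemma iota_image_closed: "I \<subseteq> carrier L \<Longrightarrow> \<iota> ` I \<subseteq> carrier A"
  using iota_closed by blast

lemma lideal_left: "I \<subseteq> carrier L \<Longrightarrow> A.left_ideal (lideal I)"
  by (rule A.lspan_left_ideal[OF iota_image_closed])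

lemma lideal_closed: "I \<subseteq> carrier L \<Longrightarrow> lideal I \<subseteq> carrier A"
  by (rule A.lspan_closed[OF iota_image_closed])

lemma lideal_gen: "I \<subseteq> carrier L \<Longrightarrow> x \<in> I \<Longrightarrow> \<iota> x \<in> lideal I"
  by (rule A.lspan_gen[OF iota_image_closed]) simp_all

lemma iota_commute:
  assumes "x \<in> carrier L" "y \<in> carrier L"
  shows "\<iota> y \<otimes> \<iota> x = \<iota> x \<otimes> \<iota> y \<oplus> \<iota> (bracket L y x)"
proof -
  have c: "\<iota> y \<otimes> \<iota> x \<in> carrier A" "\<iota> x \<otimes> \<iota> y \<in> carrier A" using assms iota_closed by auto
  have "\<iota> x \<otimes> \<iota> y \<oplus> (\<iota> y \<otimes> \<iota> x \<ominus> \<iota> x \<otimes> \<iota> y) = \<iota> y \<otimes> \<iota> x"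
    using c by (simp add: A.minus_eq A.a_comm[of "\<iota> y \<otimes> \<iota> x"] A.r_neg2 flip: A.a_assoc) (simp add: A.r_neg)
  then show ?thesis using iota_bracket[OF assms(2,1)] by simp
qed

text \<open>A letter y of \<open>I\<close> can be moved to the right end, since y x = x y + [y, x]
  and the bracket lies in \<open>I\<close> again. So the left ideal generated by an ideal of
  \<open>L\<close> is two-sided.\<close>

lemma lideal_mult_right:
  assumes I: "lie_ideal I" and u: "u \<in> lideal I" and c: "c \<in> carrier A"
  shows "u \<otimes> c \<in> lideal I"
proof -
  note I' = lie_idealD[OF I]
  have ic: "\<iota> ` I \<subseteq> carrier A" by (rule iota_image_closed[OF I'(2)])
  note N = A.left_idealD[OF lideal_left[OF I'(2)]]
  have mon: "\<iota> y \<otimes> iprod xs \<in> lideal I" if "set xs \<subseteq> carrier L" "y \<in> I" for xs y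
    using that
  proof (induction xs arbitrary: y)
    case Nil
    have "\<iota> y \<in> lideal I" by (rule lideal_gen[OF I'(2) Nil(2)])
    then show ?case using N(1) by auto
  next
    case (Cons x xs)
    have c: "\<iota> y \<in> carrier A" "\<iota> x \<in> carrier A" "iprod xs \<in> carrier A" "y \<in> carrier L" "x \<in> carrier L"
      using Cons.prems I'(2) iota_closed iprod_closed by auto
    have b: "bracket L y x \<in> I" by (rule I'(4)[OF c(5) Cons.prems(2)])
    have bc: "\<iota> (bracket L y x) \<in> carrier A" using b I'(2) iota_closed by blast
    have "\<iota> y \<otimes> iprod (x # xs) = (\<iota> y \<otimes> \<iota> x) \<otimes> iprod xs" using c by (simp add: A.m_assoc)
    also have "\<dots> = \<iota> x \<otimes> (\<iota> y \<otimes> iprod xs) \<oplus> \<iota> (bracket L y x) \<otimes> iprod xs"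
      unfolding iota_commute[OF c(5,4)] using c bc by (simp add: A.l_distr A.m_assoc)
    finally show ?case
      using N(3)[OF N(4)[OF c(2) Cons.IH[OF _ Cons.prems(2)]] Cons.IH[OF _ b]] Cons.prems(1) by simp
  qed
  have "\<iota> y \<otimes> c \<in> lideal I" if y: "y \<in> I" for y
  proof -
    have yc: "\<iota> y \<in> carrier A" "y \<in> carrier L" using y I'(2) iota_closed by auto
    have "carrier A \<subseteq> {c \<in> carrier A. \<iota> y \<otimes> c \<in> lideal I}"
    proof (rule generated)
      show "\<zero> \<in> {c \<in> carrier A. \<iota> y \<otimes> c \<in> lideal I}" using yc N(2) by simp
      show "c \<oplus> d \<in> {c \<in> carrier A. \<iota> y \<otimes> c \<in> lideal I}"
        if "c \<in> {c \<in> carrier A. \<iota> y \<otimes> c \<in> lideal I}" "d \<in> {c \<in> carrier A. \<iota> y \<otimes> c \<in> lideal I}" for c d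
        using that yc N(3) by (simp add: A.r_distr)
      fix a xs assume a: "a \<in> carrier F" and xs: "set xs \<subseteq> carrier L"
      have ac: "\<sigma> a \<in> carrier A" "iprod xs \<in> carrier A" using a xs sigma_closed iprod_closed by auto
      have "\<iota> y \<otimes> (\<sigma> a \<otimes> iprod xs) = \<sigma> a \<otimes> (\<iota> y \<otimes> iprod xs)"
        using ac yc iota_central[OF a yc(2)] by (simp flip: A.m_assoc)
      then show "\<sigma> a \<otimes> iprod xs \<in> {c \<in> carrier A. \<iota> y \<otimes> c \<in> lideal I}"
        using N(4)[OF ac(1) mon[OF xs y]] ac by simp
    qed
    then show ?thesis using c by blast
  qed
  then show ?thesis
    by (intro A.lspan_mult_right[OF ic lideal_left[OF I'(2)] c _ u]) auto
qed

lemma lideal_span: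
  assumes Y: "Y \<subseteq> carrier L" shows "lideal (span Y) \<subseteq> lideal Y"
proof (rule A.lspan_subset[OF lideal_left[OF Y]])
  note N = A.left_idealD[OF lideal_left[OF Y]]
  have "subspace F {x \<in> carrier L. \<iota> x \<in> lideal Y} L"
    by (rule subspaceI) (use N sigma_closed in \<open>auto simp: iota_zero iota_add iota_smult\<close>)
  moreover have "Y \<subseteq> {x \<in> carrier L. \<iota> x \<in> lideal Y}" using Y lideal_gen[OF Y] by auto
  ultimately have "span Y \<subseteq> {x \<in> carrier L. \<iota> x \<in> lideal Y}" by (rule span_subset)
  then show "\<iota> ` span Y \<subseteq> lideal Y" by auto
qed

text \<open>Two-sidedness absorbs the coefficient between two factors: v a is again a left
  combination of letters of \<open>Y\<close>, and each of these letters joins a product of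
  \<open>m\<close> letters.\<close>

lemma lideal_pow:
  assumes J: "lie_ideal J" and Y: "span Y = J" "Y \<subseteq> J" and v: "v \<in> lideal J"
  shows "v [^] (m::nat) \<in> A.lspan {iprod ys | ys. set ys \<subseteq> Y \<and> length ys = m}"
proof (induction m)
  case 0
  have "\<one> \<in> {iprod ys | ys. set ys \<subseteq> Y \<and> length ys = 0}" by auto
  then show ?case by (simp add: A.lspan_gen)
next
  case (Suc m)
  note J' = lie_idealD[OF J]
  have Yc: "Y \<subseteq> carrier L" using Y(2) J'(2) by blast
  let ?P = "\<lambda>m. {iprod ys | ys. set ys \<subseteq> Y \<and> length ys = m}"
  have Pc: "?P m \<subseteq> carrier A" for m using iprod_closed Yc by auto
  have vc: "v \<in> carrier A" using v lideal_closed[OF J'(2)] by blast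
  note N = A.left_idealD[OF A.lspan_left_ideal[OF Pc]]
  have "v \<otimes> u \<in> A.lspan (?P (Suc m))" if "u \<in> A.lspan (?P m)" for u
    using that
  proof induction
    case zero
    show ?case using vc N(2) by simp
  next
    case (add a x u)
    obtain zs where zs: "x = iprod zs" "set zs \<subseteq> Y" "length zs = m" using add(2) by blast
    have xc: "x \<in> carrier A" by (rule subsetD[OF Pc add(2)])
    have uc: "u \<in> carrier A" by (rule subsetD[OF N(1) add(3)])
    have "v \<otimes> a \<in> lideal Y"
      using lideal_mult_right[OF J v add(1)] lideal_span[OF Yc] Y(1) by auto
    then have "(v \<otimes> a) \<otimes> x \<in> A.lspan (?P (Suc m))"
    proof (rule A.lspan_mult_right[OF iota_image_closed[OF Yc] A.lspan_left_ideal[OF Pc] xc, rotated])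
      fix w assume "w \<in> \<iota> ` Y"
      then obtain y where y: "w = \<iota> y" "y \<in> Y" by blast
      have "w \<otimes> x \<in> ?P (Suc m)" using y zs by (intro CollectI exI[of _ "y # zs"]) simp
      then show "w \<otimes> x \<in> A.lspan (?P (Suc m))" by (rule A.lspan_gen[OF Pc])
    qed
    moreover have "v \<otimes> (a \<otimes> x \<oplus> u) = (v \<otimes> a) \<otimes> x \<oplus> v \<otimes> u"
      using vc add(1) xc uc by (simp add: A.r_distr A.m_assoc)
    ultimately show ?case using N(3) add.IH by simp
  qed
  from this[OF Suc] show ?case using A.nat_pow_Suc2[OF vc] by simp
qed

text \<open>Modulo \<open>I\<close> the letters from \<open>J\<close> commute with \<open>y\<close>, so the occurrences of \<open>y\<close> can be moved to the right end.\<close>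

lemma iprod_collect:
  assumes I: "lie_ideal I" and J: "J \<subseteq> carrier L" and y: "y \<in> J"
    and JJ: "\<And>x. x \<in> J \<Longrightarrow> bracket L y x \<in> I"
    and xs: "set xs \<subseteq> J" "k \<le> count_list xs y"
  shows "iprod xs \<in> A.lspan (insert (\<iota> y [^] k) (\<iota> ` I))"
proof -
  note I' = lie_idealD[OF I]
  have yc: "y \<in> carrier L" "\<iota> y \<in> carrier A" using y J iota_closed by auto
  let ?X = "\<lambda>k. insert (\<iota> y [^] (k::nat)) (\<iota> ` I)"
  have Xc: "?X k \<subseteq> carrier A" for k using yc iota_image_closed[OF I'(2)] by auto
  have li: "A.left_ideal (A.lspan (?X k))" for k by (rule A.lspan_left_ideal[OF Xc])
  note N = A.left_idealD[OF li]
  have lS: "lideal I \<subseteq> A.lspan (?X k)" for k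
    by (rule A.lspan_subset[OF li]) (use A.lspan_gen[OF Xc] in auto)
  have gen: "\<iota> y [^] k \<in> A.lspan (?X k)" for k by (rule A.lspan_gen[OF Xc]) simp
  have I_right: "w \<otimes> c \<in> A.lspan (?X k)" if "w \<in> \<iota> ` I" "c \<in> carrier A" for w c k
    using lideal_mult_right[OF I A.lspan_gen[OF iota_image_closed[OF I'(2)] that(1)] that(2)] lS by blast
  have step_y: "u \<otimes> \<iota> y \<in> A.lspan (?X (Suc k))" if "u \<in> A.lspan (?X k)" for u k
  proof (rule A.lspan_mult_right[OF Xc li yc(2) _ that])
    fix w assume "w \<in> ?X k"
    then show "w \<otimes> \<iota> y \<in> A.lspan (?X (Suc k))"
    proof (rule insertE)
      show ?thesis if "w = \<iota> y [^] k" unfolding that using gen[of "Suc k"] by simp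
      show ?thesis if "w \<in> \<iota> ` I" by (rule I_right[OF that yc(2)])
    qed
  qed
  have step_x: "u \<otimes> \<iota> x \<in> A.lspan (?X k)" if "u \<in> A.lspan (?X k)" "x \<in> J" for u x k
  proof -
    have xc: "x \<in> carrier L" "\<iota> x \<in> carrier A" using that(2) J iota_closed by auto
    have p: "\<iota> y [^] k \<otimes> \<iota> x \<in> A.lspan (?X k)" for k
    proof (induction k)
      case 0
      have "\<iota> x \<otimes> \<one> \<in> A.lspan (?X 0)" using N(4)[OF xc(2) gen[of 0]] by simp
      then show ?case using xc by simp
    next
      case (Suc k)
      have b: "bracket L y x \<in> I" by (rule JJ[OF that(2)])
      have bc: "\<iota> (bracket L y x) \<in> carrier A" using b I'(2) iota_closed by blast
      have pc: "\<iota> y [^] k \<in> carrier A" using yc by simp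
      have "\<iota> y [^] Suc k \<otimes> \<iota> x = \<iota> y [^] k \<otimes> (\<iota> y \<otimes> \<iota> x)" using xc yc by (simp add: A.m_assoc)
      also have "\<dots> = (\<iota> y [^] k \<otimes> \<iota> x) \<otimes> \<iota> y \<oplus> \<iota> y [^] k \<otimes> \<iota> (bracket L y x)"
        unfolding iota_commute[OF xc(1) yc(1)] using xc yc bc pc by (simp add: A.r_distr A.m_assoc)
      finally show ?case
        using N(3)[OF step_y[OF Suc] N(4)[OF pc subsetD[OF lS lideal_gen[OF I'(2) b]]]] by simp
    qed
    show ?thesis
    proof (rule A.lspan_mult_right[OF Xc li xc(2) _ that(1)])
      show "w \<otimes> \<iota> x \<in> A.lspan (?X k)" if "w \<in> ?X k" for w
        using that I_right[OF _ xc(2)] p by auto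
    qed
  qed
  show ?thesis using xs
  proof (induction xs arbitrary: k rule: rev_induct)
    case Nil
    then show ?case using gen[of 0] by simp
  next
    case (snoc x xs)
    have c: "set xs \<subseteq> carrier L" "x \<in> carrier L" using snoc.prems J by auto
    have e: "iprod (xs @ [x]) = iprod xs \<otimes> \<iota> x"
      using iprod_append[of xs "[x]"] c iota_closed iprod_closed by simp
    show ?case
    proof (cases k)
      case 0
      have "iprod (xs @ [x]) \<otimes> \<iota> y [^] k \<in> A.lspan (?X k)"
        by (rule N(4)[OF _ gen]) (use c in \<open>simp add: iprod_closed\<close>)
      moreover have "iprod (xs @ [x]) \<in> carrier A" using c by (simp add: iprod_closed)
      ultimately show ?thesis using 0 by simp
    next
      case k: (Suc k')
      show ?thesis
      proof (cases "x = y")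
        case True
        have "iprod xs \<in> A.lspan (?X k')" by (rule snoc.IH) (use snoc.prems k True in auto)
        then have "iprod xs \<otimes> \<iota> y \<in> A.lspan (?X (Suc k'))" by (rule step_y)
        then show ?thesis unfolding k using e True by simp
      next
        case False
        have "iprod xs \<in> A.lspan (?X k)" by (rule snoc.IH) (use snoc.prems False in auto)
        then show ?thesis unfolding e by (rule step_x) (use snoc.prems in simp)
      qed
    qed
  qed
qed

text \<open>By the pigeonhole principle a product of \<open>Suc (card Y * (p - 1))\<close> letters
  from \<open>Y\<close> contains some y at least \<open>p\<close> times. Collecting these
  occurrences gives y^p, which is the image of y^[p] and so comes from \<open>I\<close>.\<close>

lemma nil_step:
  assumes I: "lie_ideal I" and J: "lie_ideal J" and Y: "finite Y" "Y \<subseteq> J" "span Y = J"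
    and JJ: "\<forall>x\<in>J. \<forall>y\<in>J. bracket L x y \<in> I" and pJ: "\<forall>x\<in>J. pmap L x \<in> I"
    and v: "v \<in> lideal J"
  shows "v [^] Suc (card Y * (p - 1)) \<in> lideal I"
proof -
  note I' = lie_idealD[OF I] and J' = lie_idealD[OF J]
  let ?m = "Suc (card Y * (p - 1))"
  have "{iprod ys | ys. set ys \<subseteq> Y \<and> length ys = ?m} \<subseteq> lideal I"
  proof
    fix w assume "w \<in> {iprod ys | ys. set ys \<subseteq> Y \<and> length ys = ?m}"
    then obtain ys where ys: "w = iprod ys" "set ys \<subseteq> Y" "length ys = ?m" by blast
    have "\<exists>y\<in>Y. p \<le> count_list ys y"
    proof (rule ccontr)
      assume "\<not> ?thesis"
      then have "count_list ys y \<le> p - 1" if "y \<in> Y" for y using that by force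
      then have "sum (count_list ys) Y \<le> card Y * (p - 1)" using sum_bounded_above[of Y "count_list ys" "p - 1"] by simp
      moreover have "sum (count_list ys) Y = length ys" by (rule sum_count_set[OF ys(2) Y(1)])
      ultimately show False using ys(3) by simp
    qed
    then obtain y where y: "y \<in> Y" "p \<le> count_list ys y" by blast
    have yJ: "y \<in> J" and yc: "y \<in> carrier L" using y Y(2) J'(2) by auto
    have "w \<in> A.lspan (insert (\<iota> y [^] p) (\<iota> ` I))" unfolding ys(1)
      by (rule iprod_collect[OF I J'(2) yJ]) (use JJ yJ ys(2) Y(2) y(2) in auto)
    moreover have "insert (\<iota> y [^] p) (\<iota> ` I) = \<iota> ` I" using iota_pow[OF yc] pJ yJ by auto
    ultimately show "w \<in> lideal I" by simp
  qed
  then have "A.lspan {iprod ys | ys. set ys \<subseteq> Y \<and> length ys = ?m} \<subseteq> lideal I"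
    by (rule A.lspan_subset[OF lideal_left[OF I'(2)]])
  then show ?thesis using lideal_pow[OF J Y(3,2) v] by blast
qed

text \<open>Locality of \<open>Ae\<close>.\<close>

lemma tower_nakayama:
  assumes fd: "fin_dim" and T: "torus F L T" and max: "\<And>T'. torus F L T' \<Longrightarrow> sdim T' \<le> sdim T"
    and e: "e \<in> carrier A" "\<And>t. t \<in> T \<Longrightarrow> \<iota> t \<otimes> e = \<zero>"
    and tow: "tower I"
    and N: "A.left_ideal N" and n: "n \<in> N" "v \<in> lideal I" "e = n \<oplus> v \<otimes> e"
  shows "e \<in> N"
proof -
  note N' = A.left_idealD[OF N]
  have Tc: "T \<subseteq> carrier L" using torusD(2)[OF T] .
  show ?thesis using tow n
  proof (induction arbitrary: n v rule: tower.induct)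
    case zero
    have "A.left_ideal {\<zero>}" by (simp add: A.left_ideal_def)
    then have "lideal {\<zero>\<^bsub>L\<^esub>} \<subseteq> {\<zero>}" by (rule A.lspan_subset) (simp add: iota_zero)
    then have "v = \<zero>" using zero by auto
    then have "v \<otimes> e = \<zero>" using e(1) by simp
    then have "n \<oplus> v \<otimes> e = n" using N'(1) zero(1) by auto
    with zero(3) have "e = n" by (rule trans)
    then show ?case using zero(1) by simp
  next
    case (nil I J)
    have lI: "lie_ideal I" and lJ: "lie_ideal J" using tower_p_ideal[OF nil(1)] nil.hyps(2) by (simp_all add: p_ideal_def)
    note J' = lie_idealD[OF lJ]
    obtain Y where Y: "finite Y" "Y \<subseteq> J" "span Y = J" using subspace_basis[OF fd J'(1)] by metis
    have vc: "v \<in> carrier A" using nil.prems(2) lideal_closed[OF J'(2)] by blast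
    have nc: "n \<in> carrier A" using nil.prems(1) N'(1) by blast
    \<comment> \<open>Substituting e = n + v e into itself keeps the first summand in the left ideal
      \<open>N\<close> and raises the power of \<open>v\<close>.\<close>
    have "\<exists>n'\<in>N. e = n' \<oplus> v [^] (m::nat) \<otimes> e" for m
    proof (induction m)
      case 0
      then show ?case using e(1) N'(2) by (intro bexI[of _ \<zero>]) simp_all
    next
      case (Suc m)
      then obtain n' where n': "n' \<in> N" "e = n' \<oplus> v [^] m \<otimes> e" by (rule bexE)
      have n'c: "n' \<in> carrier A" using n'(1) N'(1) by blast
      have vm: "v [^] m \<in> carrier A" using vc by simp
      have "v [^] m \<otimes> e = v [^] m \<otimes> (n \<oplus> v \<otimes> e)" by (rule arg_cong[OF nil.prems(3)])
      also have "\<dots> = v [^] m \<otimes> n \<oplus> v [^] Suc m \<otimes> e"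
        using vc nc e(1) by (simp add: A.r_distr A.m_assoc)
      finally have "n' \<oplus> v [^] m \<otimes> e = (n' \<oplus> v [^] m \<otimes> n) \<oplus> v [^] Suc m \<otimes> e"
        using n'c vm nc vc e(1) by (simp add: A.a_assoc)
      then have "e = (n' \<oplus> v [^] m \<otimes> n) \<oplus> v [^] Suc m \<otimes> e" by (rule trans[OF n'(2)])
      then show ?case by (rule bexI[OF _ N'(3)[OF n'(1) N'(4)[OF vm nil.prems(1)]]])
    qed
    from this[of "Suc (card Y * (p - 1))"]
    obtain n' where n': "n' \<in> N" "e = n' \<oplus> v [^] Suc (card Y * (p - 1)) \<otimes> e" by (rule bexE)
    show ?case by (rule nil.IH[OF n'(1) nil_step[OF lI lJ Y nil.hyps(4,5) nil.prems(2)] n'(2)])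
  next
    case (toral I J)
    have pI: "p_ideal I" by (rule tower_p_ideal[OF toral(1)])
    have lI: "lie_ideal I" and lJ: "lie_ideal J" using pI toral.hyps(2) by (simp_all add: p_ideal_def)
    note I' = lie_idealD[OF lI] and J' = lie_idealD[OF lJ]
    note M = A.left_idealD[OF lideal_left[OF I'(2)]]
    \<comment> \<open>No nilpotency is available here. Instead a letter y of \<open>J\<close> is i +
      t with \<open>i\<close> in \<open>I\<close> and \<open>t\<close> in \<open>T\<close>, and
      \<open>t\<close> kills \<open>e\<close>, so y e = i e.\<close>
    have "\<exists>w\<in>lideal I. u \<otimes> e = w \<otimes> e" if "u \<in> lideal J" for u
      using that
    proof induction
      case zero
      show ?case using M(2) by blast
    next
      case (add a x u)
      from add.IH obtain w where w: "w \<in> lideal I" "u \<otimes> e = w \<otimes> e" by (rule bexE)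
      from add(2) obtain y where y: "x = \<iota> y" "y \<in> J" by (rule imageE)
      obtain i t where it: "i \<in> I" "t \<in> T" "y = i \<oplus>\<^bsub>L\<^esub> t"
        by (rule toral_step_in_max_torus[OF fd T max pI toral.hyps(2,3,4,5) y(2)]) (assumption | rule that)+
      have c: "i \<in> carrier L" "t \<in> carrier L" "\<iota> i \<in> carrier A" "\<iota> t \<in> carrier A"
        "u \<in> carrier A" "w \<in> carrier A"
        using it I'(2) Tc iota_closed add(3) lideal_closed[OF J'(2)] w(1) M(1) by auto
      have "x \<otimes> e = \<iota> i \<otimes> e"
        unfolding y(1) it(3) iota_add[OF c(1,2)] using c e(1) e(2)[OF it(2)] by (simp add: A.l_distr)
      moreover have "x \<in> carrier A" using y J'(2) iota_closed by auto
      ultimately have "(a \<otimes> x \<oplus> u) \<otimes> e = (a \<otimes> \<iota> i \<oplus> w) \<otimes> e"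
        using add(1) c e(1) w(2) by (simp add: A.l_distr A.m_assoc)
      moreover have "a \<otimes> \<iota> i \<oplus> w \<in> lideal I"
        by (rule M(3)[OF M(4)[OF add(1) lideal_gen[OF I'(2) it(1)]] w(1)])
      ultimately show ?case by (rule bexI)
    qed
    from this[OF toral.prems(2)] obtain w where "w \<in> lideal I" "v \<otimes> e = w \<otimes> e" by (rule bexE)
    moreover from this(2) have "e = n \<oplus> w \<otimes> e" by (rule subst[where P = "\<lambda>z. e = n \<oplus> z"]) (rule toral.prems(3))
    ultimately show ?case by (intro toral.IH[OF toral.prems(1)])
  qed
qed

lemma eps_iprod: "set xs \<subseteq> carrier L \<Longrightarrow> xs \<noteq> [] \<Longrightarrow> \<epsilon> (iprod xs) = \<zero>\<^bsub>F\<^esub>"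
  using ring_hom_mult[OF eps_hom] ring_hom_closed[OF eps_hom] eps_iota iota_closed iprod_closed
  by (cases xs) auto

text \<open>A nonempty product ends in a letter of \<open>L\<close>, so it has augmentation zero and
  lies in the left ideal generated by \<open>L\<close>; constants are removed by the
  subtraction.\<close>

lemma augmentation_ideal:
  assumes c: "c \<in> carrier A" shows "c \<ominus> \<sigma> (\<epsilon> c) \<in> lideal (carrier L)"
proof -
  note N = A.left_idealD[OF lideal_left[OF subset_refl]]
  let ?G = "{c \<in> carrier A. c \<ominus> \<sigma> (\<epsilon> c) \<in> lideal (carrier L)}"
  have ez: "\<epsilon> \<zero> = \<zero>\<^bsub>F\<^esub>" by (rule ring_hom_zero[OF eps_hom A.ring_axioms R.ring_axioms])
  have sz: "\<sigma> \<zero>\<^bsub>F\<^esub> = \<zero>" by (rule ring_hom_zero[OF sigma_hom R.ring_axioms A.ring_axioms])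
  have sc: "\<sigma> (\<epsilon> c) \<in> carrier A" if "c \<in> carrier A" for c
    using that sigma_closed ring_hom_closed[OF eps_hom] by simp
  have "carrier A \<subseteq> ?G"
  proof (rule generated)
    show "\<zero> \<in> ?G" using N(2) by (simp add: ez sz A.minus_eq)
    show "c \<oplus> d \<in> ?G" if cd: "c \<in> ?G" "d \<in> ?G" for c d
    proof -
      have c: "c \<in> carrier A" "d \<in> carrier A" using cd by auto
      have "\<sigma> (\<epsilon> (c \<oplus> d)) = \<sigma> (\<epsilon> c) \<oplus> \<sigma> (\<epsilon> d)"
        using c ring_hom_add[OF eps_hom] ring_hom_add[OF sigma_hom] ring_hom_closed[OF eps_hom] by simp
      then have "c \<oplus> d \<ominus> \<sigma> (\<epsilon> (c \<oplus> d)) = (c \<ominus> \<sigma> (\<epsilon> c)) \<oplus> (d \<ominus> \<sigma> (\<epsilon> d))"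
        using c sc by (simp add: A.minus_eq A.minus_add A.a_ac)
      then show ?thesis using N(3) cd c by simp
    qed
    fix a xs assume a: "a \<in> carrier F" and xs: "set xs \<subseteq> carrier L"
    have ac: "\<sigma> a \<in> carrier A" "iprod xs \<in> carrier A" using a xs sigma_closed iprod_closed by auto
    show "\<sigma> a \<otimes> iprod xs \<in> ?G"
    proof (cases xs rule: rev_cases)
      case Nil
      then show ?thesis using ac a N(2) by (simp add: eps_sigma A.minus_eq A.r_neg)
    next
      case (snoc ys y)
      have c: "set ys \<subseteq> carrier L" "y \<in> carrier L" "iprod ys \<in> carrier A" "\<iota> y \<in> carrier A"
        using xs snoc iprod_closed iota_closed by auto
      have "\<epsilon> (\<sigma> a \<otimes> iprod xs) = \<zero>\<^bsub>F\<^esub>"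
        using ring_hom_mult[OF eps_hom ac] eps_iprod[OF xs] snoc a by (simp add: eps_sigma)
      then have "\<sigma> a \<otimes> iprod xs \<ominus> \<sigma> (\<epsilon> (\<sigma> a \<otimes> iprod xs)) = \<sigma> a \<otimes> iprod xs"
        using ac by (simp add: sz A.minus_eq)
      moreover have "\<sigma> a \<otimes> iprod xs = (\<sigma> a \<otimes> iprod ys) \<otimes> \<iota> y"
        using iprod_append[of ys "[y]"] c ac by (simp add: snoc A.m_assoc)
      moreover have "(\<sigma> a \<otimes> iprod ys) \<otimes> \<iota> y \<in> lideal (carrier L)"
        by (rule N(4)[OF _ lideal_gen[OF subset_refl c(2)]]) (use ac c in simp)
      ultimately have "\<sigma> a \<otimes> iprod xs \<ominus> \<sigma> (\<epsilon> (\<sigma> a \<otimes> iprod xs)) \<in> lideal (carrier L)" by (simp only:)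
      then show ?thesis using A.m_closed[OF ac] by (intro CollectI conjI)
    qed
  qed
  then show ?thesis using c by blast
qed

end

section \<open>The idempotent of a torus and normal words\<close>

context lie_envelope
begin

text \<open>The linear span over \<open>F\<close>; the ring \<open>A\<close> carries its scalars
  through \<open>\<sigma>\<close>.\<close>

inductive_set fspan :: "'r set \<Rightarrow> 'r set" for S where
  zero: "\<zero> \<in> fspan S"
| add: "a \<in> carrier F \<Longrightarrow> x \<in> S \<Longrightarrow> u \<in> fspan S \<Longrightarrow> \<sigma> a \<otimes> x \<oplus> u \<in> fspan S"

lemma fspan_closed: assumes "S \<subseteq> carrier A" shows "fspan S \<subseteq> carrier A"
proof
  fix u assume "u \<in> fspan S" then show "u \<in> carrier A"
    by induction (use assms sigma_closed in auto)
qed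

lemma fspan_add:
  assumes S: "S \<subseteq> carrier A" and u: "u \<in> fspan S" and v: "v \<in> fspan S"
  shows "u \<oplus> v \<in> fspan S"
  using u
proof induction
  case zero
  show ?case using v fspan_closed[OF S] by auto
next
  case (add a x u)
  have c: "x \<in> carrier A" "u \<in> carrier A" "v \<in> carrier A"
    using add fspan_closed[OF S] S v by auto
  have "\<sigma> a \<otimes> x \<oplus> u \<oplus> v = \<sigma> a \<otimes> x \<oplus> (u \<oplus> v)"
    by (rule A.a_assoc) (use c sigma_closed[OF add(1)] in auto)
  then show ?case using fspan.add[OF add(1,2) add.IH] by simp
qed

lemma fspan_gen:
  assumes S: "S \<subseteq> carrier A" and a: "a \<in> carrier F" and x: "x \<in> S" shows "\<sigma> a \<otimes> x \<in> fspan S"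
proof -
  have "x \<in> carrier A" using S x by blast
  then show ?thesis using fspan.add[OF a x fspan.zero] sigma_closed[OF a] by simp
qed

lemma fspan_base:
  assumes "S \<subseteq> carrier A" "x \<in> S" shows "x \<in> fspan S"
proof -
  have "x \<in> carrier A" using assms by blast
  then show ?thesis using fspan_gen[OF assms(1) R.one_closed assms(2)] by (simp add: sigma_one)
qed

lemma fspan_scale:
  assumes S: "S \<subseteq> carrier A" and c: "c \<in> carrier F" and u: "u \<in> fspan S" shows "\<sigma> c \<otimes> u \<in> fspan S"
  using u
proof induction
  case zero
  show ?case using c sigma_closed fspan.zero by simp
next
  case (add a x u)
  have k: "x \<in> carrier A" "u \<in> carrier A" "\<sigma> a \<in> carrier A" "\<sigma> c \<in> carrier A"
    using add fspan_closed[OF S] S sigma_closed c by auto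
  have "\<sigma> c \<otimes> (\<sigma> a \<otimes> x \<oplus> u) = \<sigma> (c \<otimes>\<^bsub>F\<^esub> a) \<otimes> x \<oplus> \<sigma> c \<otimes> u"
    unfolding ring_hom_mult[OF sigma_hom c add(1)] using k by (simp add: A.r_distr A.m_assoc)
  then show ?case using fspan.add[OF _ add(2) add.IH, of "c \<otimes>\<^bsub>F\<^esub> a"] c add(1) by simp
qed

lemma sigma_iprod_commute:
  assumes a: "a \<in> carrier F" and xs: "set xs \<subseteq> carrier L" shows "\<sigma> a \<otimes> iprod xs = iprod xs \<otimes> \<sigma> a"
  using xs
proof (induction xs)
  case Nil
  then show ?case using sigma_closed[OF a] by simp
next
  case (Cons x xs)
  have k: "\<sigma> a \<in> carrier A" "\<iota> x \<in> carrier A" "iprod xs \<in> carrier A" "x \<in> carrier L"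
    using Cons.prems sigma_closed[OF a] iota_closed iprod_closed by auto
  have "\<sigma> a \<otimes> iprod (x # xs) = (\<sigma> a \<otimes> \<iota> x) \<otimes> iprod xs" using k by (simp add: A.m_assoc)
  also have "\<dots> = \<iota> x \<otimes> (\<sigma> a \<otimes> iprod xs)" unfolding iota_central[OF a k(4)] using k by (simp add: A.m_assoc)
  also have "\<dots> = iprod (x # xs) \<otimes> \<sigma> a" using Cons k by (simp add: A.m_assoc)
  finally show ?case .
qed

lemma fspan_mult:
  assumes xs: "\<And>xs. P xs \<Longrightarrow> set xs \<subseteq> carrier L" and ys: "\<And>ys. Q ys \<Longrightarrow> set ys \<subseteq> carrier L"
    and PQ: "\<And>xs ys. P xs \<Longrightarrow> Q ys \<Longrightarrow> R (xs @ ys)" and R: "\<And>zs. R zs \<Longrightarrow> set zs \<subseteq> carrier L"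
    and u: "u \<in> fspan {iprod xs | xs. P xs}" and v: "v \<in> fspan {iprod ys | ys. Q ys}"
  shows "u \<otimes> v \<in> fspan {iprod zs | zs. R zs}"
proof -
  have Pc: "{iprod xs | xs. P xs} \<subseteq> carrier A" using iprod_closed xs by auto
  have Qc: "{iprod ys | ys. Q ys} \<subseteq> carrier A" using iprod_closed ys by auto
  have Rc: "{iprod zs | zs. R zs} \<subseteq> carrier A" using iprod_closed R by auto
  have vc: "v \<in> carrier A" using v fspan_closed[OF Qc] by blast
  have 1: "iprod xs \<otimes> v \<in> fspan {iprod zs | zs. R zs}" if p: "P xs" for xs
    using v
  proof induction
    case zero
    show ?case using iprod_closed[OF xs[OF p]] fspan.zero by simp
  next
    case (add a y v)
    obtain ys' where y: "y = iprod ys'" "Q ys'" using add(2) by blast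
    have k: "iprod xs \<in> carrier A" "y \<in> carrier A" "v \<in> carrier A" "\<sigma> a \<in> carrier A"
      using iprod_closed[OF xs[OF p]] subsetD[OF Qc add(2)] subsetD[OF fspan_closed[OF Qc] add(3)] sigma_closed[OF add(1)] by auto
    have "iprod xs \<otimes> (\<sigma> a \<otimes> y \<oplus> v) = (iprod xs \<otimes> \<sigma> a) \<otimes> y \<oplus> iprod xs \<otimes> v"
      using k by (simp add: A.r_distr A.m_assoc)
    also have "\<dots> = \<sigma> a \<otimes> iprod (xs @ ys') \<oplus> iprod xs \<otimes> v"
      unfolding sigma_iprod_commute[OF add(1) xs[OF p], symmetric] using k
      by (simp add: A.m_assoc iprod_append[OF xs[OF p] ys[OF y(2)]] y(1))
    also have "\<dots> \<in> fspan {iprod zs | zs. R zs}"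
      by (rule fspan.add[OF add(1) _ add.IH]) (use PQ[OF p y(2)] in blast)
    finally show ?case .
  qed
  show ?thesis using u
  proof induction
    case zero
    show ?case using vc fspan.zero by simp
  next
    case (add a x u)
    obtain xs' where x: "x = iprod xs'" "P xs'" using add(2) by blast
    have k: "x \<in> carrier A" "u \<in> carrier A" "\<sigma> a \<in> carrier A"
      using subsetD[OF Pc add(2)] subsetD[OF fspan_closed[OF Pc] add(3)] sigma_closed[OF add(1)] by auto
    have "(\<sigma> a \<otimes> x \<oplus> u) \<otimes> v = \<sigma> a \<otimes> (x \<otimes> v) \<oplus> u \<otimes> v"
      using k vc by (simp add: A.l_distr A.m_assoc)
    then show ?case
      using fspan_add[OF Rc fspan_scale[OF Rc add(1) 1[OF x(2)]] add.IH] x(1) by simp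
  qed
qed

end

section \<open>The element of the enveloping algebra killed by a torus\<close>

context restricted_envelope
begin

text \<open>The augmentation ideal of the subalgebra generated by \<open>T\<close>, as the span of
  nonempty products.\<close>

abbreviation "aug T \<equiv> fspan {iprod ts | ts. set ts \<subseteq> T \<and> ts \<noteq> []}"

lemma iota_ppow: "x \<in> carrier L \<Longrightarrow> \<iota> (ppow x i) = \<iota> x [^] (p ^ i)"
proof (induction i)
  case (Suc i)
  have "\<iota> (ppow x (Suc i)) = \<iota> (ppow x i) [^] p" using iota_pow[OF ppow_closed[OF Suc.prems], of i] by simp
  then show ?case using Suc iota_closed[of x] by (simp add: A.nat_pow_pow mult.commute)
qed (simp add: iota_closed)

lemma iprod_commute:
  assumes T: "T \<subseteq> carrier L" "commuting T" and s: "s \<in> T" and ts: "set ts \<subseteq> T"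
  shows "\<iota> s \<otimes> iprod ts = iprod ts \<otimes> \<iota> s"
  using ts
proof (induction ts)
  case Nil
  then show ?case using T(1) s iota_closed by auto
next
  case (Cons t ts)
  have k: "s \<in> carrier L" "t \<in> carrier L" "\<iota> s \<in> carrier A" "\<iota> t \<in> carrier A" "iprod ts \<in> carrier A"
    using Cons.prems s T(1) iota_closed iprod_closed by auto
  have "bracket L s t = \<zero>\<^bsub>L\<^esub>" using T(2) s Cons.prems by (simp add: commuting_def)
  then have "\<iota> s \<otimes> \<iota> t = \<iota> t \<otimes> \<iota> s" using iota_commute[OF k(2,1)] iota_zero k by simp
  then have "\<iota> s \<otimes> iprod (t # ts) = \<iota> t \<otimes> (\<iota> s \<otimes> iprod ts)" using k by (simp flip: A.m_assoc)
  also have "\<dots> = iprod (t # ts) \<otimes> \<iota> s" using Cons k by (simp add: A.m_assoc)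
  finally show ?case .
qed

lemma aug_set_closed: "T \<subseteq> carrier L \<Longrightarrow> {iprod ts | ts. set ts \<subseteq> T \<and> ts \<noteq> []} \<subseteq> carrier A"
  using iprod_closed by auto

lemma aug_commute:
  assumes T: "T \<subseteq> carrier L" "commuting T" and s: "s \<in> T" and u: "u \<in> aug T"
  shows "\<iota> s \<otimes> u = u \<otimes> \<iota> s"
  using u
proof induction
  case zero
  show ?case using T(1) s iota_closed by auto
next
  case (add a x u)
  have sc: "s \<in> carrier L" using s T(1) by blast
  have k: "\<iota> s \<in> carrier A" "x \<in> carrier A" "u \<in> carrier A" "\<sigma> a \<in> carrier A"
    using iota_closed[OF sc] subsetD[OF aug_set_closed[OF T(1)] add(2)]
      subsetD[OF fspan_closed[OF aug_set_closed[OF T(1)]] add(3)] sigma_closed[OF add(1)] by simp_all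
  obtain ts where x: "x = iprod ts" "set ts \<subseteq> T" using add(2) by blast
  have "\<iota> s \<otimes> (\<sigma> a \<otimes> x) = (\<sigma> a \<otimes> x) \<otimes> \<iota> s"
  proof -
    have "\<iota> s \<otimes> (\<sigma> a \<otimes> x) = \<sigma> a \<otimes> (\<iota> s \<otimes> x)"
      using iota_central[OF add(1) sc] k by (simp flip: A.m_assoc)
    also have "\<dots> = (\<sigma> a \<otimes> x) \<otimes> \<iota> s" unfolding x(1) iprod_commute[OF T s x(2)] using k x(1) by (simp add: A.m_assoc)
    finally show ?thesis .
  qed
  then show ?case using k add.IH by (simp add: A.l_distr A.r_distr)
qed

lemma aug_kill:
  assumes T: "T \<subseteq> carrier L" and e: "e \<in> carrier A" "\<And>t. t \<in> T \<Longrightarrow> \<iota> t \<otimes> e = \<zero>" and u: "u \<in> aug T"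
  shows "u \<otimes> e = \<zero>"
  using u
proof induction
  case zero
  show ?case using e by simp
next
  case (add a x u)
  obtain ts where x: "x = iprod ts" "set ts \<subseteq> T" "ts \<noteq> []" using add(2) by blast
  obtain ys y where ts: "ts = ys @ [y]" using x(3) by (cases ts rule: rev_cases) auto
  have k: "set ys \<subseteq> carrier L" "y \<in> carrier L" "y \<in> T" using x(2) ts T by auto
  have kk: "iprod ys \<in> carrier A" "\<iota> y \<in> carrier A" using k iprod_closed iota_closed by auto
  have "x = iprod ys \<otimes> \<iota> y" using iprod_append[of ys "[y]"] k kk by (simp add: x(1) ts)
  then have "x \<otimes> e = \<zero>" using kk e(1) e(2)[OF k(3)] by (simp add: A.m_assoc)
  moreover have "x \<in> carrier A" "u \<in> carrier A" "\<sigma> a \<in> carrier A"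
    using subsetD[OF aug_set_closed[OF T] add(2)]
      subsetD[OF fspan_closed[OF aug_set_closed[OF T]] add(3)] sigma_closed[OF add(1)] by simp_all
  ultimately show ?case using add.IH e(1) by (simp add: A.l_distr A.m_assoc)
qed

lemma eps_aug:
  assumes T: "T \<subseteq> carrier L" and u: "u \<in> aug T" shows "\<epsilon> u = \<zero>\<^bsub>F\<^esub>"
  using u
proof induction
  case zero
  show ?case by (rule ring_hom_zero[OF eps_hom A.ring_axioms R.ring_axioms])
next
  case (add a x u)
  obtain ts where x: "x = iprod ts" "set ts \<subseteq> T" "ts \<noteq> []" using add(2) by blast
  have "\<epsilon> x = \<zero>\<^bsub>F\<^esub>" using eps_iprod[of ts] x T by auto
  moreover have "x \<in> carrier A" "u \<in> carrier A" "\<sigma> a \<in> carrier A"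
    using subsetD[OF aug_set_closed[OF T] add(2)]
      subsetD[OF fspan_closed[OF aug_set_closed[OF T]] add(3)] sigma_closed[OF add(1)] by simp_all
  ultimately show ?case using add.IH ring_hom_add[OF eps_hom] ring_hom_mult[OF eps_hom] ring_hom_closed[OF eps_hom] by simp
qed

lemma fspan_finsum:
  assumes S: "S \<subseteq> carrier A" and "finite K" "\<And>i. i \<in> K \<Longrightarrow> g i \<in> fspan S"
  shows "(\<Oplus>i\<in>K. g i) \<in> fspan S"
  using assms(2,3)
proof (induction K rule: finite_induct)
  case empty
  then show ?case by (simp add: fspan.zero)
next
  case (insert k K)
  have "(\<Oplus>i\<in>insert k K. g i) = g k \<oplus> (\<Oplus>i\<in>K. g i)"
    by (rule A.finsum_insert) (use insert fspan_closed[OF S] in auto)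
  then show ?case using insert fspan_add[OF S] by simp
qed

text \<open>\<open>u\<close> is minus the sum of the a_v t^(p^j - 1), where t is expanded into
  higher p-th powers of itself; multiplication by t turns \<open>u\<close> into -t.\<close>

lemma torus_factor:
  assumes T: "torus F L T" and t: "t \<in> T"
  obtains u where "u \<in> aug T" "\<iota> t \<otimes> (\<one> \<oplus> u) = \<zero>"
proof -
  note T' = torusD[OF T]
  have tc: "t \<in> carrier L" "\<iota> t \<in> carrier A" using t T'(2) iota_closed by auto
  obtain B :: "'b set" and a j where B: "finite B" "\<And>v. v \<in> B \<Longrightarrow> a v \<in> carrier F" "\<And>v. v \<in> B \<Longrightarrow> 1 \<le> j v"
    "t = (\<Oplus>\<^bsub>L\<^esub>v\<in>B. a v \<odot>\<^bsub>L\<^esub> ppow t (j v))"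
    by (rule torus_element_expand[OF T t]) (rule that)
  define g where "g v = \<sigma> (\<ominus>\<^bsub>F\<^esub> a v) \<otimes> iprod (replicate (p ^ j v - 1) t)" for v
  have g: "g v \<in> aug T" if v: "v \<in> B" for v unfolding g_def
  proof (rule fspan_gen[OF aug_set_closed[OF T'(2)]])
    show "\<ominus>\<^bsub>F\<^esub> a v \<in> carrier F" using B(2)[OF v] by simp
    \<comment> \<open>As \<open>j v\<close> is at least 1 the word is nonempty. A constant term in
      \<open>u\<close> could spoil the augmentation 1 of the factor 1 + u.\<close>
    have "p ^ 1 \<le> p ^ j v" by (rule power_increasing) (use B(3)[OF v] two_le_p in auto)
    then have "p ^ j v - 1 \<noteq> 0" using two_le_p by simp
    then show "iprod (replicate (p ^ j v - 1) t) \<in> {iprod ts | ts. set ts \<subseteq> T \<and> ts \<noteq> []}"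
      using t by (intro CollectI exI[of _ "replicate (p ^ j v - 1) t"]) auto
  qed
  have gc: "g v \<in> carrier A" if "v \<in> B" for v
    by (rule subsetD[OF fspan_closed[OF aug_set_closed[OF T'(2)]] g[OF that]])
  have tg: "\<iota> t \<otimes> g v = \<iota> ((\<ominus>\<^bsub>F\<^esub> a v) \<odot>\<^bsub>L\<^esub> ppow t (j v))" if v: "v \<in> B" for v
  proof -
    have a: "\<ominus>\<^bsub>F\<^esub> a v \<in> carrier F" using B(2)[OF v] by simp
    have pj: "p ^ j v = Suc (p ^ j v - 1)" using two_le_p by simp
    have "\<iota> t \<otimes> g v = \<sigma> (\<ominus>\<^bsub>F\<^esub> a v) \<otimes> (\<iota> t \<otimes> \<iota> t [^] (p ^ j v - 1))"
      unfolding g_def iprod_replicate[OF tc(1)] using iota_central[OF a tc(1)] tc sigma_closed[OF a]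
      by (simp flip: A.m_assoc)
    also have "\<iota> t \<otimes> \<iota> t [^] (p ^ j v - 1) = \<iota> (ppow t (j v))"
      unfolding iota_ppow[OF tc(1)] by (subst (2) pj) (rule A.nat_pow_Suc2[OF tc(2), symmetric])
    finally show ?thesis using iota_smult[OF a ppow_closed[OF tc(1)]] by simp
  qed
  define u where "u = (\<Oplus>v\<in>B. g v)"
  have u: "u \<in> aug T" unfolding u_def by (rule fspan_finsum[OF aug_set_closed[OF T'(2)] B(1) g])
  have uc: "u \<in> carrier A" by (rule subsetD[OF fspan_closed[OF aug_set_closed[OF T'(2)]] u])
  have cl: "(\<ominus>\<^bsub>F\<^esub> a v) \<odot>\<^bsub>L\<^esub> ppow t (j v) \<in> carrier L" "a v \<odot>\<^bsub>L\<^esub> ppow t (j v) \<in> carrier L" if "v \<in> B" for v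
    using B(2)[OF that] ppow_closed[OF tc(1)] by simp_all
  have "\<iota> t \<otimes> u = (\<Oplus>v\<in>B. \<iota> t \<otimes> g v)" unfolding u_def
    by (rule A.finsum_rdistr[OF B(1) tc(2)]) (use gc in auto)
  also have "\<dots> = (\<Oplus>v\<in>B. \<iota> ((\<ominus>\<^bsub>F\<^esub> a v) \<odot>\<^bsub>L\<^esub> ppow t (j v)))"
    by (rule A.finsum_cong') (use tg cl iota_closed in auto)
  also have "\<dots> = \<iota> (\<Oplus>\<^bsub>L\<^esub>v\<in>B. (\<ominus>\<^bsub>F\<^esub> a v) \<odot>\<^bsub>L\<^esub> ppow t (j v))"
    by (rule iota_finsum[symmetric, OF B(1) cl(1)])
  finally have "\<iota> t \<otimes> u \<oplus> \<iota> t = \<iota> ((\<Oplus>\<^bsub>L\<^esub>v\<in>B. (\<ominus>\<^bsub>F\<^esub> a v) \<odot>\<^bsub>L\<^esub> ppow t (j v)) \<oplus>\<^bsub>L\<^esub> t)"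
    using iota_add[OF M.finsum_closed tc(1), of "\<lambda>v. (\<ominus>\<^bsub>F\<^esub> a v) \<odot>\<^bsub>L\<^esub> ppow t (j v)" B] cl(1) by simp
  also have "(\<Oplus>\<^bsub>L\<^esub>v\<in>B. (\<ominus>\<^bsub>F\<^esub> a v) \<odot>\<^bsub>L\<^esub> ppow t (j v)) \<oplus>\<^bsub>L\<^esub> t = \<zero>\<^bsub>L\<^esub>"
  proof -
    let ?l = "\<lambda>v. (\<ominus>\<^bsub>F\<^esub> a v) \<odot>\<^bsub>L\<^esub> ppow t (j v)" and ?r = "\<lambda>v. a v \<odot>\<^bsub>L\<^esub> ppow t (j v)"
    have "finsum L ?l B \<oplus>\<^bsub>L\<^esub> finsum L ?r B = (\<Oplus>\<^bsub>L\<^esub>v\<in>B. ?l v \<oplus>\<^bsub>L\<^esub> ?r v)"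
      by (rule M.finsum_addf[symmetric]) (use cl in auto)
    also have "\<dots> = (\<Oplus>\<^bsub>L\<^esub>v\<in>B. \<zero>\<^bsub>L\<^esub>)"
    proof (rule M.finsum_cong')
      fix v assume v: "v \<in> B"
      have "?l v \<oplus>\<^bsub>L\<^esub> ?r v = (\<ominus>\<^bsub>F\<^esub> a v \<oplus>\<^bsub>F\<^esub> a v) \<odot>\<^bsub>L\<^esub> ppow t (j v)"
        using B(2)[OF v] ppow_closed[OF tc(1)] by (simp add: smult_l_distr)
      then show "?l v \<oplus>\<^bsub>L\<^esub> ?r v = \<zero>\<^bsub>L\<^esub>" using B(2)[OF v] ppow_closed[OF tc(1)] by (simp add: R.l_neg)
    qed auto
    finally show ?thesis using B(4) by simp
  qed
  finally have "\<iota> t \<otimes> u \<oplus> \<iota> t = \<zero>" by (simp add: iota_zero)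
  then have "\<iota> t \<otimes> (\<one> \<oplus> u) = \<zero>" using tc uc by (simp add: A.r_distr A.a_comm)
  then show thesis by (rule that[OF u])
qed

text \<open>The projection of \<open>A\<close> onto the trivial weight space of \<open>T\<close>, as the product of the
  commuting factors \<open>1 - \<Sum> a\<^sub>j t\<^sup>p\<^sup>j\<^sup>-\<^sup>1\<close> over a basis of \<open>T\<close>.\<close>

lemma torus_idempotent:
  assumes fd: "fin_dim" and T: "torus F L T"
  obtains u where "u \<in> aug T" "\<And>t. t \<in> T \<Longrightarrow> \<iota> t \<otimes> (\<one> \<oplus> u) = \<zero>"
proof -
  note T' = torusD[OF T]
  note Sc = aug_set_closed[OF T'(2)]
  obtain B where B: "finite B" "B \<subseteq> T" "span B = T" using subspace_basis[OF fd T'(1)] by metis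
  have "\<exists>u. u \<in> aug T \<and> (\<forall>t\<in>B'. \<iota> t \<otimes> (\<one> \<oplus> u) = \<zero>)" if "B' \<subseteq> T" "finite B'" for B'
    using that(2,1)
  proof (induction B' rule: finite_induct)
    case empty
    show ?case using fspan.zero by blast
  next
    case (insert t B')
    then obtain u where u: "u \<in> aug T" "\<forall>t\<in>B'. \<iota> t \<otimes> (\<one> \<oplus> u) = \<zero>" by auto
    have t: "t \<in> T" using insert.prems by simp
    obtain w where w: "w \<in> aug T" "\<iota> t \<otimes> (\<one> \<oplus> w) = \<zero>" by (rule torus_factor[OF T t])
    have c: "u \<in> carrier A" "w \<in> carrier A"
      using subsetD[OF fspan_closed[OF Sc] u(1)] subsetD[OF fspan_closed[OF Sc] w(1)] by simp_all
    \<comment> \<open>Chosen so that 1 + z is the product (1 + w) (1 + u).\<close>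
    let ?z = "w \<oplus> (u \<oplus> w \<otimes> u)"
    have wu: "w \<otimes> u \<in> aug T" by (rule fspan_mult[OF _ _ _ _ w(1) u(1)]) (use T'(2) in auto)
    have z: "?z \<in> aug T" by (rule fspan_add[OF Sc w(1) fspan_add[OF Sc u(1) wu]])
    have e: "\<one> \<oplus> ?z = (\<one> \<oplus> w) \<otimes> (\<one> \<oplus> u)" using c by (simp add: A.l_distr A.r_distr A.a_ac)
    have "\<iota> s \<otimes> (\<one> \<oplus> ?z) = \<zero>" if s: "s \<in> insert t B'" for s
    proof (cases "s = t")
      case True
      have tc: "\<iota> t \<in> carrier A" using t T'(2) iota_closed by auto
      have "\<iota> s \<otimes> (\<one> \<oplus> ?z) = (\<iota> t \<otimes> (\<one> \<oplus> w)) \<otimes> (\<one> \<oplus> u)"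
        unfolding e True using tc c by (simp add: A.m_assoc)
      then show ?thesis using w(2) c by simp
    next
      \<comment> \<open>The factor 1 + w commutes with \<open>T\<close>, so \<open>s\<close> reaches
        the factor 1 + u, by which it is killed.\<close>
      case False
      have sB: "s \<in> B'" "s \<in> T" using s False insert.prems by auto
      have sc: "\<iota> s \<in> carrier A" using sB T'(2) iota_closed by auto
      have "\<iota> s \<otimes> (\<one> \<oplus> w) = (\<one> \<oplus> w) \<otimes> \<iota> s"
        using aug_commute[OF T'(2,3) sB(2) w(1)] sc c by (simp add: A.l_distr A.r_distr)
      then have "\<iota> s \<otimes> (\<one> \<oplus> ?z) = (\<one> \<oplus> w) \<otimes> (\<iota> s \<otimes> (\<one> \<oplus> u))"
        unfolding e using sc c by (simp flip: A.m_assoc)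
      then show ?thesis using u(2) sB(1) c by simp
    qed
    then show ?case using z by blast
  qed
  from this[OF B(2,1)] obtain u where u: "u \<in> aug T" "\<forall>t\<in>B. \<iota> t \<otimes> (\<one> \<oplus> u) = \<zero>" by auto
  have c: "u \<in> carrier A" by (rule subsetD[OF fspan_closed[OF Sc] u(1)])
  have "subspace F {x \<in> carrier L. \<iota> x \<otimes> (\<one> \<oplus> u) = \<zero>} L"
    by (rule subspaceI) (simp_all add: iota_zero iota_add iota_smult c iota_closed sigma_closed A.l_distr[of _ _ "\<one> \<oplus> u"] A.m_assoc)
  moreover have "B \<subseteq> {x \<in> carrier L. \<iota> x \<otimes> (\<one> \<oplus> u) = \<zero>}" using u(2) B(2) T'(2) by auto
  ultimately have "span B \<subseteq> {x \<in> carrier L. \<iota> x \<otimes> (\<one> \<oplus> u) = \<zero>}" by (rule span_subset)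
  then show thesis using that[OF u(1)] B(3) by auto
qed

end

section \<open>Normal monomials span the enveloping algebra\<close>

locale based_envelope = lie_basis F L p n b coord + restricted_envelope F L p A \<sigma> \<iota> \<epsilon>
  for F and L :: "('a, 'b, 'c) restricted_lie_scheme" and p and n :: nat and b :: "nat \<Rightarrow> 'b"
    and coord :: "nat \<Rightarrow> 'b \<Rightarrow> 'a" and A :: "('r, 'e) ring_scheme" (structure)
    and \<sigma> :: "'a \<Rightarrow> 'r" and \<iota> :: "'b \<Rightarrow> 'r" and \<epsilon> :: "'r \<Rightarrow> 'a"
begin

text \<open>The condition is linear in the letter \<open>x\<close>, so the basis decides it.\<close>

lemma iprod_letter_in_fspan:
  assumes S: "S \<subseteq> carrier A" and us: "set us \<subseteq> carrier L" and ws: "set ws \<subseteq> carrier L"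
    and b: "\<And>k. k < n \<Longrightarrow> iprod (us @ b k # ws) \<in> fspan S" and x: "x \<in> carrier L"
  shows "iprod (us @ x # ws) \<in> fspan S"
proof -
  have e: "iprod (us @ x # ws) = iprod us \<otimes> (\<iota> x \<otimes> iprod ws)" if "x \<in> carrier L" for x
    using iprod_append[OF us, of "x # ws"] that ws by simp
  have c: "iprod us \<in> carrier A" "iprod ws \<in> carrier A" using us ws iprod_closed by auto
  have sub: "subspace F {x \<in> carrier L. iprod us \<otimes> (\<iota> x \<otimes> iprod ws) \<in> fspan S} L"
  proof (rule subspaceI)
    show "{x \<in> carrier L. iprod us \<otimes> (\<iota> x \<otimes> iprod ws) \<in> fspan S} \<subseteq> carrier L" by blast
    show "\<zero>\<^bsub>L\<^esub> \<in> {x \<in> carrier L. iprod us \<otimes> (\<iota> x \<otimes> iprod ws) \<in> fspan S}"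
      using c fspan.zero by (simp add: iota_zero)
    show "x \<oplus>\<^bsub>L\<^esub> y \<in> {x \<in> carrier L. iprod us \<otimes> (\<iota> x \<otimes> iprod ws) \<in> fspan S}"
      if "x \<in> {x \<in> carrier L. iprod us \<otimes> (\<iota> x \<otimes> iprod ws) \<in> fspan S}"
        "y \<in> {x \<in> carrier L. iprod us \<otimes> (\<iota> x \<otimes> iprod ws) \<in> fspan S}" for x y
      using that c fspan_add[OF S] iota_closed by (simp add: iota_add A.l_distr A.r_distr)
    fix a x assume a: "a \<in> carrier F" and x: "x \<in> {x \<in> carrier L. iprod us \<otimes> (\<iota> x \<otimes> iprod ws) \<in> fspan S}"
    have k: "x \<in> carrier L" "\<iota> x \<in> carrier A" "\<sigma> a \<in> carrier A" using x iota_closed sigma_closed[OF a] by auto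
    have "iprod us \<otimes> (\<iota> (a \<odot>\<^bsub>L\<^esub> x) \<otimes> iprod ws) = (iprod us \<otimes> \<sigma> a) \<otimes> (\<iota> x \<otimes> iprod ws)"
      unfolding iota_smult[OF a k(1)] using k c by (simp add: A.m_assoc)
    also have "\<dots> = \<sigma> a \<otimes> (iprod us \<otimes> (\<iota> x \<otimes> iprod ws))"
      unfolding sigma_iprod_commute[OF a us, symmetric] using k c by (simp add: A.m_assoc)
    finally show "a \<odot>\<^bsub>L\<^esub> x \<in> {x \<in> carrier L. iprod us \<otimes> (\<iota> x \<otimes> iprod ws) \<in> fspan S}"
      using fspan_scale[OF S a] x k(1) a by simp
  qed
  have bk: "coord k x \<odot>\<^bsub>L\<^esub> b k \<in> {x \<in> carrier L. iprod us \<otimes> (\<iota> x \<otimes> iprod ws) \<in> fspan S}" if k: "k < n" for k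
    by (rule subspaceD(4)[OF sub coord_closed[OF x]]) (use b[OF k] e[OF b_closed[OF k]] b_closed[OF k] in simp)
  have "(\<Oplus>\<^bsub>L\<^esub>k\<in>{..<n}. coord k x \<odot>\<^bsub>L\<^esub> b k) \<in> {x \<in> carrier L. iprod us \<otimes> (\<iota> x \<otimes> iprod ws) \<in> fspan S}"
    by (rule subspace_finsum[OF sub finite_lessThan bk]) simp
  then show ?thesis unfolding coord_expand[OF x] using e[OF x] by simp
qed

abbreviation "normal_monomials r \<equiv> {iprod (map b w) | w. normal_word p w \<and> set w \<subseteq> {..<r}}"

lemma normal_monomials_closed:
  assumes "r \<le> n" shows "normal_monomials r \<subseteq> carrier A"
proof
  fix x assume "x \<in> normal_monomials r"
  then obtain w where w: "x = iprod (map b w)" "set w \<subseteq> {..<r}" by (elim CollectE exE conjE)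
  have "set w \<subseteq> {..<n}" by (rule subset_trans[OF w(2)]) (simp add: assms)
  then show "x \<in> carrier A" unfolding w(1) by (intro iprod_closed map_b_closed)
qed

text \<open>The rewriting rules are read as identities in \<open>A\<close>, with the same
  termination order. The functionals above give independence of the normal monomials, this gives
  generation.\<close>

lemma monomial_in_normal_span:
  "set w \<subseteq> {..<n} \<Longrightarrow> iprod (map b w) \<in> fspan (normal_monomials n)"
proof (induction w rule: wf_induct_rule[OF wf_word_ord])
  case (1 w)
  note S = normal_monomials_closed[OF order_refl]
  have short: "iprod (map b u @ x # map b v) \<in> fspan (normal_monomials n)"
    if "set u \<subseteq> {..<n}" "set v \<subseteq> {..<n}" "length u + length v + 1 < length w" "x \<in> carrier L" for u v x
  proof (rule iprod_letter_in_fspan[OF S map_b_closed[OF that(1)] map_b_closed[OF that(2)] _ that(4)])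
    fix k assume k: "k < n"
    have "iprod (map b (u @ k # v)) \<in> fspan (normal_monomials n)"
      by (rule 1(1)[OF word_ord_shorter]) (use that k in auto)
    then show "iprod (map b u @ b k # map b v) \<in> fspan (normal_monomials n)" by simp
  qed
  show ?case
  proof (cases "normal_word p w")
    case True
    show ?thesis by (rule fspan_base[OF S]) (use True 1(2) in blast)
  next
    case False
    from not_normal_word[OF this] show ?thesis
    proof (elim disjE exE conjE)
      fix u j i v assume w: "w = u @ [j, i] @ v" and ij: "i < j"
      have k: "set u \<subseteq> {..<n}" "set v \<subseteq> {..<n}" "j < n" "i < n" using 1(2) w by auto
      have c: "b j \<in> carrier L" "b i \<in> carrier L" "\<iota> (b j) \<in> carrier A" "\<iota> (b i) \<in> carrier A"
        "iprod (map b u) \<in> carrier A" "iprod (map b v) \<in> carrier A"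
        using k b_closed iota_closed iprod_closed[OF map_b_closed] by auto
      let ?br = "bracket L (b j) (b i)"
      have bc: "?br \<in> carrier L" "\<iota> ?br \<in> carrier A" using c bracket_closed iota_closed by auto
      have "iprod (map b w) = iprod (map b u) \<otimes> ((\<iota> (b j) \<otimes> \<iota> (b i)) \<otimes> iprod (map b v))"
        using iprod_append[OF map_b_closed[OF k(1)], of "b j # b i # map b v"] c map_b_closed[OF k(2)]
        by (simp add: w A.m_assoc)
      also have "\<dots> = iprod (map b u) \<otimes> (\<iota> (b i) \<otimes> (\<iota> (b j) \<otimes> iprod (map b v))) \<oplus> iprod (map b u) \<otimes> (\<iota> ?br \<otimes> iprod (map b v))"
        unfolding iota_commute[OF c(2,1)] using c bc by (simp add: A.l_distr A.r_distr A.m_assoc)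
      also have "\<dots> = iprod (map b (u @ i # j # v)) \<oplus> iprod (map b u @ ?br # map b v)"
        using iprod_append[OF map_b_closed[OF k(1)], of "b i # b j # map b v"]
          iprod_append[OF map_b_closed[OF k(1)], of "?br # map b v"] c bc map_b_closed[OF k(2)] by simp
      also have "\<dots> \<in> fspan (normal_monomials n)"
      proof (rule fspan_add[OF S])
        have "(u @ i # j # v, w) \<in> word_ord" using word_ord_swap[OF ij, of u v] by (simp add: w)
        then show "iprod (map b (u @ i # j # v)) \<in> fspan (normal_monomials n)"
          by (rule 1(1)) (use k in simp)
        show "iprod (map b u @ ?br # map b v) \<in> fspan (normal_monomials n)"
          by (rule short[OF k(1,2) _ bc(1)]) (simp add: w)
      qed
      finally show ?thesis .
    next
      fix u i v assume w: "w = u @ replicate p i @ v"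
      have k: "set u \<subseteq> {..<n}" "set v \<subseteq> {..<n}" "i < n" using 1(2) w two_le_p by auto
      have c: "b i \<in> carrier L" "\<iota> (b i) \<in> carrier A" "pmap L (b i) \<in> carrier L"
        using k b_closed iota_closed pmap_closed by auto
      have "set (replicate p (b i)) \<subseteq> carrier L" using c by auto
      then have "iprod (map b w) = iprod (map b u) \<otimes> (iprod (replicate p (b i)) \<otimes> iprod (map b v))"
        using iprod_append[OF map_b_closed[OF k(1)], of "replicate p (b i) @ map b v"]
          iprod_append[of "replicate p (b i)" "map b v"] c map_b_closed[OF k(2)] by (simp add: w)
      also have "\<dots> = iprod (map b u @ pmap L (b i) # map b v)"
        unfolding iprod_replicate[OF c(1)] iota_pow[OF c(1)]
        using iprod_append[OF map_b_closed[OF k(1)], of "pmap L (b i) # map b v"] c map_b_closed[OF k(2)] by simp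
      also have "\<dots> \<in> fspan (normal_monomials n)"
        by (rule short[OF k(1,2) _ c(3)]) (use two_le_p in \<open>simp add: w\<close>)
      finally show ?thesis .
    qed
  qed
qed

lemma normal_span: "carrier A \<subseteq> fspan (normal_monomials n)"
proof (rule generated[OF fspan.zero])
  note S = normal_monomials_closed[OF order_refl]
  show "c \<oplus> d \<in> fspan (normal_monomials n)"
    if "c \<in> fspan (normal_monomials n)" "d \<in> fspan (normal_monomials n)" for c d
    by (rule fspan_add[OF S that])
  have "iprod (map b w @ xs) \<in> fspan (normal_monomials n)" if "set xs \<subseteq> carrier L" "set w \<subseteq> {..<n}" for w xs
    using that
  proof (induction xs arbitrary: w)
    case Nil
    then show ?case using monomial_in_normal_span[of w] by simp
  next
    case (Cons x xs)
    show ?case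
    proof (rule iprod_letter_in_fspan[OF S map_b_closed[OF Cons.prems(2)]])
      show "iprod (map b w @ b k # xs) \<in> fspan (normal_monomials n)" if "k < n" for k
        using Cons.IH[of "w @ [k]"] Cons.prems that by simp
    qed (use Cons.prems in auto)
  qed
  from this[of _ "[]"] show "\<sigma> a \<otimes> iprod xs \<in> fspan (normal_monomials n)"
    if "a \<in> carrier F" "set xs \<subseteq> carrier L" for a xs
    using fspan_scale[OF S that(1)] that(2) by simp
qed

text \<open>Normal words are sorted, so the letters that kill \<open>e\<close>, which carry the
  largest indices, stand at the right end next to \<open>e\<close>. Only words in the first
  \<open>r\<close> letters survive.\<close>

lemma cyclic_span:
  assumes e: "e \<in> carrier A" and kill: "\<And>k. r \<le> k \<Longrightarrow> k < n \<Longrightarrow> \<iota> (b k) \<otimes> e = \<zero>" and rn: "r \<le> n"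
    and c: "c \<in> carrier A"
  shows "c \<otimes> e \<in> fspan ((\<lambda>x. x \<otimes> e) ` normal_monomials r)"
proof -
  note S = normal_monomials_closed[OF order_refl]
  have "c \<in> fspan (normal_monomials n)" by (rule subsetD[OF normal_span c])
  then show ?thesis
  proof induction
    case zero
    show ?case using e fspan.zero by simp
  next
    case (add a x u)
    have k: "x \<in> carrier A" "u \<in> carrier A" "\<sigma> a \<in> carrier A"
      using subsetD[OF S add(2)] subsetD[OF fspan_closed[OF S] add(3)] sigma_closed[OF add(1)] by auto
    from add(2) obtain w where w: "x = iprod (map b w)" "normal_word p w" "set w \<subseteq> {..<n}"
      by (elim CollectE exE conjE)
    have x: "(\<sigma> a \<otimes> x \<oplus> u) \<otimes> e = \<sigma> a \<otimes> (x \<otimes> e) \<oplus> u \<otimes> e"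
      using k e by (simp add: A.l_distr A.m_assoc)
    show ?case
    proof (cases "set w \<subseteq> {..<r}")
      case True
      show ?thesis unfolding x 
        by (intro fspan.add[OF add(1) _ add.IH] imageI CollectI exI[of _ w] conjI w True)
    next
      case False
      then have "w \<noteq> []" by (intro notI) simp
      then obtain v l where v: "w = v @ [l]" by (meson rev_exhaust)
      have l: "l < n" "set v \<subseteq> {..<n}" using w(3) unfolding v by simp_all
      have "r \<le> l"
      proof -
        have le: "\<forall>i\<in>set v. i \<le> l" using w(2) unfolding v normal_word_def sorted_append by simp
        have "set w \<subseteq> {..<r}" if "l < r"
        proof
          fix i assume "i \<in> set w"
          then have "i \<le> l" using le unfolding v by (simp, elim disjE) simp_all
          then show "i \<in> {..<r}" using that by simp
        qed
        then show ?thesis using False by (meson not_less)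
      qed
      have c: "iprod (map b v) \<in> carrier A" "\<iota> (b l) \<in> carrier A"
        using iprod_closed[OF map_b_closed[OF l(2)]] b_closed[OF l(1)] iota_closed by auto
      have "x = iprod (map b v) \<otimes> \<iota> (b l)"
        using iprod_append[OF map_b_closed[OF l(2)], of "[b l]"] b_closed[OF l(1)] c by (simp add: w(1) v)
      then have "x \<otimes> e = \<zero>" using kill[OF \<open>r \<le> l\<close> l(1)] c e by (simp add: A.m_assoc)
      then have "(\<sigma> a \<otimes> x \<oplus> u) \<otimes> e = u \<otimes> e" unfolding x using k e by simp
      then show ?thesis using add.IH by simp
    qed
  qed
qed

end

lemma count_list_filter_le: "count_list (filter P w) i \<le> count_list w i"
  by (induction w) auto

text \<open>Splitting off the block of the largest letter \<open>r\<close> makes normal words in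
  \<open>Suc r\<close> letters correspond to pairs of a normal word in \<open>r\<close> letters and
  an exponent below \<open>p\<close>.\<close>

lemma normal_words_card:
  assumes p: "0 < p"
  shows "finite {w. normal_word p w \<and> set w \<subseteq> {..<r}} \<and> card {w. normal_word p w \<and> set w \<subseteq> {..<r}} = p ^ r"
proof (induction r)
  case 0
  have "{w. normal_word p w \<and> set w \<subseteq> {..<0}} = {[]}" using p by (auto simp: normal_word_def)
  then show ?case by simp
next
  case (Suc r)
  let ?N = "\<lambda>r. {w. normal_word p w \<and> set w \<subseteq> {..<r}}"
  let ?h = "\<lambda>(w, k). w @ replicate k r"
  have cnt: "count_list w r = 0" if "w \<in> ?N r" for w using that by (auto simp: count_list_0_iff)
  have inj: "inj_on ?h (?N r \<times> {..<p})"
  proof (rule inj_onI, clarify)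
    fix w k w' k' assume w: "normal_word p w" "set w \<subseteq> {..<r}" "normal_word p w'" "set w' \<subseteq> {..<r}"
      and e: "w @ replicate k r = w' @ replicate k' r"
    from arg_cong[OF e, of "\<lambda>v. count_list v r"] have "k = k'"
      using cnt[of w] cnt[of w'] w by (simp add: count_list_append count_list_replicate)
    then show "w = w' \<and> k = k'" using e by simp
  qed
  have im: "?h ` (?N r \<times> {..<p}) = ?N (Suc r)"
  proof
    show "?h ` (?N r \<times> {..<p}) \<subseteq> ?N (Suc r)"
    proof clarify
      fix w k assume w: "normal_word p w" "set w \<subseteq> {..<r}" and k: "k < p"
      have c: "count_list w r = 0" using cnt[of w] w by simp
      have "sorted (w @ replicate k r)" using w by (auto simp: normal_word_def sorted_append)
      moreover have "count_list (w @ replicate k r) i < p" for i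
        using w k c by (cases "i = r") (auto simp: count_list_append count_list_replicate normal_word_def)
      moreover have "set (w @ replicate k r) \<subseteq> {..<Suc r}" using w(2) by auto
      ultimately show "normal_word p (w @ replicate k r) \<and> set (w @ replicate k r) \<subseteq> {..<Suc r}"
        by (simp add: normal_word_def)
    qed
    show "?N (Suc r) \<subseteq> ?h ` (?N r \<times> {..<p})"
    proof
      fix w assume "w \<in> ?N (Suc r)"
      then have w: "sorted w" "\<And>i. count_list w i < p" "set w \<subseteq> {..<Suc r}" by (simp_all add: normal_word_def)
      let ?v = "filter (\<lambda>x. x < r) w"
      have "filter (\<lambda>x. r < x) w = []" using w(3) by (auto simp: filter_empty_conv)
      then have e: "w = ?v @ replicate (count_list w r) r" using sorted_split_count[OF w(1), of r] by simp
      have "sorted ?v" using sorted_filter[of "\<lambda>x. x" w] w(1) by simp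
      moreover have "count_list ?v i < p" for i using count_list_filter_le w(2) by (rule le_less_trans)
      ultimately have "?v \<in> ?N r" by (auto simp: normal_word_def)
      then have "?h (?v, count_list w r) \<in> ?h ` (?N r \<times> {..<p})" using w(2) by (intro imageI) simp
      then show "w \<in> ?h ` (?N r \<times> {..<p})" using e by simp
    qed
  qed
  have f: "finite (?N r \<times> {..<p})" using Suc by simp
  have "finite (?h ` (?N r \<times> {..<p}))" "card (?h ` (?N r \<times> {..<p})) = card (?N r \<times> {..<p})"
    by (rule finite_imageI[OF f], rule card_image[OF inj])
  then show ?case unfolding im using Suc by (simp add: card_cartesian_product)
qed

context vectorspace
begin

text \<open>The functional \<open>\<phi> i\<close> vanishes on the other vectors and not on
  \<open>v i\<close>, which gives independence. Spanning is expressed by \<open>hull\<close> through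
  subspaces, a form that the inductively defined spans in \<open>A\<close> supply directly.\<close>

lemma dim_dual_family:
  assumes fin: "finite I" and v: "\<And>i. i \<in> I \<Longrightarrow> v i \<in> carrier V"
    and add: "\<And>i x y. i \<in> I \<Longrightarrow> x \<in> carrier V \<Longrightarrow> y \<in> carrier V \<Longrightarrow> \<phi> i (x \<oplus>\<^bsub>V\<^esub> y) = \<phi> i x \<oplus>\<^bsub>K\<^esub> \<phi> i y"
    and smult: "\<And>i a x. i \<in> I \<Longrightarrow> a \<in> carrier K \<Longrightarrow> x \<in> carrier V \<Longrightarrow> \<phi> i (a \<odot>\<^bsub>V\<^esub> x) = a \<otimes>\<^bsub>K\<^esub> \<phi> i x"
    and cl: "\<And>i x. i \<in> I \<Longrightarrow> x \<in> carrier V \<Longrightarrow> \<phi> i x \<in> carrier K"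
    and dual: "\<And>i j. i \<in> I \<Longrightarrow> j \<in> I \<Longrightarrow> \<phi> i (v j) = (if i = j then \<one>\<^bsub>K\<^esub> else \<zero>\<^bsub>K\<^esub>)"
    and hull: "\<And>W. subspace K W V \<Longrightarrow> v ` I \<subseteq> W \<Longrightarrow> carrier V \<subseteq> W"
  shows "fin_dim" "dim = card I"
proof -
  have vc: "v ` I' \<subseteq> carrier V" if "I' \<subseteq> I" for I' using that v by auto
  have phi0: "\<phi> i \<zero>\<^bsub>V\<^esub> = \<zero>\<^bsub>K\<^esub>" if "i \<in> I" for i
    using smult[OF that R.zero_closed M.zero_closed] cl[OF that M.zero_closed] by simp
  have out: "v i \<notin> span (v ` I')" if i: "i \<in> I" "i \<notin> I'" "I' \<subseteq> I" for i I'
  proof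
    assume a: "v i \<in> span (v ` I')"
    have "subspace K {x \<in> carrier V. \<phi> i x = \<zero>\<^bsub>K\<^esub>} V"
      by (rule subspaceI) (use i(1) in \<open>simp_all add: phi0 add smult\<close>)
    moreover have "v ` I' \<subseteq> {x \<in> carrier V. \<phi> i x = \<zero>\<^bsub>K\<^esub>}" using i v dual by auto
    ultimately have "span (v ` I') \<subseteq> {x \<in> carrier V. \<phi> i x = \<zero>\<^bsub>K\<^esub>}" by (rule span_subset)
    then have "\<phi> i (v i) = \<zero>\<^bsub>K\<^esub>" using a by blast
    then show False using dual[OF i(1,1)] by simp
  qed
  have li: "lin_indpt (v ` I')" if "finite I'" "I' \<subseteq> I" for I'
    using that
  proof (induction I' rule: finite_induct)
    case empty
    then show ?case by (simp add: lin_indpt_empty)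
  next
    case (insert i I')
    have i: "i \<in> I" "I' \<subseteq> I" using insert.prems by auto
    have o: "v i \<notin> span (v ` I')" by (rule out[OF i(1) insert.hyps(2) i(2)])
    then have "v i \<notin> v ` I'" using span_superset[OF vc[OF i(2)]] by blast
    from lin_dep_iff_in_span[OF vc[OF i(2)] insert.IH[OF i(2)] v[OF i(1)] this] o
    show ?case by (simp add: Un_commute)
  qed
  have inj: "inj_on v I"
  proof (rule inj_onI)
    fix i j assume ij: "i \<in> I" "j \<in> I" "v i = v j"
    then have "\<phi> i (v j) = \<one>\<^bsub>K\<^esub>" using dual[of i i] by simp
    then show "i = j" using dual[OF ij(1,2)] by (cases "i = j") simp_all
  qed
  have sub: "subspace K (span (v ` I)) V" by (rule span_is_subspace[OF vc[OF subset_refl]])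
  have "carrier V \<subseteq> span (v ` I)" by (rule hull[OF sub span_superset[OF vc[OF subset_refl]]])
  then have "span (v ` I) = carrier V" using subspaceD(1)[OF sub] by simp
  then show "fin_dim" unfolding fin_dim_def
    by (intro exI[of _ "v ` I"] conjI finite_imageI fin vc[OF subset_refl])
  have "basis (v ` I)" using \<open>span (v ` I) = carrier V\<close> unfolding basis_def using li[OF fin subset_refl] vc[OF subset_refl] by simp
  then have "dim = card (v ` I)" using fin by (intro dim_basis) simp_all
  then show "dim = card I" using card_image[OF inj] by simp
qed

end

context restricted_lie_algebra
begin

text \<open>The basis of \<open>T\<close> is placed after its complement, because
  \<open>cyclic_span\<close> needs the torus letters at the right end of sorted words.\<close>

lemma adapted_basis:
  assumes fd: "fin_dim" and T: "subspace F T L"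
  obtains n r b coord where "lie_basis F L p n b coord" "n = dim" "r \<le> n" "n - r = sdim T"
    "\<And>k. r \<le> k \<Longrightarrow> k < n \<Longrightarrow> b k \<in> T" "\<And>k t. k < r \<Longrightarrow> t \<in> T \<Longrightarrow> coord k t = \<zero>\<^bsub>F\<^esub>"
proof -
  obtain S where S: "finite S" "S \<subseteq> T" "lin_indpt S" "span S = T" "card S = sdim T"
    by (rule subspace_basis[OF fd T])
  have Sc: "S \<subseteq> carrier L" using S(2) subspaceD(1)[OF T] by blast
  obtain B where B: "finite B" "S \<subseteq> B" "B \<subseteq> carrier L" "lin_indpt B" "span B = carrier L" "card B = sdim (carrier L)"
    by (rule subspace_basis_extend[OF fd whole_subspace Sc S(3)])
  obtain xs where xs: "set xs = B - S" "distinct xs" using finite_distinct_list[of "B - S"] B(1) by blast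
  obtain ys where ys: "set ys = S" "distinct ys" using finite_distinct_list[OF S(1)] by blast
  let ?l = "xs @ ys"
  define n where "n = length ?l"
  define r where "r = length xs"
  define b where "b i = ?l ! i" for i
  have dl: "distinct ?l" "set ?l = B" using xs ys B(2) by auto
  have n: "n = dim" unfolding n_def using distinct_card[OF dl(1)] dl(2) B(6) sdim_carrier by simp
  have nr: "n - r = sdim T" unfolding n_def r_def using distinct_card[OF ys(2)] ys(1) S(5) by simp
  have bB: "b k \<in> B" if "k < n" for k
    using nth_mem[of k ?l] that unfolding b_def n_def dl(2) .
  have binj: "b k = b l \<longleftrightarrow> k = l" if "k < n" "l < n" for k l
    unfolding b_def using nth_eq_iff_index_eq[OF dl(1)] that by (simp add: n_def)
  have bim: "b ` {..<n} = B"
    unfolding b_def n_def dl(2)[symmetric] by (auto simp: set_conv_nth image_iff simp del: set_append)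
  have bs: "basis B" unfolding basis_def using B by simp
  \<comment> \<open>Among extensional functions the coefficient family of a vector is unique, so
    additivity and homogeneity of the coordinates follow by exhibiting the expected family.\<close>
  define cf where "cf x = (THE a. a \<in> B \<rightarrow>\<^sub>E carrier F \<and> lincomb a B = x)" for x
  have ex1: "\<exists>!a. a \<in> B \<rightarrow>\<^sub>E carrier F \<and> lincomb a B = x" if "x \<in> carrier L" for x
    using bs that unfolding basis_criterion[OF B(1,3)] by simp
  have cfI: "cf x \<in> B \<rightarrow>\<^sub>E carrier F \<and> lincomb (cf x) B = x" if "x \<in> carrier L" for x
    unfolding cf_def by (rule theI'[OF ex1[OF that]])
  have cfB: "cf x v \<in> carrier F" if "x \<in> carrier L" "v \<in> B" for x v
    using cfI[OF that(1)] that(2) by (auto dest: PiE_mem)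
  have cfe: "cf x = a" if "x \<in> carrier L" "a \<in> B \<rightarrow>\<^sub>E carrier F" "lincomb a B = x" for x a
    unfolding cf_def by (rule the1_equality[OF ex1[OF that(1)]]) (use that in simp)
  have lc: "lincomb (restrict a B) B = (\<Oplus>v\<in>B. a v \<odot> v)" if "\<And>v. v \<in> B \<Longrightarrow> a v \<in> carrier F" for a
    unfolding lincomb_def by (rule M.finsum_cong') (use that B(3) in auto)
  have ex: "(\<Oplus>v\<in>B. cf x v \<odot> v) = x" if "x \<in> carrier L" for x
    using cfI[OF that] by (simp add: lincomb_def)
  have Bc: "v \<in> carrier L" if "v \<in> B" for v using that B(3) by blast
  \<comment> \<open>\<open>lie_basis\<close> asks for closure at every index, hence the default
    value 0 from \<open>n\<close> on.\<close>
  define coord where "coord k x = (if k < n then cf x (b k) else \<zero>\<^bsub>F\<^esub>)" for k x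
  have basis: "lie_basis F L p n b coord"
  proof (unfold_locales)
    show "b k \<in> carrier L" if "k < n" for k by (rule Bc[OF bB[OF that]])
    show "coord k x \<in> carrier F" if "x \<in> carrier L" for k x
      unfolding coord_def using cfB[OF that bB] by simp
    show "coord k (x \<oplus> y) = coord k x \<oplus>\<^bsub>F\<^esub> coord k y" if xy: "x \<in> carrier L" "y \<in> carrier L" for k x y
    proof -
      have "(\<Oplus>v\<in>B. (cf x v \<oplus>\<^bsub>F\<^esub> cf y v) \<odot> v) = (\<Oplus>v\<in>B. cf x v \<odot> v \<oplus> cf y v \<odot> v)"
        by (rule M.finsum_cong') (use Bc cfB[OF xy(1)] cfB[OF xy(2)] in \<open>simp_all add: smult_l_distr\<close>)
      also have "\<dots> = x \<oplus> y"
        using M.finsum_addf[of "\<lambda>v. cf x v \<odot> v" B "\<lambda>v. cf y v \<odot> v"] Bc cfB[OF xy(1)] cfB[OF xy(2)] ex[OF xy(1)] ex[OF xy(2)]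
        by simp
      finally have "lincomb (restrict (\<lambda>v. cf x v \<oplus>\<^bsub>F\<^esub> cf y v) B) B = x \<oplus> y"
        using lc[of "\<lambda>v. cf x v \<oplus>\<^bsub>F\<^esub> cf y v"] cfB[OF xy(1)] cfB[OF xy(2)] by simp
      then have "cf (x \<oplus> y) = restrict (\<lambda>v. cf x v \<oplus>\<^bsub>F\<^esub> cf y v) B"
        by (intro cfe) (use xy cfB in auto)
      then show ?thesis unfolding coord_def using bB by simp
    qed
    show "coord k (a \<odot> x) = a \<otimes>\<^bsub>F\<^esub> coord k x" if ax: "a \<in> carrier F" "x \<in> carrier L" for k a x
    proof -
      have "(\<Oplus>v\<in>B. (a \<otimes>\<^bsub>F\<^esub> cf x v) \<odot> v) = (\<Oplus>v\<in>B. a \<odot> (cf x v \<odot> v))"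
        by (rule M.finsum_cong') (use Bc cfB[OF ax(2)] ax(1) in \<open>simp_all add: smult_assoc1\<close>)
      also have "\<dots> = a \<odot> x"
        using finsum_smult[OF ax(1), of "\<lambda>v. cf x v \<odot> v" B] Bc cfB[OF ax(2)] ex[OF ax(2)]
        by (simp add: image_subset_iff Pi_def)
      finally have "lincomb (restrict (\<lambda>v. a \<otimes>\<^bsub>F\<^esub> cf x v) B) B = a \<odot> x"
        using lc[of "\<lambda>v. a \<otimes>\<^bsub>F\<^esub> cf x v"] cfB[OF ax(2)] ax(1) by simp
      then have "cf (a \<odot> x) = restrict (\<lambda>v. a \<otimes>\<^bsub>F\<^esub> cf x v) B"
        by (intro cfe) (use ax cfB in auto)
      then show ?thesis unfolding coord_def using bB ax(1) by simp
    qed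
    show "coord k (b l) = (if k = l then \<one>\<^bsub>F\<^esub> else \<zero>\<^bsub>F\<^esub>)" if kl: "k < n" "l < n" for k l
    proof -
      let ?d = "\<lambda>v. if v = b l then \<one>\<^bsub>F\<^esub> else \<zero>\<^bsub>F\<^esub>"
      have "(\<Oplus>v\<in>B. ?d v \<odot> v) = (\<Oplus>v\<in>B. if v = b l then v else \<zero>)"
        by (rule M.finsum_cong') (use Bc in auto)
      also have "\<dots> = b l"
        using M.add.finprod_singleton_swap[of "b l" B "\<lambda>v. v"] bB[OF kl(2)] B(1) Bc by (simp add: Pi_def)
      finally have "lincomb (restrict ?d B) B = b l" using lc[of ?d] by simp
      then have "cf (b l) = restrict ?d B" by (intro cfe) (use Bc[OF bB[OF kl(2)]] in auto)
      then show ?thesis unfolding coord_def using kl bB[OF kl(1)] binj[OF kl] by simp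
    qed
    show "(\<Oplus>k\<in>{..<n}. coord k x \<odot> b k) = x" if x: "x \<in> carrier L" for x
    proof -
      have "(\<Oplus>k\<in>{..<n}. coord k x \<odot> b k) = (\<Oplus>k\<in>{..<n}. cf x (b k) \<odot> b k)"
        by (rule M.finsum_cong') (use Bc bB cfB[OF x] in \<open>auto simp: coord_def\<close>)
      also have "\<dots> = (\<Oplus>v\<in>b ` {..<n}. cf x v \<odot> v)"
        by (rule M.finsum_reindex[symmetric]) (use binj Bc cfB[OF x] bim in \<open>auto simp: inj_on_def\<close>)
      finally show ?thesis unfolding bim using ex[OF x] by simp
    qed
  qed
  then interpret lie_basis F L p n b coord .
  have bT: "b k \<in> S" if "r \<le> k" "k < n" for k
    using that nth_mem[of "k - r" ys] ys(1) unfolding b_def r_def n_def by (simp add: nth_append)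
  have rn: "r \<le> n" by (simp add: r_def n_def)
  have cT: "coord k t = \<zero>\<^bsub>F\<^esub>" if k: "k < r" and t: "t \<in> T" for k t
  proof -
    have z: "coord k \<zero> = \<zero>\<^bsub>F\<^esub>" using coord_smult[OF R.zero_closed M.zero_closed, of k] coord_closed[OF M.zero_closed, of k] by simp
    have "subspace F {t \<in> carrier L. coord k t = \<zero>\<^bsub>F\<^esub>} L"
      by (rule subspaceI) (simp_all add: z coord_add coord_smult)
    moreover have "S \<subseteq> {t \<in> carrier L. coord k t = \<zero>\<^bsub>F\<^esub>}"
    proof
      fix s assume s: "s \<in> S"
      then obtain j where j: "j < length ys" "s = ys ! j" using ys(1) by (metis in_set_conv_nth)
      then have "s = b (r + j)" "r + j < n" by (simp_all add: b_def r_def n_def nth_append)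
      then show "s \<in> {t \<in> carrier L. coord k t = \<zero>\<^bsub>F\<^esub>}" using coord_b[of k "r + j"] k s Sc by auto
    qed
    ultimately have "span S \<subseteq> {t \<in> carrier L. coord k t = \<zero>\<^bsub>F\<^esub>}" by (rule span_subset)
    then show ?thesis using t S(4) by blast
  qed
  show thesis by (rule that[OF basis n rn nr _ cT]) (use bT S(2) in auto)
qed

end

section \<open>The projective cover of the trivial module\<close>

context ring
begin

definition ideal_module :: "'a set \<Rightarrow> ('a, 'a) module" where
  "ideal_module N = \<lparr>carrier = N, monoid.mult = (\<otimes>), one = \<one>, ring.zero = \<zero>, add = (\<oplus>), smult = (\<otimes>)\<rparr>"

lemma ideal_module_left_module:
  assumes N: "left_ideal N" shows "left_module R (ideal_module N)"
proof -
  note N' = left_idealD[OF N]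
  have c: "x \<in> carrier R" if "x \<in> N" for x using that N'(1) by blast
  have "abelian_group (ideal_module N)"
  proof (rule abelian_groupI)
    fix x assume "x \<in> carrier (ideal_module N)"
    then have x: "x \<in> N" by (simp add: ideal_module_def)
    have "\<ominus> \<one> \<otimes> x \<oplus> x = \<zero>" using c[OF x] by (simp add: l_minus l_neg)
    then show "\<exists>y\<in>carrier (ideal_module N). y \<oplus>\<^bsub>ideal_module N\<^esub> x = \<zero>\<^bsub>ideal_module N\<^esub>"
      using N'(4)[OF _ x, of "\<ominus> \<one>"] by (auto simp: ideal_module_def)
  qed (use N' c in \<open>simp_all add: ideal_module_def a_ac\<close>)
  then show ?thesis
    unfolding left_module_def left_module_axioms_def using ring_axioms N'(3,4) c
    by (simp add: ideal_module_def l_distr r_distr m_assoc)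
qed

lemma cyclic_left_ideal:
  assumes e: "e \<in> carrier R" shows "left_ideal ((\<lambda>c. c \<otimes> e) ` carrier R)"
proof -
  let ?N = "(\<lambda>c. c \<otimes> e) ` carrier R"
  have "\<zero> \<in> ?N" using e by (intro image_eqI[of _ _ \<zero>]) simp_all
  moreover have "x \<oplus> y \<in> ?N" if "x \<in> ?N" "y \<in> ?N" for x y
  proof -
    from that(1) obtain c where c: "x = c \<otimes> e" "c \<in> carrier R" by (rule imageE)
    from that(2) obtain d where d: "y = d \<otimes> e" "d \<in> carrier R" by (rule imageE)
    show ?thesis using c d e by (intro image_eqI[of _ _ "c \<oplus> d"]) (simp_all add: l_distr)
  qed
  moreover have "a \<otimes> x \<in> ?N" if "a \<in> carrier R" "x \<in> ?N" for a x
  proof -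
    from that(2) obtain c where c: "x = c \<otimes> e" "c \<in> carrier R" by (rule imageE)
    then show ?thesis using e that(1) by (intro image_eqI[of _ _ "a \<otimes> c"]) (simp_all add: m_assoc)
  qed
  moreover have "?N \<subseteq> carrier R" using e by auto
  ultimately show ?thesis unfolding left_ideal_def by (intro conjI ballI)
qed

end

context restricted_lie_algebra
begin

abbreviation "U_scalar \<equiv> restricted_env_scalar F L p"

theorem U_restricted_envelope:
  "restricted_envelope F L p U U_scalar (\<lambda>x. U_gen x) restricted_env_augmentation"
proof -
  interpret E: lie_envelope F L p U U_scalar "\<lambda>x. U_gen x" by (rule U_envelope)
  show ?thesis
  proof unfold_locales
    show "U_gen x [^]\<^bsub>U\<^esub> p = U_gen (pmap L x)" if "x \<in> carrier L" for x by (rule U_pmap[OF that])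
    show "carrier U \<subseteq> G" if "\<zero>\<^bsub>U\<^esub> \<in> G" "\<And>c d. c \<in> G \<Longrightarrow> d \<in> G \<Longrightarrow> c \<oplus>\<^bsub>U\<^esub> d \<in> G"
      "\<And>a xs. a \<in> carrier F \<Longrightarrow> set xs \<subseteq> carrier L \<Longrightarrow> U_scalar a \<otimes>\<^bsub>U\<^esub> E.iprod xs \<in> G" for G
    proof
      fix c assume "c \<in> carrier U"
      then show "c \<in> G" by (induction rule: U_induct) (simp_all add: that)
    qed
  qed (simp_all add: U_augmentation)
qed

lemma underlying_vectorspace:
  assumes "left_module U M" shows "vectorspace F (underlying_vs F L p M)"
proof -
  interpret M: left_module U M by fact
  interpret E: lie_envelope F L p U U_scalar "\<lambda>x. U_gen x" by (rule U_envelope)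
  have "abelian_group (underlying_vs F L p M)"
  proof (rule abelian_groupI)
    fix x assume "x \<in> carrier (underlying_vs F L p M)"
    then show "\<exists>y\<in>carrier (underlying_vs F L p M). y \<oplus>\<^bsub>underlying_vs F L p M\<^esub> x = \<zero>\<^bsub>underlying_vs F L p M\<^esub>"
      by (intro bexI[of _ "\<ominus>\<^bsub>M\<^esub> x"]) (simp_all add: underlying_vs_def M.M.l_neg)
  qed (simp_all add: underlying_vs_def M.M.a_ac)
  then have "module F (underlying_vs F L p M)"
    by (rule moduleI[OF R.is_cring])
      (simp_all add: underlying_vs_def M.smult_closed E.sigma_closed M.smult_r_distr M.smult_l_distr[symmetric]
        M.smult_assoc[symmetric] M.smult_one E.sigma_one ring_hom_add[OF E.sigma_hom] ring_hom_mult[OF E.sigma_hom])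
  then show ?thesis unfolding vectorspace_def using field_axioms by simp
qed

text \<open>\<open>e\<close> is the element 1 + u killed by a maximal torus. The normal monomials in
  the letters outside the torus, multiplied by \<open>e\<close>, form a basis of ue: they span it by
  \<open>cyclic_span\<close>, and the Poincare-Birkhoff-Witt functionals are dual to them.\<close>

theorem local_idempotent:
  assumes fd: "fin_dim" and sol: "solvable_lie F L"
  obtains e where "e \<in> carrier U" "e \<otimes>\<^bsub>U\<^esub> e = e" "restricted_env_augmentation e = \<one>\<^bsub>F\<^esub>"
    "\<And>N n. ring.left_ideal U N \<Longrightarrow> n \<in> N \<Longrightarrow> n \<in> (\<lambda>c. c \<otimes>\<^bsub>U\<^esub> e) ` carrier U \<Longrightarrow>
      restricted_env_augmentation n = \<one>\<^bsub>F\<^esub> \<Longrightarrow> e \<in> N"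
    "vectorspace.fin_dim F (underlying_vs F L p (ring.ideal_module U ((\<lambda>c. c \<otimes>\<^bsub>U\<^esub> e) ` carrier U)))"
    "vectorspace.dim F (underlying_vs F L p (ring.ideal_module U ((\<lambda>c. c \<otimes>\<^bsub>U\<^esub> e) ` carrier U))) = p ^ (dim - MT F L)"
proof -
  interpret E: restricted_envelope F L p U U_scalar "\<lambda>x. U_gen x" restricted_env_augmentation
    by (rule U_restricted_envelope)
  obtain T where T: "torus F L T" "sdim T = MT F L" and max: "\<And>T'. torus F L T' \<Longrightarrow> sdim T' \<le> sdim T"
    by (rule max_torus_exists[OF fd]) (rule that)
  note T' = torusD[OF T(1)]
  obtain u where u: "u \<in> E.aug T" and kill: "\<And>t. t \<in> T \<Longrightarrow> U_gen t \<otimes>\<^bsub>U\<^esub> (\<one>\<^bsub>U\<^esub> \<oplus>\<^bsub>U\<^esub> u) = \<zero>\<^bsub>U\<^esub>"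
    by (rule E.torus_idempotent[OF fd T(1)]) (rule that)
  define e where "e = \<one>\<^bsub>U\<^esub> \<oplus>\<^bsub>U\<^esub> u"
  have uc: "u \<in> carrier U" by (rule subsetD[OF E.fspan_closed[OF E.aug_set_closed[OF T'(2)]] u])
  have e: "e \<in> carrier U" unfolding e_def using uc by simp
  have ekill: "\<And>t. t \<in> T \<Longrightarrow> U_gen t \<otimes>\<^bsub>U\<^esub> e = \<zero>\<^bsub>U\<^esub>" unfolding e_def by (rule kill)
  have "e \<otimes>\<^bsub>U\<^esub> e = (\<one>\<^bsub>U\<^esub> \<oplus>\<^bsub>U\<^esub> u) \<otimes>\<^bsub>U\<^esub> e" unfolding e_def ..
  \<comment> \<open>\<open>u\<close> lies in the augmentation ideal of the torus, which kills
    \<open>e\<close>, so e e = e + u e = e.\<close>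
  then have ee: "e \<otimes>\<^bsub>U\<^esub> e = e"
    using E.aug_kill[OF T'(2) e ekill u] uc e by (simp add: E.A.l_distr)
  have eps: "restricted_env_augmentation e = \<one>\<^bsub>F\<^esub>"
    unfolding e_def using ring_hom_add[OF E.eps_hom E.A.one_closed uc] ring_hom_one[OF E.eps_hom] E.eps_aug[OF T'(2) u] by simp
  have ess: "e \<in> N" if N: "E.A.left_ideal N" and n: "n \<in> N" "n \<in> (\<lambda>c. c \<otimes>\<^bsub>U\<^esub> e) ` carrier U"
    "restricted_env_augmentation n = \<one>\<^bsub>F\<^esub>" for N n
  proof -
    obtain c where c: "c \<in> carrier U" "n = c \<otimes>\<^bsub>U\<^esub> e" using n(2) by (elim imageE)
    have "restricted_env_augmentation c = \<one>\<^bsub>F\<^esub>"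
      using ring_hom_mult[OF E.eps_hom c(1) e] ring_hom_closed[OF E.eps_hom c(1)] n(3) eps c(2) by simp
    \<comment> \<open>\<open>c\<close> and 1 have the same augmentation, so 1 - c lies in the left
      ideal generated by \<open>L\<close>, and e = n + (1 - c) e starts the descent along the
      tower.\<close>
    then have "c \<ominus>\<^bsub>U\<^esub> \<one>\<^bsub>U\<^esub> \<in> E.lideal (carrier L)" using E.augmentation_ideal[OF c(1)] E.sigma_one by simp
    then have "(\<ominus>\<^bsub>U\<^esub> \<one>\<^bsub>U\<^esub>) \<otimes>\<^bsub>U\<^esub> (c \<ominus>\<^bsub>U\<^esub> \<one>\<^bsub>U\<^esub>) \<in> E.lideal (carrier L)"
      by (rule E.A.left_idealD(4)[OF E.lideal_left[OF subset_refl] E.A.a_inv_closed[OF E.A.one_closed]])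
    moreover have "(\<ominus>\<^bsub>U\<^esub> \<one>\<^bsub>U\<^esub>) \<otimes>\<^bsub>U\<^esub> (c \<ominus>\<^bsub>U\<^esub> \<one>\<^bsub>U\<^esub>) = \<one>\<^bsub>U\<^esub> \<ominus>\<^bsub>U\<^esub> c"
      using c(1) by (simp add: E.A.l_minus E.A.minus_eq E.A.minus_add E.A.a_comm)
    ultimately have v: "\<one>\<^bsub>U\<^esub> \<ominus>\<^bsub>U\<^esub> c \<in> E.lideal (carrier L)" by simp
    have "e = n \<oplus>\<^bsub>U\<^esub> (\<one>\<^bsub>U\<^esub> \<ominus>\<^bsub>U\<^esub> c) \<otimes>\<^bsub>U\<^esub> e"
    proof -
      have "n \<oplus>\<^bsub>U\<^esub> (\<one>\<^bsub>U\<^esub> \<ominus>\<^bsub>U\<^esub> c) \<otimes>\<^bsub>U\<^esub> e = (c \<oplus>\<^bsub>U\<^esub> (\<one>\<^bsub>U\<^esub> \<ominus>\<^bsub>U\<^esub> c)) \<otimes>\<^bsub>U\<^esub> e"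
        unfolding c(2) using c(1) e by (intro E.A.l_distr[symmetric]) simp_all
      also have "c \<oplus>\<^bsub>U\<^esub> (\<one>\<^bsub>U\<^esub> \<ominus>\<^bsub>U\<^esub> c) = \<one>\<^bsub>U\<^esub>"
        using c(1) by (simp add: E.A.minus_eq E.A.a_comm[of "\<one>\<^bsub>U\<^esub>"] E.A.r_neg2)
      finally show ?thesis using e by simp
    qed
    then show ?thesis by (rule E.tower_nakayama[OF fd T(1) max e ekill tower_carrier[OF fd sol] N n(1) v, rotated 2])
  qed
  obtain n r b coord where B: "lie_basis F L p n b coord" "n = dim" "r \<le> n" "n - r = sdim T"
    and bT: "\<And>k. r \<le> k \<Longrightarrow> k < n \<Longrightarrow> b k \<in> T" and cT: "\<And>k t. k < r \<Longrightarrow> t \<in> T \<Longrightarrow> coord k t = \<zero>\<^bsub>F\<^esub>"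
    by (rule adapted_basis[OF fd T'(1)]) (rule that)
  interpret B: lie_basis F L p n b coord by (rule B(1))
  interpret BE: based_envelope F L p n b coord U U_scalar "\<lambda>x. U_gen x" restricted_env_augmentation ..
  let ?N = "(\<lambda>c. c \<otimes>\<^bsub>U\<^esub> e) ` carrier U"
  let ?V = "underlying_vs F L p (E.A.ideal_module ?N)"
  let ?I = "{w. normal_word p w \<and> set w \<subseteq> {..<r}}"
  interpret V: vectorspace F ?V
    by (rule underlying_vectorspace[OF E.A.ideal_module_left_module[OF E.A.cyclic_left_ideal[OF e]]])
  have Vs: "carrier ?V = ?N" "add ?V = add U" "smult ?V = (\<lambda>a x. U_scalar a \<otimes>\<^bsub>U\<^esub> x)"
    by (simp_all add: underlying_vs_def E.A.ideal_module_def)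
  have Nc: "?N \<subseteq> carrier U" using E.A.left_idealD(1)[OF E.A.cyclic_left_ideal[OF e]] .
  have mb: "set (map b w) \<subseteq> carrier L" if "set w \<subseteq> {..<r}" for w
    by (rule B.map_b_closed) (use that B(3) in auto)
  \<comment> \<open>The properties of a functional dual to the monomial of \<open>\<gamma>\<close>,
    collected in one predicate so that a functional can be chosen for all \<open>\<gamma>\<close> at
    once.\<close>
  define Q where "Q = (\<lambda>\<gamma> \<Psi>. (\<forall>x\<in>carrier U. \<forall>y\<in>carrier U. \<Psi> (x \<oplus>\<^bsub>U\<^esub> y) = \<Psi> x \<oplus>\<^bsub>F\<^esub> \<Psi> y) \<and> (\<forall>x\<in>carrier U. \<Psi> x \<in> carrier F)
      \<and> (\<forall>a\<in>carrier F. \<forall>x\<in>carrier U. \<Psi> (U_scalar a \<otimes>\<^bsub>U\<^esub> x) = a \<otimes>\<^bsub>F\<^esub> \<Psi> x)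
      \<and> (\<forall>w\<in>?I. \<Psi> (E.iprod (map b w) \<otimes>\<^bsub>U\<^esub> e) = (if \<gamma> = w then \<one>\<^bsub>F\<^esub> else \<zero>\<^bsub>F\<^esub>)))"
  have ex: "\<exists>\<Psi>. Q \<gamma> \<Psi>"
    if g: "\<gamma> \<in> ?I" for \<gamma>
  proof -
    obtain f where f: "range f \<subseteq> carrier F" "\<And>w. normal_word p w \<Longrightarrow> f w = (if w = \<gamma> then \<one>\<^bsub>F\<^esub> else \<zero>\<^bsub>F\<^esub>)"
      "\<And>d. B.lie_functional d f"
      "\<And>us i ws. set us \<subseteq> carrier L \<Longrightarrow> set ws \<subseteq> carrier L \<Longrightarrow> i < n \<Longrightarrow>
         B.ml (us @ replicate p (b i) @ ws) f = B.ml (us @ pmap L (b i) # ws) f"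
      "\<And>w. B.W.obeys f w" by (rule B.pbw_functional[of \<gamma>]) (assumption | rule that)+
    obtain \<Psi> where \<Psi>: "\<And>c d. c \<in> carrier U \<Longrightarrow> d \<in> carrier U \<Longrightarrow> \<Psi> (c \<oplus>\<^bsub>U\<^esub> d) = \<Psi> c \<oplus>\<^bsub>F\<^esub> \<Psi> d"
      "\<And>c. c \<in> carrier U \<Longrightarrow> \<Psi> c \<in> carrier F"
      "\<And>a xs. a \<in> carrier F \<Longrightarrow> set xs \<subseteq> carrier L \<Longrightarrow> \<Psi> (U_scalar a \<otimes>\<^bsub>U\<^esub> E.iprod xs) = a \<otimes>\<^bsub>F\<^esub> B.ml xs f"
      by (rule B.U_functional[OF f(1,3,4)]) (assumption | rule that)+
    have z: "\<Psi> \<zero>\<^bsub>U\<^esub> = \<zero>\<^bsub>F\<^esub>" using \<Psi>(1)[OF E.A.zero_closed E.A.zero_closed] \<Psi>(2)[OF E.A.zero_closed] by simp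
    have sc: "\<Psi> (U_scalar a \<otimes>\<^bsub>U\<^esub> x) = a \<otimes>\<^bsub>F\<^esub> \<Psi> x" if a: "a \<in> carrier F" and x: "x \<in> carrier U" for a x
      using x
    proof (induction rule: U_induct)
      case zero
      then show ?case using E.sigma_closed[OF a] a by (simp add: z)
    next
      case (add c d)
      then show ?case using E.sigma_closed[OF a] a by (simp add: E.A.r_distr \<Psi>(1,2) R.r_distr)
    next
      case (monomial c xs)
      have "U_scalar a \<otimes>\<^bsub>U\<^esub> (U_scalar c \<otimes>\<^bsub>U\<^esub> E.iprod xs) = U_scalar (a \<otimes>\<^bsub>F\<^esub> c) \<otimes>\<^bsub>U\<^esub> E.iprod xs"
        using ring_hom_mult[OF E.sigma_hom a monomial(1)] E.sigma_closed[OF a] E.sigma_closed[OF monomial(1)]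
          E.iprod_closed[OF monomial(2)] by (simp add: E.A.m_assoc)
      then show ?case using \<Psi>(3) a monomial B.ml_closed[OF f(1) monomial(2)] by (simp add: R.m_assoc)
    qed
    \<comment> \<open>Since e = 1 + u with \<open>u\<close> in the augmentation ideal of
      \<open>T\<close>, the value at a monomial times \<open>e\<close> equals the value at the
      monomial once the functional vanishes on monomials followed by nonempty torus
      products.\<close>
    have aug0: "\<Psi> (E.iprod (map b w) \<otimes>\<^bsub>U\<^esub> y) = \<zero>\<^bsub>F\<^esub>" if w: "w \<in> ?I" and y: "y \<in> E.aug T" for w y
      using y
    proof induction
      case zero
      then show ?case using E.iprod_closed[OF mb] w by (simp add: z)
    next
      case (add a x y)
      from add(2) obtain ts where x: "x = E.iprod ts" "set ts \<subseteq> T" "ts \<noteq> []" by (elim CollectE exE conjE)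
      have tc: "set ts \<subseteq> carrier L" using x(2) T'(2) by (rule subset_trans)
      have wn: "normal_word p w" "set w \<subseteq> {..<r}" using w by auto
      have mw: "set (map b w) \<subseteq> carrier L" by (rule mb[OF wn(2)])
      have k: "E.iprod (map b w) \<in> carrier U" "x \<in> carrier U" "y \<in> carrier U" "U_scalar a \<in> carrier U"
        using E.iprod_closed[OF mw] subsetD[OF E.aug_set_closed[OF T'(2)] add(2)]
          subsetD[OF E.fspan_closed[OF E.aug_set_closed[OF T'(2)]] add(3)] E.sigma_closed[OF add(1)] by simp_all
      have "E.iprod (map b w) \<otimes>\<^bsub>U\<^esub> (U_scalar a \<otimes>\<^bsub>U\<^esub> x) = (E.iprod (map b w) \<otimes>\<^bsub>U\<^esub> U_scalar a) \<otimes>\<^bsub>U\<^esub> x"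
        using k by (simp add: E.A.m_assoc)
      also have "\<dots> = U_scalar a \<otimes>\<^bsub>U\<^esub> E.iprod (map b w @ ts)"
        unfolding E.sigma_iprod_commute[OF add(1) mw, symmetric] E.iprod_append[OF mw tc] x(1)[symmetric]
        using k by (simp add: E.A.m_assoc)
      finally have e1: "E.iprod (map b w) \<otimes>\<^bsub>U\<^esub> (U_scalar a \<otimes>\<^bsub>U\<^esub> x \<oplus>\<^bsub>U\<^esub> y)
        = U_scalar a \<otimes>\<^bsub>U\<^esub> E.iprod (map b w @ ts) \<oplus>\<^bsub>U\<^esub> E.iprod (map b w) \<otimes>\<^bsub>U\<^esub> y"
        using k by (simp add: E.A.r_distr)
      have wt: "set (map b w @ ts) \<subseteq> carrier L" using mw tc by simp
      have "B.ml (map b w @ ts @ map b []) f = B.ml ts (\<lambda>v. f (w @ v @ []))"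
        by (rule B.ml_context[OF f(1) _ _ tc]) (use wn(2) B(3) in auto)
      also have "\<dots> = \<zero>\<^bsub>F\<^esub>"
      proof (rule B.ml_eq_zero[of _ _ r])
        show "range (\<lambda>v. f (w @ v @ [])) \<subseteq> carrier F" using f(1) by auto
        show "set ts \<subseteq> carrier L" by (rule tc)
        show "coord k t = \<zero>\<^bsub>F\<^esub>" if "t \<in> set ts" "k < r" for t k using cT[OF that(2)] that(1) x(2) by blast
        fix v assume v: "set v \<subseteq> {r..<n}" "length v = length ts"
        have "f (w @ v) = \<zero>\<^bsub>F\<^esub>"
        proof (rule B.pbw_functional_torus[OF f(1,2,5) _ wn _ _ B(3) v(1)])
          show "set \<gamma> \<subseteq> {..<r}" using g by simp
          show "coord k (bracket L (b j) (b i)) = \<zero>\<^bsub>F\<^esub>" if "i < n" "j < n" "r \<le> i" "r \<le> j" "k < r" for i j k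
          proof -
            have "bracket L (b j) (b i) = \<zero>" using T'(3) bT that by (simp add: commuting_def)
            then show ?thesis using cT[OF that(5) subspaceD(2)[OF T'(1)]] by simp
          qed
          show "coord k (pmap L (b i)) = \<zero>\<^bsub>F\<^esub>" if "i < n" "r \<le> i" "k < r" for i k
            using cT[OF that(3) T'(4)[OF bT[OF that(2,1)]]] .
          show "v \<noteq> []" using v(2) x(3) by auto
        qed
        then show "f (w @ v @ []) = \<zero>\<^bsub>F\<^esub>" by simp
      qed
      finally have "B.ml (map b w @ ts) f = \<zero>\<^bsub>F\<^esub>" by simp
      then have "\<Psi> (U_scalar a \<otimes>\<^bsub>U\<^esub> E.iprod (map b w @ ts)) = \<zero>\<^bsub>F\<^esub>" using \<Psi>(3)[OF add(1) wt] add(1) by simp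
      then show ?case unfolding e1
        using \<Psi>(1)[of "U_scalar a \<otimes>\<^bsub>U\<^esub> E.iprod (map b w @ ts)" "E.iprod (map b w) \<otimes>\<^bsub>U\<^esub> y"] k E.iprod_closed[OF wt] add.IH
        by simp
    qed
    have "\<Psi> (E.iprod (map b w) \<otimes>\<^bsub>U\<^esub> e) = (if \<gamma> = w then \<one>\<^bsub>F\<^esub> else \<zero>\<^bsub>F\<^esub>)" if w: "w \<in> ?I" for w
    proof -
      have mw: "set (map b w) \<subseteq> carrier L" "set w \<subseteq> {..<n}" using mb w B(3) by auto
      have k: "E.iprod (map b w) \<in> carrier U" by (rule E.iprod_closed[OF mw(1)])
      have "E.iprod (map b w) \<otimes>\<^bsub>U\<^esub> e = E.iprod (map b w) \<oplus>\<^bsub>U\<^esub> E.iprod (map b w) \<otimes>\<^bsub>U\<^esub> u"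
        unfolding e_def using k uc by (simp add: E.A.r_distr)
      then have "\<Psi> (E.iprod (map b w) \<otimes>\<^bsub>U\<^esub> e) = \<Psi> (E.iprod (map b w)) \<oplus>\<^bsub>F\<^esub> \<zero>\<^bsub>F\<^esub>"
        using \<Psi>(1)[OF k, of "E.iprod (map b w) \<otimes>\<^bsub>U\<^esub> u"] k uc aug0[OF w u] by simp
      moreover have "\<Psi> (E.iprod (map b w)) = f w"
        using \<Psi>(3)[OF R.one_closed mw(1)] k E.sigma_one B.ml_b[OF f(1) mw(2)] B.ml_closed[OF f(1) mw(1)] by simp
      ultimately show ?thesis using f(2)[of w] w by auto
    qed
    then show ?thesis unfolding Q_def using \<Psi>(1,2) sc by (intro exI[of _ \<Psi>] conjI ballI)
  qed
  obtain \<Psi> where Q: "\<And>\<gamma>. \<gamma> \<in> ?I \<Longrightarrow> Q \<gamma> (\<Psi> \<gamma>)" by (rule that[of "\<lambda>\<gamma>. SOME \<Psi>. Q \<gamma> \<Psi>"]) (rule someI_ex[OF ex])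
  have \<Psi>: "\<gamma> \<in> ?I \<Longrightarrow> x \<in> carrier U \<Longrightarrow> y \<in> carrier U \<Longrightarrow> \<Psi> \<gamma> (x \<oplus>\<^bsub>U\<^esub> y) = \<Psi> \<gamma> x \<oplus>\<^bsub>F\<^esub> \<Psi> \<gamma> y"
    "\<gamma> \<in> ?I \<Longrightarrow> x \<in> carrier U \<Longrightarrow> \<Psi> \<gamma> x \<in> carrier F"
    "\<gamma> \<in> ?I \<Longrightarrow> a \<in> carrier F \<Longrightarrow> x \<in> carrier U \<Longrightarrow> \<Psi> \<gamma> (U_scalar a \<otimes>\<^bsub>U\<^esub> x) = a \<otimes>\<^bsub>F\<^esub> \<Psi> \<gamma> x"
    "\<gamma> \<in> ?I \<Longrightarrow> w \<in> ?I \<Longrightarrow> \<Psi> \<gamma> (E.iprod (map b w) \<otimes>\<^bsub>U\<^esub> e) = (if \<gamma> = w then \<one>\<^bsub>F\<^esub> else \<zero>\<^bsub>F\<^esub>)"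
    for \<gamma> x y a w
    using Q[of \<gamma>] unfolding Q_def by simp_all
  have p0: "0 < p" using two_le_p by simp
  have Vv: "E.iprod (map b w) \<otimes>\<^bsub>U\<^esub> e \<in> carrier ?V" if "w \<in> ?I" for w
    unfolding Vs by (rule imageI) (use E.iprod_closed[OF mb] that in simp)
  have Vadd: "\<Psi> i (x \<oplus>\<^bsub>?V\<^esub> y) = \<Psi> i x \<oplus>\<^bsub>F\<^esub> \<Psi> i y" if "i \<in> ?I" "x \<in> carrier ?V" "y \<in> carrier ?V" for i x y
    using \<Psi>(1)[OF that(1)] that(2,3) Nc unfolding Vs by blast
  have Vsm: "\<Psi> i (a \<odot>\<^bsub>?V\<^esub> x) = a \<otimes>\<^bsub>F\<^esub> \<Psi> i x" if "i \<in> ?I" "a \<in> carrier F" "x \<in> carrier ?V" for i a x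
    using \<Psi>(3)[OF that(1,2)] that(3) Nc unfolding Vs by blast
  have Vcl: "\<Psi> i x \<in> carrier F" if "i \<in> ?I" "x \<in> carrier ?V" for i x
    using \<Psi>(2)[OF that(1)] that(2) Nc unfolding Vs by blast
  have Vdual: "\<Psi> i (E.iprod (map b j) \<otimes>\<^bsub>U\<^esub> e) = (if i = j then \<one>\<^bsub>F\<^esub> else \<zero>\<^bsub>F\<^esub>)" if "i \<in> ?I" "j \<in> ?I" for i j
    by (rule \<Psi>(4)[OF that])
  have Vhull: "carrier ?V \<subseteq> W" if W: "subspace F W ?V" and g: "(\<lambda>w. E.iprod (map b w) \<otimes>\<^bsub>U\<^esub> e) ` ?I \<subseteq> W" for W
  proof -
    note W' = V.subspaceD[OF W]
    show ?thesis
    proof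
      fix x assume "x \<in> carrier ?V"
      then obtain c where c: "c \<in> carrier U" "x = c \<otimes>\<^bsub>U\<^esub> e" unfolding Vs by (elim imageE)
      have "x \<in> E.fspan ((\<lambda>x. x \<otimes>\<^bsub>U\<^esub> e) ` BE.normal_monomials r)" unfolding c(2)
        by (rule BE.cyclic_span[OF e _ B(3) c(1)]) (use ekill bT in simp)
      then show "x \<in> W"
      proof induction
        case zero
        then show ?case using W'(2) by (simp add: underlying_vs_def E.A.ideal_module_def)
      next
        case (add a y z)
        have "y \<in> W" using add(2) g by blast
        then show ?case using W'(3)[OF W'(4)[OF add(1)] add.IH] unfolding Vs by blast
      qed
    qed
  qed
  have finI: "finite ?I" using normal_words_card[OF p0] by blast
  note V_dim = V.dim_dual_family[where v = "\<lambda>w. E.iprod (map b w) \<otimes>\<^bsub>U\<^esub> e" and \<phi> = \<Psi>,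
    OF finI Vv Vadd Vsm Vcl Vdual Vhull]
  have V_fin: "V.fin_dim" by (rule V_dim(1)) assumption+
  have "V.dim = card ?I" by (rule V_dim(2)) assumption+
  also have "\<dots> = p ^ r" using normal_words_card[OF p0] by blast
  also have "r = dim - MT F L" using B(2,3,4) T(2) by simp
  finally have dimN: "V.dim = p ^ (dim - MT F L)" .
  show thesis
  proof (rule that[of e])
    show "e \<in> N" if "E.A.left_ideal N" "n \<in> N" "n \<in> ?N" "restricted_env_augmentation n = \<one>\<^bsub>F\<^esub>" for N n
      by (rule ess[OF that])
  qed (rule e ee eps V_fin dimN)+
qed

end

section \<open>Submodules and the uniqueness of projective covers\<close>

context left_module
begin

lemma smult_minus_one:
  assumes x: "x \<in> carrier M" shows "(\<ominus>\<^bsub>R\<^esub> \<one>\<^bsub>R\<^esub>) \<odot>\<^bsub>M\<^esub> x = \<ominus>\<^bsub>M\<^esub> x"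
proof -
  have "(\<ominus>\<^bsub>R\<^esub> \<one>\<^bsub>R\<^esub>) \<odot>\<^bsub>M\<^esub> x \<oplus>\<^bsub>M\<^esub> x = (\<ominus>\<^bsub>R\<^esub> \<one>\<^bsub>R\<^esub> \<oplus>\<^bsub>R\<^esub> \<one>\<^bsub>R\<^esub>) \<odot>\<^bsub>M\<^esub> x"
    using x smult_l_distr[of "\<ominus>\<^bsub>R\<^esub> \<one>\<^bsub>R\<^esub>" "\<one>\<^bsub>R\<^esub>" x] smult_one by simp
  also have "\<dots> = \<zero>\<^bsub>M\<^esub>" using x smult_l_null by (simp add: R.l_neg)
  finally have "(\<ominus>\<^bsub>R\<^esub> \<one>\<^bsub>R\<^esub>) \<odot>\<^bsub>M\<^esub> x \<oplus>\<^bsub>M\<^esub> x = \<zero>\<^bsub>M\<^esub>" .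
  from M.minus_equality[OF this x smult_closed[OF R.a_inv_closed[OF R.one_closed] x]] show ?thesis by simp
qed

lemma submoduleI:
  assumes "N \<subseteq> carrier M" "\<zero>\<^bsub>M\<^esub> \<in> N" "\<And>x y. x \<in> N \<Longrightarrow> y \<in> N \<Longrightarrow> x \<oplus>\<^bsub>M\<^esub> y \<in> N"
    and sm: "\<And>a x. a \<in> carrier R \<Longrightarrow> x \<in> N \<Longrightarrow> a \<odot>\<^bsub>M\<^esub> x \<in> N"
  shows "Module.submodule N R M"
proof (intro Module.submodule.intro subgroup.intro Module.submodule_axioms.intro)
  show "inv\<^bsub>add_monoid M\<^esub> x \<in> N" if "x \<in> N" for x
    using sm[of "\<ominus>\<^bsub>R\<^esub> \<one>\<^bsub>R\<^esub>" x] smult_minus_one[of x] that assms(1) by (auto simp: a_inv_def)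
qed (use assms in simp_all)

lemma submoduleD:
  assumes "Module.submodule N R M"
  shows "N \<subseteq> carrier M" "\<zero>\<^bsub>M\<^esub> \<in> N" "\<And>x y. x \<in> N \<Longrightarrow> y \<in> N \<Longrightarrow> x \<oplus>\<^bsub>M\<^esub> y \<in> N"
    "\<And>a x. a \<in> carrier R \<Longrightarrow> x \<in> N \<Longrightarrow> a \<odot>\<^bsub>M\<^esub> x \<in> N"
proof -
  interpret N: Module.submodule N R M by fact
  show "N \<subseteq> carrier M" "\<zero>\<^bsub>M\<^esub> \<in> N" "\<And>x y. x \<in> N \<Longrightarrow> y \<in> N \<Longrightarrow> x \<oplus>\<^bsub>M\<^esub> y \<in> N"
    using N.subset N.one_closed N.m_closed by simp_all
  show "\<And>a x. a \<in> carrier R \<Longrightarrow> x \<in> N \<Longrightarrow> a \<odot>\<^bsub>M\<^esub> x \<in> N" by (rule N.smult_closed)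
qed

lemma image_submodule:
  assumes N: "left_module R N" and h: "h \<in> module_hom R M N"
  shows "Module.submodule (h ` carrier M) R N"
proof -
  interpret N: left_module R N by fact
  have hc: "h x \<in> carrier N" if "x \<in> carrier M" for x using module_hom_closed[OF h] that by blast
  show ?thesis
  proof (rule N.submoduleI)
    show "h ` carrier M \<subseteq> carrier N" using hc by blast
    show "\<zero>\<^bsub>N\<^esub> \<in> h ` carrier M" using hom_zero[OF N h] by (intro image_eqI[of _ _ "\<zero>\<^bsub>M\<^esub>"]) simp_all
    show "x \<oplus>\<^bsub>N\<^esub> y \<in> h ` carrier M" if xy: "x \<in> h ` carrier M" "y \<in> h ` carrier M" for x y
    proof -
      from xy(1) obtain a where a: "x = h a" "a \<in> carrier M" by (rule imageE)
      from xy(2) obtain b where b: "y = h b" "b \<in> carrier M" by (rule imageE)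
      show ?thesis using module_hom_add[OF h a(2) b(2)] a b by (intro image_eqI[of _ _ "a \<oplus>\<^bsub>M\<^esub> b"]) simp_all
    qed
    show "r \<odot>\<^bsub>N\<^esub> x \<in> h ` carrier M" if r: "r \<in> carrier R" and x: "x \<in> h ` carrier M" for r x
    proof -
      from x obtain a where a: "x = h a" "a \<in> carrier M" by (rule imageE)
      show ?thesis using module_hom_smult[OF h r a(2)] a smult_closed[OF r a(2)]
        by (intro image_eqI[of _ _ "r \<odot>\<^bsub>M\<^esub> a"]) simp_all
    qed
  qed
qed

end

text \<open>Lifting \<open>\<pi>\<close> through \<open>\<rho>\<close> gives \<open>h\<close>, which
  is onto because \<open>\<rho>\<close> is essential. Projectivity of \<open>Q\<close> gives a
  section \<open>s\<close> of \<open>h\<close>, which is onto because \<open>\<pi>\<close> is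
  essential; so \<open>h\<close> is injective as well. The three modules live in different types,
  which is what \<open>projective_lifting\<close> provides for.\<close>

lemma projective_cover_unique:
  fixes R :: "('r, 'd) ring_scheme" and P :: "('r, 'm) module" and Q :: "('r, 'n) module" and Y :: "('r, 'x) module"
  assumes P: "projective_cover R Y P \<pi>" and Q: "projective_cover R Y Q \<rho>"
  obtains h where "h \<in> module_hom R P Q" "inj_on h (carrier P)" "h ` carrier P = carrier Q"
proof -
  have p: "projective R P" "left_module R Y" "\<pi> \<in> module_hom R P Y" "\<pi> ` carrier P = carrier Y"
    "\<And>N. Module.submodule N R P \<Longrightarrow> \<pi> ` N = carrier Y \<Longrightarrow> N = carrier P"
    using P by (simp_all add: projective_cover_def)
  have q: "projective R Q" "\<rho> \<in> module_hom R Q Y" "\<rho> ` carrier Q = carrier Y"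
    "\<And>N. Module.submodule N R Q \<Longrightarrow> \<rho> ` N = carrier Y \<Longrightarrow> N = carrier Q"
    using Q by (simp_all add: projective_cover_def)
  have lP: "left_module R P" and lQ: "left_module R Q" using p(1) q(1) by (simp_all add: projective_def)
  interpret P: left_module R P by fact
  interpret Q: left_module R Q by fact
  from projective_lifting[OF p(1) lQ p(2) q(2,3) p(3)]
  obtain h where h: "h \<in> module_hom R P Q" "\<forall>x\<in>carrier P. \<rho> (h x) = \<pi> x" by (rule bexE)
  have "\<rho> ` (h ` carrier P) = carrier Y" unfolding p(4)[symmetric] image_image using h(2) by (intro image_cong) simp_all
  then have hs: "h ` carrier P = carrier Q" by (rule q(4)[OF P.image_submodule[OF lQ h(1)]])
  have "(\<lambda>y. y) \<in> module_hom R Q Q" unfolding module_hom_def by simp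
  from projective_lifting[OF q(1) lP lQ h(1) hs this]
  obtain s where s: "s \<in> module_hom R Q P" "\<forall>y\<in>carrier Q. h (s y) = y" by (rule bexE)
  have sc: "s y \<in> carrier P" if "y \<in> carrier Q" for y using module_hom_closed[OF s(1)] that by blast
  have "\<pi> (s y) = \<rho> y" if "y \<in> carrier Q" for y using h(2) sc[OF that] s(2) that by metis
  then have "\<pi> ` (s ` carrier Q) = carrier Y" unfolding q(3)[symmetric] image_image by (intro image_cong) simp_all
  then have ss: "s ` carrier Q = carrier P" by (rule p(5)[OF Q.image_submodule[OF lP s(1)]])
  have "s (h x) = x" if "x \<in> carrier P" for x
  proof -
    have "x \<in> s ` carrier Q" using that ss by simp
    then obtain y where "x = s y" "y \<in> carrier Q" by (rule imageE)
    then show ?thesis using s(2) by simp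
  qed
  then have "inj_on h (carrier P)" by (rule inj_on_inverseI)
  then show thesis using that h(1) hs by simp
qed

context ring
begin

text \<open>Since x = x e on this left ideal, a homomorphism is determined by its value at
  \<open>e\<close>. A preimage \<open>m\<close> of \<open>f e\<close> gives the lift x \<mapsto> x
  m.\<close>

lemma idempotent_projective:
  assumes e: "e \<in> carrier R" "e \<otimes> e = e"
  shows "projective R (ideal_module ((\<lambda>c. c \<otimes> e) ` carrier R))"
  unfolding projective_def
proof (intro conjI allI impI)
  let ?N = "(\<lambda>c. c \<otimes> e) ` carrier R"
  let ?Q = "ideal_module ?N"
  show lQ: "left_module R ?Q" by (rule ideal_module_left_module[OF cyclic_left_ideal[OF e(1)]])
  fix M :: "('a, 'a \<Rightarrow> 'a) module" and N :: "('a, 'a) module" and g f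
  assume A: "left_module R M \<and> left_module R N \<and> g \<in> module_hom R M N \<and> g ` carrier M = carrier N
    \<and> f \<in> module_hom R ?Q N"
  then have g: "g \<in> module_hom R M N" "g ` carrier M = carrier N" and f: "f \<in> module_hom R ?Q N" by simp_all
  interpret M: left_module R M using A by simp
  have Qs: "carrier ?Q = ?N" "add ?Q = (\<oplus>)" "smult ?Q = (\<otimes>)" by (simp_all add: ideal_module_def)
  have Nc: "?N \<subseteq> carrier R" using e by auto
  have eN: "e \<in> ?N" using e by (intro image_eqI[of _ _ e]) simp_all
  have "f e \<in> carrier N" using module_hom_closed[OF f] eN unfolding Qs by blast
  then have "f e \<in> g ` carrier M" using g(2) by simp
  then obtain m where m: "f e = g m" "m \<in> carrier M" by (rule imageE)
  have xe: "x \<otimes> e = x" if x: "x \<in> ?N" for x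
  proof -
    from x obtain c where "x = c \<otimes> e" "c \<in> carrier R" by (rule imageE)
    then show ?thesis using e by (simp add: m_assoc)
  qed
  have c: "x \<in> carrier R" if "x \<in> ?N" for x using that Nc by (rule rev_subsetD)
  show "\<exists>h\<in>module_hom R ?Q M. \<forall>x\<in>carrier ?Q. g (h x) = f x"
  proof (rule bexI[of _ "\<lambda>x. x \<odot>\<^bsub>M\<^esub> m"])
    show "(\<lambda>x. x \<odot>\<^bsub>M\<^esub> m) \<in> module_hom R ?Q M"
      unfolding module_hom_def Qs using c m(2) M.smult_closed M.smult_l_distr M.smult_assoc by (intro CollectI conjI) simp_all
    show "\<forall>x\<in>carrier ?Q. g (x \<odot>\<^bsub>M\<^esub> m) = f x"
    proof
      fix x assume "x \<in> carrier ?Q"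
      then have x: "x \<in> ?N" unfolding Qs .
      have "f x = f (x \<odot>\<^bsub>?Q\<^esub> e)" unfolding Qs using xe[OF x] by simp
      also have "\<dots> = x \<odot>\<^bsub>N\<^esub> f e" by (rule module_hom_smult[OF f c[OF x]]) (use eN in \<open>simp add: Qs\<close>)
      also have "\<dots> = g (x \<odot>\<^bsub>M\<^esub> m)" unfolding m(1) by (rule module_hom_smult[OF g(1) c[OF x] m(2), symmetric])
      finally show "g (x \<odot>\<^bsub>M\<^esub> m) = f x" by simp
    qed
  qed
qed

end

section \<open>The cover of the trivial module and its dimension\<close>

context restricted_lie_algebra
begin

lemma trivial_left_module: "left_module U (trivial_module F)"
proof -
  interpret E: restricted_envelope F L p U U_scalar "\<lambda>x. U_gen x" restricted_env_augmentation
    by (rule U_restricted_envelope)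
  have c: "restricted_env_augmentation u \<in> carrier F" if "u \<in> carrier U" for u
    by (rule ring_hom_closed[OF E.eps_hom that])
  have "abelian_group (trivial_module F)"
  proof (rule abelian_groupI)
    fix x assume "x \<in> carrier (trivial_module F)"
    then show "\<exists>y\<in>carrier (trivial_module F). y \<oplus>\<^bsub>trivial_module F\<^esub> x = \<zero>\<^bsub>trivial_module F\<^esub>"
      by (intro bexI[of _ "\<ominus>\<^bsub>F\<^esub> x"]) (simp_all add: trivial_module_def R.l_neg)
  qed (simp_all add: trivial_module_def R.a_ac)
  then show ?thesis
    unfolding left_module_def left_module_axioms_def using U_ring c
    by (simp add: trivial_module_def R.l_distr R.r_distr R.m_assoc ring_hom_add[OF E.eps_hom]
        ring_hom_mult[OF E.eps_hom] ring_hom_one[OF E.eps_hom])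
qed

text \<open>The isomorphism of the two covers is linear over \<open>F\<close>, since the scalars act
  through u(L,0). Finite dimension is asked of \<open>Q\<close>, which will be ue; \<open>P\<close>
  is an arbitrary cover in any type.\<close>

lemma projective_cover_dim:
  assumes Q: "projective_cover U Y Q \<rho>" "vectorspace.fin_dim F (underlying_vs F L p Q)"
    and P: "projective_cover U Y P \<pi>"
  shows "vectorspace.dim F (underlying_vs F L p P) = vectorspace.dim F (underlying_vs F L p Q)"
proof -
  interpret E: lie_envelope F L p U U_scalar "\<lambda>x. U_gen x" by (rule U_envelope)
  have l: "left_module U P" "left_module U Q" using P Q(1) by (simp_all add: projective_cover_def projective_def)
  obtain h where h: "h \<in> module_hom U Q P" "inj_on h (carrier Q)" "h ` carrier Q = carrier P"
    by (rule projective_cover_unique[OF Q(1) P])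
  have "h \<in> module_hom F (underlying_vs F L p Q) (underlying_vs F L p P)"
    using h(1) E.sigma_closed unfolding module_hom_def underlying_vs_def by simp
  then have "linear_map F (underlying_vs F L p Q) (underlying_vs F L p P) h"
    using underlying_vectorspace[OF l(1)] underlying_vectorspace[OF l(2)]
    by (intro linear_map.intro mod_hom.intro mod_hom_axioms.intro vectorspace.axioms)
  from linear_map.dim_eq[OF this Q(2)] show ?thesis using h(2,3) by (simp add: underlying_vs_def)
qed

text \<open>The cover is ue with the augmentation. It is essential because a submodule mapping onto
  \<open>F\<close> contains an element of augmentation 1, and then locality puts \<open>e\<close>
  into it.\<close>

theorem trivial_projective_cover:
  assumes fd: "fin_dim" and sol: "solvable_lie F L"
  obtains Q :: "(('b list \<Rightarrow> 'a) set set, ('b list \<Rightarrow> 'a) set set) module"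
  where "projective_cover U (trivial_module F) Q restricted_env_augmentation"
    "vectorspace.fin_dim F (underlying_vs F L p Q)"
    "vectorspace.dim F (underlying_vs F L p Q) = p ^ (dim - MT F L)"
proof -
  interpret E: restricted_envelope F L p U U_scalar "\<lambda>x. U_gen x" restricted_env_augmentation
    by (rule U_restricted_envelope)
  obtain e where e: "e \<in> carrier U" "e \<otimes>\<^bsub>U\<^esub> e = e" "restricted_env_augmentation e = \<one>\<^bsub>F\<^esub>"
    and ess: "\<And>N n. E.A.left_ideal N \<Longrightarrow> n \<in> N \<Longrightarrow> n \<in> (\<lambda>c. c \<otimes>\<^bsub>U\<^esub> e) ` carrier U \<Longrightarrow>
      restricted_env_augmentation n = \<one>\<^bsub>F\<^esub> \<Longrightarrow> e \<in> N"
    and dim: "vectorspace.fin_dim F (underlying_vs F L p (E.A.ideal_module ((\<lambda>c. c \<otimes>\<^bsub>U\<^esub> e) ` carrier U)))"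
      "vectorspace.dim F (underlying_vs F L p (E.A.ideal_module ((\<lambda>c. c \<otimes>\<^bsub>U\<^esub> e) ` carrier U))) = p ^ (dim - MT F L)"
    by (rule local_idempotent[OF fd sol]) (rule that)
  let ?N = "(\<lambda>c. c \<otimes>\<^bsub>U\<^esub> e) ` carrier U"
  let ?Q = "E.A.ideal_module ?N"
  let ?X = "trivial_module F :: (('b list \<Rightarrow> 'a) set set, 'a) module"
  have Qs: "carrier ?Q = ?N" "add ?Q = add U" "smult ?Q = (\<lambda>x y. x \<otimes>\<^bsub>U\<^esub> y)" "\<zero>\<^bsub>?Q\<^esub> = \<zero>\<^bsub>U\<^esub>"
    by (simp_all add: E.A.ideal_module_def)
  have Xs: "carrier ?X = carrier F" "add ?X = add F" "smult ?X = (\<lambda>u a. restricted_env_augmentation u \<otimes>\<^bsub>F\<^esub> a)"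
    by (simp_all add: trivial_module_def)
  have Nc: "x \<in> carrier U" if "x \<in> ?N" for x
    using E.A.left_idealD(1)[OF E.A.cyclic_left_ideal[OF e(1)]] that by (rule subsetD)
  note c = ring_hom_closed[OF E.eps_hom]
  interpret Q: left_module U ?Q by (rule E.A.ideal_module_left_module[OF E.A.cyclic_left_ideal[OF e(1)]])
  have "projective_cover U ?X ?Q restricted_env_augmentation"
    unfolding projective_cover_def
  proof (intro conjI allI impI)
    show "projective U ?Q" by (rule E.A.idempotent_projective[OF e(1,2)])
    show "left_module U ?X" by (rule trivial_left_module)
    show "restricted_env_augmentation \<in> module_hom U ?Q ?X"
      unfolding module_hom_def Qs Xs using Nc c ring_hom_add[OF E.eps_hom] ring_hom_mult[OF E.eps_hom]
      by (intro CollectI conjI) simp_all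
    show "restricted_env_augmentation ` carrier ?Q = carrier ?X"
    proof
      show "restricted_env_augmentation ` carrier ?Q \<subseteq> carrier ?X" unfolding Qs Xs using Nc c by blast
      show "carrier ?X \<subseteq> restricted_env_augmentation ` carrier ?Q"
      proof
        fix a assume "a \<in> carrier ?X"
        then have a: "a \<in> carrier F" unfolding Xs .
        have "restricted_env_augmentation (U_scalar a \<otimes>\<^bsub>U\<^esub> e) = a"
          using ring_hom_mult[OF E.eps_hom E.sigma_closed[OF a] e(1)] E.eps_sigma[OF a] e(3) a by simp
        then show "a \<in> restricted_env_augmentation ` carrier ?Q"
          unfolding Qs using E.sigma_closed[OF a] by (intro image_eqI[of _ _ "U_scalar a \<otimes>\<^bsub>U\<^esub> e"] imageI) simp_all
      qed
    qed
    fix N assume "Module.submodule N U ?Q \<and> restricted_env_augmentation ` N = carrier ?X"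
    then have N: "Module.submodule N U ?Q" "restricted_env_augmentation ` N = carrier F" unfolding Xs by simp_all
    note N' = Q.submoduleD[OF N(1), unfolded Qs]
    have li: "E.A.left_ideal N" unfolding E.A.left_ideal_def using N' Nc by (intro conjI ballI subsetI) blast+
    have "\<one>\<^bsub>F\<^esub> \<in> restricted_env_augmentation ` N" unfolding N(2) by simp
    then obtain n where n: "\<one>\<^bsub>F\<^esub> = restricted_env_augmentation n" "n \<in> N" by (rule imageE)
    have "e \<in> N" by (rule ess[OF li n(2) subsetD[OF N'(1) n(2)] n(1)[symmetric]])
    then have "?N \<subseteq> N" using N'(4) by blast
    then show "N = carrier ?Q" unfolding Qs using N'(1) by simp
  qed
  then show thesis by (rule that[OF _ dim])
qed

end

text \<open>Existence is part of the claim so that the dimension formula does not hold vacuously.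
  The formula is obtained for covers in every type by comparison with the cover ue.\<close>

theorem theorem2p2:
  fixes F :: "('a, 'd) ring_scheme"
    and L :: "('a, 'b, 'c) restricted_lie_scheme"
    and p :: nat
  assumes "restricted_lie_algebra F L p"
    and "vectorspace.fin_dim F L"
    and "solvable_lie F L"
  shows "(\<exists>(P :: (('b list \<Rightarrow> 'a) set set, ('b list \<Rightarrow> 'a) set set) module) \<pi>.
            projective_cover (restricted_env F L p) (trivial_module F) P \<pi>)
       \<and> (\<forall>(P :: (('b list \<Rightarrow> 'a) set set, 'm) module) \<pi>.
            projective_cover (restricted_env F L p) (trivial_module F) P \<pi>
            \<longrightarrow> vectorspace.dim F (underlying_vs F L p P)
                = p ^ (vectorspace.dim F L - MT F L))"
proof -
  interpret restricted_lie_algebra F L p by fact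
  obtain Q :: "(('b list \<Rightarrow> 'a) set set, ('b list \<Rightarrow> 'a) set set) module"
    where Q: "projective_cover U (trivial_module F) Q restricted_env_augmentation"
    "vectorspace.fin_dim F (underlying_vs F L p Q)"
    "vectorspace.dim F (underlying_vs F L p Q) = p ^ (dim - MT F L)"
    by (rule trivial_projective_cover[OF assms(2,3)])
  show ?thesis
  proof (intro conjI allI impI)
    show "\<exists>(P :: (('b list \<Rightarrow> 'a) set set, ('b list \<Rightarrow> 'a) set set) module) \<pi>.
      projective_cover U (trivial_module F) P \<pi>" using Q(1) by (intro exI)
    show "vectorspace.dim F (underlying_vs F L p P) = p ^ (dim - MT F L)"
      if "projective_cover U (trivial_module F) P \<pi>" for P :: "(('b list \<Rightarrow> 'a) set set, 'm) module" and \<pi>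
      unfolding projective_cover_dim[OF Q(1,2) that] by (rule Q(3))
  qed
qed

end
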